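(* Let $\Gamma_1,\Gamma_2$ be two locally perturbed sound-soft surfaces (Dirichlet boundary condition) of polyhedral type, and let $d\in\mathbb S^2_-$ be a single fixed incident direction. If $u^{sc}_{1,\infty}(\hat x;d)=u^{sc}_{2,\infty}(\hat x;d)$ for all $\hat x\in\mathbb S^2_+$, then $\Gamma_1=\Gamma_2$.
   Context: Fix a wave number $k>0$. Write $x=(\tilde x,x_3)\in\mathbb R^3$ with $\tilde x=(x_1,x_2)$, and $\mathbb S^2_\pm=\{x\in\mathbb R^3:|x|=1,\ \pm x_3>0\}$. A locally perturbed surface is $\Gamma=\{(\tilde x,f(\tilde x)):\tilde x\in\mathbb R^2\}$, where $f:\mathbb R^2\to\mathbb R$ is Lipschitz continuous and $f(\tilde x)=0$ for $|\tilde x|>R$ for some $R>\max|f|$; $\Omega=\{x:x_3>f(\tilde x)\}$ is the region above $\Gamma$ and $\nu$ is the unit normal on $\Gamma$ pointing into $\Omega$. $\Gamma$ is of polyhedral type if $f$ is (continuous and) piecewise linear. For $d=(\alpha,\beta,-\gamma)\in\mathbb S^2_-$ the incident plane wave is $u^{in}(x;d)=e^{ikx\cdot d}$ and its reflected wave from the flat plane $\{x_3=0\}$ is $u^{re}(x;d)=-e^{ik(\alpha x_1+\beta x_2+\gamma x_3)}$ in the Dirichlet case and $u^{re}(x;d)=+e^{ik(\alpha x_1+\beta x_2+\gamma x_3)}$ in the Neumann case. The total field is $u=u^{in}+u^{re}+u^{sc}$, where $u$ satisfies $\Delta u+k^2u=0$ in $\Omega$, the boundary condition $u=0$ on $\Gamma$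 (sound-soft/Dirichlet) or $\partial_\nu u=0$ on $\Gamma$ (sound-hard/Neumann), and the scattered field $u^{sc}$ satisfies the Sommerfeld radiation condition $\lim_{r\to\infty}r(\partial_ru^{sc}-iku^{sc})=0$, $r=|x|$, $x\in\Omega$; this problem is uniquely solvable. Then $u^{sc}(x;d)=\frac{e^{ik|x|}}{|x|}\{u^{sc}_\infty(\hat x;d)+O(1/|x|)\}$ as $|x|\to\infty$ in $\Omega$, $\hat x=x/|x|\in\mathbb S^2_+$, and $u^{sc}_\infty(\cdot;d)$ is the far-field pattern. Quantities associated with a surface $\Gamma_j=\{x_3=f_j(\tilde x)\}$ carry the index $j$. *)

theory Defs
  imports "HOL-Analysis.Analysis"
begin

definition hproj :: "real^3 \<Rightarrow> real^2" where
  "hproj x = vector [x$1, x$2]"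

definition Gamma :: "(real^2 \<Rightarrow> real) \<Rightarrow> (real^3) set" where
  "Gamma f = {x. x$3 = f (hproj x)}"

definition Omega :: "(real^2 \<Rightarrow> real) \<Rightarrow> (real^3) set" where
  "Omega f = {x. x$3 > f (hproj x)}"

definition locally_perturbed :: "(real^2 \<Rightarrow> real) \<Rightarrow> bool" where
  "locally_perturbed f \<longleftrightarrow>
     (\<exists>L. lipschitz_on L UNIV f) \<and>
     (\<exists>R. (\<forall>y. \<bar>f y\<bar> < R) \<and> (\<forall>y. norm y > R \<longrightarrow> f y = 0))"

definition polyhedral_type :: "(real^2 \<Rightarrow> real) \<Rightarrow> bool" where
  "polyhedral_type f \<longleftrightarrow> continuous_on UNIV f \<and>
     (\<exists>\<P>. finite \<P> \<and> \<Union>\<P> = UNIV \<and>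
        (\<forall>P\<in>\<P>. polyhedron P \<and> (\<exists>a b. \<forall>y\<in>P. f y = a \<bullet> y + b)))"

definition S2_minus :: "(real^3) set" where
  "S2_minus = {d. norm d = 1 \<and> d$3 < 0}"

definition S2_plus :: "(real^3) set" where
  "S2_plus = {d. norm d = 1 \<and> d$3 > 0}"

definition mirror :: "real^3 \<Rightarrow> real^3" where
  "mirror d = (\<chi> i. if i = 3 then - d$i else d$i)"

definition u_in :: "real \<Rightarrow> real^3 \<Rightarrow> real^3 \<Rightarrow> complex" where
  "u_in k d x = exp (\<i> * complex_of_real (k * (x \<bullet> d)))"

definition u_re_D :: "real \<Rightarrow> real^3 \<Rightarrow> real^3 \<Rightarrow> complex" where
  "u_re_D k d x = - exp (\<i> * complex_of_real (k * (x \<bullet> mirror d)))"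

definition u_sc_D :: "real \<Rightarrow> real^3 \<Rightarrow> (real^3 \<Rightarrow> complex) \<Rightarrow> real^3 \<Rightarrow> complex" where
  "u_sc_D k d u x = u x - u_in k d x - u_re_D k d x"

definition pd :: "3 \<Rightarrow> (real^3 \<Rightarrow> complex) \<Rightarrow> real^3 \<Rightarrow> complex" where
  "pd i u x = vector_derivative (\<lambda>t. u (x + t *\<^sub>R axis i 1)) (at 0)"

definition laplacian :: "(real^3 \<Rightarrow> complex) \<Rightarrow> real^3 \<Rightarrow> complex" where
  "laplacian u x = (\<Sum>i\<in>UNIV. pd i (pd i u) x)"

definition C2_on :: "(real^3) set \<Rightarrow> (real^3 \<Rightarrow> complex) \<Rightarrow> bool" where
  "C2_on S u \<longleftrightarrow> (\<forall>x\<in>S. u differentiable (at x)) \<and>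
     (\<forall>i. \<forall>x\<in>S. pd i u differentiable (at x)) \<and>
     (\<forall>i j. continuous_on S (pd j (pd i u)))"

definition radial_deriv :: "(real^3 \<Rightarrow> complex) \<Rightarrow> real^3 \<Rightarrow> complex" where
  "radial_deriv v x = vector_derivative (\<lambda>t. v (x + t *\<^sub>R (x /\<^sub>R norm x))) (at 0)"

definition sommerfeld :: "real \<Rightarrow> (real^3) set \<Rightarrow> (real^3 \<Rightarrow> complex) \<Rightarrow> bool" where
  "sommerfeld k S v \<longleftrightarrow>
     (\<forall>\<epsilon>>0. \<exists>R. \<forall>x\<in>S. norm x \<ge> R \<longrightarrow>
        cmod (complex_of_real (norm x) * (radial_deriv v x - \<i> * complex_of_real k * v x)) \<le> \<epsilon>)"

definition dirichlet_total_field ::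
  "real \<Rightarrow> (real^2 \<Rightarrow> real) \<Rightarrow> real^3 \<Rightarrow> (real^3 \<Rightarrow> complex) \<Rightarrow> bool" where
  "dirichlet_total_field k f d u \<longleftrightarrow>
     C2_on (Omega f) u \<and>
     (\<forall>x\<in>Omega f. laplacian u x + (complex_of_real k)\<^sup>2 * u x = 0) \<and>
     continuous_on (closure (Omega f)) u \<and>
     (\<forall>x\<in>Gamma f. u x = 0) \<and>
     sommerfeld k (Omega f) (u_sc_D k d u)"

text \<open>Far-field pattern: v(x) = e^{ik|x|}/|x| (v_inf(xhat) + O(1/|x|)); v_inf(xhat) is
  recovered as the limit of r e^{-ikr} v(r xhat) as r \<rightarrow> \<infinity>.\<close>
definition far_field :: "real \<Rightarrow> (real^3 \<Rightarrow> complex) \<Rightarrow> real^3 \<Rightarrow> complex" where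
  "far_field k v xh =
     Lim at_top (\<lambda>r::real. complex_of_real r * exp (- \<i> * complex_of_real (k * r)) * v (r *\<^sub>R xh))"

end

theory Submission
  imports Defs "HOL-Complex_Analysis.Complex_Analysis"
begin

text \<open>
  Extended oddly across the flat part of the surface, the scattered field becomes a radiating solution of
  the Helmholtz equation outside a ball, hence \<open>exp (i k r) / r\<close> times a function that is holomorphic in
  \<open>1 / r\<close>. Rellich's argument kills the coefficients of the difference of two such fields one after the
  other, so equal far fields give equal total fields above both surfaces.

  If now \<open>f1 > f2\<close> somewhere, then \<open>u2\<close> vanishes on facets of the first surface that lie above the second
  one, and \<open>u2\<close> is odd with respect to the plane of every such nodal disc. Reflect the vertical ray that
  starts at a nodal point in its nodal plane. Either the reflected ray leaves the domain through a facet,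
  whose mirror image is a nodal disc further up the ray; or it stays in the domain, which is impossible
  since \<open>|u2|\<close> is asymptotic to \<open>2 |sin (k \<gamma> x\<^sub>3)|\<close> and the two rays climb at different speeds.
  Nodal discs on a vertical ray form a closed set, so they occur at arbitrary height, where they must be
  horizontal. Reflecting the surface in such a disc shows that \<open>f2\<close> has only horizontal facets, thus
  \<open>f2 = 0\<close>; but then all facets of \<open>f1\<close> above the plane are horizontal as well, and \<open>f1 \<le> f2\<close>.
\<close>

text \<open>The total field is known to be continuous up to the surface and nothing more, so normal
  derivatives, Green's formula on the boundary and surface integrals are out of reach. Volume
  integrals replace them throughout: the sphere integrals of a representation formula become
  integrals over shells on which a cut-off varies, and integration by parts in the radius becomes
  the scaling law of Lebesgue measure. The radiation condition is used through oscillation. A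
  radiating field times the outgoing phase behaves like \<open>exp (2 i k r)\<close>, so its
  averages over growing shells tend to zero, although the field itself is at first only known to
  grow at most logarithmically. In Rellich's argument a leading term of order
  \<open>1 / r ^ (n + 1)\<close> with \<open>n > 0\<close> contradicts the transport equation along
  rays, which allows the decay \<open>1 / r\<close> only; the term with \<open>n = 0\<close> is the
  far field, which is assumed to cancel.\<close>

type_synonym wave = "real^3 \<Rightarrow> complex"

abbreviation cof :: "real \<Rightarrow> complex" where "cof \<equiv> complex_of_real"

section \<open>Weak solutions of the Helmholtz equation\<close>

text \<open>Test functions carry their gradient and Hessian as explicit data; testing against them makes odd
 reflection and the removal of cut-offs possible without any regularity theory up to the boundary.\<close>
definition C2_data ::
 "wave \<Rightarrow> (3 \<Rightarrow> wave) \<Rightarrow> (3 \<Rightarrow> 3 \<Rightarrow> wave) \<Rightarrow> bool" where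
 "C2_data \<phi> g h \<longleftrightarrow>
   (\<forall>x. (\<phi> has_derivative (\<lambda>v. \<Sum>i\<in>UNIV. v$i *\<^sub>R g i x)) (at x)) \<and>
   (\<forall>i x. (g i has_derivative (\<lambda>v. \<Sum>j\<in>UNIV. v$j *\<^sub>R h i j x)) (at x)) \<and>
   (\<forall>i j. continuous_on UNIV (h i j))"

definition helm :: "real \<Rightarrow> wave \<Rightarrow> (3 \<Rightarrow> 3 \<Rightarrow> wave) \<Rightarrow> wave" where
 "helm k \<phi> h x = (\<Sum>i\<in>UNIV. h i i x) + (cof k)\<^sup>2 * \<phi> x"

text \<open>The integral runs over the whole space: \<open>helm k \<phi> h\<close> vanishes off
  \<open>K\<close>, so the values of \<open>u\<close> outside \<open>S\<close> have no influence and
  need no convention.\<close>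

definition weak_helmholtz :: "real \<Rightarrow> (real^3) set \<Rightarrow> wave \<Rightarrow> bool" where
 "weak_helmholtz k S u \<longleftrightarrow> continuous_on S u \<and>
   (\<forall>\<phi> g h K. C2_data \<phi> g h \<longrightarrow> compact K \<longrightarrow> K \<subseteq> S \<longrightarrow> (\<forall>x. x \<notin> K \<longrightarrow> \<phi> x = 0) \<longrightarrow>
    (LINT x|lborel. u x * helm k \<phi> h x) = 0)"

lemma C2_dataD:
 assumes "C2_data \<phi> g h"
 shows "(\<phi> has_derivative (\<lambda>v. \<Sum>i\<in>UNIV. v$i *\<^sub>R g i x)) (at x)"
  and "(g i has_derivative (\<lambda>v. \<Sum>j\<in>UNIV. v$j *\<^sub>R h i j x)) (at x)"
  and "continuous_on UNIV (h i j)" and "continuous_on UNIV (g i)" and "continuous_on UNIV \<phi>"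
proof -
 show 1: "(\<phi> has_derivative (\<lambda>v. \<Sum>i\<in>UNIV. v$i *\<^sub>R g i x)) (at x)" for x
  using assms unfolding C2_data_def by auto
 show 2: "(g i has_derivative (\<lambda>v. \<Sum>j\<in>UNIV. v$j *\<^sub>R h i j x)) (at x)" for i x
  using assms unfolding C2_data_def by auto
 show "continuous_on UNIV (h i j)"
  using assms unfolding C2_data_def by auto
 show "continuous_on UNIV (g i)" "continuous_on UNIV \<phi>"
  using 1 2 by (auto intro!: continuous_at_imp_continuous_on has_derivative_continuous)
qed

text \<open>The data are separate arguments, but off the closed set the function is locally zero,
  and uniqueness of derivatives carries this over to the gradient and then to the Hessian.\<close>

lemma C2_data_zero_outside:
 assumes "C2_data \<phi> g h" "closed K" "\<And>x. x \<notin> K \<Longrightarrow> \<phi> x = 0" "x \<notin> K"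
 shows "g i x = 0" "h i j x = 0"
proof -
 have op: "open (-K)" using assms by auto
 have z: "g i x = 0" if "x \<notin> K" for i x
 proof -
  have "(\<phi> has_derivative (\<lambda>v. 0)) (at x)"
   by (rule has_derivative_transform_within_open[of "\<lambda>_. 0" _ _ UNIV "-K"]) (use that op assms in auto)
  with C2_dataD(1)[OF assms(1)] have "(\<lambda>v. \<Sum>i\<in>UNIV. v$i *\<^sub>R g i x) = (\<lambda>v. 0)"
   using has_derivative_unique by blast
  from fun_cong[OF this, of "axis i 1"] show ?thesis
   by (simp add: axis_def if_distrib[of "\<lambda>c. c *\<^sub>R _"] cong: if_cong)
 qed
 thus "g i x = 0" using assms by auto
 have "(g i has_derivative (\<lambda>v. 0)) (at x)"
  by (rule has_derivative_transform_within_open[of "\<lambda>_. 0" _ _ UNIV "-K"]) (use z op assms in auto)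
 with C2_dataD(2)[OF assms(1)] have "(\<lambda>v. \<Sum>j\<in>UNIV. v$j *\<^sub>R h i j x) = (\<lambda>v. 0)"
  using has_derivative_unique by blast
 from fun_cong[OF this, of "axis j 1"] show "h i j x = 0"
  by (simp add: axis_def if_distrib[of "\<lambda>c. c *\<^sub>R _"] cong: if_cong)
qed

lemma helm_zero_outside:
 assumes "C2_data \<phi> g h" "closed K" "\<And>x. x \<notin> K \<Longrightarrow> \<phi> x = 0" "x \<notin> K"
 shows "helm k \<phi> h x = 0"
 using C2_data_zero_outside(2)[OF assms] assms by (simp add: helm_def)

lemma continuous_on_helm:
 assumes "C2_data \<phi> g h" shows "continuous_on UNIV (helm k \<phi> h)"
 unfolding helm_def by (intro continuous_intros C2_dataD[OF assms])

section \<open>Constructing test functions\<close>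

lemma C2_data_mult:
 assumes "C2_data \<phi> g h" "C2_data \<psi> g' h'"
 shows "C2_data (\<lambda>x. \<phi> x * \<psi> x) (\<lambda>i x. \<phi> x * g' i x + g i x * \<psi> x)
  (\<lambda>i j x. \<phi> x * h' i j x + g j x * g' i x + (g i x * g' j x + h i j x * \<psi> x))"
 unfolding C2_data_def
proof (intro conjI allI)
 note d = C2_dataD(1,2)[OF assms(1)] C2_dataD(1,2)[OF assms(2)]
 show "((\<lambda>x. \<phi> x * \<psi> x) has_derivative (\<lambda>v. \<Sum>i\<in>UNIV. v$i *\<^sub>R (\<phi> x * g' i x + g i x * \<psi> x))) (at x)" for x
  by (rule derivative_eq_intros d refl)+
    (simp add: sum_distrib_left sum_distrib_right sum.distrib[symmetric] algebra_simps)
 show "((\<lambda>x. \<phi> x * g' i x + g i x * \<psi> x) has_derivative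
   (\<lambda>v. \<Sum>j\<in>UNIV. v$j *\<^sub>R (\<phi> x * h' i j x + g j x * g' i x + (g i x * g' j x + h i j x * \<psi> x)))) (at x)" for i x
  by (rule derivative_eq_intros d refl)+
    (simp add: sum_distrib_left sum_distrib_right sum.distrib[symmetric] algebra_simps)
qed (intro continuous_intros C2_dataD[OF assms(1)] C2_dataD[OF assms(2)])

lemma C2_data_diff:
 assumes "C2_data \<phi> g h" "C2_data \<psi> g' h'"
 shows "C2_data (\<lambda>x. \<phi> x - \<psi> x) (\<lambda>i x. g i x - g' i x) (\<lambda>i j x. h i j x - h' i j x)"
 unfolding C2_data_def
proof (intro conjI allI)
 note d = C2_dataD(1,2)[OF assms(1)] C2_dataD(1,2)[OF assms(2)]
 show "((\<lambda>x. \<phi> x - \<psi> x) has_derivative (\<lambda>v. \<Sum>i\<in>UNIV. v$i *\<^sub>R (g i x - g' i x))) (at x)" for x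
  by (rule derivative_eq_intros d refl)+
    (simp add: sum_subtractf[symmetric] algebra_simps)
 show "((\<lambda>x. g i x - g' i x) has_derivative
   (\<lambda>v. \<Sum>j\<in>UNIV. v$j *\<^sub>R (h i j x - h' i j x))) (at x)" for i x
  by (rule derivative_eq_intros d refl)+
    (simp add: sum_subtractf[symmetric] algebra_simps)
qed (intro continuous_intros C2_dataD[OF assms(1)] C2_dataD[OF assms(2)])

lemma has_derivative_vector_compose:
 fixes F :: "real \<Rightarrow> 'b::real_normed_vector"
 assumes "(s has_derivative s') (at x within S)" "(F has_vector_derivative F') (at (s x))"
 shows "((\<lambda>y. F (s y)) has_derivative (\<lambda>v. s' v *\<^sub>R F')) (at x within S)"
 using has_derivative_compose[OF assms(1), of F] assms(2)
 by (simp add: has_vector_derivative_def)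

text \<open>The squared distance is a polynomial, so the composite is twice differentiable at the
  centre as well and no point has to be excluded.\<close>

lemma C2_data_radial:
 fixes F F' F'' :: "real \<Rightarrow> complex"
 assumes "\<And>t. (F has_vector_derivative F' t) (at t)" "\<And>t. (F' has_vector_derivative F'' t) (at t)"
  "continuous_on UNIV F''"
 shows "C2_data (\<lambda>y. F ((y-a) \<bullet> (y-a))) (\<lambda>i y. (2 * (y-a)$i) *\<^sub>R F' ((y-a) \<bullet> (y-a)))
  (\<lambda>i j y. (if i = j then 2 else 0) *\<^sub>R F' ((y-a) \<bullet> (y-a)) +
    (4 * (y-a)$i * (y-a)$j) *\<^sub>R F'' ((y-a) \<bullet> (y-a)))"
 unfolding C2_data_def
proof (intro conjI allI)
 have s: "((\<lambda>y. (y-a) \<bullet> (y-a)) has_derivative (\<lambda>v. 2 * ((x-a) \<bullet> v))) (at x)" for x :: "real^3"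
  by (auto intro!: derivative_eq_intros simp: inner_commute)
 have e: "(x-a) \<bullet> v = (\<Sum>i\<in>UNIV. v$i * (x-a)$i)" for x v :: "real^3"
  by (simp add: inner_vec_def mult.commute)
 show "((\<lambda>y. F ((y-a) \<bullet> (y-a))) has_derivative (\<lambda>v. \<Sum>i\<in>UNIV. v$i *\<^sub>R ((2 * (x-a)$i) *\<^sub>R F' ((x-a) \<bullet> (x-a))))) (at x)" for x
  using has_derivative_vector_compose[OF s[of x] assms(1)[of "(x-a) \<bullet> (x-a)"]]
  by (simp add: e[of x] scaleR_sum_left sum_distrib_left mult_ac del: vector_minus_component)
 have c: "continuous_on UNIV F'" using assms(2)
  by (meson continuous_at_imp_continuous_on has_vector_derivative_continuous)
 have co: "((\<lambda>y. (y - a)$i) has_derivative (\<lambda>v. v$i)) (at x)" for i and x :: "real^3"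
  by (auto intro!: derivative_eq_intros bounded_linear.has_derivative[OF bounded_linear_vec_nth])
 show "((\<lambda>y. (2 * (y-a)$i) *\<^sub>R F' ((y-a) \<bullet> (y-a))) has_derivative (\<lambda>v. \<Sum>j\<in>UNIV. v$j *\<^sub>R
   ((if i = j then 2 else 0) *\<^sub>R F' ((x-a) \<bullet> (x-a)) + (4 * (x-a)$i * (x-a)$j) *\<^sub>R F'' ((x-a) \<bullet> (x-a))))) (at x)" for i x
 proof -
  have "((\<lambda>y. (2 * (y-a)$i) *\<^sub>R F' ((y-a) \<bullet> (y-a))) has_derivative
    (\<lambda>v. (2 * (x-a)$i) *\<^sub>R ((2 * ((x-a) \<bullet> v)) *\<^sub>R F'' ((x-a) \<bullet> (x-a))) + (2 * v$i) *\<^sub>R F' ((x-a) \<bullet> (x-a)))) (at x)"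
   by (rule derivative_eq_intros has_derivative_vector_compose[OF s[of x] assms(2)[of "(x-a) \<bullet> (x-a)"]] co refl)+ simp
  moreover have "(\<Sum>j\<in>UNIV. v$j *\<^sub>R
   ((if i = j then 2 else 0) *\<^sub>R F' ((x-a) \<bullet> (x-a)) + (4 * (x-a)$i * (x-a)$j) *\<^sub>R F'' ((x-a) \<bullet> (x-a)))) =
   (2 * (x-a)$i) *\<^sub>R ((2 * ((x-a) \<bullet> v)) *\<^sub>R F'' ((x-a) \<bullet> (x-a))) + (2 * v$i) *\<^sub>R F' ((x-a) \<bullet> (x-a))" for v
   by (simp add: e[of x] scaleR_sum_left scaleR_sum_right sum_distrib_left scaleR_add_right sum.distrib if_distrib[of "\<lambda>c. _ *\<^sub>R c"] if_distrib[of "\<lambda>c. _ * c"] if_distrib[of "\<lambda>c. c *\<^sub>R _"] mult_ac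
     del: vector_minus_component cong: if_cong)
  ultimately show ?thesis by simp
 qed
 show "continuous_on UNIV (\<lambda>y. (if i = j then 2 else 0) *\<^sub>R F' ((y-a) \<bullet> (y-a)) +
    (4 * (y-a)$i * (y-a)$j) *\<^sub>R F'' ((y-a) \<bullet> (y-a)))" for i j
  by (intro continuous_intros continuous_on_compose2[OF c] continuous_on_compose2[OF assms(3)]) auto
qed

lemma C2_data_planar:
 fixes F F' F'' :: "real \<Rightarrow> complex"
 assumes "\<And>t. (F has_vector_derivative F' t) (at t)" "\<And>t. (F' has_vector_derivative F'' t) (at t)"
  "continuous_on UNIV F''"
 shows "C2_data (\<lambda>y. F (y \<bullet> n - c)) (\<lambda>i y. n$i *\<^sub>R F' (y \<bullet> n - c))
  (\<lambda>i j y. (n$i * n$j) *\<^sub>R F'' (y \<bullet> n - c))"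
 unfolding C2_data_def
proof (intro conjI allI)
 have s: "((\<lambda>y. y \<bullet> n - c) has_derivative (\<lambda>v. v \<bullet> n)) (at x)" for x :: "real^3"
  by (auto intro!: derivative_eq_intros)
 have e: "v \<bullet> n = (\<Sum>i\<in>UNIV. v$i * n$i)" for v :: "real^3"
  by (simp add: inner_vec_def)
 show "((\<lambda>y. F (y \<bullet> n - c)) has_derivative (\<lambda>v. \<Sum>i\<in>UNIV. v$i *\<^sub>R (n$i *\<^sub>R F' (x \<bullet> n - c)))) (at x)" for x
  using has_derivative_vector_compose[OF s[of x] assms(1)[of "x \<bullet> n - c"]]
  by (simp add: e[of _] scaleR_sum_left)
 show "((\<lambda>y. n$i *\<^sub>R F' (y \<bullet> n - c)) has_derivative (\<lambda>v. \<Sum>j\<in>UNIV. v$j *\<^sub>R ((n$i * n$j) *\<^sub>R F'' (x \<bullet> n - c)))) (at x)" for i x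
  using has_derivative_scaleR_right[OF has_derivative_vector_compose[OF s[of x] assms(2)[of "x \<bullet> n - c"]], of "n$i"]
  by (simp add: e[of _] scaleR_sum_left sum_distrib_left mult_ac scaleR_sum_right)
qed (intro continuous_intros continuous_on_compose2[OF assms(3)]; auto)

section \<open>Integrals of compactly supported functions\<close>

lemma integrable_continuous_compact_support:
 fixes f :: "'a::euclidean_space \<Rightarrow> 'b::{banach, second_countable_topology}"
 assumes "continuous_on UNIV f" "compact K" "\<And>x. x \<notin> K \<Longrightarrow> f x = 0"
 shows "integrable lborel f"
proof -
 have "integrable lborel (\<lambda>x. indicator K x *\<^sub>R f x)"
  using assms by (intro borel_integrable_compact) (auto intro: continuous_on_subset)
 moreover have "(\<lambda>x. indicator K x *\<^sub>R f x) = f" using assms by (auto simp: indicator_def)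
 ultimately show ?thesis by simp
qed

lemma continuous_on_UNIV_support:
 fixes f :: "'a::t2_space \<Rightarrow> 'b::real_normed_vector"
 assumes "continuous_on S f" "open S" "compact K" "K \<subseteq> S" "\<And>x. x \<notin> K \<Longrightarrow> f x = 0"
 shows "continuous_on UNIV f"
proof -
 have "continuous_on (-K) f" using assms by (subst continuous_on_cong[of _ "-K" _ "\<lambda>_. 0"]) auto
 moreover have "open (-K)" using assms compact_imp_closed by blast
 ultimately have "continuous_on (S \<union> -K) f" using assms by (intro continuous_on_open_Un)
 moreover have "S \<union> -K = UNIV" using assms by auto
 ultimately show ?thesis by simp
qed

lemma bounded_compact_support:
 fixes f :: "'a::euclidean_space \<Rightarrow> 'b::real_normed_vector"
 assumes "continuous_on UNIV f" "compact K" "\<And>x. x \<notin> K \<Longrightarrow> f x = 0"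
 obtains B where "B > 0" "\<And>x. norm (f x) \<le> B"
proof -
 have "bounded (f ` K)"
  by (intro compact_imp_bounded compact_continuous_image continuous_on_subset[OF assms(1)] assms) auto
 then obtain B where B: "B > 0" "\<And>x. x \<in> K \<Longrightarrow> norm (f x) \<le> B" by (auto simp: bounded_pos)
 show ?thesis by (rule that[of B]) (use B in simp, metis B assms(3) less_imp_le norm_zero)
qed

lemma lborel_integral_translate:
 fixes f :: "'a::euclidean_space \<Rightarrow> 'b::{banach, second_countable_topology}"
 assumes [measurable]: "f \<in> borel_measurable borel"
 shows "(LINT x|lborel. f (a + x)) = (LINT x|lborel. f x)"
proof -
 have "(LINT x|lborel. f x) = (LINT x|distr lborel borel ((+) a). f x)"
  by (simp add: lborel_distr_plus)
 also have "\<dots> = (LINT x|lborel. f (a + x))" by (subst integral_distr) auto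
 finally show ?thesis ..
qed

lemma lborel_integral_dilate:
 fixes f :: "'a::euclidean_space \<Rightarrow> 'b::{banach, second_countable_topology}"
 assumes [measurable]: "f \<in> borel_measurable borel" and c: "c > 0"
 shows "(LINT x|lborel. f x) = c ^ DIM('a) *\<^sub>R (LINT x|lborel. f (c *\<^sub>R x))"
proof -
 have "(LINT x|lborel. f x) = (LINT x|density (distr lborel borel (\<lambda>x. 0 + c *\<^sub>R x)) (\<lambda>_. \<bar>c\<bar>^DIM('a)). f x)"
  using lborel_affine[of c "0::'a"] c by simp
 also have "\<dots> = (LINT x|distr lborel borel (\<lambda>x. 0 + c *\<^sub>R x). \<bar>c\<bar>^DIM('a) *\<^sub>R f x)"
  using c by (subst integral_density) auto
 also have "\<dots> = (LINT x|lborel. \<bar>c\<bar>^DIM('a) *\<^sub>R f (c *\<^sub>R x))" by (subst integral_distr) auto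
 finally show ?thesis using c by simp
qed

lemma has_vector_derivative_difference_quotient:
 fixes f :: "real \<Rightarrow> 'b::real_normed_vector"
 assumes "(f has_vector_derivative D) (at x)"
 shows "((\<lambda>t. (f (x + t) - f x) /\<^sub>R t) \<longlongrightarrow> D) (at 0)"
proof -
 have "((\<lambda>h. norm (f (x + h) - f x - h *\<^sub>R D) / norm h) \<longlongrightarrow> 0) (at 0)"
  using assms unfolding has_vector_derivative_def has_derivative_at by blast
 moreover have "norm (f (x + h) - f x - h *\<^sub>R D) / norm h = norm ((f (x + h) - f x) /\<^sub>R h - D)" if "h \<noteq> 0" for h
 proof -
  have "(f (x + h) - f x) /\<^sub>R h - D = (f (x + h) - f x - h *\<^sub>R D) /\<^sub>R h"
   using that by (simp add: scaleR_diff_right)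
  thus ?thesis by (simp only: norm_scaleR) (simp add: divide_inverse mult.commute)
 qed
 ultimately have "((\<lambda>h. norm ((f (x + h) - f x) /\<^sub>R h - D)) \<longlongrightarrow> 0) (at 0)"
  by (metis (mono_tags, lifting) LIM_cong)
 from LIM_zero_cancel[OF tendsto_norm_zero_cancel[OF this]] show ?thesis .
qed

lemma norm_diff_le_vector_derivative:
 fixes f :: "real \<Rightarrow> 'b::real_normed_vector"
 assumes "convex S" "\<And>t. t \<in> S \<Longrightarrow> (f has_vector_derivative f' t) (at t within S)"
  "\<And>t. t \<in> S \<Longrightarrow> norm (f' t) \<le> B" "x \<in> S" "y \<in> S"
 shows "norm (f x - f y) \<le> B * \<bar>x - y\<bar>"
proof -
 have "norm (f x - f y) \<le> B * norm (x - y)"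
 proof (rule differentiable_bound[where S = S and f' = "\<lambda>t h. h *\<^sub>R f' t"])
  show "onorm (\<lambda>h. h *\<^sub>R f' t) \<le> B" if "t \<in> S" for t
  proof (rule onorm_le)
   fix h :: real
   show "norm (h *\<^sub>R f' t) \<le> B * norm h" using mult_left_mono[OF assms(3)[OF that], of "\<bar>h\<bar>"] by (simp add: mult.commute)
  qed
 qed (use assms in \<open>auto simp: has_vector_derivative_def\<close>)
 thus ?thesis by simp
qed

text \<open>Translation invariance makes the difference quotients integrate to zero.\<close>
lemma integral_directional_derivative:
 fixes G D :: wave
 assumes G: "continuous_on UNIV G" and D: "continuous_on UNIV D"
  and K: "compact K" "\<And>x. x \<notin> K \<Longrightarrow> G x = 0"
  and der: "\<And>x. ((\<lambda>t. G (x + t *\<^sub>R e)) has_vector_derivative D x) (at 0)"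
 shows "integrable lborel D" "(LINT x|lborel. D x) = 0"
proof -
 have D0: "D x = 0" if "x \<notin> K" for x
 proof -
  have "open (-K)" using K by (simp add: compact_imp_closed open_Compl)
  hence op: "open ((\<lambda>t. x + t *\<^sub>R e) -` (-K))" by (rule open_vimage) (intro continuous_intros)
  have "((\<lambda>t. 0) has_vector_derivative D x) (at 0)"
   by (rule has_vector_derivative_transform_within_open[OF der op]) (use that K in auto)
  thus ?thesis
   using vector_derivative_unique_at[OF _ has_vector_derivative_const] by blast
 qed
 show "integrable lborel D" by (rule integrable_continuous_compact_support[OF D K(1) D0])
 obtain B where B: "B > 0" "\<And>x. norm (D x) \<le> B" using bounded_compact_support[OF D K(1) D0] by metis
 have Gint: "integrable lborel G" by (rule integrable_continuous_compact_support[OF G K])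
 have Gm[measurable]: "G \<in> borel_measurable borel" using G by (simp add: borel_measurable_continuous_onI)
 have Dm[measurable]: "D \<in> borel_measurable borel" using D by (simp add: borel_measurable_continuous_onI)
 have der': "((\<lambda>t. G (x + t *\<^sub>R e)) has_vector_derivative D (x + t *\<^sub>R e)) (at t)" for x t
 proof -
  have 1: "((\<lambda>s. s - t) has_vector_derivative 1) (at t)" by (auto intro!: derivative_eq_intros)
  have 2: "((\<lambda>s. G ((x + t *\<^sub>R e) + s *\<^sub>R e)) has_vector_derivative D (x + t *\<^sub>R e)) (at (t - t))"
   using der[of "x + t *\<^sub>R e"] by simp
  have "((\<lambda>s. G ((x + t *\<^sub>R e) + s *\<^sub>R e)) \<circ> (\<lambda>s. s - t) has_vector_derivative 1 *\<^sub>R D (x + t *\<^sub>R e)) (at t)"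
   by (rule vector_diff_chain_at[OF 1 2])
  thus ?thesis by (simp add: o_def algebra_simps)
 qed
 obtain r where r: "r > 0" "K \<subseteq> cball 0 r"
  using compact_imp_bounded[OF K(1)] unfolding bounded_pos by (auto simp: subset_eq)
 \<comment> \<open>The shifts have length at most \<open>norm e\<close>; a ball enlarged by that
   much supports all the difference quotients \<open>s n\<close> at once and carries the dominating
   function.\<close>
 define K' where "K' = cball (0::real^3) (r + norm e)"
 define s where "s n x = (real (Suc n)) *\<^sub>R (G (x + (1 / real (Suc n)) *\<^sub>R e) - G x)" for n x
 have lim: "(\<lambda>n. s n x) \<longlonglongrightarrow> D x" for x
 proof -
  have "((\<lambda>t. (G (x + t *\<^sub>R e) - G x) /\<^sub>R t) \<longlongrightarrow> D x) (at 0)"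
   using has_vector_derivative_difference_quotient[OF der[of x]] by simp
  hence "((\<lambda>n. (G (x + (1 / real (Suc n)) *\<^sub>R e) - G x) /\<^sub>R (1 / real (Suc n))) \<longlongrightarrow> D x) sequentially"
   by (rule filterlim_compose) (use LIMSEQ_Suc[OF lim_1_over_n[where 'a=real]] in \<open>auto simp: filterlim_at\<close>)
  thus ?thesis by (simp add: s_def)
 qed
 have bnd: "norm (s n x) \<le> indicator K' x * B" for n x
 proof (cases "x \<in> K'")
  case True
  have "norm (G (x + (1 / real (Suc n)) *\<^sub>R e) - G (x + 0 *\<^sub>R e)) \<le> B * norm (1 / real (Suc n) - 0)"
   unfolding real_norm_def
   by (rule norm_diff_le_vector_derivative[where S = UNIV and f = "\<lambda>t. G (x + t *\<^sub>R e)" and f' = "\<lambda>t. D (x + t *\<^sub>R e)"]) (use B der' in auto)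
  hence "norm (s n x) \<le> real (Suc n) * (B * (1 / real (Suc n)))"
   unfolding s_def norm_scaleR by (intro mult_mono) auto
  thus ?thesis using True by simp
 next
  case False
  have a: "x \<notin> K"
  proof
   assume "x \<in> K"
   hence "norm x \<le> r" using r(2) by auto
   thus False using False norm_ge_zero[of e] unfolding K'_def by (simp add: add_increasing2)
  qed
  have "x + (1 / real (Suc n)) *\<^sub>R e \<notin> K"
  proof
   assume "x + (1 / real (Suc n)) *\<^sub>R e \<in> K"
   hence "norm (x + (1 / real (Suc n)) *\<^sub>R e) \<le> r" using r by auto
   moreover have "norm ((1 / real (Suc n)) *\<^sub>R e) \<le> norm e"
    using mult_right_mono[of "1 / real (Suc n)" 1 "norm e"] by simp
   ultimately have "norm x \<le> r + norm e"
    using norm_triangle_ineq4[of "x + (1 / real (Suc n)) *\<^sub>R e" "(1 / real (Suc n)) *\<^sub>R e"] by simp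
   thus False using False unfolding K'_def by simp
  qed
  thus ?thesis using a K False by (simp add: s_def)
 qed
 have "(\<lambda>n. LINT x|lborel. s n x) \<longlonglongrightarrow> (LINT x|lborel. D x)"
 proof (rule integral_dominated_convergence[where w = "\<lambda>x. indicator K' x * B"])
  have "emeasure lborel K' < \<infinity>" unfolding K'_def by (intro emeasure_compact_finite) auto
  thus "integrable lborel (\<lambda>x. indicator K' x * B)" unfolding K'_def by (intro integrable_mult_left) auto
  show "s n \<in> borel_measurable lborel" for n unfolding s_def by measurable
 qed (use lim bnd in auto)
 moreover have "(LINT x|lborel. s n x) = 0" for n
 proof -
  have 1: "(LINT x|lborel. G (x + (1 / real (Suc n)) *\<^sub>R e)) = (LINT x|lborel. G x)"
   using lborel_integral_translate[OF Gm, of "(1 / real (Suc n)) *\<^sub>R e"] by (simp add: add.commute)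
  have 2: "integrable lborel (\<lambda>x. G (x + (1 / real (Suc n)) *\<^sub>R e))"
  proof (rule integrable_continuous_compact_support[of _ "(\<lambda>x. x - (1 / real (Suc n)) *\<^sub>R e) ` K"])
   show "continuous_on UNIV (\<lambda>x. G (x + (1 / real (Suc n)) *\<^sub>R e))"
    by (intro continuous_on_compose2[OF G] continuous_intros) auto
   show "compact ((\<lambda>x. x - (1 / real (Suc n)) *\<^sub>R e) ` K)"
    by (intro compact_continuous_image K continuous_intros)
   show "G (x + (1 / real (Suc n)) *\<^sub>R e) = 0" if "x \<notin> (\<lambda>x. x - (1 / real (Suc n)) *\<^sub>R e) ` K" for x

   proof (rule K(2), rule notI)
    assume "x + (1 / real (Suc n)) *\<^sub>R e \<in> K"
    hence "(x + (1 / real (Suc n)) *\<^sub>R e) - (1 / real (Suc n)) *\<^sub>R e \<in> (\<lambda>x. x - (1 / real (Suc n)) *\<^sub>R e) ` K"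
     by (rule imageI)
    thus False using that by simp
   qed
  qed
  show ?thesis unfolding s_def using Gint 1 2 by simp
 qed
 ultimately show "(LINT x|lborel. D x) = 0" by (simp add: LIMSEQ_const_iff)
qed

section \<open>Closure properties of weak solutions\<close>

lemma helm_mult_continuous:
 assumes "continuous_on S u" "open S" "C2_data \<phi> g h" "compact K" "K \<subseteq> S" "\<And>x. x \<notin> K \<Longrightarrow> \<phi> x = 0"
 shows "continuous_on UNIV (\<lambda>x. u x * helm k \<phi> h x)"
proof (rule continuous_on_UNIV_support[OF _ assms(2,4,5)])
 show "continuous_on S (\<lambda>x. u x * helm k \<phi> h x)"
  by (intro continuous_intros assms(1) continuous_on_subset[OF continuous_on_helm[OF assms(3)]]) auto
 show "u x * helm k \<phi> h x = 0" if "x \<notin> K" for x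
  using helm_zero_outside[OF assms(3) compact_imp_closed[OF assms(4)] assms(6) that] by simp
qed

lemma helm_mult_integrable:
 assumes "continuous_on S u" "open S" "C2_data \<phi> g h" "compact K" "K \<subseteq> S" "\<And>x. x \<notin> K \<Longrightarrow> \<phi> x = 0"
 shows "integrable lborel (\<lambda>x. u x * helm k \<phi> h x)"
proof (rule integrable_continuous_compact_support[OF helm_mult_continuous[OF assms] assms(4)])
 show "u x * helm k \<phi> h x = 0" if "x \<notin> K" for x
  using helm_zero_outside[OF assms(3) compact_imp_closed[OF assms(4)] assms(6) that] by simp
qed

lemma weak_helmholtzD:
 assumes "weak_helmholtz k S u" "C2_data \<phi> g h" "compact K" "K \<subseteq> S" "\<And>x. x \<notin> K \<Longrightarrow> \<phi> x = 0"
 shows "(LINT x|lborel. u x * helm k \<phi> h x) = 0"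
 using assms unfolding weak_helmholtz_def by blast

lemma weak_helmholtz_continuous: "weak_helmholtz k S u \<Longrightarrow> continuous_on S u"
 unfolding weak_helmholtz_def by blast

lemma weak_helmholtz_subset:
 assumes "weak_helmholtz k S u" "T \<subseteq> S" shows "weak_helmholtz k T u"
 unfolding weak_helmholtz_def
 using weak_helmholtzD[OF assms(1)] continuous_on_subset[OF weak_helmholtz_continuous[OF assms(1)] assms(2)] assms(2)
 by (metis order_trans)

lemma weak_helmholtz_cong:
 assumes "weak_helmholtz k S u" "\<And>x. x \<in> S \<Longrightarrow> u x = v x" shows "weak_helmholtz k S v"
 unfolding weak_helmholtz_def
proof (intro conjI allI impI)
 show "continuous_on S v" using weak_helmholtz_continuous[OF assms(1)] assms(2) continuous_on_cong[of S S u v] by simp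
 fix \<phi> g h K assume a: "C2_data \<phi> g h" "compact K" "K \<subseteq> S" "\<forall>x. x \<notin> K \<longrightarrow> \<phi> x = 0"
 have "v x * helm k \<phi> h x = u x * helm k \<phi> h x" for x
  using assms(2)[of x] a(3) helm_zero_outside[OF a(1) compact_imp_closed[OF a(2)], of x k] a(4) by (cases "x \<in> K") auto
 hence "(LINT x|lborel. v x * helm k \<phi> h x) = (LINT x|lborel. u x * helm k \<phi> h x)" by presburger
 thus "(LINT x|lborel. v x * helm k \<phi> h x) = 0"
  using weak_helmholtzD[OF assms(1) a(1-3)] a(4) by metis
qed

lemma weak_helmholtz_diff:
 assumes "weak_helmholtz k S u" "weak_helmholtz k S v" "open S"
 shows "weak_helmholtz k S (\<lambda>x. u x - v x)"
 unfolding weak_helmholtz_def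
proof (intro conjI allI impI)
 show "continuous_on S (\<lambda>x. u x - v x)"
  by (intro continuous_intros weak_helmholtz_continuous[OF assms(1)] weak_helmholtz_continuous[OF assms(2)])
 fix \<phi> g h K assume a: "C2_data \<phi> g h" "compact K" "K \<subseteq> S" "\<forall>x. x \<notin> K \<longrightarrow> \<phi> x = 0"
 have z: "\<And>x. x \<notin> K \<Longrightarrow> \<phi> x = 0" using a(4) by blast
 show "(LINT x|lborel. (u x - v x) * helm k \<phi> h x) = 0"
  using weak_helmholtzD[OF assms(1) a(1-3) z] weak_helmholtzD[OF assms(2) a(1-3) z]
   helm_mult_integrable[OF weak_helmholtz_continuous[OF assms(1)] assms(3) a(1-3) z, of k]
   helm_mult_integrable[OF weak_helmholtz_continuous[OF assms(2)] assms(3) a(1-3) z, of k]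
  by (simp add: left_diff_distrib)
qed

lemma has_vector_derivative_pd:
 assumes "u differentiable (at x)"
 shows "((\<lambda>t. u (x + t *\<^sub>R axis i 1)) has_vector_derivative pd i u x) (at 0)"
proof -
 have "(\<lambda>t. u (x + t *\<^sub>R axis i 1)) differentiable (at 0)"
 proof (rule differentiable_compose[of u])
  show "u differentiable at (x + 0 *\<^sub>R axis i 1)" using assms by simp
  show "(\<lambda>t. x + t *\<^sub>R axis i 1) differentiable at 0"
   by (rule differentiableI[of _ "\<lambda>t. t *\<^sub>R axis i 1"]) (auto intro!: derivative_eq_intros)
 qed
 thus ?thesis unfolding pd_def by (simp add: vector_derivative_works[symmetric])
qed

text \<open>Green's second identity without a boundary: the components \<open>G i\<close> of
  \<open>u grad \<phi> - \<phi> grad u\<close> have compact support, the first-order terms cancel in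
  their derivatives \<open>D i\<close>, and each \<open>D i\<close> integrates to zero.\<close>

lemma C2_on_imp_weak_helmholtz:
 assumes C2: "C2_on S u" and S: "open S"
  and eq: "\<And>x. x \<in> S \<Longrightarrow> laplacian u x + (cof k)\<^sup>2 * u x = 0"
 shows "weak_helmholtz k S u"
 unfolding weak_helmholtz_def
proof (intro conjI allI impI)
 have du: "\<And>x. x \<in> S \<Longrightarrow> u differentiable (at x)" and dpu: "\<And>x i. x \<in> S \<Longrightarrow> pd i u differentiable (at x)"
  and ch: "\<And>i j. continuous_on S (pd j (pd i u))" using C2 unfolding C2_on_def by auto
 show cu: "continuous_on S u" using du by (meson continuous_at_imp_continuous_on differentiable_imp_continuous_within)
 have cpu: "continuous_on S (pd i u)" for i using dpu by (meson continuous_at_imp_continuous_on differentiable_imp_continuous_within)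
 fix \<phi> g h K assume a: "C2_data \<phi> g h" "compact K" "K \<subseteq> S" "\<forall>x. x \<notin> K \<longrightarrow> \<phi> x = 0"
 have z: "\<And>x. x \<notin> K \<Longrightarrow> \<phi> x = 0" using a(4) by blast
 note z2 = C2_data_zero_outside[OF a(1) compact_imp_closed[OF a(2)] z]
 define G where "G i x = u x * g i x - \<phi> x * pd i u x" for i x
 define D where "D i x = u x * h i i x - \<phi> x * pd i (pd i u) x" for i x
 have zG: "G i x = 0" and zD: "D i x = 0" if "x \<notin> K" for i x
  using z[OF that] z2[OF _ that] that by (auto simp: G_def D_def z z2)
 have cS: "continuous_on S (G i)" "continuous_on S (D i)" for i
  unfolding G_def D_def
  by (intro continuous_intros cu cpu ch continuous_on_subset[OF C2_dataD(3)[OF a(1)]]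
    continuous_on_subset[OF C2_dataD(4)[OF a(1)]] continuous_on_subset[OF C2_dataD(5)[OF a(1)]] subset_UNIV)+
 have cG: "continuous_on UNIV (G i)" for i
  by (rule continuous_on_UNIV_support[OF cS(1) S a(2,3) zG])
 have cD: "continuous_on UNIV (D i)" for i
  by (rule continuous_on_UNIV_support[OF cS(2) S a(2,3) zD])
 have der: "((\<lambda>t. G i (x + t *\<^sub>R axis i 1)) has_vector_derivative D i x) (at 0)" for i x
 proof (cases "x \<in> S")
  case True
  have s: "((\<lambda>t. x + t *\<^sub>R axis i 1) has_derivative (\<lambda>t. t *\<^sub>R axis i 1)) (at 0)" by (auto intro!: derivative_eq_intros)
  have sm: "(\<Sum>j\<in>UNIV. (t *\<^sub>R axis i 1 :: real^3) $ j *\<^sub>R w j) = t *\<^sub>R w i" for t and w :: "3 \<Rightarrow> complex"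
   by (simp add: axis_def if_distrib[of "\<lambda>c. c *\<^sub>R _"] if_distrib[of "\<lambda>c. _ * c"] cong: if_cong)
  have 1: "((\<lambda>t. \<phi> (x + t *\<^sub>R axis i 1)) has_vector_derivative g i x) (at 0)"
   using has_derivative_compose[OF s, of \<phi> "\<lambda>v. \<Sum>i\<in>UNIV. v$i *\<^sub>R g i x"] C2_dataD(1)[OF a(1), of x]
   by (simp add: has_vector_derivative_def sm del: vector_scaleR_component)
  have 2: "((\<lambda>t. g i (x + t *\<^sub>R axis i 1)) has_vector_derivative h i i x) (at 0)"
   using has_derivative_compose[OF s, of "g i" "\<lambda>v. \<Sum>j\<in>UNIV. v$j *\<^sub>R h i j x"] C2_dataD(2)[OF a(1), of i x]
   by (simp add: has_vector_derivative_def sm del: vector_scaleR_component)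
  note 3 = has_vector_derivative_pd[OF du[OF True], of i] has_vector_derivative_pd[OF dpu[OF True], of i i]
  show ?thesis unfolding G_def D_def
   using has_vector_derivative_diff[OF has_vector_derivative_mult[OF 3(1) 2] has_vector_derivative_mult[OF 1 3(2)]]
   by (simp add: algebra_simps)
 next
  case False
  hence xK: "x \<notin> K" using a(3) by auto
  have "open (-K)" using a(2) by (simp add: compact_imp_closed open_Compl)
  hence op: "open ((\<lambda>t. x + t *\<^sub>R axis i 1) -` (-K))" by (rule open_vimage) (intro continuous_intros)
  show ?thesis unfolding zD[OF xK]
   by (rule has_vector_derivative_transform_within_open[OF has_vector_derivative_const op]) (use xK zG in auto)
 qed
 note I = integral_directional_derivative[OF cG cD a(2) zG der]
 have "u x * helm k \<phi> h x = (\<Sum>i\<in>UNIV. D i x)" for x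
 proof (cases "x \<in> S")
  case True
  have "(\<Sum>i\<in>UNIV. D i x) = u x * (\<Sum>i\<in>UNIV. h i i x) - \<phi> x * laplacian u x"
   by (simp add: D_def laplacian_def sum_subtractf sum_distrib_left)
  also have "laplacian u x = - (cof k)\<^sup>2 * u x" using eq[OF True] by (simp add: eq_neg_iff_add_eq_0)
  finally show ?thesis by (simp add: helm_def algebra_simps)
 next
  case False
  hence xK: "x \<notin> K" using a(3) by auto
  thus ?thesis using zD[OF xK] helm_zero_outside[OF a(1) compact_imp_closed[OF a(2)] z xK] by simp
 qed
 thus "(LINT x|lborel. u x * helm k \<phi> h x) = 0" using I by (simp add: Bochner_Integration.integral_sum)
qed

section \<open>Reflection in a plane\<close>

definition plane_refl :: "real^3 \<Rightarrow> real \<Rightarrow> real^3 \<Rightarrow> real^3" where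
 "plane_refl n c x = x - (2 * (x \<bullet> n - c)) *\<^sub>R n"

context
 fixes n :: "real^3" and c :: real
 assumes n: "norm n = 1"
begin

lemma nn: "n \<bullet> n = 1" using n by (simp add: norm_eq_1)

lemma plane_refl_inner: "plane_refl n c x \<bullet> n - c = - (x \<bullet> n - c)"
 by (simp add: plane_refl_def inner_diff_left nn)

lemma plane_refl_plane_refl: "plane_refl n c (plane_refl n c x) = x"
 using plane_refl_inner[of x] by (simp add: plane_refl_def[of n c "plane_refl n c x"]) (simp add: plane_refl_def algebra_simps)

lemma plane_refl_on_plane: "x \<bullet> n = c \<Longrightarrow> plane_refl n c x = x"
 by (simp add: plane_refl_def)

lemma continuous_on_plane_refl: "continuous_on S (plane_refl n c)"
 unfolding plane_refl_def by (intro continuous_intros)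

lemma dist_plane_refl: "dist (plane_refl n c x) (plane_refl n c y) = dist x y"
proof -
 have e: "plane_refl n c x - plane_refl n c y = (x - y) - (2 * ((x - y) \<bullet> n)) *\<^sub>R n"
  by (simp add: plane_refl_def inner_diff_left algebra_simps)
 have "(norm ((x - y) - (2 * ((x - y) \<bullet> n)) *\<^sub>R n))\<^sup>2 = (norm (x - y))\<^sup>2"
  unfolding power2_norm_eq_inner by (simp add: inner_diff_left inner_diff_right nn inner_commute algebra_simps)
 thus ?thesis unfolding dist_norm e by simp
qed

text \<open>The linear part \<open>L\<close> is an orthogonal involution, so preimages of boxes are
  images and keep their measure; what remains is a translation.\<close>

lemma lborel_plane_refl: "distr lborel borel (plane_refl n c) = lborel"
proof -
 define L where "L x = x - (2 * (x \<bullet> n)) *\<^sub>R n" for x :: "real^3"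
 have lin: "linear L" unfolding L_def
  by (rule linearI) (simp_all add: inner_add_left algebra_simps)
 have L2: "L (L x) = x" for x unfolding L_def by (simp add: inner_diff_left nn algebra_simps)
 have iso: "norm (L x) = norm x" for x
 proof -
  have "(norm (L x))\<^sup>2 = (norm x)\<^sup>2" unfolding power2_norm_eq_inner L_def
   by (simp add: inner_diff_left inner_diff_right nn inner_commute algebra_simps)
  thus ?thesis by simp
 qed
 have orth: "orthogonal_transformation L" using lin iso by (simp add: orthogonal_transformation)
 have [measurable]: "L \<in> borel_measurable borel" unfolding L_def by measurable
 have "lborel = distr lborel borel L"
 proof (rule lborel_eqI)
  fix l u :: "real^3" assume le: "\<And>b. b \<in> Basis \<Longrightarrow> l \<bullet> b \<le> u \<bullet> b"
  have v: "L -` box l u = L ` box l u" using L2 by (auto simp: image_iff) metis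
  have m: "L ` box l u \<in> sets borel"
   unfolding v[symmetric] using measurable_sets[of L borel borel "box l u"] by simp
  have "emeasure (distr lborel borel L) (box l u) = emeasure lborel (L ` box l u)"
   by (simp add: emeasure_distr v)
  also have "\<dots> = emeasure lebesgue (L ` box l u)" using m by simp
  also have "\<dots> = ennreal (measure lebesgue (L ` box l u))"
   by (intro emeasure_eq_measure2 measurable_orthogonal_image orth) simp
  also have "measure lebesgue (L ` box l u) = measure lebesgue (box l u)"
   by (rule measure_orthogonal_image[OF orth]) simp
  also have "\<dots> = prod ((\<bullet>) (u - l)) Basis" using le by (simp add: measure_lborel_box inner_diff_left)
  finally show "emeasure (distr lborel borel L) (box l u) = ennreal (prod ((\<bullet>) (u - l)) Basis)" .
 qed simp
 moreover have "plane_refl n c = (\<lambda>x. (2 * c) *\<^sub>R n + x) \<circ> L"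
  by (auto simp: plane_refl_def L_def algebra_simps)
 ultimately show ?thesis
  using distr_distr[of "\<lambda>x. (2 * c) *\<^sub>R n + x" borel borel L lborel] lborel_distr_plus[of "(2 * c) *\<^sub>R n"] by simp
qed

lemma lborel_integral_plane_refl:
 fixes f :: wave
 assumes "continuous_on UNIV f"
 shows "(LINT x|lborel. f (plane_refl n c x)) = (LINT x|lborel. f x)"
proof -
 have [measurable]: "f \<in> borel_measurable borel" "plane_refl n c \<in> borel_measurable borel"
  using assms by (auto intro!: borel_measurable_continuous_onI continuous_on_plane_refl)
 have "(LINT x|lborel. f x) = (LINT x|distr lborel borel (plane_refl n c). f x)" by (simp add: lborel_plane_refl)
 also have "\<dots> = (LINT x|lborel. f (plane_refl n c x))" by (subst integral_distr) auto
 finally show ?thesis ..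
qed

text \<open>\<open>m\<close> is the Householder matrix of the reflection. Its columns are
  orthonormal, which is \<open>mm\<close> below, and therefore the transformed Hessian has the same
  trace as the old one.\<close>

lemma C2_data_plane_refl:
 fixes \<phi> g h
 assumes "C2_data \<phi> g h"
 defines "m \<equiv> \<lambda>i l. (if i = l then 1 else 0) - 2 * n$i * n$l"
 shows "C2_data (\<lambda>x. \<phi> (plane_refl n c x)) (\<lambda>i x. \<Sum>l\<in>UNIV. m i l *\<^sub>R g l (plane_refl n c x))
   (\<lambda>i j x. \<Sum>l\<in>UNIV. m i l *\<^sub>R (\<Sum>p\<in>UNIV. m j p *\<^sub>R h l p (plane_refl n c x)))"
  and "helm k (\<lambda>x. \<phi> (plane_refl n c x))
   (\<lambda>i j x. \<Sum>l\<in>UNIV. m i l *\<^sub>R (\<Sum>p\<in>UNIV. m j p *\<^sub>R h l p (plane_refl n c x))) x = helm k \<phi> h (plane_refl n c x)"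
proof -
 have R: "(plane_refl n c has_derivative (\<lambda>v. v - (2 * (v \<bullet> n)) *\<^sub>R n)) (at x)" for x
  unfolding plane_refl_def by (auto intro!: derivative_eq_intros)
 have sm: "(\<Sum>l\<in>UNIV. (v - (2 * (v \<bullet> n)) *\<^sub>R n)$l *\<^sub>R w l) = (\<Sum>i\<in>UNIV. v$i *\<^sub>R (\<Sum>l\<in>UNIV. m i l *\<^sub>R w l))"
  for v and w :: "3 \<Rightarrow> complex"
 proof -
  have e: "(v - (2 * (v \<bullet> n)) *\<^sub>R n)$l = v$l - 2 * (v$1 * n$1 + v$2 * n$2 + v$3 * n$3) * n$l" for l
   by (simp add: inner_vec_def sum_3)
  show ?thesis unfolding e by (simp add: m_def sum_3 scaleR_conv_of_real algebra_simps)
 qed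
 show "C2_data (\<lambda>x. \<phi> (plane_refl n c x)) (\<lambda>i x. \<Sum>l\<in>UNIV. m i l *\<^sub>R g l (plane_refl n c x))
   (\<lambda>i j x. \<Sum>l\<in>UNIV. m i l *\<^sub>R (\<Sum>p\<in>UNIV. m j p *\<^sub>R h l p (plane_refl n c x)))"
  unfolding C2_data_def
 proof (intro conjI allI)
  show "((\<lambda>x. \<phi> (plane_refl n c x)) has_derivative (\<lambda>v. \<Sum>i\<in>UNIV. v$i *\<^sub>R (\<Sum>l\<in>UNIV. m i l *\<^sub>R g l (plane_refl n c x)))) (at x)" for x
   using has_derivative_compose[OF R C2_dataD(1)[OF assms(1)], of x] by (simp only: sm)
  have gd: "((\<lambda>x. g l (plane_refl n c x)) has_derivative (\<lambda>v. \<Sum>i\<in>UNIV. v$i *\<^sub>R (\<Sum>p\<in>UNIV. m i p *\<^sub>R h l p (plane_refl n c x)))) (at x)" for x l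
   using has_derivative_compose[OF R C2_dataD(2)[OF assms(1), of l], of x] by (simp only: sm)
  show "((\<lambda>x. \<Sum>l\<in>UNIV. m i l *\<^sub>R g l (plane_refl n c x)) has_derivative
    (\<lambda>v. \<Sum>j\<in>UNIV. v$j *\<^sub>R (\<Sum>l\<in>UNIV. m i l *\<^sub>R (\<Sum>p\<in>UNIV. m j p *\<^sub>R h l p (plane_refl n c x))))) (at x)" for i x
   by (rule derivative_eq_intros gd refl)+
    (simp add: sum_3 scaleR_conv_of_real algebra_simps)
  show "continuous_on UNIV (\<lambda>x. \<Sum>l\<in>UNIV. m i l *\<^sub>R (\<Sum>p\<in>UNIV. m j p *\<^sub>R h l p (plane_refl n c x)))" for i j
   by (intro continuous_intros continuous_on_compose2[OF C2_dataD(3)[OF assms(1)] continuous_on_plane_refl]) auto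
 qed
 have n2: "n$1 * n$1 + n$2 * n$2 + n$3 * n$3 = 1" using nn by (simp add: inner_vec_def sum_3)
 have mm: "(\<Sum>i\<in>UNIV. m i l * m i p) = (if l = p then 1 else 0)" for l p
 proof -
  have "(\<Sum>i\<in>UNIV. m i l * m i p) = (if l = p then 1 else 0) - 4 * n$l * n$p + 4 * n$l * n$p * (\<Sum>i\<in>UNIV. n$i * n$i)"
   using exhaust_3[of l] exhaust_3[of p] by (auto simp: m_def sum_3 algebra_simps)
  thus ?thesis using n2 by (simp add: sum_3)
 qed
 have "(\<Sum>i\<in>UNIV. \<Sum>l\<in>UNIV. m i l *\<^sub>R (\<Sum>p\<in>UNIV. m i p *\<^sub>R w l p)) = (\<Sum>l\<in>UNIV. \<Sum>p\<in>UNIV. (\<Sum>i\<in>UNIV. m i l * m i p) *\<^sub>R w l p)"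
  for w :: "3 \<Rightarrow> 3 \<Rightarrow> complex"
  by (simp add: sum_3 scaleR_conv_of_real algebra_simps)
 also have "\<dots> w = (\<Sum>l\<in>UNIV. w l l)" for w :: "3 \<Rightarrow> 3 \<Rightarrow> complex"
  by (simp add: mm if_distrib[of "\<lambda>c. c *\<^sub>R _"] cong: if_cong)
 finally show "helm k (\<lambda>x. \<phi> (plane_refl n c x))
   (\<lambda>i j x. \<Sum>l\<in>UNIV. m i l *\<^sub>R (\<Sum>p\<in>UNIV. m j p *\<^sub>R h l p (plane_refl n c x))) x = helm k \<phi> h (plane_refl n c x)"
  by (simp only: helm_def)
qed

end

section \<open>A smooth step function\<close>

lemma has_real_derivative_cutoff:
 fixes p p' :: "real \<Rightarrow> real"
 assumes d: "\<And>t. (p has_real_derivative p' t) (at t)"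
  and z: "p a = 0" "p b = 0" "p' a = 0" "p' b = 0" and ab: "a < b"
 shows "((\<lambda>t. if a \<le> t \<and> t \<le> b then p t else 0) has_real_derivative (if a \<le> t \<and> t \<le> b then p' t else 0)) (at t)"
proof -
 let ?f = "\<lambda>t. if a \<le> t \<and> t \<le> b then p t else 0"
 \<comment> \<open>Where \<open>p\<close> and \<open>p'\<close> both vanish, truncation can only
   shrink the difference quotient, which tends to zero already.\<close>
 have e: "(?f has_real_derivative 0) (at s)" if "s = a \<or> s = b" for s
 proof -
  have ps: "p s = 0" "p' s = 0" "?f s = 0" using that z by auto
  have "((\<lambda>h. (p (s + h) - p s) / h) \<longlongrightarrow> 0) (at 0)" using d[of s] ps by (simp add: DERIV_def)
  hence "((\<lambda>h. (?f (s + h) - ?f s) / h) \<longlongrightarrow> 0) (at 0)"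
   by (rule Lim_null_comparison[OF _ tendsto_norm_zero, rotated]) (use ps in \<open>auto intro!: always_eventually\<close>)
  thus ?thesis by (simp add: DERIV_def)
 qed
 consider "t < a" | "t > b" | "t = a \<or> t = b" | "a < t" "t < b" by linarith
 thus ?thesis
 proof cases
  case 1
  have "(?f has_real_derivative 0) (at t)"
   by (rule has_field_derivative_transform_within_open[OF DERIV_const[of 0], where S = "{..<a}"]) (use 1 in auto)
  thus ?thesis using 1 by simp
 next
  case 2
  have "(?f has_real_derivative 0) (at t)"
   by (rule has_field_derivative_transform_within_open[OF DERIV_const[of 0], where S = "{b<..}"]) (use 2 in auto)
  thus ?thesis using 2 by simp
 next
  case 3
  thus ?thesis using e[OF 3] z by auto
 next
  case 4
  have "(?f has_real_derivative p' t) (at t)"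
   by (rule has_field_derivative_transform_within_open[OF d, where S = "{a<..<b}"]) (use 4 in auto)
  thus ?thesis using 4 by simp
 qed
qed

text \<open>\<open>bump_poly j\<close> is the j-th derivative of \<open>w ^ 5\<close> for
  \<open>j \<le> 3\<close>, with \<open>z\<close> the derivative of \<open>w\<close>. The fifth
  power still leaves factors of \<open>w\<close> after three differentiations, so truncation to the
  interval keeps all of them continuous. The two radial integrations by parts at infinity consume
  derivatives of \<open>step\<close> up to the fourth.\<close>

definition bump_poly :: "nat \<Rightarrow> real \<Rightarrow> real" where
 "bump_poly j t = (let w = (t-1)*(2-t); z = 3 - 2*t in
   if j = 0 then w^5 else if j = 1 then 5*w^4*z else if j = 2 then 20*w^3*z^2 - 10*w^4
   else 60*w^2*z^3 - 120*w^3*z)"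

definition bump :: "nat \<Rightarrow> real \<Rightarrow> real" where
 "bump j t = (if 1 \<le> t \<and> t \<le> 2 then bump_poly j t else 0)"

lemma bump_poly_deriv:
 assumes "j < 3" shows "(bump_poly j has_real_derivative bump_poly (Suc j) t) (at t)"
proof -
 let ?w = "\<lambda>t::real. (t-1)*(2-t)" and ?z = "\<lambda>t::real. 3 - 2*t"
 have w: "(?w has_real_derivative ?z t) (at t)" by (auto intro!: derivative_eq_intros)
 have z: "(?z has_real_derivative -2) (at t)" by (auto intro!: derivative_eq_intros)
 have d: "((\<lambda>t. ?w t ^ n) has_real_derivative of_nat n * (?z t * ?w t ^ (n - 1))) (at t)" for n
  using DERIV_power[OF w, of n] by simp
 have p2: "((\<lambda>t. ?z t ^ 2) has_real_derivative 2 * (-2 * ?z t)) (at t)"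
  using DERIV_power[OF z, of 2] by simp
 consider "j = 0" | "j = 1" | "j = 2" using assms by linarith
 thus ?thesis
 proof cases
  case 1
  thus ?thesis using d[of 5] by (simp add: bump_poly_def[abs_def] Let_def mult_ac)
 next
  case 2
  have "((\<lambda>t. 5 * ?w t ^ 4 * ?z t) has_real_derivative 20*?w t^3*?z t^2 - 10*?w t^4) (at t)"
   by (rule DERIV_cong[OF DERIV_mult[OF DERIV_cmult[OF d[of 4]] z]]) (simp add: power2_eq_square)
  thus ?thesis using 2 by (simp add: bump_poly_def[abs_def] Let_def)
 next
  case 3
  have "((\<lambda>t. 20 * ?w t ^ 3 * ?z t ^ 2 - 10 * ?w t ^ 4) has_real_derivative 60*?w t^2*?z t^3 - 120*?w t^3*?z t) (at t)"
   by (rule DERIV_cong[OF DERIV_diff[OF DERIV_mult[OF DERIV_cmult[OF d[of 3]] p2] DERIV_cmult[OF d[of 4]]]])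
     (simp add: power2_eq_square power3_eq_cube, algebra)
  thus ?thesis using 3 by (simp add: bump_poly_def[abs_def] Let_def)
 qed
qed

lemma bump_deriv: "j < 3 \<Longrightarrow> (bump j has_real_derivative bump (Suc j) t) (at t)"
proof -
 assume "j < 3"
 have "(bump_poly j has_real_derivative bump_poly (Suc j) t) (at t)" for t by (rule bump_poly_deriv[OF \<open>j < 3\<close>])
 thus ?thesis unfolding bump_def[abs_def]
  by (rule has_real_derivative_cutoff) (use \<open>j < 3\<close> in \<open>auto simp: bump_poly_def Let_def\<close>)
qed

lemma bump_zero: "t \<le> 1 \<or> t \<ge> 2 \<Longrightarrow> bump j t = 0"
 by (auto simp: bump_def bump_poly_def Let_def)

lemma continuous_on_bump: "continuous_on UNIV (bump j)"
proof (cases "j < 3")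
 case True
 thus ?thesis using bump_deriv by (meson DERIV_continuous continuous_at_imp_continuous_on)
next
 case False
 have p: "continuous_on UNIV (bump_poly j)"
  using False by (simp add: bump_poly_def[abs_def] Let_def) (intro continuous_intros)
 have c: "continuous_on {1..2} (bump j)"
  using continuous_on_subset[OF p, of "{1..2}"] by (subst continuous_on_cong[of _ "{1..2}" _ "bump_poly j"]) (auto simp: bump_def)
 have d: "continuous_on {..1} (bump j)"
  by (subst continuous_on_cong[of _ "{..1}" _ "\<lambda>_. 0"]) (auto simp: bump_zero)
 have d': "continuous_on {2..} (bump j)"
  by (subst continuous_on_cong[of _ "{2..}" _ "\<lambda>_. 0"]) (auto simp: bump_zero)
 have "continuous_on ({..1} \<union> {1..2} \<union> {2..}) (bump j)"
  by (intro continuous_on_closed_Un c d d') auto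
 moreover have "{..1} \<union> {1..2} \<union> {2..} = (UNIV :: real set)" by auto
 ultimately show ?thesis by simp
qed

lemma bump0_nonneg: "bump 0 t \<ge> 0"
 by (auto simp: bump_def bump_poly_def Let_def)

definition bump_mass :: real where "bump_mass = integral {0..2} (bump 0)"

lemma bump_mass_pos: "bump_mass > 0"
proof -
 have c: "continuous_on {0..2} (bump 0)" using continuous_on_bump continuous_on_subset by blast
 have "bump_mass \<noteq> 0"
 proof
  assume "bump_mass = 0"
  hence "\<forall>t\<in>cbox 0 2. bump 0 t = 0"
   using integral_eq_0_iff[of 0 2 "bump 0"] c bump0_nonneg unfolding bump_mass_def by auto
  hence "bump 0 (3/2) = 0" by auto
  thus False by (simp add: bump_def bump_poly_def Let_def)
 qed
 moreover have "bump_mass \<ge> 0" unfolding bump_mass_def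
  by (rule integral_nonneg) (use c bump0_nonneg integrable_continuous_real in auto)
 ultimately show ?thesis by simp
qed

text \<open>A normalised primitive of the bump, constant 0 below 1 and constant 1 above 2, listed
  with its derivatives: \<open>step j\<close> is the j-th one for \<open>j \<le> 4\<close>.\<close>

definition step :: "nat \<Rightarrow> real \<Rightarrow> real" where
 "step j t = (case j of 0 \<Rightarrow> integral {0..t} (bump 0) / bump_mass | Suc i \<Rightarrow> bump i t / bump_mass)"

lemma step_zero: "t \<le> 1 \<Longrightarrow> step j t = 0"
proof (cases j)
 case 0
 assume "t \<le> 1"
 hence "integral {0..t} (bump 0) = integral {0..t} (\<lambda>_. 0)" by (intro integral_cong bump_zero) auto
 thus ?thesis using 0 by (simp add: step_def)
qed (auto simp: step_def bump_zero)

lemma step_one: "t \<ge> 2 \<Longrightarrow> step 0 t = 1"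
proof -
 assume "t \<ge> 2"
 have i: "bump 0 integrable_on {0..t}"
  using continuous_on_bump continuous_on_subset integrable_continuous_real by blast
 have "integral {0..2} (bump 0) + integral {2..t} (bump 0) = integral {0..t} (bump 0)"
  by (rule Henstock_Kurzweil_Integration.integral_combine) (use \<open>t \<ge> 2\<close> i in auto)
 moreover have "integral {2..t} (bump 0) = integral {2..t} (\<lambda>_. 0)" by (intro integral_cong bump_zero) auto
 ultimately show ?thesis using bump_mass_pos by (simp add: step_def bump_mass_def)
qed

lemma step_Suc_zero: "t \<ge> 2 \<Longrightarrow> step (Suc j) t = 0"
 by (simp add: step_def bump_zero)

lemma step_deriv: "j < 4 \<Longrightarrow> (step j has_real_derivative step (Suc j) t) (at t)"
proof (cases j)
 case 0
 show ?thesis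
 proof (cases "t > 0")
  case True
  have "((\<lambda>u. integral {0..u} (bump 0)) has_real_derivative bump 0 t) (at t within {0..t+1})"
   by (rule integral_has_real_derivative) (use True continuous_on_bump continuous_on_subset in \<open>auto intro: continuous_on_subset\<close>)
  moreover have "at t within {0..t+1} = at t" using True by (intro at_within_interior) (auto simp: interior_atLeastAtMost_real)
  ultimately have "((\<lambda>u. integral {0..u} (bump 0)) has_real_derivative bump 0 t) (at t)" by simp
  thus ?thesis unfolding 0 step_def[abs_def] using bump_mass_pos by (auto intro!: derivative_eq_intros)
 next
  case False
  have "(step 0 has_real_derivative 0) (at t)"
   by (rule has_field_derivative_transform_within_open[OF DERIV_const[of 0], where S = "{..<1}"])
     (use False in \<open>auto simp: step_zero\<close>)
  thus ?thesis using 0 False by (simp add: step_zero)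
 qed
next
 case (Suc i)
 assume "j < 4"
 hence "(bump i has_real_derivative bump (Suc i) t) (at t)" using Suc by (intro bump_deriv) auto
 thus ?thesis unfolding Suc step_def[abs_def] using bump_mass_pos by (auto intro!: derivative_eq_intros)
qed

lemma continuous_on_step: "j \<le> 4 \<Longrightarrow> continuous_on UNIV (step j)"
proof (cases j)
 case 0
 thus ?thesis using step_deriv[of 0] by (meson DERIV_continuous continuous_at_imp_continuous_on zero_less_numeral)
next
 case (Suc i)
 thus ?thesis unfolding step_def[abs_def] using bump_mass_pos by (auto intro!: continuous_intros continuous_on_bump)
qed

section \<open>Representation formula and analyticity\<close>

lemma has_vector_derivative_glue:
 fixes f g f' g' :: "real \<Rightarrow> 'b::real_normed_vector"
 assumes f: "\<And>t. t \<ge> a \<Longrightarrow> (f has_vector_derivative f' t) (at t)"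
  and g: "\<And>t. t \<le> a \<Longrightarrow> (g has_vector_derivative g' t) (at t)"
  and eq: "f a = g a" "f' a = g' a"
 shows "((\<lambda>t. if t \<ge> a then f t else g t) has_vector_derivative (if t \<ge> a then f' t else g' t)) (at t)"
proof -
 let ?F = "\<lambda>t. if t \<ge> a then f t else g t"
 consider "t < a" | "t > a" | "t = a" by linarith
 thus ?thesis
 proof cases
  case 1
  have "(?F has_vector_derivative g' t) (at t)"
   by (rule has_vector_derivative_transform_within_open[OF g, where S = "{..<a}"]) (use 1 in auto)
  thus ?thesis using 1 by simp
 next
  case 2
  have "(?F has_vector_derivative f' t) (at t)"
   by (rule has_vector_derivative_transform_within_open[OF f, where S = "{a<..}"]) (use 2 in auto)
  thus ?thesis using 2 by simp
 next
  case 3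
  have lf: "((\<lambda>h. norm (f (a + h) - f a - h *\<^sub>R f' a) / norm h) \<longlongrightarrow> 0) (at 0)"
   using f[of a] unfolding has_vector_derivative_def has_derivative_at by simp
  have lg: "((\<lambda>h. norm (g (a + h) - g a - h *\<^sub>R g' a) / norm h) \<longlongrightarrow> 0) (at 0)"
   using g[of a] unfolding has_vector_derivative_def has_derivative_at by simp
  \<comment> \<open>Both remainders are non-negative for the norm, so their sum dominates the
    remainder of the glued function on either side of \<open>a\<close>.\<close>
  have "((\<lambda>h. norm (f (a + h) - f a - h *\<^sub>R f' a) / norm h + norm (g (a + h) - g a - h *\<^sub>R g' a) / norm h) \<longlongrightarrow> 0) (at 0)"
   using tendsto_add[OF lf lg] by simp
  hence "((\<lambda>h. norm (?F (a + h) - ?F a - h *\<^sub>R f' a) / norm h) \<longlongrightarrow> 0) (at 0)"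
   by (rule Lim_null_comparison[rotated]) (use eq in \<open>auto intro!: always_eventually divide_nonneg_neg\<close>)
  hence "(?F has_vector_derivative f' a) (at a)"
   unfolding has_vector_derivative_def has_derivative_at by (simp add: bounded_linear_scaleR_left)
  thus ?thesis using 3 by simp
 qed
qed

text \<open>\<open>exp (i k r) / r\<close> and its first two derivatives with respect to
  \<open>z = r\<^sup>2\<close>. The variable is complex since points on a line will be given complex
  parameters.\<close>

definition fsol :: "real \<Rightarrow> nat \<Rightarrow> complex \<Rightarrow> complex" where
 "fsol k j z = (let q = csqrt z in
   if j = 0 then exp (\<i> * k * q) / q
   else if j = 1 then exp (\<i> * k * q) * (\<i> * k * q - 1) / (2 * q ^ 3)
   else exp (\<i> * k * q) * (3 - 3 * \<i> * k * q - k\<^sup>2 * q\<^sup>2) / (4 * q ^ 5))"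

lemma csqrt_nonzero: "z \<notin> \<real>\<^sub>\<le>\<^sub>0 \<Longrightarrow> csqrt z \<noteq> 0"
 by auto

lemma fsol_deriv:
 assumes z: "z \<notin> \<real>\<^sub>\<le>\<^sub>0" and j: "j < 2"
 shows "(fsol k j has_field_derivative fsol k (Suc j) z) (at z)"
proof -
 define q where "q = csqrt z"
 have q: "q \<noteq> 0" using csqrt_nonzero[OF z] by (simp add: q_def)
 have d: "(csqrt has_field_derivative (1 / (2 * q))) (at z)"
  using has_field_derivative_csqrt[OF z] by (simp add: q_def inverse_eq_divide)
 have chain: "((\<lambda>z. F (csqrt z)) has_field_derivative F' * (1 / (2 * q))) (at z)"
  if "(F has_field_derivative F') (at q)" for F F'
  using DERIV_chain2[OF _ d, of F F'] that by (simp add: q_def)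
 consider "j = 0" | "j = 1" using j by linarith
 thus ?thesis
 proof cases
  case 1
  have "((\<lambda>q. exp (\<i> * k * q) / q) has_field_derivative
    (exp (\<i> * k * q) * (\<i> * k) * q - exp (\<i> * k * q)) / (q * q)) (at q)"
   by (rule derivative_eq_intros refl q | simp)+
  from chain[OF this] have "((\<lambda>z. exp (\<i> * k * csqrt z) / csqrt z) has_field_derivative
    exp (\<i> * k * q) * (\<i> * k * q - 1) / (2 * q ^ 3)) (at z)"
   by (rule DERIV_cong) (use q in \<open>simp add: field_simps power3_eq_cube\<close>)
  thus ?thesis using 1 by (simp add: fsol_def[abs_def] Let_def q_def)
 next
  case 2
  have "((\<lambda>q. exp (\<i> * k * q) * (\<i> * k * q - 1) / (2 * q ^ 3)) has_field_derivative
    ((exp (\<i> * k * q) * (\<i> * k) * (\<i> * k * q - 1) + exp (\<i> * k * q) * (\<i> * k)) * (2 * q ^ 3) -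
     exp (\<i> * k * q) * (\<i> * k * q - 1) * (6 * q\<^sup>2)) / ((2 * q ^ 3) * (2 * q ^ 3))) (at q)"
   by (rule derivative_eq_intros refl | simp add: q)+
  from chain[OF this] have "((\<lambda>z. exp (\<i> * k * csqrt z) * (\<i> * k * csqrt z - 1) / (2 * csqrt z ^ 3)) has_field_derivative
    exp (\<i> * k * q) * (3 - 3 * \<i> * k * q - k\<^sup>2 * q\<^sup>2) / (4 * q ^ 5)) (at z)"
  proof (rule DERIV_cong)
   define e where "e = exp (\<i> * k * q)"
   have ii: "\<i> * \<i> = -1" by simp
   have "((e * (\<i> * k) * (\<i> * k * q - 1) + e * (\<i> * k)) * (2 * q ^ 3) - e * (\<i> * k * q - 1) * (6 * q\<^sup>2)) * (4 * q^5) =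
    e * (3 - 3 * \<i> * k * q - k\<^sup>2 * q\<^sup>2) * (((2 * q ^ 3) * (2 * q ^ 3)) * (2 * q))"
    unfolding of_real_power using ii by algebra
   thus "((exp (\<i> * k * q) * (\<i> * k) * (\<i> * k * q - 1) + exp (\<i> * k * q) * (\<i> * k)) * (2 * q ^ 3) -
     exp (\<i> * k * q) * (\<i> * k * q - 1) * (6 * q\<^sup>2)) / ((2 * q ^ 3) * (2 * q ^ 3)) * (1 / (2 * q)) =
     exp (\<i> * k * q) * (3 - 3 * \<i> * k * q - k\<^sup>2 * q\<^sup>2) / (4 * q ^ 5)"
    unfolding e_def using q by (simp add: frac_eq_eq)
  qed
  thus ?thesis using 2 by (simp add: fsol_def[abs_def] Let_def q_def numeral_2_eq_2[symmetric])
 qed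
qed

lemma continuous_on_fsol:
 assumes "continuous_on S f" "\<And>x. x \<in> S \<Longrightarrow> f x \<notin> \<real>\<^sub>\<le>\<^sub>0"
 shows "continuous_on S (\<lambda>x. fsol k j (f x))"
proof -
 have c: "continuous_on S (\<lambda>x. csqrt (f x))"
  by (rule continuous_on_compose2[OF continuous_on_csqrt assms(1)]) (use assms(2) in auto)
 show ?thesis unfolding fsol_def Let_def
  using csqrt_nonzero[OF assms(2)] by (cases "j = 0"; cases "j = 1") (auto intro!: continuous_intros c assms(1))
qed

lemma pos_notin_nonpos_Reals: "t > 0 \<Longrightarrow> cof t \<notin> \<real>\<^sub>\<le>\<^sub>0"
 by (simp add: complex_nonpos_Reals_iff)

lemma fsol_real_deriv:
 assumes "t > 0" "j < 2"
 shows "((\<lambda>t. fsol k j (cof t)) has_vector_derivative fsol k (Suc j) (cof t)) (at t)"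
proof -
 have "(cof has_vector_derivative 1) (at t)"
  using has_vector_derivative_of_real[OF DERIV_ident[of "at t"]] by simp
 hence "(fsol k j \<circ> cof has_vector_derivative 1 * fsol k (Suc j) (cof t)) (at t)"
  by (rule field_vector_diff_chain_at) (rule fsol_deriv[OF pos_notin_nonpos_Reals[OF assms(1)] assms(2)])
 thus ?thesis by (simp add: o_def)
qed

text \<open>For a radial function \<open>F (r\<^sup>2)\<close> in three dimensions the Laplacian is
  \<open>4 t F'' + 6 F'\<close> at \<open>t = r\<^sup>2\<close>, so this is the Helmholtz equation
  away from the pole.\<close>

lemma fsol_ode:
 assumes "t > 0"
 shows "4 * t * fsol k 2 (cof t) + 6 * fsol k 1 (cof t) + k\<^sup>2 * fsol k 0 (cof t) = 0"
proof -
 define q where "q = cof (sqrt t)"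
 have q: "csqrt (cof t) = q" using assms by (simp add: q_def)
 have t: "cof t = q * q" using assms unfolding q_def by (simp flip: of_real_mult)
 have q0: "q \<noteq> 0" using assms by (simp add: q_def)
 have "4 * (q * q) * (exp (\<i> * k * q) * (3 - 3 * \<i> * k * q - k\<^sup>2 * q\<^sup>2) / (4 * q ^ 5)) +
   6 * (exp (\<i> * k * q) * (\<i> * k * q - 1) / (2 * q ^ 3)) + k\<^sup>2 * (exp (\<i> * k * q) / q) = 0"
  using q0 by (simp add: field_simps) (simp add: eval_nat_numeral algebra_simps)
 thus ?thesis unfolding fsol_def Let_def q by (simp add: t)
qed

text \<open>Replacing a function of \<open>t = r\<^sup>2\<close> below \<open>a\<close> by its quadratic Taylor polynomial at \<open>a\<close> keeps it twice
 continuously differentiable; this regularises the fundamental solution at its singularity.\<close>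
definition taylor_glue :: "real \<Rightarrow> (nat \<Rightarrow> real \<Rightarrow> complex) \<Rightarrow> nat \<Rightarrow> real \<Rightarrow> complex" where
 "taylor_glue a F j t = (if t \<ge> a then F j t else
   if j = 0 then F 0 a + (t - a) *\<^sub>R F 1 a + ((t - a)\<^sup>2 / 2) *\<^sub>R F 2 a
   else if j = 1 then F 1 a + (t - a) *\<^sub>R F 2 a else F 2 a)"

lemma taylor_glue_deriv:
 assumes "\<And>t j. t \<ge> a \<Longrightarrow> j < 2 \<Longrightarrow> (F j has_vector_derivative F (Suc j) t) (at t)" "continuous_on {a..} (F 2)"
 shows "(taylor_glue a F 0 has_vector_derivative taylor_glue a F 1 t) (at t)"
  and "(taylor_glue a F 1 has_vector_derivative taylor_glue a F 2 t) (at t)"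
  and "continuous_on UNIV (taylor_glue a F 2)"
proof -
 have e: "taylor_glue a F 0 = (\<lambda>t. if t \<ge> a then F 0 t else F 0 a + (t - a) *\<^sub>R F 1 a + ((t - a)\<^sup>2 / 2) *\<^sub>R F 2 a)"
  "taylor_glue a F 1 = (\<lambda>t. if t \<ge> a then F 1 t else F 1 a + (t - a) *\<^sub>R F 2 a)"
  "taylor_glue a F 2 = (\<lambda>t. if t \<ge> a then F 2 t else F 2 a)"
  by (simp_all add: taylor_glue_def fun_eq_iff)
 have "((\<lambda>t. if t \<ge> a then F 0 t else F 0 a + (t - a) *\<^sub>R F 1 a + ((t - a)\<^sup>2 / 2) *\<^sub>R F 2 a) has_vector_derivative
  (if t \<ge> a then F 1 t else F 1 a + (t - a) *\<^sub>R F 2 a)) (at t)"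
 proof (rule has_vector_derivative_glue)
  show "((\<lambda>t. F 0 a + (t - a) *\<^sub>R F 1 a + ((t - a)\<^sup>2 / 2) *\<^sub>R F 2 a) has_vector_derivative F 1 a + (t - a) *\<^sub>R F 2 a) (at t)" for t
  proof -
   have r: "((\<lambda>t. t - a) has_real_derivative 1) (at t)" "((\<lambda>t. (t - a)\<^sup>2 / 2) has_real_derivative (t - a)) (at t)"
    by (auto intro!: derivative_eq_intros)
   have "((\<lambda>t. F 0 a + (t - a) *\<^sub>R F 1 a + ((t - a)\<^sup>2 / 2) *\<^sub>R F 2 a) has_vector_derivative
    (0 + ((t - a) *\<^sub>R 0 + 1 *\<^sub>R F 1 a)) + (((t - a)\<^sup>2 / 2) *\<^sub>R 0 + (t - a) *\<^sub>R F 2 a)) (at t)"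
    by (intro has_vector_derivative_add has_vector_derivative_const has_vector_derivative_scaleR r)
   thus ?thesis by simp
  qed
 qed (use assms(1)[of _ 0] in auto)
 thus "(taylor_glue a F 0 has_vector_derivative taylor_glue a F 1 t) (at t)"
  by (simp only: e)
 have "((\<lambda>t. if t \<ge> a then F 1 t else F 1 a + (t - a) *\<^sub>R F 2 a) has_vector_derivative
  (if t \<ge> a then F 2 t else F 2 a)) (at t)"
 proof (rule has_vector_derivative_glue)
  show "((\<lambda>t. F 1 a + (t - a) *\<^sub>R F 2 a) has_vector_derivative F 2 a) (at t)" for t
   unfolding has_vector_derivative_def by (rule derivative_eq_intros refl | simp add: algebra_simps)+
 qed (use assms(1)[of _ 1] in \<open>auto simp: numeral_2_eq_2\<close>)
 thus "(taylor_glue a F 1 has_vector_derivative taylor_glue a F 2 t) (at t)"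
  by (simp only: e)
 have c1: "continuous_on {a..} (taylor_glue a F 2)"
  by (subst continuous_on_cong[of _ "{a..}" _ "F 2"]) (auto simp: taylor_glue_def assms(2))
 have c2: "continuous_on {..a} (taylor_glue a F 2)"
  by (subst continuous_on_cong[of _ "{..a}" _ "\<lambda>_. F 2 a"]) (auto simp: taylor_glue_def)
 have "continuous_on ({a..} \<union> {..a}) (taylor_glue a F 2)" by (intro continuous_on_closed_Un c1 c2) auto
 moreover have "{a..} \<union> {..a} = (UNIV :: real set)" by auto
 ultimately show "continuous_on UNIV (taylor_glue a F 2)" by simp
qed

lemma helm_radial:
 "helm k (\<lambda>y. F ((y-a) \<bullet> (y-a))) (\<lambda>i j y. (if i = j then 2 else 0) *\<^sub>R F' ((y-a) \<bullet> (y-a)) +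
    (4 * (y-a)$i * (y-a)$j) *\<^sub>R F'' ((y-a) \<bullet> (y-a))) y =
  6 * F' ((y-a) \<bullet> (y-a)) + 4 * cof ((y-a) \<bullet> (y-a)) * F'' ((y-a) \<bullet> (y-a)) +
   (cof k)\<^sup>2 * F ((y-a) \<bullet> (y-a))"
proof -
 define t where "t = (y-a) \<bullet> (y-a)"
 have "t = (y-a)$1 * (y-a)$1 + (y-a)$2 * (y-a)$2 + (y-a)$3 * (y-a)$3" by (simp add: t_def inner_vec_def sum_3)
 hence t: "cof t = of_real ((y-a)$1) * of_real ((y-a)$1) + of_real ((y-a)$2) * of_real ((y-a)$2) + of_real ((y-a)$3) * of_real ((y-a)$3)"
  by (simp only: of_real_add of_real_mult)
 show ?thesis unfolding helm_def sum_3 t_def[symmetric]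
  by (simp add: t scaleR_conv_of_real algebra_simps del: vector_minus_component)
qed

lemma helm_mult:
 "helm k (\<lambda>x. \<phi> x * \<psi> x) (\<lambda>i j x. \<phi> x * h' i j x + g j x * g' i x + (g i x * g' j x + h i j x * \<psi> x)) x =
  \<phi> x * helm k \<psi> h' x + 2 * (\<Sum>i\<in>UNIV. g i x * g' i x) + (\<Sum>i\<in>UNIV. h i i x) * \<psi> x"
 by (simp add: helm_def sum_3 algebra_simps)

lemma sum_radial_gradients:
 "(\<Sum>i\<in>UNIV. ((2 * ((y::real^3)-a)$i) *\<^sub>R p) * ((2 * (y-b)$i) *\<^sub>R q)) = 4 * cof ((y-a) \<bullet> (y-b)) * p * (q::complex)"
 by (simp add: sum_3 inner_vec_def scaleR_conv_of_real algebra_simps)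

text \<open>What is left of \<open>helm\<close> of the product of a cut-off around \<open>x0\<close>
  and the fundamental solution with pole \<open>x\<close> once the Helmholtz equation of the latter
  is used: twice the product of the gradients, plus the Laplacian of the cut-off times the
  fundamental solution. It is supported where the cut-off varies.\<close>

definition repr_kernel ::
 "real \<Rightarrow> (real \<Rightarrow> complex) \<Rightarrow> (real \<Rightarrow> complex) \<Rightarrow> real^3 \<Rightarrow> real^3 \<Rightarrow> wave" where
 "repr_kernel k \<theta>1 \<theta>2 x0 x y = (let s = (y-x0) \<bullet> (y-x0); t = cof ((y-x) \<bullet> (y-x)) in
   8 * cof ((y-x0) \<bullet> (y-x)) * \<theta>1 s * fsol k 1 t +
   (6 * \<theta>1 s + 4 * cof s * \<theta>2 s) * fsol k 0 t)"

text \<open>The value is \<open>4 \<pi>\<close>, the strength of the point source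
  \<open>exp (i k r) / r\<close>. Up to sign the integrand is the limit of \<open>reg_limit\<close>
  as the regularisation radius tends to zero.\<close>

definition repr_const :: real where
 "repr_const = (LINT z|lborel. (if 1 \<le> (z::real^3) \<bullet> z then 0 else 15/2 * (1 - z \<bullet> z)))"

lemma repr_const_pos: "repr_const > 0"
proof -
 let ?f = "\<lambda>z::real^3. if 1 \<le> z \<bullet> z then 0 else 15/2 * (1 - z \<bullet> z)"
 have nz: "z \<bullet> z = (norm z)\<^sup>2" for z :: "real^3" by (simp add: power2_norm_eq_inner)
 have i: "integrable lborel ?f"
 proof (rule integrable_continuous_compact_support[of _ "cball 0 1"])
  have "?f = (\<lambda>z. max 0 (15/2 * (1 - z \<bullet> z)))" by (auto simp: max_def)
  thus "continuous_on UNIV ?f" by (simp only:) (intro continuous_intros)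
  show "?f z = 0" if "z \<notin> cball 0 1" for z
  proof -
   have "norm z > 1" using that by simp
   hence "(norm z)\<^sup>2 \<ge> 1\<^sup>2" by (intro power_mono) auto
   thus ?thesis by (simp add: nz)
  qed
 qed simp
 have i2: "integrable lborel (\<lambda>z::real^3. indicator (ball 0 (1/2)) z * (1::real))"
  by (auto intro!: integrable_real_indicator emeasure_bounded_finite)
 have "0 < measure lborel (ball (0::real^3) (1/2))" using content_ball_pos[of "1/2" "0::real^3"] by simp
 also have "\<dots> = (LINT z|lborel. indicator (ball (0::real^3) (1/2)) z * 1)" by simp
 also have "\<dots> \<le> repr_const" unfolding repr_const_def
 proof (rule integral_mono[OF i2 i])
  fix z :: "real^3"
  show "indicator (ball 0 (1/2)) z * 1 \<le> ?f z"
  proof (cases "z \<in> ball 0 (1/2)")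
   case True
   hence "norm z \<le> 1/2" by simp
   hence "(norm z)\<^sup>2 \<le> (1/2)\<^sup>2" by (intro power_mono) auto
   thus ?thesis using True by (simp add: nz power2_eq_square)
  qed (auto simp: indicator_def)
 qed
 finally show ?thesis .
qed

text \<open>\<open>A\<close>, \<open>B\<close>, \<open>C\<close> are \<open>fsol\<close> and its two
  derivatives at \<open>e\<^sup>2\<close>, multiplied by \<open>e\<close>, \<open>e ^ 3\<close> and
  \<open>e ^ 5\<close>. In these terms \<open>e ^ 3\<close> times the Helmholtz operator applied to
  the glued function has a finite limit, and \<open>e ^ 3\<close> is exactly the volume factor of a
  dilation by \<open>e\<close>.\<close>

definition reg_limit :: "real \<Rightarrow> real \<Rightarrow> real \<Rightarrow> complex" where
 "reg_limit k e s = (let A = exp (\<i> * k * e); B = A * (\<i> * k * e - 1) / 2; C = A * (3 - 3 * \<i> * k * e - k\<^sup>2 * e\<^sup>2) / 4 in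
   6 * (B + (s - 1) * C) + 4 * s * C + k\<^sup>2 * e\<^sup>2 * (A + (s - 1) * B + (s - 1)\<^sup>2 / 2 * C))"

lemma reg_fsol_scaled:
 fixes k e s :: real and F :: "nat \<Rightarrow> real \<Rightarrow> complex"
 assumes e: "e > 0"
 defines "F \<equiv> taylor_glue (e\<^sup>2) (\<lambda>j t. fsol k j (cof t))"
 shows "e ^ 3 * (6 * F 1 (e\<^sup>2 * s) + 4 * (e\<^sup>2 * s) * F 2 (e\<^sup>2 * s) + k\<^sup>2 * F 0 (e\<^sup>2 * s)) =
  (if 1 \<le> s then 0 else reg_limit k e s)"
proof (cases "1 \<le> s")
 case True
 hence "e\<^sup>2 * s \<ge> e\<^sup>2" "e\<^sup>2 * s > 0" using e by auto
 thus ?thesis using fsol_ode[of "e\<^sup>2 * s" k] True unfolding F_def taylor_glue_def by (simp add: algebra_simps)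
next
 case False
 define E where "E = cof e"
 have E0: "E \<noteq> 0" using e by (simp add: E_def)
 have lt: "\<not> e\<^sup>2 \<le> e\<^sup>2 * s" using False e by simp
 have q: "csqrt (cof (e\<^sup>2)) = E" using e by (simp add: E_def csqrt_of_real_nonneg del: of_real_power)
 define A where "A = exp (\<i> * k * E)"
 define B where "B = A * (\<i> * k * E - 1) / 2"
 define C where "C = A * (3 - 3 * \<i> * k * E - k\<^sup>2 * E\<^sup>2) / 4"
 have f: "fsol k 0 (cof (e\<^sup>2)) = A / E" "fsol k 1 (cof (e\<^sup>2)) = B / E^3"
  "fsol k 2 (cof (e\<^sup>2)) = C / E^5"
  by (simp_all only: fsol_def Let_def q) (simp_all add: A_def B_def C_def)
 define G where "G j = fsol k j (cof (e\<^sup>2))" for j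
 have Fr: "F 2 (e\<^sup>2 * s) = G 2" "F 1 (e\<^sup>2 * s) = G 1 + (e\<^sup>2 * s - e\<^sup>2) *\<^sub>R G 2"
  "F 0 (e\<^sup>2 * s) = G 0 + (e\<^sup>2 * s - e\<^sup>2) *\<^sub>R G 1 + ((e\<^sup>2 * s - e\<^sup>2)\<^sup>2 / 2) *\<^sub>R G 2"
  unfolding F_def taylor_glue_def G_def using lt by simp_all
 note f = f[folded G_def]
 have F: "F 2 (e\<^sup>2 * s) = C / E^5" "F 1 (e\<^sup>2 * s) = B / E^3 + E\<^sup>2 * (s - 1) * (C / E^5)"
  "F 0 (e\<^sup>2 * s) = A / E + E\<^sup>2 * (s - 1) * (B / E^3) + (E\<^sup>2 * (s - 1))\<^sup>2 / 2 * (C / E^5)"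
  unfolding Fr f by (simp_all add: scaleR_conv_of_real E_def algebra_simps power2_eq_square)
 have "E^3 * (6 * F 1 (e\<^sup>2 * s) + 4 * (E\<^sup>2 * s) * F 2 (e\<^sup>2 * s) + k\<^sup>2 * F 0 (e\<^sup>2 * s)) =
  6 * (B + (s - 1) * C) + 4 * s * C + k\<^sup>2 * E\<^sup>2 * (A + (s - 1) * B + (s - 1)\<^sup>2 / 2 * C)"
 proof -
  define a b c where "a = A / E" and "b = B / E^3" and "c = C / E^5"
  have abc: "A = E * a" "B = E^3 * b" "C = E^5 * c" using E0 by (simp_all add: a_def b_def c_def)
  show ?thesis unfolding F a_def[symmetric] b_def[symmetric] c_def[symmetric] unfolding abc divide_inverse
    of_real_mult of_real_power of_real_inverse of_real_numeral
   by algebra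
 qed
 thus ?thesis using False unfolding reg_limit_def Let_def A_def B_def C_def E_def by simp
qed

lemma reg_limit_tendsto: "(\<lambda>n. reg_limit k (1 / real (Suc n)) s) \<longlonglongrightarrow> cof (15/2 * (s - 1))"
proof -
 have l: "(\<lambda>n. 1 / real (Suc n)) \<longlonglongrightarrow> 0" by (rule LIMSEQ_Suc[OF lim_1_over_n])
 have "isCont (\<lambda>e. reg_limit k e s) 0" unfolding reg_limit_def Let_def by (intro continuous_intros) auto
 from isCont_tendsto_compose[OF this l] have "(\<lambda>n. reg_limit k (1 / real (Suc n)) s) \<longlonglongrightarrow> reg_limit k 0 s" .
 moreover have "reg_limit k 0 s = cof (15/2 * (s - 1))" by (simp add: reg_limit_def Let_def field_simps)
 ultimately show ?thesis by simp
qed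

lemma reg_limit_bounded: obtains B where "\<And>e s. 0 \<le> e \<Longrightarrow> e \<le> 1 \<Longrightarrow> 0 \<le> s \<Longrightarrow> s \<le> 1 \<Longrightarrow> norm (reg_limit k e s) \<le> B"
proof -
 have "continuous_on ({0..1} \<times> {0..1}) (\<lambda>p. reg_limit k (fst p) (snd p))"
  unfolding reg_limit_def Let_def by (intro continuous_intros) auto
 hence "bounded ((\<lambda>p. reg_limit k (fst p) (snd p)) ` ({0..1} \<times> {0..1}))"
  by (intro compact_imp_bounded compact_continuous_image compact_Times) auto
 then obtain B where B: "\<forall>z \<in> (\<lambda>p. reg_limit k (fst p) (snd p)) ` ({0..1} \<times> {0..1}). norm z \<le> B"
  unfolding bounded_iff by blast
 show ?thesis
 proof (rule that[of B])
  fix e s :: real assume "0 \<le> e" "e \<le> 1" "0 \<le> s" "s \<le> 1"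
  hence "(e, s) \<in> {0..1} \<times> {0..1}" by simp
  from bspec[OF B imageI[OF this]] show "norm (reg_limit k e s) \<le> B" by simp
 qed
qed

text \<open>Test with the cut-off times the fundamental solution, regularised in the ball of radius
  \<open>e\<close> around \<open>x\<close>. The regularised factor violates the Helmholtz equation
  in that ball alone; rescaled to unit size, this contribution tends to
  \<open>- repr_const * u x\<close>, and the remaining terms are those of the kernel.\<close>

lemma helmholtz_representation:
 fixes \<theta> \<theta>1 \<theta>2 :: "real \<Rightarrow> complex" and u :: wave
 assumes weak: "weak_helmholtz k S u" and S: "open S"
  and th: "\<And>t. (\<theta> has_vector_derivative \<theta>1 t) (at t)" "\<And>t. (\<theta>1 has_vector_derivative \<theta>2 t) (at t)"
   "continuous_on UNIV \<theta>2"
  and K: "compact K" "K \<subseteq> S" "\<And>y. y \<notin> K \<Longrightarrow> \<theta> ((y-x0) \<bullet> (y-x0)) = 0"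
  and d: "\<delta> > 0" "\<And>y. dist y x < \<delta> \<Longrightarrow> \<theta> ((y-x0) \<bullet> (y-x0)) = 1"
   "\<And>y. dist y x < \<delta> \<Longrightarrow> \<theta>1 ((y-x0) \<bullet> (y-x0)) = 0" "\<And>y. dist y x < \<delta> \<Longrightarrow> \<theta>2 ((y-x0) \<bullet> (y-x0)) = 0"
 shows "repr_const * u x = (LINT y|lborel. u y * repr_kernel k \<theta>1 \<theta>2 x0 x y)"
proof -
 define ct where "ct y = \<theta> ((y-x0) \<bullet> (y-x0))" for y
 define w where "w y = u y * ct y" for y
 define F where "F e = taylor_glue (e\<^sup>2) (\<lambda>j t. fsol k j (cof t))" for e :: real
 define L where "L e t = 6 * F e 1 t + 4 * cof t * F e 2 t + (cof k)\<^sup>2 * F e 0 t" for e :: real and t :: real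
 note chi = C2_data_radial[OF th, of x0, folded ct_def]
 have cw: "continuous_on UNIV w"
 proof (rule continuous_on_UNIV_support[OF _ S K(1,2)])
  show "continuous_on S w" unfolding w_def
   by (intro continuous_intros weak_helmholtz_continuous[OF weak] continuous_on_subset[OF C2_dataD(5)[OF chi]]) auto
  show "w y = 0" if "y \<notin> K" for y using K(3)[OF that] by (simp add: w_def ct_def)
 qed
 have w0: "w y = 0" if "y \<notin> K" for y using K(3)[OF that] by (simp add: w_def ct_def)
 obtain Bw where Bw: "Bw > 0" "\<And>y. norm (w y) \<le> Bw" using bounded_compact_support[OF cw K(1) w0] by metis
 have wx: "w x = u x" using d(1) d(2)[of x] by (simp add: w_def ct_def)
 \<comment> \<open>For \<open>e < \<delta>\<close> the regularised ball lies where the cut-off is 1,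
   so the kernel never sees the regularisation and the right-hand side does not depend on
   \<open>e\<close>.\<close>
 have key: "(LINT z|lborel. w (x + e *\<^sub>R z) * (if 1 \<le> z \<bullet> z then 0 else reg_limit k e (z \<bullet> z))) =
  - (LINT y|lborel. u y * repr_kernel k \<theta>1 \<theta>2 x0 x y)" if e: "0 < e" "e < \<delta>" for e
 proof -
  have Fd: "\<And>t. (F e 0 has_vector_derivative F e 1 t) (at t)" "\<And>t. (F e 1 has_vector_derivative F e 2 t) (at t)"
   "continuous_on UNIV (F e 2)"
   unfolding F_def
  proof -
   have e2: "e\<^sup>2 > 0" using e by simp
   have a: "((\<lambda>t. fsol k j (cof t)) has_vector_derivative fsol k (Suc j) (cof t)) (at t)"
    if "t \<ge> e\<^sup>2" "j < 2" for t j
    by (rule fsol_real_deriv) (use that e2 in linarith)+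
   have b: "continuous_on {e\<^sup>2..} (\<lambda>t. fsol k 2 (cof t))"
    by (intro continuous_on_fsol continuous_intros pos_notin_nonpos_Reals) (use e2 in \<open>auto dest: less_le_trans[OF e2]\<close>)
   note T = taylor_glue_deriv[of "e\<^sup>2" "\<lambda>j t. fsol k j (cof t)", OF a b]
   show "(taylor_glue (e\<^sup>2) (\<lambda>j t. fsol k j (cof t)) 0 has_vector_derivative
     taylor_glue (e\<^sup>2) (\<lambda>j t. fsol k j (cof t)) 1 t) (at t)" for t using T(1) by blast
   show "(taylor_glue (e\<^sup>2) (\<lambda>j t. fsol k j (cof t)) 1 has_vector_derivative
     taylor_glue (e\<^sup>2) (\<lambda>j t. fsol k j (cof t)) 2 t) (at t)" for t using T(2) by blast
   show "continuous_on UNIV (taylor_glue (e\<^sup>2) (\<lambda>j t. fsol k j (cof t)) 2)" using T(3) by blast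
  qed
  note Phi = C2_data_radial[OF Fd, of x]
  note prod = C2_data_mult[OF chi Phi]
  have z: "ct y * F e 0 ((y-x) \<bullet> (y-x)) = 0" if "y \<notin> K" for y using K(3)[OF that] by (simp add: ct_def)
  have split: "u y * helm k (\<lambda>y. ct y * F e 0 ((y-x) \<bullet> (y-x))) (\<lambda>i j y.
    ct y * ((if i = j then 2 else 0) *\<^sub>R F e 1 ((y-x) \<bullet> (y-x)) + (4 * (y-x)$i * (y-x)$j) *\<^sub>R F e 2 ((y-x) \<bullet> (y-x))) +
    (2 * (y-x0)$j) *\<^sub>R \<theta>1 ((y-x0) \<bullet> (y-x0)) * ((2 * (y-x)$i) *\<^sub>R F e 1 ((y-x) \<bullet> (y-x))) +
    ((2 * (y-x0)$i) *\<^sub>R \<theta>1 ((y-x0) \<bullet> (y-x0)) * ((2 * (y-x)$j) *\<^sub>R F e 1 ((y-x) \<bullet> (y-x))) +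
     ((if i = j then 2 else 0) *\<^sub>R \<theta>1 ((y-x0) \<bullet> (y-x0)) + (4 * (y-x0)$i * (y-x0)$j) *\<^sub>R \<theta>2 ((y-x0) \<bullet> (y-x0))) * F e 0 ((y-x) \<bullet> (y-x)))) y
   = w y * L e ((y-x) \<bullet> (y-x)) + u y * repr_kernel k \<theta>1 \<theta>2 x0 x y" for y
  proof -
   define s where "s = (y-x0) \<bullet> (y-x0)"
   define t where "t = (y-x) \<bullet> (y-x)"
   have lap: "(\<Sum>i\<in>UNIV. (if i = i then 2 else 0) *\<^sub>R \<theta>1 s + (4 * (y-x0)$i * (y-x0)$i) *\<^sub>R \<theta>2 s) = 6 * \<theta>1 s + 4 * cof s * \<theta>2 s"
    using helm_radial[of 0 \<theta> x0 \<theta>1 \<theta>2 y] by (simp add: helm_def s_def[symmetric])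
   have "8 * cof ((y-x0) \<bullet> (y-x)) * \<theta>1 s * F e 1 t + (6 * \<theta>1 s + 4 * cof s * \<theta>2 s) * F e 0 t = repr_kernel k \<theta>1 \<theta>2 x0 x y"
   proof (cases "dist y x < \<delta>")
    case True
    thus ?thesis using d(3)[OF True] d(4)[OF True] by (simp add: repr_kernel_def Let_def s_def)
   next
    case False
    hence "norm (y - x) \<ge> e" using e by (simp add: dist_norm)
    hence "t \<ge> e\<^sup>2" unfolding t_def using e by (simp add: power2_norm_eq_inner[symmetric] power_mono)
    thus ?thesis by (simp add: F_def taylor_glue_def repr_kernel_def Let_def s_def t_def)
   qed
   thus ?thesis
    unfolding helm_mult helm_radial s_def[symmetric] t_def[symmetric] lap sum_radial_gradients
    unfolding w_def L_def ct_def s_def[symmetric] by (simp add: algebra_simps)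
  qed
  have cL: "continuous_on UNIV (\<lambda>y. w y * L e ((y-x) \<bullet> (y-x)))"
  proof -
   have "continuous_on UNIV (F e 0)" "continuous_on UNIV (F e 1)"
    using Fd by (meson continuous_at_imp_continuous_on has_vector_derivative_continuous)+
   hence cL: "continuous_on UNIV (L e)" unfolding L_def by (intro continuous_intros Fd(3))
   show ?thesis by (intro continuous_intros cw continuous_on_compose2[OF cL]) auto
  qed
  have i1: "integrable lborel (\<lambda>y. w y * L e ((y-x) \<bullet> (y-x)))"
   by (rule integrable_continuous_compact_support[OF cL K(1)]) (simp add: w0)
  note W = weak_helmholtzD[OF weak prod K(1,2) z, unfolded split]
  note I = helm_mult_integrable[OF weak_helmholtz_continuous[OF weak] S prod K(1,2) z, of k, unfolded split]
  have i2: "integrable lborel (\<lambda>y. u y * repr_kernel k \<theta>1 \<theta>2 x0 x y)"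
   using Bochner_Integration.integrable_diff[OF I i1] by simp
  have "(LINT y|lborel. w y * L e ((y-x) \<bullet> (y-x))) = - (LINT y|lborel. u y * repr_kernel k \<theta>1 \<theta>2 x0 x y)"
   using W i1 i2 by (simp add: eq_neg_iff_add_eq_0)
  moreover have "(LINT y|lborel. w y * L e ((y-x) \<bullet> (y-x))) =
    (LINT z|lborel. w (x + e *\<^sub>R z) * (if 1 \<le> z \<bullet> z then 0 else reg_limit k e (z \<bullet> z)))"
  proof -
   have m: "(\<lambda>y. w y * L e ((y-x) \<bullet> (y-x))) \<in> borel_measurable borel"
    using cL by (rule borel_measurable_continuous_onI)
   have m': "(\<lambda>y. w (x + y) * L e (y \<bullet> y)) \<in> borel_measurable borel"
   proof (rule borel_measurable_continuous_onI)
    have "continuous_on UNIV (\<lambda>y. w (x + y) * L e (((x + y) - x) \<bullet> ((x + y) - x)))"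
     by (rule continuous_on_compose2[OF cL]) (auto intro!: continuous_intros)
    thus "continuous_on UNIV (\<lambda>y. w (x + y) * L e (y \<bullet> y))" by simp
   qed
   have "(LINT y|lborel. w y * L e ((y-x) \<bullet> (y-x))) = (LINT y|lborel. w (x + y) * L e (y \<bullet> y))"
    using lborel_integral_translate[OF m, of x] by simp
   also have "\<dots> = e ^ 3 *\<^sub>R (LINT z|lborel. w (x + e *\<^sub>R z) * L e ((e *\<^sub>R z) \<bullet> (e *\<^sub>R z)))"
    using lborel_integral_dilate[OF m' e(1)] by simp
   also have "\<dots> = (LINT z|lborel. e ^ 3 *\<^sub>R (w (x + e *\<^sub>R z) * L e ((e *\<^sub>R z) \<bullet> (e *\<^sub>R z))))" by simp
   also have "\<dots> = (LINT z|lborel. w (x + e *\<^sub>R z) * (if 1 \<le> z \<bullet> z then 0 else reg_limit k e (z \<bullet> z)))"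
   proof (rule Bochner_Integration.integral_cong[OF refl])
    fix z :: "real^3"
    have "(e *\<^sub>R z) \<bullet> (e *\<^sub>R z) = e\<^sup>2 * (z \<bullet> z)" by (simp add: power2_eq_square)
    hence "e ^ 3 * L e ((e *\<^sub>R z) \<bullet> (e *\<^sub>R z)) = (if 1 \<le> z \<bullet> z then 0 else reg_limit k e (z \<bullet> z))"
     using reg_fsol_scaled[OF e(1), of k "z \<bullet> z"] unfolding L_def F_def by (simp only:) simp
    thus "e ^ 3 *\<^sub>R (w (x + e *\<^sub>R z) * L e ((e *\<^sub>R z) \<bullet> (e *\<^sub>R z))) =
     w (x + e *\<^sub>R z) * (if 1 \<le> z \<bullet> z then 0 else reg_limit k e (z \<bullet> z))"
     unfolding scaleR_conv_of_real of_real_power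
     by (simp only: mult.left_commute[of "cof e ^ 3"])
   qed
   finally show ?thesis .
  qed
  ultimately show ?thesis by simp
 qed
 obtain B where B: "\<And>e s. 0 \<le> e \<Longrightarrow> e \<le> 1 \<Longrightarrow> 0 \<le> s \<Longrightarrow> s \<le> 1 \<Longrightarrow> norm (reg_limit k e s) \<le> B"
  using reg_limit_bounded by blast
 have B0: "B \<ge> 0" using B[of 0 0] norm_ge_zero[of "reg_limit k 0 0"] by linarith
 define e where "e n = 1 / real (Suc n)" for n
 have e0: "e \<longlonglongrightarrow> 0" unfolding e_def by (rule LIMSEQ_Suc[OF lim_1_over_n])
 define s where "s n z = w (x + e n *\<^sub>R z) * (if 1 \<le> z \<bullet> z then 0 else reg_limit k (e n) (z \<bullet> z))" for n and z :: "real^3"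
 have "(\<lambda>n. LINT z|lborel. s n z) \<longlonglongrightarrow> (LINT z|lborel. u x * (if 1 \<le> (z::real^3) \<bullet> z then 0 else cof (15/2 * (z \<bullet> z - 1))))"
 proof (rule integral_dominated_convergence[where w = "\<lambda>z. indicator (cball (0::real^3) 1) z * (Bw * B)"])
  have mw: "w \<in> borel_measurable borel" using cw by (rule borel_measurable_continuous_onI)
  have [measurable]: "(\<lambda>z. w (x + e n *\<^sub>R z)) \<in> borel_measurable borel" for n
   using mw by (rule measurable_compose[rotated]) measurable
  show "s n \<in> borel_measurable lborel" for n unfolding s_def reg_limit_def Let_def by measurable
  show "(\<lambda>z. u x * (if 1 \<le> (z::real^3) \<bullet> z then 0 else cof (15/2 * (z \<bullet> z - 1)))) \<in> borel_measurable lborel" by measurable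
  show "integrable lborel (\<lambda>z. indicator (cball (0::real^3) 1) z * (Bw * B))"
   by (intro integrable_mult_left integrable_real_indicator emeasure_compact_finite) auto
  show "AE z in lborel. (\<lambda>n. s n z) \<longlonglongrightarrow> u x * (if 1 \<le> z \<bullet> z then 0 else cof (15/2 * (z \<bullet> z - 1)))"
  proof (rule AE_I2)
   fix z :: "real^3"
   have "(\<lambda>n. x + e n *\<^sub>R z) \<longlonglongrightarrow> x + 0 *\<^sub>R z" by (intro tendsto_intros e0)
   hence "(\<lambda>n. w (x + e n *\<^sub>R z)) \<longlonglongrightarrow> w x"
    by (intro continuous_on_tendsto_compose[OF cw]) auto
   moreover have "(\<lambda>n. if 1 \<le> z \<bullet> z then 0 else reg_limit k (e n) (z \<bullet> z)) \<longlonglongrightarrow> (if 1 \<le> z \<bullet> z then 0 else cof (15/2 * (z \<bullet> z - 1)))"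
    using reg_limit_tendsto[of k "z \<bullet> z"] by (auto simp: e_def)
   ultimately show "(\<lambda>n. s n z) \<longlonglongrightarrow> u x * (if 1 \<le> z \<bullet> z then 0 else cof (15/2 * (z \<bullet> z - 1)))"
    unfolding s_def wx by (intro tendsto_mult) auto
  qed
  show "AE z in lborel. norm (s n z) \<le> indicator (cball 0 1) z * (Bw * B)" for n
  proof (rule AE_I2)
   fix z :: "real^3"
   show "norm (s n z) \<le> indicator (cball 0 1) z * (Bw * B)"
   proof (cases "1 \<le> z \<bullet> z")
    case True
    thus ?thesis using Bw B0 by (simp add: s_def)
   next
    case False
    hence "(norm z)\<^sup>2 < 1\<^sup>2" by (simp add: power2_norm_eq_inner)
    hence "norm z < 1" by (rule power2_less_imp_less) simp
    moreover have "norm (reg_limit k (e n) (z \<bullet> z)) \<le> B" by (rule B) (use False in \<open>auto simp: e_def\<close>)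
    ultimately show ?thesis using False Bw by (simp add: s_def norm_mult mult_mono)
   qed
  qed
 qed
 moreover have "eventually (\<lambda>n. (LINT z|lborel. s n z) = - (LINT y|lborel. u y * repr_kernel k \<theta>1 \<theta>2 x0 x y)) sequentially"
  using order_tendstoD(2)[OF e0 d(1)] by eventually_elim (unfold s_def, rule key, auto simp: e_def)
 ultimately have "(\<lambda>n::nat. - (LINT y|lborel. u y * repr_kernel k \<theta>1 \<theta>2 x0 x y)) \<longlonglongrightarrow> (LINT z|lborel. u x * (if 1 \<le> (z::real^3) \<bullet> z then 0 else cof (15/2 * (z \<bullet> z - 1))))"
  by (simp add: tendsto_cong)
 hence "- (LINT y|lborel. u y * repr_kernel k \<theta>1 \<theta>2 x0 x y) = (LINT z|lborel. u x * (if 1 \<le> (z::real^3) \<bullet> z then 0 else cof (15/2 * (z \<bullet> z - 1))))"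
  by (simp add: LIMSEQ_const_iff)
 also have "\<dots> = u x * (LINT z|lborel. (if 1 \<le> (z::real^3) \<bullet> z then 0 else cof (15/2 * (z \<bullet> z - 1))))"
  by (simp only: integral_mult_right_zero)
 also have "(LINT z|lborel. (if 1 \<le> (z::real^3) \<bullet> z then 0 else cof (15/2 * (z \<bullet> z - 1)))) =
   (LINT z|lborel. cof (- (if 1 \<le> (z::real^3) \<bullet> z then 0 else 15/2 * (1 - z \<bullet> z))))"
  by (rule Bochner_Integration.integral_cong) (auto simp: field_simps)
 also have "\<dots> = cof (- repr_const)" unfolding repr_const_def by (subst integral_complex_of_real) simp
 finally show ?thesis by (simp add: algebra_simps)
qed

section \<open>Analyticity along lines and unique continuation\<close>

lemma holomorphic_parametric_integral:
 fixes f f' :: "complex \<Rightarrow> wave"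
 assumes U: "open U" "convex U" and T: "open T" and K: "compact K" "K \<subseteq> T"
  and der: "\<And>z y. z \<in> U \<Longrightarrow> y \<in> T \<Longrightarrow> ((\<lambda>z. f z y) has_field_derivative f' z y) (at z)"
  and cf: "\<And>z. z \<in> U \<Longrightarrow> continuous_on T (f z)"
  and cf': "continuous_on (U \<times> T) (\<lambda>(z, y). f' z y)"
  and zero: "\<And>z y. y \<notin> K \<Longrightarrow> f z y = 0" "\<And>z y. y \<notin> K \<Longrightarrow> f' z y = 0"
 shows "(\<lambda>z. LINT y|lborel. f z y) holomorphic_on U"
proof -
 obtain a b where ab: "K \<subseteq> cbox a b"
  using bounded_subset_cbox_symmetric[OF compact_imp_bounded[OF K(1)]] by blast
 have c: "continuous_on UNIV (f z)" if "z \<in> U" for z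
  by (rule continuous_on_UNIV_support[OF cf[OF that] T K zero(1)])
 have c': "continuous_on (U \<times> cbox a b) (\<lambda>(z, y). f' z y)"
 proof -
  have o: "open (-K)" using K by (simp add: compact_imp_closed open_Compl)
  have "continuous_on (U \<times> -K) (\<lambda>(z, y). f' z y)"
   by (subst continuous_on_cong[of _ "U \<times> -K" _ "\<lambda>_. 0"]) (auto simp: zero)
  hence "continuous_on ((U \<times> T) \<union> (U \<times> -K)) (\<lambda>(z, y). f' z y)"
   by (intro continuous_on_open_Un cf' open_Times U T o)
  thus ?thesis by (rule continuous_on_subset) (use K in auto)
 qed
 have eq: "(LINT y|lborel. f z y) = integral (cbox a b) (f z)" if "z \<in> U" for z
 proof -
  have "set_integrable lborel (cbox a b) (f z)" unfolding set_integrable_def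
   by (rule borel_integrable_compact) (auto intro: continuous_on_subset[OF c[OF that]])
  from set_borel_integral_eq_integral(2)[OF this]
  have "(LINT y:cbox a b|lborel. f z y) = integral (cbox a b) (f z)" .
  moreover have "indicator (cbox a b) y *\<^sub>R f z y = f z y" for y
   using zero(1)[of y z] ab by (cases "y \<in> cbox a b") auto
  ultimately show ?thesis unfolding set_lebesgue_integral_def by simp
 qed
 have "(\<lambda>z. integral (cbox a b) (f z)) holomorphic_on U"
 proof (rule leibniz_rule_holomorphic[OF _ _ c' U(2)])
  show "((\<lambda>z. f z y) has_field_derivative f' z y) (at z within U)" if "z \<in> U" for z y
  proof (cases "y \<in> T")
   case True
   thus ?thesis using der[OF that True] has_field_derivative_at_within by blast
  next
   case False
   hence "y \<notin> K" using K by auto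
   thus ?thesis using zero by simp
  qed
  show "f z integrable_on cbox a b" if "z \<in> U" for z
   by (intro integrable_continuous continuous_on_subset[OF c[OF that]]) auto
 qed
 thus ?thesis using eq by (simp cong: holomorphic_cong)
qed

text \<open>The radial cut-off that is 1 on the ball of radius \<open>r\<close> and vanishes outside the ball of radius \<open>\<surd>2 r\<close>,
 with its derivatives, as functions of the squared distance.\<close>
definition cutoff :: "real \<Rightarrow> nat \<Rightarrow> real \<Rightarrow> complex" where
 "cutoff r j t = (if j = 0 then 1 else 0) - cof (step j (t / r\<^sup>2) / (r\<^sup>2) ^ j)"

lemma cutoff_deriv:
 assumes "r > 0" "j < 4"
 shows "(cutoff r j has_vector_derivative cutoff r (Suc j) t) (at t)"
proof -
 have "((\<lambda>t. step j (t / r\<^sup>2)) has_real_derivative step (Suc j) (t / r\<^sup>2) * (1 / r\<^sup>2)) (at t)"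
  by (rule DERIV_chain2[OF step_deriv[OF assms(2)] DERIV_cdivide[OF DERIV_ident]])
 hence "((\<lambda>t. step j (t / r\<^sup>2) / (r\<^sup>2) ^ j) has_real_derivative step (Suc j) (t / r\<^sup>2) / (r\<^sup>2) ^ Suc j) (at t)"
  by (rule DERIV_cong[OF DERIV_cdivide]) (simp only: power_Suc divide_inverse inverse_mult_distrib mult_1_left mult_ac)
 from has_vector_derivative_of_real[OF this, where 'a = complex]
 have "((\<lambda>t. (if j = 0 then 1 else 0) - cof (step j (t / r\<^sup>2) / (r\<^sup>2) ^ j)) has_vector_derivative
   0 - cof (step (Suc j) (t / r\<^sup>2) / (r\<^sup>2) ^ Suc j)) (at t)"
  by (intro has_vector_derivative_diff has_vector_derivative_const)
 thus ?thesis unfolding cutoff_def[abs_def] by simp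
qed

lemma continuous_on_cutoff: "r > 0 \<Longrightarrow> j \<le> 4 \<Longrightarrow> continuous_on UNIV (cutoff r j)"
 unfolding cutoff_def[abs_def]
 by (intro continuous_intros continuous_on_compose2[OF continuous_on_step]) auto

lemma cutoff_inside: "r > 0 \<Longrightarrow> t \<le> r\<^sup>2 \<Longrightarrow> cutoff r j t = (if j = 0 then 1 else 0)"
 by (simp add: cutoff_def step_zero)

lemma cutoff_outside: "r > 0 \<Longrightarrow> t \<ge> 2 * r\<^sup>2 \<Longrightarrow> cutoff r j t = 0"
 by (cases j) (simp_all add: cutoff_def step_one step_Suc_zero pos_le_divide_eq)

lemma cutoff_derivs:
 assumes "r > 0"
 shows "\<And>t. (cutoff r 0 has_vector_derivative cutoff r 1 t) (at t)"
  "\<And>t. (cutoff r 1 has_vector_derivative cutoff r 2 t) (at t)" "continuous_on UNIV (cutoff r 2)"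
 using cutoff_deriv[OF assms, of 0] cutoff_deriv[OF assms, of 1] continuous_on_cutoff[OF assms, of 2]
 by (auto simp: numeral_2_eq_2)

definition shell :: "real^3 \<Rightarrow> real \<Rightarrow> (real^3) set" where
 "shell p r = {y. r\<^sup>2 \<le> (y-p) \<bullet> (y-p) \<and> (y-p) \<bullet> (y-p) \<le> 2 * r\<^sup>2}"

lemma compact_shell: "compact (shell p r)"
proof -
 have "closed (shell p r)" unfolding shell_def
  by (intro closed_Collect_conj closed_Collect_le continuous_intros)
 moreover have "shell p r \<subseteq> cball p (2 * \<bar>r\<bar>)"
 proof
  fix y assume "y \<in> shell p r"
  hence "(norm (y - p))\<^sup>2 \<le> 2 * r\<^sup>2" by (simp add: shell_def power2_norm_eq_inner)
  also have "\<dots> \<le> (2 * \<bar>r\<bar>)\<^sup>2" by (simp add: power_mult_distrib)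
  finally have "norm (y - p) \<le> 2 * \<bar>r\<bar>" by (rule power2_le_imp_le) simp
  thus "y \<in> cball p (2 * \<bar>r\<bar>)" by (simp add: dist_norm norm_minus_commute)
 qed
 ultimately show ?thesis using bounded_subset[OF bounded_cball] compact_eq_bounded_closed by blast
qed

lemma cutoff_zero_off_shell:
 assumes "r > 0" "y \<notin> shell p r" "j > 0" shows "cutoff r j ((y-p) \<bullet> (y-p)) = 0"
proof -
 have "(y-p) \<bullet> (y-p) \<le> r\<^sup>2 \<or> (y-p) \<bullet> (y-p) \<ge> 2 * r\<^sup>2" using assms(2) by (auto simp: shell_def)
 thus ?thesis using cutoff_inside[OF assms(1), of _ j] cutoff_outside[OF assms(1)] assms(3) by auto
qed

lemma Re_gt_0_notin_nonpos_Reals: "Re z > 0 \<Longrightarrow> z \<notin> \<real>\<^sub>\<le>\<^sub>0"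
 by (auto simp: complex_nonpos_Reals_iff)

text \<open>In the representation formula the point \<open>p + t e\<close> enters through
  \<open>P t y\<close> and \<open>Q t y\<close>, polynomials in \<open>t\<close>. They make sense
  for complex \<open>t\<close>, and as long as \<open>Re (Q t y) > 0\<close> on the shell the
  principal square root in \<open>fsol\<close> is holomorphic.\<close>

lemma weak_helmholtz_line_holomorphic:
 assumes weak: "weak_helmholtz k S u" and S: "open S" and p: "p \<in> S"
 obtains \<epsilon> f where "\<epsilon> > 0" "f holomorphic_on ball 0 \<epsilon>" "\<And>t::real. \<bar>t\<bar> < \<epsilon> \<Longrightarrow> u (p + t *\<^sub>R e) = f (cof t)"
proof -
 obtain R where R: "R > 0" "ball p R \<subseteq> S" using S p open_contains_ball by blast
 define r where "r = R / 4"
 have r: "r > 0" using R by (simp add: r_def)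
 define N where "N = norm e + 1"
 \<comment> \<open>Then \<open>\<epsilon> * norm e < r / 8\<close>, a quarter of the lower bound
   \<open>r / 2\<close> for the distance from \<open>p\<close> to points of \<open>T\<close>; the
   linear and quadratic terms of \<open>Q\<close> are thus at most a half and a sixteenth of the
   constant one. The \<open>+ 1\<close> in \<open>N\<close> covers \<open>e = 0\<close>.\<close>
 define \<epsilon> where "\<epsilon> = r / (8 * N)"
 have ne: "N > 0" using norm_ge_zero[of e] unfolding N_def by linarith
 have eps: "\<epsilon> > 0" using r ne by (simp add: \<epsilon>_def)
 have eps': "\<epsilon> * norm e < r / 8"
 proof -
  have "\<epsilon> * norm e < \<epsilon> * N" using eps by (simp add: N_def)
  also have "\<dots> = r / 8" using ne by (simp add: \<epsilon>_def)
  finally show ?thesis .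
 qed
 define T where "T = {y. (r/2)\<^sup>2 < (y-p) \<bullet> (y-p)} \<inter> ball p R"
 have oT: "open T" unfolding T_def by (intro open_Int open_Collect_less continuous_intros) auto
 have KT: "shell p r \<subseteq> T"
 proof
  fix y assume y: "y \<in> shell p r"
  hence "(norm (y - p))\<^sup>2 \<le> 2 * r\<^sup>2" by (simp add: shell_def power2_norm_eq_inner)
  also have "\<dots> < R\<^sup>2" using R by (simp add: r_def power_divide)
  finally have "norm (y - p) < R" using R by (intro power2_less_imp_less[of "norm (y-p)"]) auto
  moreover have "(r/2)\<^sup>2 < r\<^sup>2" using r by (simp add: power_divide)
  hence "(r/2)\<^sup>2 < (y-p) \<bullet> (y-p)" using y by (simp add: shell_def)
  ultimately show "y \<in> T" by (simp add: T_def dist_norm norm_minus_commute)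
 qed
 define Q where "Q t y = cof ((y-p) \<bullet> (y-p)) - 2 * t * cof ((y-p) \<bullet> e) + t\<^sup>2 * cof (e \<bullet> e)" for t :: complex and y
 define Q' where "Q' t y = - 2 * cof ((y-p) \<bullet> e) + 2 * t * cof (e \<bullet> e)" for t :: complex and y
 define c1 where "c1 y = cutoff r 1 ((y-p) \<bullet> (y-p))" for y
 define c2 where "c2 y = 6 * cutoff r 1 ((y-p) \<bullet> (y-p)) + 4 * cof ((y-p) \<bullet> (y-p)) * cutoff r 2 ((y-p) \<bullet> (y-p))" for y
 define P where "P t y = 8 * (cof ((y-p) \<bullet> (y-p)) - t * cof ((y-p) \<bullet> e)) * c1 y" for t :: complex and y
 define P' where "P' y = - 8 * cof ((y-p) \<bullet> e) * c1 y" for y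
 define f where "f t y = u y * (P t y * fsol k 1 (Q t y) + c2 y * fsol k 0 (Q t y))" for t y
 define f' where "f' t y = u y * (P' y * fsol k 1 (Q t y) + P t y * (fsol k 2 (Q t y) * Q' t y) + c2 y * (fsol k 1 (Q t y) * Q' t y))" for t y
 have Qpos: "Re (Q t y) > 0" if "t \<in> ball 0 \<epsilon>" "y \<in> T" for t y
 proof -
  define m where "m = norm (y - p)"
  have m2: "(y-p) \<bullet> (y-p) = m\<^sup>2" by (simp add: m_def power2_norm_eq_inner)
  have "(r/2)\<^sup>2 < m\<^sup>2" using that by (simp add: T_def m2)
  hence m: "m > r/2" by (rule power2_less_imp_less) (simp add: m_def)
  have t: "norm t < \<epsilon>" using that by simp
  have te: "norm t * norm e < r / 8" using eps' mult_right_mono[OF less_imp_le[OF t] norm_ge_zero[of e]] by linarith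
  have "norm (2 * t * cof ((y-p) \<bullet> e)) \<le> 2 * norm t * (m * norm e)"
   unfolding norm_mult norm_of_real m_def using Cauchy_Schwarz_ineq2[of "y-p" e] by (simp add: mult_left_mono)
  also have "\<dots> = 2 * m * (norm t * norm e)" by simp
  also have "\<dots> \<le> 2 * m * (r/8)" using te m r by (intro mult_left_mono) auto
  also have "\<dots> \<le> 2 * m * (m / 4)" using m r by (intro mult_left_mono) auto
  finally have 1: "norm (2 * t * cof ((y-p) \<bullet> e)) \<le> m\<^sup>2 / 2" by (simp add: power2_eq_square)
  have "norm (t\<^sup>2 * cof (e \<bullet> e)) = (norm t * norm e)\<^sup>2"
   by (simp add: norm_mult norm_power power_mult_distrib power2_norm_eq_inner)
  also have "\<dots> \<le> (m / 4)\<^sup>2" using te m r by (intro power_mono) auto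
  finally have 2: "norm (t\<^sup>2 * cof (e \<bullet> e)) \<le> m\<^sup>2 / 16" by (simp add: power_divide)
  have "m\<^sup>2 > 0" using m r by simp
  thus ?thesis unfolding Q_def m2
   using 1 2 abs_Re_le_cmod[of "2 * t * cof ((y-p) \<bullet> e)"] abs_Re_le_cmod[of "t\<^sup>2 * cof (e \<bullet> e)"]
   by (simp only: plus_complex.sel minus_complex.sel Re_complex_of_real)
 qed
 have nQ: "Q t y \<notin> \<real>\<^sub>\<le>\<^sub>0" if "t \<in> ball 0 \<epsilon>" "y \<in> T" for t y
  using Qpos[OF that] by (rule Re_gt_0_notin_nonpos_Reals)
 have cu: "continuous_on T u" using weak_helmholtz_continuous[OF weak] R by (auto simp: T_def intro: continuous_on_subset)
 have cc: "continuous_on A c1" "continuous_on A c2" for A unfolding c1_def c2_def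
  by (intro continuous_intros continuous_on_compose2[OF continuous_on_cutoff[OF r]]; auto)+
 have hol: "(\<lambda>t. LINT y|lborel. f t y) holomorphic_on ball 0 \<epsilon>"
 proof (rule holomorphic_parametric_integral[OF _ _ oT compact_shell KT])
  show "((\<lambda>t. f t y) has_field_derivative f' t y) (at t)" if "t \<in> ball 0 \<epsilon>" "y \<in> T" for t y
  proof -
   have dQ: "((\<lambda>t. Q t y) has_field_derivative Q' t y) (at t)" unfolding Q_def Q'_def by (auto intro!: derivative_eq_intros)
   have dP: "((\<lambda>t. P t y) has_field_derivative P' y) (at t)" unfolding P_def P'_def by (auto intro!: derivative_eq_intros)
   have d0: "((\<lambda>t. fsol k 0 (Q t y)) has_field_derivative fsol k 1 (Q t y) * Q' t y) (at t)"
    using DERIV_chain2[OF fsol_deriv[OF nQ[OF that], of 0] dQ] by simp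
   have d1: "((\<lambda>t. fsol k 1 (Q t y)) has_field_derivative fsol k 2 (Q t y) * Q' t y) (at t)"
    using DERIV_chain2[OF fsol_deriv[OF nQ[OF that], of 1] dQ] by (simp add: numeral_2_eq_2)
   show ?thesis unfolding f_def f'_def
    by (rule DERIV_cong[OF DERIV_cmult[OF DERIV_add[OF DERIV_mult[OF dP d1] DERIV_cmult[OF d0]]]]) (simp add: algebra_simps)
  qed
  show "continuous_on T (f t)" if "t \<in> ball 0 \<epsilon>" for t
   unfolding f_def P_def
  proof (intro continuous_intros cu cc continuous_on_fsol)
   show "continuous_on T (Q t)" unfolding Q_def by (intro continuous_intros)
   thus "continuous_on T (Q t)" .
  qed (use nQ that in auto)
  show "continuous_on (ball 0 \<epsilon> \<times> T) (\<lambda>(t, y). f' t y)"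
  proof -
   have s: "continuous_on (ball 0 \<epsilon> \<times> T) (\<lambda>x. u (snd x))" "continuous_on (ball 0 \<epsilon> \<times> T) (\<lambda>x. c1 (snd x))"
    "continuous_on (ball 0 \<epsilon> \<times> T) (\<lambda>x. c2 (snd x))"
    by (rule continuous_on_compose2[OF cu] continuous_on_compose2[OF cc(1)] continuous_on_compose2[OF cc(2)];
      auto intro!: continuous_intros)+
   have q: "continuous_on (ball 0 \<epsilon> \<times> T) (\<lambda>x. Q (fst x) (snd x))" unfolding Q_def by (intro continuous_intros)
   have "continuous_on (ball 0 \<epsilon> \<times> T) (\<lambda>x. f' (fst x) (snd x))"
    unfolding f'_def P_def P'_def Q'_def
    by (intro continuous_intros s continuous_on_fsol q) (use nQ in auto)
   thus ?thesis by (simp add: case_prod_unfold)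
  qed
  show "f t y = 0" "f' t y = 0" if "y \<notin> shell p r" for t y
   using cutoff_zero_off_shell[OF r that, of 1] cutoff_zero_off_shell[OF r that, of 2]
   by (simp_all add: f_def f'_def P_def P'_def c1_def c2_def)
 qed auto
 have rep: "u (p + t *\<^sub>R e) = (LINT y|lborel. f (cof t) y) / cof repr_const" if t: "\<bar>t\<bar> < \<epsilon>" for t :: real
 proof -
  have te: "norm (t *\<^sub>R e) < r / 8" using eps' mult_right_mono[OF less_imp_le[OF t] norm_ge_zero[of e]] by simp
  have in_r: "(y-p) \<bullet> (y-p) \<le> r\<^sup>2" if "dist y (p + t *\<^sub>R e) < r/2" for y
  proof -
   have "norm (y - p) \<le> norm (y - (p + t *\<^sub>R e)) + norm (t *\<^sub>R e)"
    using norm_triangle_ineq[of "y - (p + t *\<^sub>R e)" "t *\<^sub>R e"] by simp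
   hence "norm (y - p) \<le> r" using that te r by (simp add: dist_norm)
   thus ?thesis using power_mono[of "norm (y - p)" r 2] by (simp add: power2_norm_eq_inner[symmetric])
  qed
  have "repr_const * u (p + t *\<^sub>R e) = (LINT y|lborel. u y * repr_kernel k (cutoff r 1) (cutoff r 2) p (p + t *\<^sub>R e) y)"
  proof (rule helmholtz_representation[OF weak S cutoff_derivs[OF r], where K = "cball p (2 * r)" and \<delta> = "r/2"])
   show "cball p (2 * r) \<subseteq> S" using R by (force simp: r_def)
   show "cutoff r 0 ((y-p) \<bullet> (y-p)) = 0" if "y \<notin> cball p (2 * r)" for y
   proof -
    have "norm (y - p) > 2 * r" using that by (simp add: dist_norm norm_minus_commute)
    hence "(norm (y - p))\<^sup>2 \<ge> (2 * r)\<^sup>2" using r by (intro power_mono) auto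
    hence "(y-p) \<bullet> (y-p) \<ge> 4 * r\<^sup>2" by (simp add: power2_norm_eq_inner power_mult_distrib)
    thus ?thesis using zero_le_power2[of r] by (intro cutoff_outside[OF r]) linarith
   qed
  qed (use r in_r in \<open>auto simp: cutoff_inside\<close>)
  moreover have "u y * repr_kernel k (cutoff r 1) (cutoff r 2) p (p + t *\<^sub>R e) y = f (cof t) y" for y
  proof -
   have 1: "(y - (p + t *\<^sub>R e)) \<bullet> (y - (p + t *\<^sub>R e)) = (y-p) \<bullet> (y-p) - 2 * t * ((y-p) \<bullet> e) + t\<^sup>2 * (e \<bullet> e)"
    by (simp add: inner_diff_left inner_diff_right inner_add_left inner_add_right inner_commute power2_eq_square algebra_simps)
   have 2: "(y - p) \<bullet> (y - (p + t *\<^sub>R e)) = (y-p) \<bullet> (y-p) - t * ((y-p) \<bullet> e)"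
    by (simp add: inner_diff_left inner_diff_right inner_add_left inner_add_right inner_commute algebra_simps)
   show ?thesis unfolding repr_kernel_def Let_def 1 2 f_def P_def Q_def c1_def c2_def by (simp add: algebra_simps)
  qed
  ultimately have "repr_const * u (p + t *\<^sub>R e) = (LINT y|lborel. f (cof t) y)" by presburger
  thus ?thesis using repr_const_pos by (simp add: field_simps)
 qed
 show ?thesis
 proof (rule that[OF eps])
  show "(\<lambda>z. (LINT y|lborel. f z y) / cof repr_const) holomorphic_on ball 0 \<epsilon>"
   using hol repr_const_pos by (intro holomorphic_intros) auto
 qed (use rep in auto)
qed

text \<open>The parameters near which \<open>u\<close> vanishes form an open subset \<open>A\<close>
  of \<open>I\<close>; by the identity theorem its complement in \<open>I\<close> is open too, and
  \<open>I\<close> is connected.\<close>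

lemma weak_helmholtz_line_unique:
 assumes weak: "weak_helmholtz k S u" and S: "open S"
  and I: "open I" "connected I" and line: "\<And>t. t \<in> I \<Longrightarrow> p + t *\<^sub>R e \<in> S"
  and t0: "t0 \<in> I" "\<delta> > 0" "\<And>t. \<bar>t - t0\<bar> < \<delta> \<Longrightarrow> u (p + t *\<^sub>R e) = 0"
  and t: "t \<in> I"
 shows "u (p + t *\<^sub>R e) = 0"
proof -
 define Z where "Z t \<longleftrightarrow> (\<exists>\<delta>>0. \<forall>t'. \<bar>t' - t\<bar> < \<delta> \<longrightarrow> u (p + t' *\<^sub>R e) = 0)" for t
 define A where "A = {t \<in> I. Z t}"
 \<comment> \<open>The radius \<epsilon> depends on \<open>t\<close> alone. If \<open>u\<close>
   vanishes near some \<open>a\<close> within it, then \<open>a - t\<close> is a limit point of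
   zeros of \<open>f\<close>, so \<open>f\<close> vanishes on the whole disc.\<close>
 have loc: "\<exists>\<epsilon>>0. \<forall>a. \<bar>a - t\<bar> < \<epsilon> \<longrightarrow> Z a \<longrightarrow> Z t" if tI: "t \<in> I" for t
 proof -
  obtain \<epsilon> f where f: "\<epsilon> > 0" "f holomorphic_on ball 0 \<epsilon>" "\<And>s::real. \<bar>s\<bar> < \<epsilon> \<Longrightarrow> u ((p + t *\<^sub>R e) + s *\<^sub>R e) = f (cof s)"
   using weak_helmholtz_line_holomorphic[OF weak S line[OF tI], of e] by metis
  have "Z t" if a: "\<bar>a - t\<bar> < \<epsilon>" "Z a" for a
  proof -
   obtain d where d: "d > 0" "\<And>t'. \<bar>t' - a\<bar> < d \<Longrightarrow> u (p + t' *\<^sub>R e) = 0" using a by (auto simp: Z_def)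
   define U where "U = cof ` {s. \<bar>s - (a - t)\<bar> < d \<and> \<bar>s\<bar> < \<epsilon>}"
   have lim: "cof (a - t) islimpt U"
    unfolding islimpt_approachable
   proof (intro allI impI)
    fix \<eta> :: real assume \<eta>: "\<eta> > 0"
    define m where "m = min (d / 2) (min (\<eta> / 2) ((\<epsilon> - \<bar>a - t\<bar>) / 2))"
    have m: "m > 0" "m < d" "m < \<eta>" "\<bar>a - t\<bar> + m < \<epsilon>" using \<eta> d a by (auto simp: m_def min_def field_simps)
    show "\<exists>x'\<in>U. x' \<noteq> cof (a - t) \<and> dist x' (cof (a - t)) < \<eta>"
    proof (intro bexI[of _ "cof (a - t + m)"] conjI)
     show "cof (a - t + m) \<noteq> cof (a - t)" using m(1) by (simp only: of_real_eq_iff)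
     show "dist (cof (a - t + m)) (cof (a - t)) < \<eta>"
      unfolding dist_norm of_real_diff[symmetric] norm_of_real using m by simp
     show "cof (a - t + m) \<in> U" unfolding U_def using m by (intro imageI) auto
    qed
   qed
   have zero: "f z = 0" if "z \<in> ball 0 \<epsilon>" for z
   proof (rule analytic_continuation[OF f(2) open_ball connected_ball _ _ lim _ that])
    show "U \<subseteq> ball 0 \<epsilon>" by (auto simp: U_def)
    show "cof (a - t) \<in> ball 0 \<epsilon>" using a by (simp add: dist_norm flip: of_real_diff)
    show "f z = 0" if zU: "z \<in> U" for z
    proof -
     obtain s where s: "z = cof s" "\<bar>s - (a - t)\<bar> < d" "\<bar>s\<bar> < \<epsilon>" using zU unfolding U_def by blast
     have "u (p + (t + s) *\<^sub>R e) = 0" by (rule d(2)) (use s in \<open>simp add: algebra_simps\<close>)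
     thus ?thesis using f(3)[OF s(3)] s(1) by (simp add: algebra_simps)
    qed
   qed
   show ?thesis unfolding Z_def
   proof (intro exI[of _ \<epsilon>] conjI allI impI f(1))
    fix t' assume "\<bar>t' - t\<bar> < \<epsilon>"
    thus "u (p + t' *\<^sub>R e) = 0"
     using f(3)[of "t' - t"] zero[of "cof (t' - t)"] by (simp add: algebra_simps dist_norm flip: of_real_diff)
   qed
  qed
  thus ?thesis using f(1) by blast
 qed
 have oA: "open A" unfolding open_dist
 proof (intro ballI)
  fix t assume "t \<in> A"
  then obtain d where d: "d > 0" "\<And>t'. \<bar>t' - t\<bar> < d \<Longrightarrow> u (p + t' *\<^sub>R e) = 0" and tI: "t \<in> I" by (auto simp: A_def Z_def)
  obtain d2 where d2: "d2 > 0" "\<And>y. dist y t < d2 \<Longrightarrow> y \<in> I" using I(1) tI unfolding open_dist by blast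
  show "\<exists>e>0. \<forall>y. dist y t < e \<longrightarrow> y \<in> A"
  proof (intro exI[of _ "min (d/2) d2"] conjI allI impI)
   show "0 < min (d/2) d2" using d d2 by simp
   fix y assume y: "dist y t < min (d/2) d2"
   have "Z y" unfolding Z_def
   proof (intro exI[of _ "d/2"] conjI allI impI)
    fix t' assume "\<bar>t' - y\<bar> < d / 2"
    moreover have "\<bar>y - t\<bar> < d / 2" using y by (simp add: dist_real_def)
    ultimately have "\<bar>t' - t\<bar> < d" by linarith
    thus "u (p + t' *\<^sub>R e) = 0" by (rule d(2))
   qed (use d in simp)
   thus "y \<in> A" using d2(2)[of y] y by (simp add: A_def)
  qed
 qed
 have oB: "open (I - A)" unfolding open_dist
 proof (intro ballI)
  fix t assume "t \<in> I - A"
  hence tI: "t \<in> I" and nz: "\<not> Z t" by (auto simp: A_def)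
  obtain \<epsilon> where \<epsilon>: "\<epsilon> > 0" "\<And>a. \<bar>a - t\<bar> < \<epsilon> \<Longrightarrow> Z a \<Longrightarrow> Z t" using loc[OF tI] by blast
  obtain d2 where d2: "d2 > 0" "\<And>y. dist y t < d2 \<Longrightarrow> y \<in> I" using I(1) tI unfolding open_dist by blast
  show "\<exists>e>0. \<forall>y. dist y t < e \<longrightarrow> y \<in> I - A"
   by (rule exI[of _ "min \<epsilon> d2"]) (use \<epsilon> d2 nz in \<open>auto simp: A_def dist_real_def\<close>)
 qed
 have "t0 \<in> A" using t0 by (auto simp: A_def Z_def)
 hence "I - A = {}"
  using connectedD[OF I(2) oA oB] t0(1) by (auto simp: A_def)
 hence "t \<in> A" using t by auto
 thus ?thesis by (auto simp: A_def Z_def)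
qed

lemma weak_helmholtz_zero_on_ball:
 assumes weak: "weak_helmholtz k S u" and S: "open S" and ball: "ball a \<rho> \<subseteq> S"
  and d: "\<delta> > 0" "\<And>y. dist y a < \<delta> \<Longrightarrow> u y = 0" and y: "y \<in> ball a \<rho>"
 shows "u y = 0"
proof (cases "y = a")
 case True
 thus ?thesis using d by simp
next
 case False
 define e where "e = y - a"
 have e: "norm e > 0" using False by (simp add: e_def)
 have "u (a + 1 *\<^sub>R e) = 0"
 proof (rule weak_helmholtz_line_unique[OF weak S, where I = "ball 0 (\<rho> / norm e)" and ?t0.0 = 0 and \<delta> = "\<delta> / norm e"])
  show "a + t *\<^sub>R e \<in> S" if "t \<in> ball 0 (\<rho> / norm e)" for t
  proof -
   have "\<bar>t\<bar> * norm e < \<rho>" using that e by (simp add: pos_less_divide_eq)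
   thus ?thesis using ball by (auto simp: dist_norm)
  qed
  have r: "norm e < \<rho>" using y by (simp add: e_def dist_norm norm_minus_commute)
  show "(1::real) \<in> ball 0 (\<rho> / norm e)" using e r by (simp add: pos_less_divide_eq)
  show "0 \<in> ball (0::real) (\<rho> / norm e)" using divide_pos_pos[OF less_trans[OF e r] e] by simp
  show "u (a + t *\<^sub>R e) = 0" if "\<bar>t - 0\<bar> < \<delta> / norm e" for t
   by (rule d(2)) (use that e in \<open>simp add: dist_norm pos_less_divide_eq\<close>)
 qed (use d e in auto)
 thus ?thesis by (simp add: e_def)
qed

theorem weak_helmholtz_unique_continuation:
 assumes weak: "weak_helmholtz k S u" and S: "open S" "connected S"
  and a: "a \<in> S" "\<delta> > 0" "\<And>y. dist y a < \<delta> \<Longrightarrow> u y = 0" and x: "x \<in> S"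
 shows "u x = 0"
proof -
 define Z where "Z x \<longleftrightarrow> (\<exists>\<delta>>0. \<forall>y. dist y x < \<delta> \<longrightarrow> u y = 0)" for x
 define A where "A = {x \<in> S. Z x}"
 have Zn: "Z y" if "dist y x < d" "\<And>y. dist y x < d \<Longrightarrow> u y = 0" for x y d
  unfolding Z_def
 proof (intro exI[of _ "d - dist y x"] conjI allI impI)
  fix z assume "dist z y < d - dist y x"
  thus "u z = 0" using that(2)[of z] dist_triangle[of z x y] by simp
 qed (use that in simp)
 have oA: "open A" unfolding open_dist
 proof (intro ballI)
  fix x assume "x \<in> A"
  then obtain d where d: "d > 0" "\<And>y. dist y x < d \<Longrightarrow> u y = 0" and xS: "x \<in> S" by (auto simp: A_def Z_def)
  obtain d2 where d2: "d2 > 0" "\<And>y. dist y x < d2 \<Longrightarrow> y \<in> S" using S(1) xS unfolding open_dist by blast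
  show "\<exists>e>0. \<forall>y. dist y x < e \<longrightarrow> y \<in> A"
   by (rule exI[of _ "min d d2"]) (use d d2 Zn[OF _ d(2)] in \<open>auto simp: A_def\<close>)
 qed
 have oB: "open (S - A)" unfolding open_dist
 proof (intro ballI)
  fix x assume "x \<in> S - A"
  hence xS: "x \<in> S" and nz: "\<not> Z x" by (auto simp: A_def)
  obtain R where R: "R > 0" "ball x R \<subseteq> S" using S(1) xS open_contains_ball by blast
  \<comment> \<open>The ball of radius \<open>R / 2\<close> around \<open>b\<close> lies in
    \<open>S\<close> and contains \<open>x\<close>, so zeros near \<open>b\<close> would spread to
    \<open>x\<close>.\<close>
  have "\<not> Z b" if b: "dist b x < R / 2" for b
  proof
   assume "Z b"
   then obtain d where d: "d > 0" "\<And>y. dist y b < d \<Longrightarrow> u y = 0" by (auto simp: Z_def)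
   have sub: "ball b (R/2) \<subseteq> S"
   proof
    fix z assume "z \<in> ball b (R/2)"
    hence "dist x z < R" using dist_triangle[of x z b] b by (simp add: dist_commute)
    thus "z \<in> S" using R by auto
   qed
   have "u y = 0" if "dist y b < R/2" for y
    using weak_helmholtz_zero_on_ball[OF weak S(1) sub d] that by (simp add: dist_commute)
   hence "Z x" using Zn[of x b "R/2"] b by (simp add: dist_commute)
   thus False using nz by simp
  qed
  thus "\<exists>e>0. \<forall>y. dist y x < e \<longrightarrow> y \<in> S - A"
   using R by (intro exI[of _ "R/2"]) (auto simp: A_def subset_eq dist_commute)
 qed
 have "a \<in> A" using a by (auto simp: A_def Z_def)
 hence "S - A = {}"
  using connectedD[OF S(2) oA oB] a(1) by (auto simp: A_def)
 hence "x \<in> A" using x by auto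
 thus ?thesis by (auto simp: A_def Z_def)
qed

section \<open>Odd reflection\<close>

lemma step_bounded:
 assumes "j \<le> 4" obtains M where "M > 0" "\<And>t. \<bar>step j t\<bar> \<le> M"
proof -
 have "bounded (step j ` {1..2})"
  by (intro compact_imp_bounded compact_continuous_image continuous_on_subset[OF continuous_on_step[OF assms]]) auto
 then obtain B where B: "B > 0" "\<forall>y\<in>step j ` {1..2}. norm y \<le> B" unfolding bounded_pos by blast
 show ?thesis
 proof (rule that[of "B + 1"])
  fix t :: real
  consider "t \<le> 1" | "t \<ge> 2" | "t \<in> {1..2}" by fastforce
  thus "\<bar>step j t\<bar> \<le> B + 1"
  proof cases
   case 1 thus ?thesis using B by (simp add: step_zero)
  next
   case 2 thus ?thesis using B by (cases j) (simp_all add: step_one step_Suc_zero)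
  next
   case 3
   from bspec[OF B(2) imageI[OF this]] show ?thesis by simp
  qed
 qed (use B in simp)
qed

lemma C2_data_directional:
 assumes "C2_data \<phi> g h"
 shows "((\<lambda>t. \<phi> (x + t *\<^sub>R e)) has_vector_derivative (\<Sum>i\<in>UNIV. e$i *\<^sub>R g i (x + t *\<^sub>R e))) (at t)"
proof -
 have "((\<lambda>t. x + t *\<^sub>R e) has_derivative (\<lambda>t. t *\<^sub>R e)) (at t)" by (auto intro!: derivative_eq_intros)
 from has_derivative_compose[OF this C2_dataD(1)[OF assms]] show ?thesis
  by (simp add: has_vector_derivative_def scaleR_sum_right)
qed

text \<open>The thickness of the strip enters through integration by parts against \<open>arctan ((x \<bullet> n - c) / \<epsilon>)\<close>,
 whose normal derivative dominates the normalised indicator of the strip.\<close>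
lemma strip_integral_bound:
 fixes n :: "real^3"
 assumes n: "norm n = 1" and K: "compact K"
 obtains M where "M \<ge> 0"
  "\<And>\<epsilon> C (f :: wave). \<epsilon> > 0 \<Longrightarrow> C \<ge> 0 \<Longrightarrow> integrable lborel f \<Longrightarrow>
   (\<And>x. norm (f x) \<le> (if x \<in> K \<and> \<epsilon> \<le> x \<bullet> n - c \<and> x \<bullet> n - c \<le> 2 * \<epsilon> then C / \<epsilon> else 0)) \<Longrightarrow>
   norm (LINT x|lborel. f x) \<le> C * M"
proof -
 obtain r where r: "r > 0" "\<forall>x\<in>K. norm x \<le> r" using compact_imp_bounded[OF K] unfolding bounded_pos by blast
 note d0 = C2_data_radial[OF cutoff_derivs[OF r(1)], of 0, simplified]
 note d1 = C2_data_mult[OF d0 d0]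
 \<comment> \<open>The localiser is the square of a cut-off, which makes it non-negative without
   further estimates.\<close>
 define b where "b x = cutoff r 0 (x \<bullet> x) * cutoff r 0 (x \<bullet> x)" for x :: "real^3"
 obtain g h where bgh: "C2_data b g h" using d1 unfolding b_def[abs_def] by blast
 define \<beta> where "\<beta> x = (1 - step 0 (x \<bullet> x / r\<^sup>2))\<^sup>2" for x :: "real^3"
 have b\<beta>: "b x = cof (\<beta> x)" for x by (simp add: b_def \<beta>_def cutoff_def power2_eq_square)
 have \<beta>0: "\<beta> x \<ge> 0" for x by (simp add: \<beta>_def)
 have \<beta>1: "\<beta> x = 1" if "x \<in> K" for x
 proof -
  have "(norm x)\<^sup>2 \<le> r\<^sup>2" using r that by (intro power_mono) auto
  thus ?thesis using r(1) by (simp add: \<beta>_def step_zero power2_norm_eq_inner)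
 qed
 have bz: "b x = 0" if "x \<notin> cball 0 (2 * r)" for x
 proof -
  have "(norm x)\<^sup>2 \<ge> (2 * r)\<^sup>2" using r that by (intro power_mono) auto
  hence "x \<bullet> x \<ge> 4 * r\<^sup>2" by (simp add: power2_norm_eq_inner power_mult_distrib)
  hence "x \<bullet> x \<ge> 2 * r\<^sup>2" using zero_le_power2[of r] by linarith
  thus ?thesis using cutoff_outside[OF r(1)] by (simp add: b_def)
 qed
 define db where "db x = (\<Sum>i\<in>UNIV. n$i *\<^sub>R g i x)" for x
 have cb: "continuous_on UNIV b" by (rule C2_dataD(5)[OF bgh])
 have cdb: "continuous_on UNIV db" unfolding db_def by (intro continuous_intros C2_dataD(4)[OF bgh])
 have dbz: "db x = 0" if "x \<notin> cball 0 (2 * r)" for x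
  using C2_data_zero_outside(1)[OF bgh closed_cball bz that] by (simp add: db_def)
 have idb: "integrable lborel (\<lambda>x. norm (db x))"
  by (rule integrable_norm[OF integrable_continuous_compact_support[OF cdb compact_cball dbz]])
 \<comment> \<open>\<open>2\<close> bounds the modulus of \<open>arctan\<close>, and
   \<open>5\<close> is the reciprocal of the minimum of \<open>1 / (1 + s\<^sup>2)\<close> for
   \<open>1 \<le> s \<le> 2\<close>. Neither \<epsilon> nor \<open>C\<close> enters.\<close>
 define M where "M = 5 * (2 * (LINT x|lborel. norm (db x)))"
 have M0: "M \<ge> 0" unfolding M_def by simp
 show ?thesis
 proof (rule that[OF M0])
  fix \<epsilon> C :: real and f :: wave
  assume e: "\<epsilon> > 0" and C: "C \<ge> 0" and f: "integrable lborel f"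
   and fb: "\<And>x. norm (f x) \<le> (if x \<in> K \<and> \<epsilon> \<le> x \<bullet> n - c \<and> x \<bullet> n - c \<le> 2 * \<epsilon> then C / \<epsilon> else 0)"
  define s where "s x = (x \<bullet> n - c) / \<epsilon>" for x
  have n1: "n \<bullet> n = 1" using n by (simp add: norm_eq_1)
  define p where "p x = (1 / \<epsilon>) / (1 + (s x)\<^sup>2)" for x
  define G where "G x = cof (arctan (s x)) * b x" for x
  define D where "D x = cof (p x) * b x + cof (arctan (s x)) * db x" for x
  have cs: "continuous_on UNIV s" unfolding s_def using e by (intro continuous_intros) auto
  have nz: "1 + (s x)\<^sup>2 \<noteq> 0" for x using zero_le_power2[of "s x"] by linarith
  have cp: "continuous_on UNIV p" unfolding p_def using e nz by (intro continuous_intros cs) auto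
  have ca: "continuous_on UNIV (\<lambda>x. arctan (s x))" by (intro continuous_intros cs)
  have cG: "continuous_on UNIV G" unfolding G_def by (intro continuous_intros ca cb)
  have c1: "continuous_on UNIV (\<lambda>x. cof (p x) * b x)" by (intro continuous_intros cp cb)
  have c2: "continuous_on UNIV (\<lambda>x. cof (arctan (s x)) * db x)" by (intro continuous_intros ca cdb)
  have cD: "continuous_on UNIV D" unfolding D_def by (intro continuous_intros c1 c2)
  have i1: "integrable lborel (\<lambda>x. cof (p x) * b x)"
   by (rule integrable_continuous_compact_support[OF c1 compact_cball[of 0 "2*r"]]) (simp add: bz)
  have i2: "integrable lborel (\<lambda>x. cof (arctan (s x)) * db x)"
   by (rule integrable_continuous_compact_support[OF c2 compact_cball[of 0 "2*r"]]) (simp add: dbz)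
  have der: "((\<lambda>t. G (x + t *\<^sub>R n)) has_vector_derivative D x) (at 0)" for x
  proof -
   have "((\<lambda>t. s (x + t *\<^sub>R n)) has_real_derivative 1 / \<epsilon>) (at 0)"
    unfolding s_def inner_add_left inner_scaleR_left n1 using e by (auto intro!: derivative_eq_intros)
   from DERIV_chain2[OF DERIV_arctan this]
   have "((\<lambda>t. arctan (s (x + t *\<^sub>R n))) has_real_derivative p x) (at 0)" by (simp add: p_def field_simps)
   from has_vector_derivative_of_real[OF this, where 'a = complex]
   have a: "((\<lambda>t. cof (arctan (s (x + t *\<^sub>R n)))) has_vector_derivative cof (p x)) (at 0)" .
   have b': "((\<lambda>t. b (x + t *\<^sub>R n)) has_vector_derivative db x) (at 0)"
    using C2_data_directional[OF bgh, of x n 0] by (simp add: db_def)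
   show ?thesis unfolding G_def D_def using has_vector_derivative_mult[OF a b'] by (simp add: add.commute)
  qed
  have "(LINT x|lborel. D x) = 0"
   by (rule integral_directional_derivative(2)[OF cG cD compact_cball[of 0 "2*r"] _ der]) (simp add: G_def bz)
  hence "(LINT x|lborel. cof (p x) * b x) = - (LINT x|lborel. cof (arctan (s x)) * db x)"
   unfolding D_def using i1 i2 by (simp add: eq_neg_iff_add_eq_0)
  moreover have "norm (LINT x|lborel. cof (arctan (s x)) * db x) \<le> (LINT x|lborel. 2 * norm (db x))"
  proof (rule order_trans[OF integral_norm_bound], rule integral_mono)
   show "integrable lborel (\<lambda>x. norm (cof (arctan (s x)) * db x))" by (rule integrable_norm[OF i2])
   show "integrable lborel (\<lambda>x. 2 * norm (db x))" by (intro integrable_mult_right idb)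
   fix x
   have "\<bar>arctan (s x)\<bar> \<le> 2" using arctan_bounded[of "s x"] pi_half_less_two by (simp add: abs_le_iff)
   thus "norm (cof (arctan (s x)) * db x) \<le> 2 * norm (db x)"
    by (simp add: norm_mult mult_right_mono)
  qed
  ultimately have le: "norm (LINT x|lborel. cof (p x) * b x) \<le> 2 * (LINT x|lborel. norm (db x))" by simp
  have eqp: "cof (p x) * b x = cof (p x * \<beta> x)" for x by (simp add: b\<beta>)
  have ip: "integrable lborel (\<lambda>x. p x * \<beta> x)"
   using integrable_Re[OF i1] unfolding eqp by simp
  have le2: "(LINT x|lborel. p x * \<beta> x) \<le> 2 * (LINT x|lborel. norm (db x))"
   using le unfolding eqp integral_complex_of_real norm_of_real by linarith
  have "norm (LINT x|lborel. f x) \<le> (LINT x|lborel. norm (f x))" by (rule integral_norm_bound)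
  also have "\<dots> \<le> (LINT x|lborel. (5 * C) * (p x * \<beta> x))"
  proof (rule integral_mono)
   show "integrable lborel (\<lambda>x. norm (f x))" using f by (rule integrable_norm)
   show "integrable lborel (\<lambda>x. (5 * C) * (p x * \<beta> x))" by (intro integrable_mult_right ip)
   fix x
   have p0: "p x \<ge> 0" using e by (simp add: p_def)
   show "norm (f x) \<le> (5 * C) * (p x * \<beta> x)"
   proof (cases "x \<in> K \<and> \<epsilon> \<le> x \<bullet> n - c \<and> x \<bullet> n - c \<le> 2 * \<epsilon>")
    case True
    hence "1 \<le> s x" "s x \<le> 2" using e by (auto simp: s_def field_simps)
    hence "(s x)\<^sup>2 \<le> 2\<^sup>2" by (intro power_mono) auto
    hence "1 / (1 + (s x)\<^sup>2) \<ge> 1 / 5" by (intro divide_left_mono) (auto intro: add_pos_nonneg)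
    hence "1 / 5 / \<epsilon> \<le> 1 / (1 + (s x)\<^sup>2) / \<epsilon>" using e by (intro divide_right_mono) auto
    hence "1 / \<epsilon> \<le> 5 * p x" by (simp add: p_def field_simps)
    hence "C * (1 / \<epsilon>) \<le> C * (5 * p x)" using C by (intro mult_left_mono)
    thus ?thesis using fb[of x] True \<beta>1[of x] by (simp add: mult_ac)
   next
    case False
    thus ?thesis using fb[of x] p0 \<beta>0[of x] C by auto
   qed
  qed
  also have "\<dots> = 5 * C * (LINT x|lborel. p x * \<beta> x)" by simp
  also have "\<dots> \<le> 5 * C * (2 * (LINT x|lborel. norm (db x)))" using C le2 by (intro mult_left_mono) auto
  finally show "norm (LINT x|lborel. f x) \<le> C * M" by (simp add: M_def mult_ac)
 qed
qed

lemma helm_diff: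
 "helm k (\<lambda>x. \<phi> x - \<psi> x) (\<lambda>i j x. h i j x - h' i j x) x = helm k \<phi> h x - helm k \<psi> h' x"
 by (simp add: helm_def sum_subtractf algebra_simps)

text \<open>Testing with functions that vanish on the plane: the cut-off near the plane costs a factor \<open>1/\<epsilon>\<close>
 on a strip of width \<open>\<epsilon>\<close>, which the continuity of \<open>W\<close> absorbs.\<close>
lemma half_space_test:
 fixes W :: wave
 assumes n: "norm n = 1" and S: "open S" and cW: "continuous_on S W"
  and W0: "\<And>x. x \<in> S \<Longrightarrow> x \<bullet> n = c \<Longrightarrow> W x = 0"
  and weak: "weak_helmholtz k (S \<inter> {x. x \<bullet> n > c}) W"
  and psi: "C2_data \<psi> g h" and K: "compact K" "K \<subseteq> S" "\<And>x. x \<notin> K \<Longrightarrow> \<psi> x = 0"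
  and psi0: "\<And>x. x \<bullet> n = c \<Longrightarrow> \<psi> x = 0"
 shows "(LINT x|lborel. (if x \<bullet> n > c then W x else 0) * helm k \<psi> h x) = 0"
proof -
 have nn: "n \<bullet> n = 1" using n by (simp add: norm_eq_1)
 define dn where "dn x = (\<Sum>i\<in>UNIV. n$i *\<^sub>R g i x)" for x
 have cdn: "continuous_on UNIV dn" unfolding dn_def by (intro continuous_intros C2_dataD(4)[OF psi])
 have dnz: "dn x = 0" if "x \<notin> K" for x
  using C2_data_zero_outside(1)[OF psi compact_imp_closed[OF K(1)] K(3) that] by (simp add: dn_def)
 obtain B where B: "B > 0" "\<And>x. norm (dn x) \<le> B" using bounded_compact_support[OF cdn K(1) dnz] by metis
 \<comment> \<open>Move from \<open>x\<close> along the normal to its foot point \<open>y\<close> on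
   the plane, where \<psi> vanishes.\<close>
 have psib: "norm (\<psi> x) \<le> B * \<bar>x \<bullet> n - c\<bar>" for x
 proof -
  define t where "t = x \<bullet> n - c"
  define y where "y = x - t *\<^sub>R n"
  have "y \<bullet> n = c" by (simp add: y_def t_def inner_diff_left nn)
  hence y0: "\<psi> y = 0" by (rule psi0)
  have "norm (\<psi> (y + t *\<^sub>R n) - \<psi> (y + 0 *\<^sub>R n)) \<le> B * \<bar>t - 0\<bar>"
   by (rule norm_diff_le_vector_derivative[where S = UNIV and f = "\<lambda>t. \<psi> (y + t *\<^sub>R n)" and f' = "\<lambda>t. dn (y + t *\<^sub>R n)"])
     (use C2_data_directional[OF psi, of y n] B in \<open>auto simp: dn_def\<close>)
  thus ?thesis using y0 by (simp add: y_def t_def)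
 qed
 obtain M1 where M1: "M1 > 0" "\<And>t. \<bar>step 1 t\<bar> \<le> M1" using step_bounded[of 1] by auto
 obtain M2 where M2: "M2 > 0" "\<And>t. \<bar>step 2 t\<bar> \<le> M2" using step_bounded[of 2] by auto
 obtain M0 where M0: "M0 > 0" "\<And>t. \<bar>step 0 t\<bar> \<le> M0" using step_bounded[of 0] by auto
 obtain M where M: "M \<ge> 0" "\<And>\<epsilon> C (f :: wave). \<epsilon> > 0 \<Longrightarrow> C \<ge> 0 \<Longrightarrow> integrable lborel f \<Longrightarrow>
   (\<And>x. norm (f x) \<le> (if x \<in> K \<and> \<epsilon> \<le> x \<bullet> n - c \<and> x \<bullet> n - c \<le> 2 * \<epsilon> then C / \<epsilon> else 0)) \<Longrightarrow>
   norm (LINT x|lborel. f x) \<le> C * M"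
  using strip_integral_bound[OF n K(1), of c] by metis
 define Wh where "Wh x = W x * helm k \<psi> h x" for x
 have cWh: "continuous_on UNIV Wh" unfolding Wh_def by (rule helm_mult_continuous[OF cW S psi K])
 have Whz: "Wh x = 0" if "x \<notin> K" for x
  using helm_zero_outside[OF psi compact_imp_closed[OF K(1)] K(3) that] by (simp add: Wh_def)
 have iWh: "integrable lborel Wh" by (rule integrable_continuous_compact_support[OF cWh K(1) Whz])
 define th where "th \<epsilon> j x = cof (step j ((x \<bullet> n - c) / \<epsilon>) / \<epsilon> ^ j)" for \<epsilon> j and x :: "real^3"
 have key: "(LINT x|lborel. th \<epsilon> 0 x * Wh x) = - (LINT x|lborel. W x * (2 * th \<epsilon> 1 x * dn x + th \<epsilon> 2 x * \<psi> x))"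
  "integrable lborel (\<lambda>x. W x * (2 * th \<epsilon> 1 x * dn x + th \<epsilon> 2 x * \<psi> x))" if e: "\<epsilon> > 0" for \<epsilon>
 proof -
  have F: "((\<lambda>t. cof (step j (t / \<epsilon>) / \<epsilon> ^ j)) has_vector_derivative cof (step (Suc j) (t / \<epsilon>) / \<epsilon> ^ Suc j)) (at t)"
   if "j < 4" for j t
  proof (rule has_vector_derivative_of_real)
   have "((\<lambda>t. step j (t / \<epsilon>)) has_real_derivative step (Suc j) (t / \<epsilon>) * (1 / \<epsilon>)) (at t)"
    by (rule DERIV_chain2[OF step_deriv[OF that] DERIV_cdivide[OF DERIV_ident]])
   thus "((\<lambda>t. step j (t / \<epsilon>) / \<epsilon> ^ j) has_real_derivative step (Suc j) (t / \<epsilon>) / \<epsilon> ^ Suc j) (at t)"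
    by (rule DERIV_cong[OF DERIV_cdivide]) (simp only: power_Suc divide_inverse inverse_mult_distrib mult_1_left mult_ac)
  qed
  have F0: "\<And>t. ((\<lambda>t. cof (step 0 (t / \<epsilon>) / \<epsilon> ^ 0)) has_vector_derivative cof (step 1 (t / \<epsilon>) / \<epsilon> ^ 1)) (at t)"
   and F1: "\<And>t. ((\<lambda>t. cof (step 1 (t / \<epsilon>) / \<epsilon> ^ 1)) has_vector_derivative cof (step 2 (t / \<epsilon>) / \<epsilon> ^ 2)) (at t)"
   using F[of 0] F[of 1] by (simp_all add: numeral_2_eq_2)
  have F2: "continuous_on UNIV (\<lambda>t. cof (step 2 (t / \<epsilon>) / \<epsilon> ^ 2))"
   using e by (intro continuous_intros continuous_on_compose2[OF continuous_on_step[of 2]]) auto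
  note pl = C2_data_planar[OF F0 F1 F2, of n c, folded th_def]
  note pr = C2_data_mult[OF pl psi]
  have Kc: "compact (K \<inter> {x. \<epsilon> \<le> x \<bullet> n - c})"
   by (intro compact_Int_closed K(1) closed_Collect_le continuous_intros)
  have Ks: "K \<inter> {x. \<epsilon> \<le> x \<bullet> n - c} \<subseteq> S \<inter> {x. x \<bullet> n > c}" using K(2) e by auto
  have Kz: "th \<epsilon> 0 x * \<psi> x = 0" if "x \<notin> K \<inter> {x. \<epsilon> \<le> x \<bullet> n - c}" for x
  proof (cases "x \<in> K")
   case True
   hence "(x \<bullet> n - c) / \<epsilon> \<le> 1" using that e by simp
   thus ?thesis by (simp add: th_def step_zero)
  qed (simp add: K(3))
  have s: "(\<Sum>i\<in>UNIV. n$i *\<^sub>R th \<epsilon> 1 x * g i x) = th \<epsilon> 1 x * dn x" "(\<Sum>i\<in>UNIV. (n$i * n$i) *\<^sub>R th \<epsilon> 2 x) = th \<epsilon> 2 x" for x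
  proof -
   show "(\<Sum>i\<in>UNIV. n$i *\<^sub>R th \<epsilon> 1 x * g i x) = th \<epsilon> 1 x * dn x"
    unfolding dn_def sum_distrib_left by (rule sum.cong) (simp_all add: scaleR_conv_of_real)
   have "(\<Sum>i\<in>UNIV. n$i * n$i) = 1" using nn by (simp add: inner_vec_def)
   thus "(\<Sum>i\<in>UNIV. (n$i * n$i) *\<^sub>R th \<epsilon> 2 x) = th \<epsilon> 2 x"
    by (simp only: scaleR_sum_left[symmetric]) simp
  qed
  have oS: "open (S \<inter> {x. x \<bullet> n > c})" by (intro open_Int S open_Collect_less continuous_intros)
  have sp: "W x * helm k (\<lambda>x. th \<epsilon> 0 x * \<psi> x) (\<lambda>i j x. th \<epsilon> 0 x * h i j x + n$j *\<^sub>R th \<epsilon> 1 x * g i x + (n$i *\<^sub>R th \<epsilon> 1 x * g j x + (n$i * n$j) *\<^sub>R th \<epsilon> 2 x * \<psi> x)) x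
   = th \<epsilon> 0 x * Wh x + W x * (2 * th \<epsilon> 1 x * dn x + th \<epsilon> 2 x * \<psi> x)" for x
   unfolding helm_mult s Wh_def by (simp add: algebra_simps)
  note wk = weak_helmholtzD[OF weak pr Kc Ks Kz, unfolded sp]
  note ik = helm_mult_integrable[OF weak_helmholtz_continuous[OF weak] oS pr Kc Ks Kz, of k, unfolded sp]
  have i1: "integrable lborel (\<lambda>x. th \<epsilon> 0 x * Wh x)"
   by (rule integrable_continuous_compact_support[OF _ K(1)])
     (auto simp: Whz intro!: continuous_intros cWh C2_dataD(5)[OF pl])
  show i2: "integrable lborel (\<lambda>x. W x * (2 * th \<epsilon> 1 x * dn x + th \<epsilon> 2 x * \<psi> x))"
   using Bochner_Integration.integrable_diff[OF ik i1] by simp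
  show "(LINT x|lborel. th \<epsilon> 0 x * Wh x) = - (LINT x|lborel. W x * (2 * th \<epsilon> 1 x * dn x + th \<epsilon> 2 x * \<psi> x))"
   using wk i1 i2 by (simp add: eq_neg_iff_add_eq_0)
 qed
 define e where "e m = 1 / real (Suc m)" for m
 have e0: "e \<longlonglongrightarrow> 0" unfolding e_def by (rule LIMSEQ_Suc[OF lim_1_over_n])
 have ep: "e m > 0" for m by (simp add: e_def)
 have lim: "(\<lambda>m. LINT x|lborel. th (e m) 0 x * Wh x) \<longlonglongrightarrow> (LINT x|lborel. (if x \<bullet> n > c then W x else 0) * helm k \<psi> h x)"
 proof (rule integral_dominated_convergence[where w = "\<lambda>x. M0 * norm (Wh x)"])
  have [measurable]: "Wh \<in> borel_measurable borel" using cWh by (rule borel_measurable_continuous_onI)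
  have [measurable]: "step 0 \<in> borel_measurable borel" using continuous_on_step[of 0] by (intro borel_measurable_continuous_onI) simp
  show "(\<lambda>x. th (e m) 0 x * Wh x) \<in> borel_measurable lborel" for m unfolding th_def by measurable
  have eq: "(\<lambda>x. (if x \<bullet> n > c then W x else 0) * helm k \<psi> h x) = (\<lambda>x. if x \<bullet> n > c then Wh x else 0)"
   by (auto simp: Wh_def)
  show "(\<lambda>x. (if x \<bullet> n > c then W x else 0) * helm k \<psi> h x) \<in> borel_measurable lborel"
   unfolding eq by measurable
  show "integrable lborel (\<lambda>x. M0 * norm (Wh x))" by (intro integrable_mult_right integrable_norm iWh)
  show "AE x in lborel. (\<lambda>m. th (e m) 0 x * Wh x) \<longlonglongrightarrow> (if x \<bullet> n > c then W x else 0) * helm k \<psi> h x"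
  proof (rule AE_I2)
   fix x :: "real^3"
   show "(\<lambda>m. th (e m) 0 x * Wh x) \<longlonglongrightarrow> (if x \<bullet> n > c then W x else 0) * helm k \<psi> h x"
   proof (cases "x \<bullet> n > c")
    case True
    hence "0 < (x \<bullet> n - c) / 2" by simp
    hence "eventually (\<lambda>m. e m < (x \<bullet> n - c) / 2) sequentially" using order_tendstoD(2)[OF e0] by blast
    hence "eventually (\<lambda>m. th (e m) 0 x * Wh x = Wh x) sequentially"
    proof eventually_elim
     case (elim m)
     hence "(x \<bullet> n - c) / e m \<ge> 2" using ep[of m] by (simp add: pos_le_divide_eq)
     thus ?case by (simp add: th_def step_one)
    qed
    from tendsto_eventually[OF this] show ?thesis using True by (simp add: Wh_def)
   next
    case False
    hence "(x \<bullet> n - c) / e m \<le> 1" for m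
     using ep[of m] divide_nonpos_pos[of "x \<bullet> n - c" "e m"] by linarith
    thus ?thesis using False by (simp add: th_def step_zero)
   qed
  qed
  show "AE x in lborel. norm (th (e m) 0 x * Wh x) \<le> M0 * norm (Wh x)" for m
   by (rule AE_I2) (use M0(2) in \<open>auto simp: th_def norm_mult intro!: mult_right_mono\<close>)
 qed
 have "(\<lambda>m. LINT x|lborel. th (e m) 0 x * Wh x) \<longlonglongrightarrow> 0"
 proof (rule LIMSEQ_I)
  fix \<eta> :: real assume \<eta>: "\<eta> > 0"
  \<comment> \<open>On the strip the gradient term is at most
    \<open>2 * (M1 / \<epsilon>) * B\<close> and the term with the second derivative at most
    \<open>M2 / \<epsilon>\<^sup>2\<close> times \<open>B * (2 * \<epsilon>)\<close>; together this
    is \<open>C0 / \<epsilon>\<close>.\<close>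
  define C0 where "C0 = 2 * M1 * B + 2 * M2 * B"
  have C0: "C0 > 0" using M1(1) M2(1) B(1) unfolding C0_def by (intro add_pos_pos mult_pos_pos) auto
  define \<delta> where "\<delta> = \<eta> / (2 * C0 * (M + 1))"
  have d: "\<delta> > 0" using \<eta> C0 M by (simp add: \<delta>_def)
  have dM: "\<delta> * C0 * M < \<eta>"
  proof -
   have "\<delta> * C0 * M \<le> \<delta> * C0 * (M + 1)" using d C0 by (intro mult_left_mono) auto
   also have "\<dots> = \<eta> / 2"
   proof -
    have "C0 * (M + 1) \<noteq> 0" using C0 M by simp
    thus ?thesis by (simp add: \<delta>_def field_simps)
   qed
   finally show ?thesis using \<eta> by simp
  qed
  \<comment> \<open>The part of \<open>K\<close> on which \<open>W\<close> is not small is compact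
    and misses the plane, hence keeps a distance \<open>\<epsilon>0\<close> from it.\<close>
  define K1 where "K1 = {x \<in> K. \<delta> \<le> norm (W x)}"
  have K1: "compact K1"
  proof -
   have cnW: "continuous_on K (\<lambda>x. norm (W x))" by (intro continuous_intros continuous_on_subset[OF cW K(2)])
   have "closedin (top_of_set K) (K \<inter> (\<lambda>x. norm (W x)) -` {\<delta>..})"
    by (rule continuous_closedin_preimage[OF cnW]) simp
   hence "compact (K \<inter> (\<lambda>x. norm (W x)) -` {\<delta>..})" using closedin_compact[OF K(1)] by blast
   moreover have "K \<inter> (\<lambda>x. norm (W x)) -` {\<delta>..} = K1" by (auto simp: K1_def)
   ultimately show ?thesis by simp
  qed
  obtain \<epsilon>0 where \<epsilon>0: "\<epsilon>0 > 0" "\<And>x. x \<in> K \<Longrightarrow> \<bar>x \<bullet> n - c\<bar> < \<epsilon>0 \<Longrightarrow> norm (W x) < \<delta>"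
  proof (cases "K1 = {}")
   case True
   show ?thesis by (rule that[of 1]) (use True in \<open>auto simp: K1_def not_le\<close>)
  next
   case False
   have "continuous_on K1 (\<lambda>x. \<bar>x \<bullet> n - c\<bar>)" by (intro continuous_intros)
   then obtain x1 where x1: "x1 \<in> K1" "\<And>x. x \<in> K1 \<Longrightarrow> \<bar>x1 \<bullet> n - c\<bar> \<le> \<bar>x \<bullet> n - c\<bar>"
    using continuous_attains_inf[OF K1 False] by blast
   have "x1 \<bullet> n \<noteq> c" using W0[of x1] x1(1) K(2) d by (auto simp: K1_def)
   show ?thesis
   proof (rule that[of "\<bar>x1 \<bullet> n - c\<bar>"])
    show "0 < \<bar>x1 \<bullet> n - c\<bar>" using \<open>x1 \<bullet> n \<noteq> c\<close> by simp
    fix x assume "x \<in> K" "\<bar>x \<bullet> n - c\<bar> < \<bar>x1 \<bullet> n - c\<bar>"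
    thus "norm (W x) < \<delta>" using x1(2)[of x] by (force simp: K1_def)
   qed
  qed
  have "0 < \<epsilon>0 / 2" using \<epsilon>0 by simp
  then obtain N where N: "\<And>m. m \<ge> N \<Longrightarrow> e m < \<epsilon>0 / 2"
   using order_tendstoD(2)[OF e0] unfolding eventually_sequentially by blast
  show "\<exists>no. \<forall>m\<ge>no. norm ((LINT x|lborel. th (e m) 0 x * Wh x) - 0) < \<eta>"
  proof (intro exI[of _ N] allI impI)
   fix m assume m: "m \<ge> N"
   let ?e = "e m"
   have "norm (LINT x|lborel. W x * (2 * th ?e 1 x * dn x + th ?e 2 x * \<psi> x)) \<le> (\<delta> * C0) * M"
   proof (rule M(2)[OF ep[of m] _ key(2)[OF ep[of m]]])
    show "0 \<le> \<delta> * C0" using d C0 by simp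
    fix x :: "real^3"
    show "norm (W x * (2 * th ?e 1 x * dn x + th ?e 2 x * \<psi> x)) \<le>
     (if x \<in> K \<and> ?e \<le> x \<bullet> n - c \<and> x \<bullet> n - c \<le> 2 * ?e then \<delta> * C0 / ?e else 0)"
    proof (cases "x \<in> K \<and> ?e \<le> x \<bullet> n - c \<and> x \<bullet> n - c \<le> 2 * ?e")
     case True
     have W: "norm (W x) \<le> \<delta>" using True N[OF m] ep[of m] by (intro less_imp_le \<epsilon>0(2)) auto
     have t1: "norm (th ?e 1 x) \<le> M1 / ?e" using M1(2) ep[of m] by (simp add: th_def divide_right_mono norm_divide)
     have t2: "norm (th ?e 2 x) \<le> M2 / ?e\<^sup>2" using M2(2) ep[of m] by (simp add: th_def divide_right_mono norm_divide norm_power)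
     have p: "norm (\<psi> x) \<le> B * (2 * ?e)"
      using psib[of x] True ep[of m] B mult_left_mono[of "\<bar>x \<bullet> n - c\<bar>" "2 * ?e" B] by linarith
     have "norm (2 * th ?e 1 x * dn x + th ?e 2 x * \<psi> x) \<le> 2 * (norm (th ?e 1 x) * norm (dn x)) + norm (th ?e 2 x) * norm (\<psi> x)"
      using norm_triangle_ineq[of "2 * th ?e 1 x * dn x" "th ?e 2 x * \<psi> x"] by (simp add: norm_mult)
     also have "\<dots> \<le> 2 * (M1 / ?e * B) + M2 / ?e\<^sup>2 * (B * (2 * ?e))"
      using t1 t2 p B M1(1) M2(1) ep[of m] by (intro add_mono mult_left_mono mult_mono) auto
     also have "\<dots> = C0 / ?e" using ep[of m] by (simp add: C0_def field_simps power2_eq_square)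
     finally have q: "norm (2 * th ?e 1 x * dn x + th ?e 2 x * \<psi> x) \<le> C0 / ?e" .
     have "norm (W x * (2 * th ?e 1 x * dn x + th ?e 2 x * \<psi> x)) \<le> \<delta> * (C0 / ?e)"
      unfolding norm_mult using W q d C0 ep[of m] by (intro mult_mono) auto
     thus ?thesis using True by simp
    next
     case False
     show ?thesis
     proof (cases "x \<in> K")
      case True
      hence "(x \<bullet> n - c) / ?e \<le> 1 \<or> 2 \<le> (x \<bullet> n - c) / ?e" using False ep[of m] by (auto simp: pos_le_divide_eq)
      hence "step (Suc j) ((x \<bullet> n - c) / ?e) = 0" for j by (auto simp: step_zero step_Suc_zero)
      from this[of 0] this[of 1] have "th ?e 1 x = 0" "th ?e 2 x = 0" by (simp_all add: th_def numeral_2_eq_2)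
      thus ?thesis using False by (auto split: if_splits)
     next
      case False
      thus ?thesis using dnz[of x] K(3)[of x] by simp
     qed
    qed
   qed
   thus "norm ((LINT x|lborel. th ?e 0 x * Wh x) - 0) < \<eta>" using key(1)[OF ep[of m]] dM by simp
  qed
 qed
 from LIMSEQ_unique[OF lim this] show ?thesis .
qed

text \<open>Transferring the lower half of the integral to the upper one by reflection pairs
  \<open>W\<close> with \<phi> minus its mirror image. That difference vanishes on the plane, so
  \<open>half_space_test\<close> applies to it.\<close>

theorem weak_helmholtz_odd_reflection:
 fixes W :: wave
 assumes n: "norm n = 1" and S: "open S" and sym: "\<And>x. x \<in> S \<Longrightarrow> plane_refl n c x \<in> S"
  and cW: "continuous_on S W" and odd: "\<And>x. x \<in> S \<Longrightarrow> W (plane_refl n c x) = - W x"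
  and weak: "weak_helmholtz k (S \<inter> {x. x \<bullet> n > c}) W"
 shows "weak_helmholtz k S W"
 unfolding weak_helmholtz_def
proof (intro conjI allI impI cW)
 fix \<phi> g h K assume a: "C2_data \<phi> g h" "compact K" "K \<subseteq> S" "\<forall>x. x \<notin> K \<longrightarrow> \<phi> x = 0"
 let ?R = "plane_refl n c"
 have z: "\<And>x. x \<notin> K \<Longrightarrow> \<phi> x = 0" using a(4) by blast
 obtain g' h' where gh': "C2_data (\<lambda>x. \<phi> (?R x)) g' h'" "\<And>x. helm k (\<lambda>x. \<phi> (?R x)) h' x = helm k \<phi> h (?R x)"
  using C2_data_plane_refl(1)[OF n a(1), of c] C2_data_plane_refl(2)[OF n a(1), of k c] by blast
 note psi = C2_data_diff[OF a(1) gh'(1)]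
 have W0: "W x = 0" if "x \<in> S" "x \<bullet> n = c" for x
  using odd[OF that(1)] plane_refl_on_plane[OF n that(2)] by simp
 define K' where "K' = K \<union> ?R ` K"
 have K': "compact K'" "K' \<subseteq> S" unfolding K'_def
  using a(2,3) sym by (auto intro!: compact_Un compact_continuous_image continuous_on_plane_refl[OF n])
 have zR: "\<phi> (?R x) = 0" if "x \<notin> K'" for x
  using that plane_refl_plane_refl[OF n, of c x] by (intro z) (auto simp: K'_def image_iff)
 have z': "\<phi> x - \<phi> (?R x) = 0" if "x \<notin> K'" for x using zR[OF that] z[of x] that by (simp add: K'_def)
 define Wp where "Wp x = (if x \<bullet> n > c then W x else 0)" for x
 have half: "(LINT x|lborel. Wp x * helm k (\<lambda>x. \<phi> x - \<phi> (?R x)) (\<lambda>i j x. h i j x - h' i j x) x) = 0"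
  unfolding Wp_def
  by (rule half_space_test[OF n S cW W0 weak psi K' z']) (simp_all add: plane_refl_on_plane[OF n])
 have cWp: "continuous_on S Wp"
 proof -
  have 1: "continuous_on (S \<inter> {x. x \<bullet> n \<ge> c}) Wp"
   by (subst continuous_on_cong[of _ "S \<inter> {x. x \<bullet> n \<ge> c}" _ W])
     (auto simp: Wp_def W0 order_le_less intro!: continuous_on_subset[OF cW])
  have 2: "continuous_on (S \<inter> {x. x \<bullet> n \<le> c}) Wp"
   by (subst continuous_on_cong[of _ "S \<inter> {x. x \<bullet> n \<le> c}" _ "\<lambda>_. 0"]) (auto simp: Wp_def)
  have "continuous_on ((S \<inter> {x. x \<bullet> n \<ge> c}) \<union> (S \<inter> {x. x \<bullet> n \<le> c})) Wp"
  proof (rule continuous_on_Un_local[OF _ _ 1 2])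
   have e: "(S \<inter> {x. x \<bullet> n \<ge> c}) \<union> (S \<inter> {x. x \<bullet> n \<le> c}) = S" by auto
   show "closedin (top_of_set ((S \<inter> {x. x \<bullet> n \<ge> c}) \<union> (S \<inter> {x. x \<bullet> n \<le> c}))) (S \<inter> {x. x \<bullet> n \<ge> c})"
    "closedin (top_of_set ((S \<inter> {x. x \<bullet> n \<ge> c}) \<union> (S \<inter> {x. x \<bullet> n \<le> c}))) (S \<inter> {x. x \<bullet> n \<le> c})"
    unfolding e by (rule closedin_closed_Int closed_Collect_le continuous_intros)+
  qed
  moreover have "(S \<inter> {x. x \<bullet> n \<ge> c}) \<union> (S \<inter> {x. x \<bullet> n \<le> c}) = S" by auto
  ultimately show ?thesis by simp
 qed
 have cWm: "continuous_on S (\<lambda>x. W x - Wp x)" by (intro continuous_intros cW cWp)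
 have sK: "closed K" using a(2) by (rule compact_imp_closed)
 note I1 = helm_mult_integrable[OF cWp S a(1-3) z, of k]
 note I2 = helm_mult_integrable[OF cWm S a(1-3) z, of k]
 note c2 = helm_mult_continuous[OF cWm S a(1-3) z, of k]
 have zR': "helm k (\<lambda>x. \<phi> (?R x)) h' x = 0" if "x \<notin> K'" for x
  by (rule helm_zero_outside[OF gh'(1) compact_imp_closed[OF K'(1)] zR that])
 note I3 = helm_mult_integrable[OF cWp S gh'(1) K' zR, of k]
 have "(LINT x|lborel. W x * helm k \<phi> h x) = (LINT x|lborel. Wp x * helm k \<phi> h x + (W x - Wp x) * helm k \<phi> h x)"
  by (simp add: algebra_simps)
 also have "\<dots> = (LINT x|lborel. Wp x * helm k \<phi> h x) + (LINT x|lborel. (W x - Wp x) * helm k \<phi> h x)"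
  by (rule Bochner_Integration.integral_add[OF I1 I2])
 also have "(LINT x|lborel. (W x - Wp x) * helm k \<phi> h x) = (LINT x|lborel. (W (?R x) - Wp (?R x)) * helm k \<phi> h (?R x))"
  by (rule lborel_integral_plane_refl[OF n c2, symmetric])
 also have "\<dots> = (LINT x|lborel. - (Wp x * helm k (\<lambda>x. \<phi> (?R x)) h' x))"
 proof (rule Bochner_Integration.integral_cong[OF refl])
  fix x
  show "(W (?R x) - Wp (?R x)) * helm k \<phi> h (?R x) = - (Wp x * helm k (\<lambda>x. \<phi> (?R x)) h' x)"
  proof (cases "x \<in> K'")
   case True
   hence xS: "x \<in> S" using K'(2) by auto
   have "W (?R x) - Wp (?R x) = - Wp x"
    using odd[OF xS] plane_refl_inner[OF n, of c x] W0[OF xS] by (cases "x \<bullet> n" c rule: linorder_cases) (auto simp: Wp_def)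
   thus ?thesis by (simp add: gh'(2))
  next
   case False
   thus ?thesis using zR'[OF False] gh'(2)[of x] by simp
  qed
 qed
 also have "\<dots> = - (LINT x|lborel. Wp x * helm k (\<lambda>x. \<phi> (?R x)) h' x)" by simp
 also have "(LINT x|lborel. Wp x * helm k \<phi> h x) + \<dots> = (LINT x|lborel. Wp x * helm k \<phi> h x - Wp x * helm k (\<lambda>x. \<phi> (?R x)) h' x)"
  using Bochner_Integration.integral_diff[OF I1 I3] by simp
 also have "\<dots> = 0" using half unfolding helm_diff by (simp add: right_diff_distrib)
 finally show "(LINT x|lborel. W x * helm k \<phi> h x) = 0" .
qed

section \<open>Radiating solutions outside a ball\<close>

lemma integrable_bounded_support:
 fixes f :: wave
 assumes "f \<in> borel_measurable borel" "\<And>y. norm (f y) \<le> B" "\<And>y. norm y > b \<Longrightarrow> f y = 0" "B \<ge> 0"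
 shows "integrable lborel f" "norm (LINT y|lborel. f y) \<le> B * measure lborel (cball (0::real^3) b)"
proof -
 have i: "integrable lborel (\<lambda>y. indicator (cball (0::real^3) b) y * B)"
  by (intro integrable_mult_left integrable_real_indicator emeasure_compact_finite) auto
 have le: "norm (f y) \<le> indicator (cball (0::real^3) b) y * B" for y
  using assms(2)[of y] assms(3)[of y] by (cases "norm y \<le> b") (auto simp: indicator_def)
 show f: "integrable lborel f"
  by (rule Bochner_Integration.integrable_bound[OF i]) (use assms(1,4) le in \<open>auto intro!: AE_I2 simp: abs_mult\<close>)
 have "norm (LINT y|lborel. f y) \<le> (LINT y|lborel. norm (f y))" by (rule integral_norm_bound)
 also have "\<dots> \<le> (LINT y|lborel. indicator (cball (0::real^3) b) y * B)"
  by (rule integral_mono[OF integrable_norm[OF f] i le])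
 also have "\<dots> = B * measure lborel (cball (0::real^3) b)" by simp
 finally show "norm (LINT y|lborel. f y) \<le> B * measure lborel (cball (0::real^3) b)" .
qed

text \<open>The scaling law of Lebesgue measure replaces integration by parts in polar coordinates.\<close>
lemma integral_radial_derivative:
 fixes G D :: wave
 assumes G[measurable]: "G \<in> borel_measurable borel" and G0: "\<And>y. norm y > b \<Longrightarrow> G y = 0"
  and GB: "\<And>y. norm (G y) \<le> B" and DB: "\<And>y. norm (D y) \<le> B"
  and der: "\<And>y. ((\<lambda>s. G (s *\<^sub>R y)) has_vector_derivative D y) (at 1)"
 shows "D \<in> borel_measurable borel" "(LINT y|lborel. D y) = - 3 * (LINT y|lborel. G y)"
  "\<And>y. norm y > b \<Longrightarrow> D y = 0"
proof -
 have B0: "B \<ge> 0" using GB[of 0] norm_ge_zero[of "G 0"] by linarith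
 define l where "l n = 1 + 1 / real (Suc n)" for n
 have l1: "l n > 1" for n by (simp add: l_def)
 define s where "s n y = real (Suc n) *\<^sub>R (G (l n *\<^sub>R y) - G y)" for n y
 have [measurable]: "(\<lambda>y. G (c *\<^sub>R y)) \<in> borel_measurable borel" for c
  by (rule measurable_compose[OF _ G]) measurable
 have sm: "s n \<in> borel_measurable borel" for n unfolding s_def by measurable
 have l0: "(\<lambda>n. 1 / real (Suc n)) \<longlonglongrightarrow> 0" by (rule LIMSEQ_Suc[OF lim_1_over_n])
 have fl: "filterlim (\<lambda>n. 1 / real (Suc n)) (at 0) sequentially"
  using l0 by (auto simp: filterlim_at)
 have lim: "(\<lambda>n. s n y) \<longlonglongrightarrow> D y" for y
  using filterlim_compose[OF has_vector_derivative_difference_quotient[OF der[of y]] fl]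
  by (simp add: s_def l_def)
 show Dm: "D \<in> borel_measurable borel" by (rule borel_measurable_LIMSEQ_metric[OF sm lim])
 show "D y = 0" if "norm y > b" for y
 proof -
  have "norm (l n *\<^sub>R y) > b" for n
  proof -
   have "1 * norm y \<le> l n * norm y" using l1[of n] by (intro mult_right_mono) auto
   thus ?thesis using that l1[of n] by simp
  qed
  hence "s n y = 0" for n using G0[OF that] G0[of "l n *\<^sub>R y"] by (simp add: s_def)
  thus ?thesis using lim[of y] by (simp add: LIMSEQ_const_iff)
 qed
 have der': "((\<lambda>s. G (s *\<^sub>R y)) has_vector_derivative (1 / t) *\<^sub>R D (t *\<^sub>R y)) (at t)" if "t > 0" for t y
 proof -
  have 1: "((\<lambda>s. s / t) has_vector_derivative (1 / t)) (at t)"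
   using that by (auto intro!: derivative_eq_intros simp flip: has_real_derivative_iff_has_vector_derivative)
  have 2: "((\<lambda>s. G (s *\<^sub>R (t *\<^sub>R y))) has_vector_derivative D (t *\<^sub>R y)) (at (t / t))"
   using der[of "t *\<^sub>R y"] that by simp
  have "((\<lambda>s. G (s *\<^sub>R (t *\<^sub>R y))) \<circ> (\<lambda>s. s / t) has_vector_derivative (1 / t) *\<^sub>R D (t *\<^sub>R y)) (at t)"
   by (rule vector_diff_chain_at[OF 1 2])
  thus ?thesis using that by (simp add: o_def)
 qed
 have bnd: "norm (s n y) \<le> indicator (cball 0 b) y * B" for n y
 proof (cases "norm y \<le> b")
  case True
  have "norm (G (l n *\<^sub>R y) - G (1 *\<^sub>R y)) \<le> B * \<bar>l n - 1\<bar>"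
  proof (rule norm_diff_le_vector_derivative[where S = "{1..}" and f = "\<lambda>s. G (s *\<^sub>R y)" and f' = "\<lambda>t. (1/t) *\<^sub>R D (t *\<^sub>R y)"])
   show "((\<lambda>s. G (s *\<^sub>R y)) has_vector_derivative (1/t) *\<^sub>R D (t *\<^sub>R y)) (at t within {1..})" if "t \<in> {1..}" for t
    using der'[of t y] that by (simp add: has_vector_derivative_at_within)
   show "norm ((1/t) *\<^sub>R D (t *\<^sub>R y)) \<le> B" if "t \<in> {1..}" for t
   proof -
    have "norm ((1/t) *\<^sub>R D (t *\<^sub>R y)) = (1/t) * norm (D (t *\<^sub>R y))" using that by simp
    also have "\<dots> \<le> 1 * B" using that DB[of "t *\<^sub>R y"] by (intro mult_mono) auto
    finally show ?thesis by simp
   qed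
  qed (use l1[of n] in auto)
  hence "norm (G (l n *\<^sub>R y) - G y) \<le> B * (1 / real (Suc n))" by (simp add: l_def)
  hence "real (Suc n) * norm (G (l n *\<^sub>R y) - G y) \<le> real (Suc n) * (B * (1 / real (Suc n)))"
   by (rule mult_left_mono) simp
  moreover have "norm (s n y) = real (Suc n) * norm (G (l n *\<^sub>R y) - G y)" unfolding s_def norm_scaleR by simp
  moreover have "real (Suc n) * (B * (1 / real (Suc n))) = B" by (simp del: of_nat_Suc)
  ultimately have "norm (s n y) \<le> B" by linarith
  thus ?thesis using True by simp
 next
  case False
  have "1 * norm y \<le> l n * norm y" using l1[of n] by (intro mult_right_mono) auto
  hence "norm (l n *\<^sub>R y) > b" using False l1[of n] by simp
  thus ?thesis using False G0[of y] G0[of "l n *\<^sub>R y"] by (simp add: s_def)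
 qed
 have "(\<lambda>n. LINT y|lborel. s n y) \<longlonglongrightarrow> (LINT y|lborel. D y)"
 proof (rule integral_dominated_convergence[where w = "\<lambda>y. indicator (cball 0 b) y * B"])
  show "integrable lborel (\<lambda>y. indicator (cball (0::real^3) b) y * B)"
   by (intro integrable_mult_left integrable_real_indicator emeasure_compact_finite) auto
 qed (use sm Dm lim bnd in auto)
 moreover have "(LINT y|lborel. s n y) = (real (Suc n) * (1 / l n ^ 3 - 1)) *\<^sub>R (LINT y|lborel. G y)" for n
 proof -
  have iG: "integrable lborel G" by (rule integrable_bounded_support(1)[OF G GB G0 B0])
  have iGl: "integrable lborel (\<lambda>y. G (l n *\<^sub>R y))"
  proof (rule integrable_bounded_support(1)[where b = b and B = B])
   show "G (l n *\<^sub>R y) = 0" if "norm y > b" for y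
   proof -
    have "1 * norm y \<le> l n * norm y" using l1[of n] by (intro mult_right_mono) auto
    thus ?thesis using that l1[of n] by (intro G0) simp
   qed
  qed (use GB B0 in auto)
  have "(LINT y|lborel. G y) = l n ^ 3 *\<^sub>R (LINT y|lborel. G (l n *\<^sub>R y))"
   using lborel_integral_dilate[OF G, of "l n"] l1[of n] by simp
  hence e: "(LINT y|lborel. G (l n *\<^sub>R y)) = (1 / l n ^ 3) *\<^sub>R (LINT y|lborel. G y)"
   using l1[of n] by simp
  have "(LINT y|lborel. s n y) = real (Suc n) *\<^sub>R ((LINT y|lborel. G (l n *\<^sub>R y)) - (LINT y|lborel. G y))"
   unfolding s_def using iG iGl by (simp del: of_nat_Suc)
  thus ?thesis unfolding e by (simp add: scaleR_diff_left right_diff_distrib scaleR_diff_right del: of_nat_Suc)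
 qed
 \<comment> \<open>\<open>- 3\<close> is the derivative at 1 of \<open>1 / l ^ 3\<close>, the factor
   by which dilation changes the integral.\<close>
 moreover have "(\<lambda>n. (real (Suc n) * (1 / l n ^ 3 - 1)) *\<^sub>R (LINT y|lborel. G y)) \<longlonglongrightarrow> (-3) *\<^sub>R (LINT y|lborel. G y)"
 proof (intro tendsto_scaleR tendsto_const)
  have "((\<lambda>x. 1 / x ^ 3) has_real_derivative -3) (at 1)"
   by (auto intro!: derivative_eq_intros)
  hence "((\<lambda>h. (1 / (1 + h) ^ 3 - 1 / 1 ^ 3) / h) \<longlongrightarrow> (-3::real)) (at 0)" unfolding DERIV_def .
  from filterlim_compose[OF this fl]
  show "(\<lambda>n. real (Suc n) * (1 / l n ^ 3 - 1)) \<longlonglongrightarrow> -3" by (simp add: l_def mult.commute)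
 qed
 ultimately have "(LINT y|lborel. D y) = (-3) *\<^sub>R (LINT y|lborel. G y)" using LIMSEQ_unique by simp
 thus "(LINT y|lborel. D y) = - 3 * (LINT y|lborel. G y)" by (simp add: scaleR_conv_of_real)
qed

section \<open>Oscillating integrals over growing shells\<close>

definition ball_const :: real where "ball_const = 8 * unit_ball_vol 3"

lemma measure_cball_double: "\<rho> \<ge> 0 \<Longrightarrow> measure lborel (cball (0::real^3) (2 * \<rho>)) = ball_const * \<rho> ^ 3"
 using content_cball[of "2 * \<rho>" "0::real^3"] by (simp add: ball_const_def power_mult_distrib)

lemma ball_const_pos: "ball_const > 0"
 by (simp add: ball_const_def)

definition outgoing :: "real \<Rightarrow> wave" where
 "outgoing k y = exp (\<i> * cof (k * norm y))"

lemma norm_outgoing [simp]: "norm (outgoing k y) = 1"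
 by (simp add: outgoing_def)

lemma borel_measurable_outgoing [measurable]: "outgoing k \<in> borel_measurable borel"
 unfolding outgoing_def by measurable

lemma outgoing_radial:
 "((\<lambda>s. outgoing k (s *\<^sub>R y)) has_vector_derivative \<i> * cof (k * norm y) * outgoing k y) (at 1)"
proof -
 have "((\<lambda>s. exp (\<i> * cof (k * norm y) * cof s)) has_vector_derivative
   \<i> * cof (k * norm y) * exp (\<i> * cof (k * norm y))) (at 1)"
 proof -
  have "((\<lambda>z. exp (\<i> * cof (k * norm y) * z)) has_field_derivative
   \<i> * cof (k * norm y) * exp (\<i> * cof (k * norm y))) (at (cof 1))"
   by (auto intro!: derivative_eq_intros)
  moreover have "(cof has_vector_derivative 1) (at 1)"
   using has_vector_derivative_of_real[OF DERIV_ident[of "at 1"]] by simp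
  ultimately have "((\<lambda>z. exp (\<i> * cof (k * norm y) * z)) \<circ> cof has_vector_derivative
   1 * (\<i> * cof (k * norm y) * exp (\<i> * cof (k * norm y)))) (at 1)"
   by (intro field_vector_diff_chain_at)
  thus ?thesis by (simp add: o_def)
 qed
 thus ?thesis unfolding outgoing_def
  by (rule has_vector_derivative_transform_within_open[where S = "{0<..}"]) (auto simp: mult_ac)
qed

lemma norm_radial:
 assumes "y \<noteq> 0"
 shows "((\<lambda>s. cof (1 / norm (s *\<^sub>R y))) has_vector_derivative cof (- (1 / norm y))) (at 1)"
proof -
 have "((\<lambda>s. 1 / (s * norm y)) has_real_derivative - (1 / norm y)) (at 1)"
  using assms by (auto intro!: derivative_eq_intros simp: field_simps)
 from has_vector_derivative_of_real[OF this, where 'a = complex] show ?thesis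
  by (rule has_vector_derivative_transform_within_open[where S = "{0<..}"]) auto
qed

text \<open>Up to the radiation error, the radial derivative at \<open>s = 1\<close> multiplies both
  \<open>V\<close> and \<open>outgoing k\<close> by \<open>i k r\<close>, so their product by
  \<open>2 i k r\<close>. Integrating by parts after dividing by \<open>r\<close> trades the
  amplitude \<open>N\<close> for \<open>N1\<close>, which is smaller by a factor of order
  \<open>1 / \<rho>\<close>. The \<open>2\<close> in \<open>N1\<close> is the dimension 3 minus the
  1 from differentiating \<open>1 / norm y\<close>.\<close>

lemma radial_oscillation_step:
 fixes V DV N DN :: wave
 assumes k: "k > 0" and R0: "R0 > 0" "\<rho> > R0"
  and V[measurable]: "V \<in> borel_measurable borel"
  and dV: "\<And>y. norm y > R0 \<Longrightarrow> ((\<lambda>s. V (s *\<^sub>R y)) has_vector_derivative DV y) (at 1)"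
  and N[measurable]: "N \<in> borel_measurable borel"
  and dN: "\<And>y. ((\<lambda>s. N (s *\<^sub>R y)) has_vector_derivative DN y) (at 1)"
  and N0: "\<And>y. norm y < \<rho> \<or> norm y > 2 * \<rho> \<Longrightarrow> N y = 0"
  and b: "b \<ge> 0" "\<And>y. norm (N y) \<le> b" "\<And>y. norm (DN y) \<le> b"
  and v: "v \<ge> 0" "\<And>y. \<rho> \<le> norm y \<Longrightarrow> norm y \<le> 2 * \<rho> \<Longrightarrow> norm (V y) \<le> v"
  and eta: "\<eta> \<ge> 0" "\<And>y. \<rho> \<le> norm y \<Longrightarrow> norm y \<le> 2 * \<rho> \<Longrightarrow> norm (DV y - \<i> * cof (k * norm y) * V y) \<le> \<eta>"
 defines "N1 \<equiv> \<lambda>y. (DN y + 2 * N y) * cof (1 / norm y)"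
 shows "DN \<in> borel_measurable borel" "\<And>y. norm y < \<rho> \<or> norm y > 2 * \<rho> \<Longrightarrow> DN y = 0"
  "norm (LINT y|lborel. V y * outgoing k y * N y) \<le>
   (1 / (2 * k)) * (\<eta> * b / \<rho> * (ball_const * \<rho> ^ 3) + norm (LINT y|lborel. V y * outgoing k y * N1 y))"
proof -
 have rho: "\<rho> > 0" using R0 by simp
 show DNm[measurable]: "DN \<in> borel_measurable borel"
  by (rule integral_radial_derivative(1)[where G = N and b = "2 * \<rho>" and B = b]) (use N0 b dN in auto)
 show DN0: "DN y = 0" if "norm y < \<rho> \<or> norm y > 2 * \<rho>" for y
 proof (cases "norm y < \<rho>")
  case True
  have op: "open ((\<lambda>s. s *\<^sub>R y) -` {z. norm z < \<rho>})"
   by (intro open_vimage open_Collect_less continuous_intros)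
  have "((\<lambda>s. 0) has_vector_derivative DN y) (at 1)"
   by (rule has_vector_derivative_transform_within_open[OF dN op]) (use True N0 in auto)
  thus ?thesis using vector_derivative_unique_at[OF _ has_vector_derivative_const] by blast
 next
  case False
  hence "norm y > 2 * \<rho>" using that by simp
  thus ?thesis
   by (intro integral_radial_derivative(3)[where G = N and D = DN and b = "2 * \<rho>" and B = b]) (use N0 b dN in auto)
 qed
 define i where "i y = cof (1 / norm y)" for y :: "real^3"
 have [measurable]: "i \<in> borel_measurable borel" unfolding i_def by measurable
 have ib: "norm (i y) \<le> 1 / \<rho>" if "\<rho> \<le> norm y" for y
  using that rho by (simp add: i_def norm_divide frac_le)
 define G where "G y = V y * outgoing k y * (N y * i y)" for y
 define D where "D y = DV y * outgoing k y * (N y * i y) + V y * (\<i> * cof (k * norm y) * outgoing k y) * (N y * i y)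
   + V y * outgoing k y * (DN y * i y - N y * i y)" for y
 have Gm: "G \<in> borel_measurable borel" unfolding G_def by measurable
 have z: "N y = 0" "DN y = 0" if "\<not> (\<rho> \<le> norm y \<and> norm y \<le> 2 * \<rho>)" for y
  using N0[of y] DN0[of y] that by auto
 have VN: "norm (V y * outgoing k y * (X y * i y)) \<le> v * (c / \<rho>)"
  if "\<And>y. \<not> (\<rho> \<le> norm y \<and> norm y \<le> 2 * \<rho>) \<Longrightarrow> X y = 0" "norm (X y) \<le> c" "c \<ge> 0" for X y c
 proof (cases "\<rho> \<le> norm y \<and> norm y \<le> 2 * \<rho>")
  case True
  have "norm (X y) * norm (i y) \<le> c * (1 / \<rho>)" using that ib[of y] True rho by (intro mult_mono) auto
  hence "norm (V y) * (norm (X y) * norm (i y)) \<le> v * (c * (1 / \<rho>))"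
   using v True by (intro mult_mono[of "norm (V y)" v]) auto
  thus ?thesis unfolding norm_mult norm_outgoing by simp
 next
  case False
  thus ?thesis using that(1)[OF False] v that(3) rho by simp
 qed
 define B1 where "B1 = v * (b / \<rho>)"
 define B2 where "B2 = (\<eta> + k * (2 * \<rho>) * v) * (b / \<rho>)"
 define B3 where "B3 = k * (2 * \<rho>) * v * (b / \<rho>)"
 define B4 where "B4 = v * (2 * b / \<rho>)"
 define Bd where "Bd = B1 + (B2 + B3 + B4)"
 have pos: "0 \<le> B1" "0 \<le> B2" "0 \<le> B3" "0 \<le> B4"
  unfolding B1_def B2_def B3_def B4_def using v(1) b(1) eta(1) k rho
  by (intro add_nonneg_nonneg mult_nonneg_nonneg divide_nonneg_nonneg; simp)+
 have GB: "norm (G y) \<le> Bd" for y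
 proof -
  have "norm (G y) \<le> B1" unfolding B1_def G_def by (rule VN) (use z b in auto)
  thus ?thesis using pos by (simp add: Bd_def)
 qed
 have DB: "norm (D y) \<le> Bd" for y
 proof (cases "\<rho> \<le> norm y \<and> norm y \<le> 2 * \<rho>")
  case True
  have kV: "norm (\<i> * cof (k * norm y) * V y) \<le> k * (2 * \<rho>) * v"
  proof -
   have "norm (\<i> * cof (k * norm y) * V y) = (k * norm y) * norm (V y)" using k by (simp add: norm_mult)
   also have "\<dots> \<le> (k * (2 * \<rho>)) * v" using True k v rho by (intro mult_mono mult_left_mono) auto
   finally show ?thesis .
  qed
  have dv: "norm (DV y) \<le> \<eta> + k * (2 * \<rho>) * v"
   using norm_triangle_ineq[of "DV y - \<i> * cof (k * norm y) * V y" "\<i> * cof (k * norm y) * V y"]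
    eta(2)[of y] True kV by simp
  have Ni: "norm (N y * i y) \<le> b / \<rho>" unfolding norm_mult using mult_mono[OF b(2)[of y] ib[of y]] True b by simp
  have DNi: "norm (DN y * i y - N y * i y) \<le> 2 * b / \<rho>"
  proof -
   have "norm (DN y * i y) \<le> b / \<rho>" unfolding norm_mult using mult_mono[OF b(3)[of y] ib[of y]] True b by simp
   thus ?thesis using norm_triangle_ineq4[of "DN y * i y" "N y * i y"] Ni by simp
  qed
  have 1: "norm (DV y * outgoing k y * (N y * i y)) \<le> B2"
   unfolding B2_def norm_mult[of "DV y * outgoing k y"] norm_mult[of "DV y"] norm_outgoing using dv Ni eta k v rho by (intro mult_mono) auto
  have 2: "norm (V y * (\<i> * cof (k * norm y) * outgoing k y) * (N y * i y)) \<le> B3"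
  proof -
   have "norm (V y * (\<i> * cof (k * norm y) * outgoing k y) * (N y * i y)) =
    norm (\<i> * cof (k * norm y) * V y) * norm (N y * i y)" by (simp add: norm_mult)
   also have "\<dots> \<le> B3" unfolding B3_def using kV Ni k v rho by (intro mult_mono) auto
   finally show ?thesis .
  qed
  have 3: "norm (V y * outgoing k y * (DN y * i y - N y * i y)) \<le> B4"
   unfolding B4_def norm_mult[of "V y * outgoing k y"] norm_mult[of "V y"] norm_outgoing mult_1_right
   using v True DNi by (intro mult_mono) auto
  have "norm (D y) \<le> B2 + B3 + B4"
   unfolding D_def by (intro norm_triangle_le add_mono 1 2 3)
  thus ?thesis unfolding Bd_def using pos by linarith
 next
  case False
  thus ?thesis using z[OF False] pos by (simp add: D_def Bd_def)
 qed
 have der: "((\<lambda>s. G (s *\<^sub>R y)) has_vector_derivative D y) (at 1)" for y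
 proof (cases "norm y > R0")
  case True
  hence y: "y \<noteq> 0" using R0 by auto
  have di: "((\<lambda>s. i (s *\<^sub>R y)) has_vector_derivative - i y) (at 1)"
   using norm_radial[OF y] unfolding i_def by simp
  have "((\<lambda>s. V (s *\<^sub>R y) * outgoing k (s *\<^sub>R y) * (N (s *\<^sub>R y) * i (s *\<^sub>R y))) has_vector_derivative
    (V (1 *\<^sub>R y) * outgoing k (1 *\<^sub>R y)) * (N (1 *\<^sub>R y) * (- i y) + DN y * i (1 *\<^sub>R y)) +
    (V (1 *\<^sub>R y) * (\<i> * cof (k * norm y) * outgoing k y) + DV y * outgoing k (1 *\<^sub>R y)) * (N (1 *\<^sub>R y) * i (1 *\<^sub>R y))) (at 1)"
   by (rule has_vector_derivative_mult[OF has_vector_derivative_mult[OF dV[OF True] outgoing_radial] has_vector_derivative_mult[OF dN di]])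
  thus ?thesis unfolding G_def D_def by (simp add: algebra_simps)
 next
  case False
  hence yr: "norm y < \<rho>" using R0 by simp
  have op: "open ((\<lambda>s. s *\<^sub>R y) -` {z. norm z < \<rho>})"
   by (intro open_vimage open_Collect_less continuous_intros)
  have D0: "D y = 0" using z[of y] yr by (simp add: D_def)
  show ?thesis unfolding D0
   by (rule has_vector_derivative_transform_within_open[OF has_vector_derivative_const op]) (use yr N0 in \<open>auto simp: G_def\<close>)
 qed
 have G0: "G y = 0" if "norm y > 2 * \<rho>" for y using N0[of y] that by (simp add: G_def)
 note R = integral_radial_derivative[OF Gm G0 GB DB der]
 define P where "P y = V y * outgoing k y * N y" for y
 define Q where "Q y = V y * outgoing k y * N1 y" for y
 define E where "E y = (DV y - \<i> * cof (k * norm y) * V y) * outgoing k y * (N y * i y)" for y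
 have Pm: "P \<in> borel_measurable borel" "Q \<in> borel_measurable borel" unfolding P_def Q_def N1_def by measurable
 have "norm (P y) \<le> v * b" for y
 proof (cases "\<rho> \<le> norm y \<and> norm y \<le> 2 * \<rho>")
  case True thus ?thesis unfolding P_def norm_mult norm_outgoing using v b by (simp add: mult_mono)
 next
  case False thus ?thesis using z[OF False] v b by (simp add: P_def)
 qed
 hence iP: "integrable lborel P"
  by (rule integrable_bounded_support(1)[OF Pm(1), where b = "2 * \<rho>"]) (use N0 v b in \<open>auto simp: P_def\<close>)
 have N1i: "N1 y = (DN y + 2 * N y) * i y" for y by (simp add: N1_def i_def)
 have "norm (Q y) \<le> v * (3 * b / \<rho>)" for y unfolding Q_def N1i
 proof (rule VN)
  show "norm (DN y + 2 * N y) \<le> 3 * b" using b(2,3)[of y] norm_triangle_ineq[of "DN y" "2 * N y"] by (simp add: norm_mult)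
 qed (use z b in auto)
 hence iQ: "integrable lborel Q"
  by (rule integrable_bounded_support(1)[OF Pm(2), where b = "2 * \<rho>"]) (use N0 DN0 v b rho in \<open>auto simp: Q_def N1_def\<close>)
 have iG: "integrable lborel G" by (rule integrable_bounded_support(1)[OF Gm GB G0]) (use order_trans[OF norm_ge_zero GB] in auto)
 have iD: "integrable lborel D" by (rule integrable_bounded_support(1)[OF R(1) DB R(3)]) (use order_trans[OF norm_ge_zero GB] in auto)
 \<comment> \<open>\<open>E\<close> is the radiation error, \<open>P\<close> the integrand to be
   estimated and \<open>Q\<close> the one with the new amplitude; after integration
   \<open>3 * G\<close> cancels \<open>D\<close>.\<close>
 have id: "E y = D y + 3 * G y - (2 * \<i> * cof k * P y + Q y)" for y
 proof (cases "y = 0")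
  case True
  hence "N y = 0" "DN y = 0" using z[of y] rho by auto
  thus ?thesis by (simp add: E_def D_def G_def P_def Q_def N1_def)
 next
  case False
  hence i1: "cof (norm y) * i y = 1" by (simp add: i_def)
  have "P y = V y * outgoing k y * N y * (cof (norm y) * i y)" unfolding i1 by (simp add: P_def)
  thus ?thesis unfolding E_def D_def G_def Q_def N1i by (simp add: algebra_simps)
 qed
 have iE: "integrable lborel E" unfolding id using iP iQ iG iD by (auto intro!: Bochner_Integration.integrable_diff)
 have R2: "(LINT y|lborel. D y) = - 3 * (LINT y|lborel. G y)"
  by (rule integral_radial_derivative(2)[OF Gm G0 GB DB der])
 have "(LINT y|lborel. E y) = (LINT y|lborel. D y) + 3 * (LINT y|lborel. G y) - (2 * \<i> * cof k * (LINT y|lborel. P y) + (LINT y|lborel. Q y))"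
  unfolding id using iP iQ iG iD by simp
 hence "(LINT y|lborel. E y) = - (2 * \<i> * cof k * (LINT y|lborel. P y) + (LINT y|lborel. Q y))"
  unfolding R2 by simp
 hence eq: "2 * \<i> * cof k * (LINT y|lborel. P y) = - (LINT y|lborel. E y) - (LINT y|lborel. Q y)"
  by simp
 have "norm (E y) \<le> \<eta> * (b / \<rho>)" for y
 proof (cases "\<rho> \<le> norm y \<and> norm y \<le> 2 * \<rho>")
  case True
  have Ni: "norm (N y * i y) \<le> b / \<rho>" unfolding norm_mult using mult_mono[OF b(2)[of y] ib[of y]] True b by simp
  show ?thesis unfolding E_def norm_mult[of "_ * outgoing k y"] norm_mult[of _ "outgoing k y"] norm_outgoing mult_1_right
   using eta(2)[of y] True Ni eta(1) by (intro mult_mono) auto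
 next
  case False
  thus ?thesis using z[OF False] eta b rho by (simp add: E_def)
 qed
 hence nE: "norm (LINT y|lborel. E y) \<le> \<eta> * (b / \<rho>) * (ball_const * \<rho> ^ 3)"
  using integrable_bounded_support(2)[of E "\<eta> * (b / \<rho>)" "2 * \<rho>"] iE N0 eta b rho measure_cball_double[of \<rho>]
  by (auto simp: E_def)
 have "2 * k * norm (LINT y|lborel. P y) = norm (2 * \<i> * cof k * (LINT y|lborel. P y))"
  using k by (simp add: norm_mult)
 also have "\<dots> \<le> norm (LINT y|lborel. E y) + norm (LINT y|lborel. Q y)"
  unfolding eq using norm_triangle_ineq4[of "- (LINT y|lborel. E y)" "LINT y|lborel. Q y"] by simp
 finally have "2 * k * norm (LINT y|lborel. P y) \<le> \<eta> * b / \<rho> * (ball_const * \<rho> ^ 3) + norm (LINT y|lborel. Q y)"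
  using nE by simp
 thus "norm (LINT y|lborel. V y * outgoing k y * N y) \<le>
   (1 / (2 * k)) * (\<eta> * b / \<rho> * (ball_const * \<rho> ^ 3) + norm (LINT y|lborel. V y * outgoing k y * N1 y))"
  using k unfolding P_def Q_def by (simp add: field_simps)
qed

text \<open>Along a ray, in the variable \<open>\<tau> = ln r\<close>, the product of
  \<open>V\<close> with the conjugate phase has a derivative of modulus at most 1 far out, by the
  radiation condition with \<open>\<eta> = 1\<close>. So it grows at most linearly in
  \<tau>.\<close>

lemma radiating_log_bound:
 fixes V DV :: wave
 assumes R0: "R0 > 0" and cV: "continuous_on {y. norm y > R0} V"
  and dV: "\<And>y. norm y > R0 \<Longrightarrow> ((\<lambda>s. V (s *\<^sub>R y)) has_vector_derivative DV y) (at 1)"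
  and som: "\<And>\<eta>. \<eta> > 0 \<Longrightarrow> \<exists>R. \<forall>y. norm y \<ge> R \<longrightarrow> norm y > R0 \<longrightarrow> norm (DV y - \<i> * cof (k * norm y) * V y) \<le> \<eta>"
 obtains C R where "C > 0" "R > R0" "R \<ge> 1" "\<And>y. norm y \<ge> R \<Longrightarrow> norm (V y) \<le> C + ln (norm y)"
proof -
 obtain R' where R': "\<forall>y. norm y \<ge> R' \<longrightarrow> norm y > R0 \<longrightarrow> norm (DV y - \<i> * cof (k * norm y) * V y) \<le> 1"
  using som[of 1] by auto
 define R where "R = max (max R' 1) (R0 + 1)"
 have R: "R > R0" "R \<ge> R'" "R \<ge> 1" by (auto simp: R_def)
 have "continuous_on (sphere 0 R) V" by (rule continuous_on_subset[OF cV]) (use R in auto)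
 hence "bounded (V ` sphere 0 R)" by (intro compact_imp_bounded compact_continuous_image) auto
 then obtain C where C: "C > 0" "\<forall>z\<in>V ` sphere 0 R. norm z \<le> C" unfolding bounded_pos by blast
 show ?thesis
 proof (rule that[OF C(1) R(1) R(3)])
  fix y :: "real^3" assume y: "norm y \<ge> R"
  have y0: "norm y > 0" using y R by linarith
  have lny: "ln R \<le> ln (norm y)" "0 \<le> ln R" using y R y0 by (auto simp: ln_le_cancel_iff)
  define w where "w = y /\<^sub>R norm y"
  have w: "norm w = 1" using y0 by (simp add: w_def)
  define f where "f \<tau> = V (exp \<tau> *\<^sub>R w) * outgoing (-k) (exp \<tau> *\<^sub>R w)" for \<tau>
  define f' where "f' \<tau> = (DV (exp \<tau> *\<^sub>R w) - \<i> * cof (k * norm (exp \<tau> *\<^sub>R w)) * V (exp \<tau> *\<^sub>R w)) * outgoing (-k) (exp \<tau> *\<^sub>R w)" for \<tau>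
  have fd: "(f has_vector_derivative f' \<tau>) (at \<tau>)" if "exp \<tau> \<ge> R" for \<tau>
  proof -
   let ?z = "exp \<tau> *\<^sub>R w"
   have nz: "norm ?z > R0" using that R w by simp
   have 1: "((\<lambda>s. V (s *\<^sub>R ?z) * outgoing (-k) (s *\<^sub>R ?z)) has_vector_derivative
    V (1 *\<^sub>R ?z) * (\<i> * cof (-k * norm ?z) * outgoing (-k) ?z) + DV ?z * outgoing (-k) (1 *\<^sub>R ?z)) (at (exp (\<tau> - \<tau>)))"
    using has_vector_derivative_mult[OF dV[OF nz] outgoing_radial[of "-k" ?z]] by simp
   have 2: "((\<lambda>t. exp (t - \<tau>)) has_vector_derivative 1) (at \<tau>)"
    by (auto intro!: derivative_eq_intros simp flip: has_real_derivative_iff_has_vector_derivative)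
   have "((\<lambda>s. V (s *\<^sub>R ?z) * outgoing (-k) (s *\<^sub>R ?z)) \<circ> (\<lambda>t. exp (t - \<tau>)) has_vector_derivative
    1 *\<^sub>R (V (1 *\<^sub>R ?z) * (\<i> * cof (-k * norm ?z) * outgoing (-k) ?z) + DV ?z * outgoing (-k) (1 *\<^sub>R ?z))) (at \<tau>)"
    by (rule vector_diff_chain_at[OF 2 1])
   moreover have "(\<lambda>s. V (s *\<^sub>R ?z) * outgoing (-k) (s *\<^sub>R ?z)) \<circ> (\<lambda>t. exp (t - \<tau>)) = f"
    by (auto simp: f_def fun_eq_iff exp_add[symmetric])
   moreover have "1 *\<^sub>R (V (1 *\<^sub>R ?z) * (\<i> * cof (-k * norm ?z) * outgoing (-k) ?z) + DV ?z * outgoing (-k) (1 *\<^sub>R ?z)) = f' \<tau>"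
    by (simp add: f'_def algebra_simps)
   ultimately show ?thesis by simp
  qed
  have "norm (f (ln (norm y)) - f (ln R)) \<le> 1 * \<bar>ln (norm y) - ln R\<bar>"
  proof (rule norm_diff_le_vector_derivative[where S = "{ln R..}" and f' = f'])
   have ge: "exp \<tau> \<ge> R" if "\<tau> \<in> {ln R..}" for \<tau> using that R exp_le_cancel_iff[of "ln R" \<tau>] by simp
   show "(f has_vector_derivative f' \<tau>) (at \<tau> within {ln R..})" if "\<tau> \<in> {ln R..}" for \<tau>
    using fd[OF ge[OF that]] by (rule has_vector_derivative_at_within)
   show "norm (f' \<tau>) \<le> 1" if "\<tau> \<in> {ln R..}" for \<tau>
    using R'[rule_format, of "exp \<tau> *\<^sub>R w"] ge[OF that] R w by (simp add: f'_def norm_mult)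
  qed (use lny in auto)
  moreover have "norm (f (ln (norm y))) = norm (V y)" using y0 by (simp add: f_def norm_mult w_def)
  moreover have "norm (f (ln R)) \<le> C"
  proof -
   have "V (R *\<^sub>R w) \<in> V ` sphere 0 R" using w R by (intro imageI) auto
   from bspec[OF C(2) this] show ?thesis using R by (simp add: f_def norm_mult)
  qed
  moreover have "\<bar>ln (norm y) - ln R\<bar> \<le> ln (norm y)" using lny by simp
  ultimately have "norm (f (ln R)) + norm (f (ln (norm y)) - f (ln R)) \<le> C + ln (norm y)" by (intro add_mono) auto
  thus "norm (V y) \<le> C + ln (norm y)"
   using norm_triangle_sub[of "f (ln (norm y))" "f (ln R)"] \<open>norm (f (ln (norm y))) = norm (V y)\<close> by simp
 qed
qed

text \<open>An amplitude of size \<open>b / \<rho>\<^sup>2\<close> on a shell of volume of order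
  \<open>\<rho> ^ 3\<close> leaves one power of \<rho> and the logarithm from
  \<open>radiating_log_bound\<close> to beat. Each integration by parts gains
  \<open>1 / \<rho>\<close>: one would leave the logarithm, two give
  \<open>ln \<rho> / \<rho>\<close>. The radiation error contributes multiples of \<eta>.\<close>

lemma radial_oscillation_limit:
 fixes V DV :: wave and N DN DDN :: "real \<Rightarrow> wave"
 assumes k: "k > 0" and R0: "R0 > 0"
  and V[measurable]: "V \<in> borel_measurable borel" and cV: "continuous_on {y. norm y > R0} V"
  and dV: "\<And>y. norm y > R0 \<Longrightarrow> ((\<lambda>s. V (s *\<^sub>R y)) has_vector_derivative DV y) (at 1)"
  and som: "\<And>\<eta>. \<eta> > 0 \<Longrightarrow> \<exists>R. \<forall>y. norm y \<ge> R \<longrightarrow> norm y > R0 \<longrightarrow> norm (DV y - \<i> * cof (k * norm y) * V y) \<le> \<eta>"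
  and N: "\<And>\<rho>. \<rho> \<ge> \<rho>0 \<Longrightarrow> N \<rho> \<in> borel_measurable borel"
  and dN: "\<And>\<rho> y. \<rho> \<ge> \<rho>0 \<Longrightarrow> ((\<lambda>s. N \<rho> (s *\<^sub>R y)) has_vector_derivative DN \<rho> y) (at 1)"
  and dDN: "\<And>\<rho> y. \<rho> \<ge> \<rho>0 \<Longrightarrow> ((\<lambda>s. DN \<rho> (s *\<^sub>R y)) has_vector_derivative DDN \<rho> y) (at 1)"
  and N0: "\<And>\<rho> y. \<rho> \<ge> \<rho>0 \<Longrightarrow> norm y < \<rho> \<or> norm y > 2 * \<rho> \<Longrightarrow> N \<rho> y = 0"
  and b: "b \<ge> 0" "\<And>\<rho> y. \<rho> \<ge> \<rho>0 \<Longrightarrow> norm (N \<rho> y) \<le> b / \<rho>\<^sup>2" "\<And>\<rho> y. \<rho> \<ge> \<rho>0 \<Longrightarrow> norm (DN \<rho> y) \<le> b / \<rho>\<^sup>2"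
   "\<And>\<rho> y. \<rho> \<ge> \<rho>0 \<Longrightarrow> norm (DDN \<rho> y) \<le> b / \<rho>\<^sup>2"
 shows "((\<lambda>\<rho>. LINT y|lborel. V y * outgoing k y * N \<rho> y) \<longlongrightarrow> 0) at_top"
proof -
 obtain C R where CR: "C > 0" "R > R0" "R \<ge> 1" "\<And>y. norm y \<ge> R \<Longrightarrow> norm (V y) \<le> C + ln (norm y)"
  using radiating_log_bound[OF R0 cV dV som] by metis
 define I where "I \<rho> = (LINT y|lborel. V y * outgoing k y * N \<rho> y)" for \<rho>
 define kk where "kk = 1 / (2 * k)"
 define Bc where "Bc = b * ball_const"
 have kB: "kk \<ge> 0" "Bc \<ge> 0" using k b(1) ball_const_pos by (simp_all add: kk_def Bc_def)
 define A where "A = kk * Bc + kk * kk * (6 * Bc) + kk * kk * (18 * Bc)"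
 have A0: "A \<ge> 0" unfolding A_def using kB by (intro add_nonneg_nonneg mult_nonneg_nonneg) auto
 have main: "norm (I \<rho>) \<le> A * (\<eta> + (C + ln (2 * \<rho>)) / \<rho>)"
  if rho: "\<rho> \<ge> \<rho>0" "\<rho> \<ge> R" and eta: "\<eta> > 0" "\<And>y. norm y \<ge> \<rho> \<Longrightarrow> norm (DV y - \<i> * cof (k * norm y) * V y) \<le> \<eta>" for \<rho> \<eta>
 proof -
  have r1: "\<rho> \<ge> 1" "\<rho> > R0" "\<rho> > 0" using rho CR by auto
  define v where "v = C + ln (2 * \<rho>)"
  have v: "v \<ge> 0" "\<And>y. \<rho> \<le> norm y \<Longrightarrow> norm y \<le> 2 * \<rho> \<Longrightarrow> norm (V y) \<le> v"
  proof -
   have "ln (2 * \<rho>) \<ge> 0" using r1 by simp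
   thus "v \<ge> 0" using CR(1) by (simp add: v_def)
   fix y :: "real^3" assume y: "\<rho> \<le> norm y" "norm y \<le> 2 * \<rho>"
   have "ln (norm y) \<le> ln (2 * \<rho>)" using y r1 by (subst ln_le_cancel_iff) auto
   thus "norm (V y) \<le> v" using CR(4)[of y] y rho by (simp add: v_def)
  qed
  define b2 where "b2 = b / \<rho>\<^sup>2"
  have b2: "b2 \<ge> 0" using b(1) by (simp add: b2_def)
  define i where "i y = cof (1 / norm y)" for y :: "real^3"
  define N1 where "N1 y = (DN \<rho> y + 2 * N \<rho> y) * i y" for y
  note S1 = radial_oscillation_step[OF k R0 r1(2) V dV N[OF rho(1)] dN[OF rho(1)] N0[OF rho(1)] b2
    b(2)[OF rho(1), folded b2_def] b(3)[OF rho(1), folded b2_def] v less_imp_le[OF eta(1)] eta(2), folded i_def, folded N1_def]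
  have DN0: "DN \<rho> y = 0" if "norm y < \<rho> \<or> norm y > 2 * \<rho>" for y by (rule S1(2)) (use that in auto)
  have DNm: "DN \<rho> \<in> borel_measurable borel" by (rule S1(1)) auto
  have I1: "norm (I \<rho>) \<le> (1 / (2 * k)) * (\<eta> * b2 / \<rho> * (ball_const * \<rho> ^ 3) + norm (LINT y|lborel. V y * outgoing k y * N1 y))"
   unfolding I_def by (rule S1(3)) auto
  define DN1 where "DN1 y = (DDN \<rho> y + 2 * DN \<rho> y) * i y - N1 y" for y
  have DDN0: "DDN \<rho> y = 0" if "norm y < \<rho> \<or> norm y > 2 * \<rho>" for y
  proof -
   have "open {y :: real^3. norm y < \<rho> \<or> norm y > 2 * \<rho>}"
    by (intro open_Collect_disj open_Collect_less continuous_intros)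
   hence op: "open ((\<lambda>s. s *\<^sub>R y) -` {y. norm y < \<rho> \<or> norm y > 2 * \<rho>})"
    by (rule open_vimage) (intro continuous_intros)
   have "((\<lambda>s. 0) has_vector_derivative DDN \<rho> y) (at 1)"
    by (rule has_vector_derivative_transform_within_open[OF dDN[OF rho(1)] op]) (use that DN0 in auto)
   thus ?thesis using vector_derivative_unique_at[OF _ has_vector_derivative_const] by blast
  qed
  \<comment> \<open>\<open>N1\<close> is bounded by \<open>3 * b2 / \<rho>\<close>, and
    \<open>DN1\<close> by that plus another \<open>3 * b2 / \<rho>\<close>, so one constant serves
    both.\<close>
  define b3 where "b3 = 6 * (b2 / \<rho>)"
  have b3: "b3 \<ge> 0" using b2 r1 by (simp add: b3_def)
  have ib: "norm (i y) \<le> 1 / \<rho>" if "\<rho> \<le> norm y" for y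
   using that r1 by (simp add: i_def norm_divide frac_le)
  have mb: "norm (X * i y) \<le> c * (1 / \<rho>)" if "\<rho> \<le> norm y" "norm X \<le> c" for X y c
   unfolding norm_mult using that ib[OF that(1)] order_trans[OF norm_ge_zero that(2)] by (intro mult_mono) auto
  have n1: "norm (N1 y) \<le> 3 * b2 * (1 / \<rho>)" for y
  proof (cases "norm y < \<rho>")
   case True thus ?thesis using DN0[of y] N0[OF rho(1), of y] b2 r1 by (simp add: N1_def)
  next
   case False
   have "norm (DN \<rho> y + 2 * N \<rho> y) \<le> 3 * b2"
    using b(2,3)[OF rho(1), of y, folded b2_def] norm_triangle_ineq[of "DN \<rho> y" "2 * N \<rho> y"] by (simp add: norm_mult)
   thus ?thesis unfolding N1_def using False by (intro mb) auto
  qed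
  have N1b: "norm (N1 y) \<le> b3" for y
  proof -
   have "3 * b2 * (1 / \<rho>) \<le> 6 * b2 * (1 / \<rho>)" using b2 r1 by (intro mult_right_mono) auto
   hence "3 * b2 * (1 / \<rho>) \<le> b3" by (simp add: b3_def)
   thus ?thesis using n1[of y] by linarith
  qed
  have DN1b: "norm (DN1 y) \<le> b3" for y
  proof (cases "norm y < \<rho>")
   case True thus ?thesis using DN0[of y] N0[OF rho(1), of y] DDN0[of y] b3 by (simp add: DN1_def N1_def)
  next
   case False
   have "norm (DDN \<rho> y + 2 * DN \<rho> y) \<le> 3 * b2"
    using b(4,3)[OF rho(1), of y, folded b2_def] norm_triangle_ineq[of "DDN \<rho> y" "2 * DN \<rho> y"] by (simp add: norm_mult)
   hence "norm ((DDN \<rho> y + 2 * DN \<rho> y) * i y) \<le> 3 * b2 * (1 / \<rho>)" using False by (intro mb) auto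
   thus ?thesis unfolding DN1_def b3_def
    using n1[of y] norm_triangle_ineq4[of "(DDN \<rho> y + 2 * DN \<rho> y) * i y" "N1 y"] by simp
  qed
  have N1m: "N1 \<in> borel_measurable borel"
   unfolding N1_def i_def using DNm N[OF rho(1)] by measurable
  have N10: "N1 y = 0" if "norm y < \<rho> \<or> norm y > 2 * \<rho>" for y
   using DN0[OF that] N0[OF rho(1) that] by (simp add: N1_def)
  have dN1: "((\<lambda>s. N1 (s *\<^sub>R y)) has_vector_derivative DN1 y) (at 1)" for y
  proof (cases "norm y < \<rho>")
   case True
   have op: "open ((\<lambda>s. s *\<^sub>R y) -` {z. norm z < \<rho>})"
    by (intro open_vimage open_Collect_less continuous_intros)
   have D0: "DN1 y = 0" using DN0[of y] N0[OF rho(1), of y] DDN0[of y] True by (simp add: DN1_def N1_def)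
   show ?thesis unfolding D0
    by (rule has_vector_derivative_transform_within_open[OF has_vector_derivative_const op]) (use True N10 in auto)
  next
   case False
   hence "y \<noteq> 0" using r1 by auto
   hence di: "((\<lambda>s. i (s *\<^sub>R y)) has_vector_derivative - i y) (at 1)"
    using norm_radial unfolding i_def by simp
   have "((\<lambda>s. (DN \<rho> (s *\<^sub>R y) + 2 * N \<rho> (s *\<^sub>R y)) * i (s *\<^sub>R y)) has_vector_derivative
    (DN \<rho> (1 *\<^sub>R y) + 2 * N \<rho> (1 *\<^sub>R y)) * (- i y) + (DDN \<rho> y + 2 * DN \<rho> y) * i (1 *\<^sub>R y)) (at 1)"
    by (intro has_vector_derivative_mult has_vector_derivative_add has_vector_derivative_mult_right dN dDN di rho)
   thus ?thesis unfolding N1_def DN1_def by (simp add: algebra_simps)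
  qed
  define N2 where "N2 y = (DN1 y + 2 * N1 y) * i y" for y
  note S2 = radial_oscillation_step[OF k R0 r1(2) V dV N1m dN1 N10 b3 N1b DN1b v less_imp_le[OF eta(1)] eta(2), folded i_def, folded N2_def]
  have I2: "norm (LINT y|lborel. V y * outgoing k y * N1 y) \<le> (1 / (2 * k)) * (\<eta> * b3 / \<rho> * (ball_const * \<rho> ^ 3) + norm (LINT y|lborel. V y * outgoing k y * N2 y))"
   by (rule S2(3)) auto
  have DN1m: "DN1 \<in> borel_measurable borel" by (rule S2(1)) auto
  have DN10: "DN1 y = 0" if "norm y < \<rho> \<or> norm y > 2 * \<rho>" for y by (rule S2(2)) (use that in auto)
  have I3: "norm (LINT y|lborel. V y * outgoing k y * N2 y) \<le> v * (3 * b3 * (1 / \<rho>)) * (ball_const * \<rho> ^ 3)"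
   unfolding measure_cball_double[OF less_imp_le[OF r1(3)], symmetric]
  proof (rule integrable_bounded_support(2))
   show "(\<lambda>y. V y * outgoing k y * N2 y) \<in> borel_measurable borel"
    unfolding N2_def i_def using DN1m N1m by measurable
   show "norm (V y * outgoing k y * N2 y) \<le> v * (3 * b3 * (1 / \<rho>))" for y
   proof (cases "\<rho> \<le> norm y \<and> norm y \<le> 2 * \<rho>")
    case True
    have "norm (DN1 y + 2 * N1 y) \<le> 3 * b3"
     using N1b[of y] DN1b[of y] norm_triangle_ineq[of "DN1 y" "2 * N1 y"] by (simp add: norm_mult)
    hence "norm (N2 y) \<le> 3 * b3 * (1 / \<rho>)" unfolding N2_def using True by (intro mb) auto
    thus ?thesis unfolding norm_mult norm_outgoing mult_1_right using v True by (intro mult_mono) auto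
   next
    case False
    hence "N2 y = 0" using DN10[of y] N10[of y] by (auto simp: N2_def)
    thus ?thesis using v b3 r1 by simp
   qed
   show "V y * outgoing k y * N2 y = 0" if "norm y > 2 * \<rho>" for y
    using DN10[of y] N10[of y] that by (simp add: N2_def)
   show "0 \<le> v * (3 * b3 * (1 / \<rho>))" using v b3 r1 by simp
  qed
  have e1: "\<eta> * b2 / \<rho> * (ball_const * \<rho> ^ 3) = Bc * \<eta>"
   using r1 by (simp add: Bc_def b2_def field_simps power2_eq_square power3_eq_cube)
  have e2: "\<eta> * b3 / \<rho> * (ball_const * \<rho> ^ 3) = 6 * Bc * (\<eta> / \<rho>)"
   using r1 by (simp add: Bc_def b2_def b3_def field_simps power2_eq_square power3_eq_cube)
  have e3: "v * (3 * b3 * (1 / \<rho>)) * (ball_const * \<rho> ^ 3) = 18 * Bc * (v / \<rho>)"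
   using r1 by (simp add: Bc_def b2_def b3_def field_simps power2_eq_square power3_eq_cube)
  define x2 where "x2 = v / \<rho>"
  have x2: "x2 \<ge> 0" using v r1 by (simp add: x2_def)
  have er: "\<eta> / \<rho> \<le> \<eta>" using eta r1 by (simp add: divide_le_eq mult_le_cancel_left1)
  have "norm (LINT y|lborel. V y * outgoing k y * N1 y) \<le> kk * (6 * Bc * (\<eta> / \<rho>) + 18 * Bc * x2)"
   using I2 I3 mult_left_mono[OF add_left_mono[OF I3], of kk "6 * Bc * (\<eta> / \<rho>)"] kB unfolding e2 e3 kk_def[symmetric] x2_def[symmetric]
   by linarith
  also have "\<dots> \<le> kk * (6 * Bc * \<eta> + 18 * Bc * x2)"
   using kB er by (intro mult_left_mono add_right_mono) auto
  finally have "kk * (Bc * \<eta> + norm (LINT y|lborel. V y * outgoing k y * N1 y)) \<le> kk * (Bc * \<eta> + kk * (6 * Bc * \<eta> + 18 * Bc * x2))"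
   using kB by (intro mult_left_mono add_left_mono) auto
  moreover have "kk * (Bc * \<eta> + kk * (6 * Bc * \<eta> + 18 * Bc * x2)) + (kk * Bc * x2 + kk * kk * (6 * Bc) * x2 + kk * kk * (18 * Bc) * \<eta>) = A * (\<eta> + x2)"
   by (simp add: A_def algebra_simps)
  moreover have "0 \<le> kk * Bc * x2 + kk * kk * (6 * Bc) * x2 + kk * kk * (18 * Bc) * \<eta>"
   using kB x2 eta by (intro add_nonneg_nonneg mult_nonneg_nonneg) auto
  ultimately show ?thesis using I1 unfolding e1 kk_def[symmetric] x2_def v_def by linarith
 qed
 have l0: "((\<lambda>\<rho>. (C + ln (2 * \<rho>)) / \<rho>) \<longlongrightarrow> 0) at_top"
 proof -
  have 1: "((\<lambda>\<rho>::real. (C + ln 2) / \<rho>) \<longlongrightarrow> 0) at_top"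
   by (rule real_tendsto_divide_at_top[OF tendsto_const filterlim_ident])
  have "((\<lambda>\<rho>::real. (C + ln 2) / \<rho> + ln \<rho> / \<rho>) \<longlongrightarrow> 0 + 0) at_top"
   by (intro tendsto_add 1 ln_x_over_x_tendsto_0)
  moreover have "eventually (\<lambda>\<rho>::real. (C + ln 2) / \<rho> + ln \<rho> / \<rho> = (C + ln (2 * \<rho>)) / \<rho>) at_top"
   using eventually_gt_at_top[of 0] by eventually_elim (simp add: ln_mult add_divide_distrib)
  ultimately show ?thesis by (simp add: tendsto_cong)
 qed
 have "(I \<longlongrightarrow> 0) at_top"
 proof (rule tendstoI)
  fix e :: real assume e: "e > 0"
  define A1 where "A1 = A + 1"
  have A1: "A1 > 0" using A0 by (simp add: A1_def)
  define \<eta> where "\<eta> = e / (2 * A1)"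
  have eta: "\<eta> > 0" using e A1 by (simp add: \<eta>_def)
  have Ae: "A * (\<eta> + \<eta>) < e"
  proof -
   have "A * (\<eta> + \<eta>) < A1 * (\<eta> + \<eta>)" using eta by (intro mult_strict_right_mono) (auto simp: A1_def)
   also have "\<dots> = e" using A1 by (simp add: \<eta>_def)
   finally show ?thesis .
  qed
  obtain R1 where R1: "\<And>y. norm y \<ge> R1 \<Longrightarrow> norm y > R0 \<Longrightarrow> norm (DV y - \<i> * cof (k * norm y) * V y) \<le> \<eta>"
   using som[OF eta] by blast
  show "eventually (\<lambda>\<rho>. dist (I \<rho>) 0 < e) at_top"
   using order_tendstoD(2)[OF l0 eta] eventually_ge_at_top[of "max (max \<rho>0 R) R1"]
  proof eventually_elim
   case (elim \<rho>)
   have "norm (I \<rho>) \<le> A * (\<eta> + (C + ln (2 * \<rho>)) / \<rho>)"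
    by (rule main) (use elim eta R1 CR(2) in auto)
   also have "\<dots> \<le> A * (\<eta> + \<eta>)" using elim A0 by (intro mult_left_mono) auto
   finally show ?case using Ae by simp
  qed
 qed
 thus ?thesis by (simp add: I_def[abs_def])
qed

lemma holomorphic_deriv_bounds:
 fixes f :: "complex \<Rightarrow> complex"
 assumes f: "f holomorphic_on ball 0 s0" and s0: "s0 > 0" and B: "\<And>z. z \<in> ball 0 s0 \<Longrightarrow> norm (f z) \<le> B"
  and s: "norm s < s0 / 2"
 shows "norm (deriv f s) \<le> 2 * B / s0" "norm (deriv (deriv f) s) \<le> 8 * B / s0\<^sup>2"
proof -
 have sub: "cball s (s0 / 2) \<subseteq> ball 0 s0"
 proof
  fix z assume "z \<in> cball s (s0 / 2)"
  hence "norm (z - s) \<le> s0 / 2" by (simp add: dist_norm norm_minus_commute)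
  thus "z \<in> ball 0 s0" using s norm_triangle_ineq[of "z - s" s] by simp
 qed
 have "norm ((deriv ^^ n) f s) \<le> fact n * B / (s0 / 2) ^ n" for n
 proof (rule Cauchy_inequality)
  show "f holomorphic_on ball s (s0 / 2)" by (rule holomorphic_on_subset[OF f]) (use sub in auto)
  show "continuous_on (cball s (s0 / 2)) f"
   by (rule continuous_on_subset[OF holomorphic_on_imp_continuous_on[OF f] sub])
  show "norm (f z) \<le> B" if "norm (s - z) = s0 / 2" for z
   by (rule B) (use sub that in \<open>auto simp: dist_norm subset_eq\<close>)
 qed (use s0 in simp)
 from this[of 1] this[of 2] show "norm (deriv f s) \<le> 2 * B / s0" "norm (deriv (deriv f) s) \<le> 8 * B / s0\<^sup>2"
  by (simp_all add: power_divide numeral_2_eq_2 field_simps)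
qed

lemma symbol_radial_derivative:
 fixes a a' :: "real \<Rightarrow> complex" and j j' :: "complex \<Rightarrow> complex"
 assumes a: "\<And>t. (a has_vector_derivative a' t) (at t)"
  and j: "(j has_field_derivative j' (cof (1 / r))) (at (cof (1 / r)))" and r: "r > 0" and \<rho>: "\<rho> > 0"
 shows "((\<lambda>s. a ((s * r)\<^sup>2 / \<rho>\<^sup>2) * j (cof (1 / (s * r)))) has_vector_derivative
  cof (2 * (r\<^sup>2 / \<rho>\<^sup>2)) * a' (r\<^sup>2 / \<rho>\<^sup>2) * j (cof (1 / r)) -
  a (r\<^sup>2 / \<rho>\<^sup>2) * (cof (1 / r) * j' (cof (1 / r)))) (at 1)"
proof -
 have 1: "((\<lambda>s. (s * r)\<^sup>2 / \<rho>\<^sup>2) has_vector_derivative 2 * (r\<^sup>2 / \<rho>\<^sup>2)) (at 1)"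
  using \<rho> by (auto intro!: derivative_eq_intros simp: power2_eq_square simp flip: has_real_derivative_iff_has_vector_derivative)
 have 2: "(a has_vector_derivative a' (r\<^sup>2 / \<rho>\<^sup>2)) (at ((1 * r)\<^sup>2 / \<rho>\<^sup>2))" using a by simp
 have A: "(a \<circ> (\<lambda>s. (s * r)\<^sup>2 / \<rho>\<^sup>2) has_vector_derivative (2 * (r\<^sup>2 / \<rho>\<^sup>2)) *\<^sub>R a' (r\<^sup>2 / \<rho>\<^sup>2)) (at 1)"
  by (rule vector_diff_chain_at[OF 1 2])
 have "((\<lambda>s. 1 / (s * r)) has_real_derivative - (1 / r)) (at 1)"
  using r by (auto intro!: derivative_eq_intros simp: field_simps)
 from has_vector_derivative_of_real[OF this, where 'a = complex]
 have 3: "((\<lambda>s. cof (1 / (s * r))) has_vector_derivative cof (- (1 / r))) (at 1)" .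
 have 4: "(j has_field_derivative j' (cof (1 / r))) (at (cof (1 / (1 * r))))" using j by simp
 have J: "(j \<circ> (\<lambda>s. cof (1 / (s * r))) has_vector_derivative cof (- (1 / r)) * j' (cof (1 / r))) (at 1)"
  by (rule field_vector_diff_chain_at[OF 3 4])
 from has_vector_derivative_mult[OF A J] show ?thesis
  by (simp add: o_def scaleR_conv_of_real algebra_simps)
qed

text \<open>On a profile in \<open>(r / \<rho>)\<^sup>2\<close> a radial derivative acts as
  \<open>2 t d/dt\<close>, on a holomorphic function of \<open>s = 1 / r\<close> as
  \<open>- s d/ds\<close>. Both operations preserve the form of the amplitude and its size
  \<open>1 / \<rho>\<^sup>2\<close>, so the two derivatives that
  \<open>radial_oscillation_limit\<close> needs are of the same order as the amplitude.\<close>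

lemma symbol_oscillation:
 fixes V DV :: wave and a a' a'' :: "real \<Rightarrow> complex" and J :: "complex \<Rightarrow> wave"
 assumes k: "k > 0" and R0: "R0 > 0"
  and V: "V \<in> borel_measurable borel" and cV: "continuous_on {y. norm y > R0} V"
  and dV: "\<And>y. norm y > R0 \<Longrightarrow> ((\<lambda>s. V (s *\<^sub>R y)) has_vector_derivative DV y) (at 1)"
  and som: "\<And>\<eta>. \<eta> > 0 \<Longrightarrow> \<exists>R. \<forall>y. norm y \<ge> R \<longrightarrow> norm y > R0 \<longrightarrow> norm (DV y - \<i> * cof (k * norm y) * V y) \<le> \<eta>"
  and a: "\<And>t. (a has_vector_derivative a' t) (at t)" "\<And>t. (a' has_vector_derivative a'' t) (at t)"
  and a0: "\<And>t. t \<le> 1 \<or> t \<ge> 2 \<Longrightarrow> a t = 0" "\<And>t. t \<le> 1 \<or> t \<ge> 2 \<Longrightarrow> a' t = 0" "\<And>t. t \<le> 1 \<or> t \<ge> 2 \<Longrightarrow> a'' t = 0"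
  and aA: "\<And>t. norm (a t) \<le> A" "\<And>t. norm (a' t) \<le> A" "\<And>t. norm (a'' t) \<le> A"
  and s0: "s0 > 0" and J: "\<And>w. norm w = 1 \<Longrightarrow> (\<lambda>s. J s w) holomorphic_on ball 0 s0"
  and JB: "\<And>w s. norm w = 1 \<Longrightarrow> s \<in> ball 0 s0 \<Longrightarrow> norm (J s w) \<le> B"
 defines "N \<equiv> \<lambda>\<rho> y. cof (1 / \<rho>\<^sup>2) * (a (y \<bullet> y / \<rho>\<^sup>2) * J (cof (1 / norm y)) (y /\<^sub>R norm y))"
 assumes Nm: "\<And>\<rho>. \<rho> > 2 / s0 \<Longrightarrow> N \<rho> \<in> borel_measurable borel"
 shows "((\<lambda>\<rho>. LINT y|lborel. V y * outgoing k y * N \<rho> y) \<longlongrightarrow> 0) at_top"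
proof -
 define Ta where "Ta t = cof (2 * t) * a' t" for t
 define Ta' where "Ta' t = cof (2 * t) * a'' t + 2 * a' t" for t
 have dTa: "(Ta has_vector_derivative Ta' t) (at t)" for t
 proof -
  have "((\<lambda>t. 2 * t) has_real_derivative 2) (at t)" by (auto intro!: derivative_eq_intros)
  from has_vector_derivative_mult[OF has_vector_derivative_of_real[OF this] a(2)[of t]]
  show ?thesis unfolding Ta_def Ta'_def by simp
 qed
 define J1 where "J1 w s = deriv (\<lambda>s. J s w) s" for w s
 define J2 where "J2 w s = deriv (J1 w) s" for w s
 define T1 where "T1 w s = s * J1 w s" for w s
 have A0: "A \<ge> 0" using order_trans[OF norm_ge_zero aA(1)[of 0]] .
 have B0: "B \<ge> 0" using JB[of "axis 1 1" 0] s0 norm_ge_zero order_trans by (metis centre_in_ball norm_axis_1)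
 have dJ: "((\<lambda>s. J s w) has_field_derivative J1 w s) (at s)" "(J1 w has_field_derivative J2 w s) (at s)"
  "(T1 w has_field_derivative J1 w s + s * J2 w s) (at s)" if "norm w = 1" "s \<in> ball 0 s0" for w s
 proof -
  show "((\<lambda>s. J s w) has_field_derivative J1 w s) (at s)"
   unfolding J1_def by (rule holomorphic_derivI[OF J[OF that(1)] open_ball that(2)])
  have "J1 w holomorphic_on ball 0 s0" unfolding J1_def by (rule holomorphic_deriv[OF J[OF that(1)] open_ball])
  thus d: "(J1 w has_field_derivative J2 w s) (at s)"
   unfolding J2_def by (rule holomorphic_derivI[OF _ open_ball that(2)])
  show "(T1 w has_field_derivative J1 w s + s * J2 w s) (at s)"
   unfolding T1_def by (rule DERIV_cong[OF DERIV_mult[OF DERIV_ident d]]) (simp add: mult.commute)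
 qed
 have bJ: "norm (J1 w s) \<le> 2 * B / s0" "norm (J2 w s) \<le> 8 * B / s0\<^sup>2" if "norm w = 1" "norm s < s0 / 2" for w s
 proof -
  note h = holomorphic_deriv_bounds[OF J[OF that(1)] s0 JB[OF that(1)] that(2)]
  show "norm (J1 w s) \<le> 2 * B / s0" using h(1) by (simp add: J1_def)
  show "norm (J2 w s) \<le> 8 * B / s0\<^sup>2" using h(2) unfolding J2_def J1_def[abs_def] by simp
 qed
 define S where "S y = cof (1 / norm y)" for y :: "real^3"
 define w where "w y = y /\<^sub>R norm y" for y :: "real^3"
 define DN where "DN \<rho> y = cof (1 / \<rho>\<^sup>2) * (Ta (y \<bullet> y / \<rho>\<^sup>2) * J (S y) (w y) - a (y \<bullet> y / \<rho>\<^sup>2) * T1 (w y) (S y))" for \<rho> y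
 define DDN where "DDN \<rho> y = cof (1 / \<rho>\<^sup>2) * ((cof (2 * (y \<bullet> y / \<rho>\<^sup>2)) * Ta' (y \<bullet> y / \<rho>\<^sup>2) * J (S y) (w y) - Ta (y \<bullet> y / \<rho>\<^sup>2) * T1 (w y) (S y))
   - (Ta (y \<bullet> y / \<rho>\<^sup>2) * T1 (w y) (S y) - a (y \<bullet> y / \<rho>\<^sup>2) * (S y * (J1 (w y) (S y) + S y * J2 (w y) (S y)))))" for \<rho> y
 define \<rho>0 where "\<rho>0 = 2 / s0 + 1"
 have \<rho>0: "\<rho> > 2 / s0" "\<rho> > 0" if "\<rho> \<ge> \<rho>0" for \<rho>
  using that s0 divide_pos_pos[of 2 s0] unfolding \<rho>0_def by linarith+
 have tz: "y \<bullet> y / \<rho>\<^sup>2 \<le> 1 \<or> y \<bullet> y / \<rho>\<^sup>2 \<ge> 2" if "norm y < \<rho> \<or> norm y > 2 * \<rho>" "\<rho> > 0" for \<rho> and y :: "real^3"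
 proof (cases "norm y < \<rho>")
  case True
  hence "(norm y)\<^sup>2 \<le> \<rho>\<^sup>2" by (intro power_mono) auto
  thus ?thesis using that by (simp add: power2_norm_eq_inner)
 next
  case False
  hence "(norm y)\<^sup>2 \<ge> (2 * \<rho>)\<^sup>2" using that by (intro power_mono) auto
  hence "y \<bullet> y \<ge> 4 * \<rho>\<^sup>2" by (simp add: power2_norm_eq_inner power_mult_distrib)
  hence "y \<bullet> y \<ge> 2 * \<rho>\<^sup>2" using zero_le_power2[of \<rho>] by linarith
  thus ?thesis using that by (simp add: pos_le_divide_eq)
 qed
 have z: "N \<rho> y = 0" "DN \<rho> y = 0" "DDN \<rho> y = 0" if "norm y < \<rho> \<or> norm y > 2 * \<rho>" "\<rho> > 0" for \<rho> y
  using a0[OF tz[OF that]] by (simp_all add: N_def DN_def DDN_def Ta_def Ta'_def)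
 have sb: "norm (S y) < s0 / 2" "norm (w y) = 1" "norm y > 0" if "norm y \<ge> \<rho>" "\<rho> \<ge> \<rho>0" for \<rho> y
 proof -
  have ny: "norm y > 2 / s0" "norm y > 0" using \<rho>0[OF that(2)] that(1) by linarith+
  have "2 < norm y * s0" using ny s0 by (simp add: pos_divide_less_eq)
  hence "1 < s0 / 2 * norm y" by (simp add: mult.commute)
  hence "1 / norm y < s0 / 2" using ny by (simp add: pos_divide_less_eq)
  thus "norm (S y) < s0 / 2" using ny by (simp add: S_def norm_divide)
  show "norm (w y) = 1" "norm y > 0" using ny by (simp_all add: w_def)
 qed
 have der: "((\<lambda>s. cof (1 / \<rho>\<^sup>2) * (b ((s *\<^sub>R y) \<bullet> (s *\<^sub>R y) / \<rho>\<^sup>2) * j (w (s *\<^sub>R y)) (S (s *\<^sub>R y)))) has_vector_derivative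
   cof (1 / \<rho>\<^sup>2) * (cof (2 * (y \<bullet> y / \<rho>\<^sup>2)) * b' (y \<bullet> y / \<rho>\<^sup>2) * j (w y) (S y) - b (y \<bullet> y / \<rho>\<^sup>2) * (S y * j' (w y) (S y)))) (at 1)"
  if "\<And>t. (b has_vector_derivative b' t) (at t)" "\<And>w s. norm w = 1 \<Longrightarrow> s \<in> ball 0 s0 \<Longrightarrow> (j w has_field_derivative j' w s) (at s)"
   "norm y \<ge> \<rho>" "\<rho> \<ge> \<rho>0" for b b' :: "real \<Rightarrow> complex" and j j' :: "real^3 \<Rightarrow> complex \<Rightarrow> complex" and y \<rho>
 proof -
  have s1: "S y \<in> ball 0 s0" using sb(1)[OF that(3,4)] s0 by simp
  have yy: "y \<bullet> y = (norm y)\<^sup>2" by (simp add: power2_norm_eq_inner)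
  have jd: "(j (w y) has_field_derivative j' (w y) (cof (1 / norm y))) (at (cof (1 / norm y)))"
   using that(2)[OF sb(2)[OF that(3,4)] s1] by (simp add: S_def)
  note d = has_vector_derivative_mult_right[OF symbol_radial_derivative[where \<rho> = \<rho> and j = "j (w y)" and j' = "j' (w y)", OF that(1) jd sb(3)[OF that(3,4)] \<rho>0(2)[OF that(4)]], of "cof (1 / \<rho>\<^sup>2)"]
  show ?thesis unfolding yy S_def
  proof (rule has_vector_derivative_transform_within_open[OF d, where S = "{0<..}"])
   fix s :: real assume "s \<in> {0<..}"
   hence s: "s > 0" by simp
   have "w (s *\<^sub>R y) = w y" using s by (simp add: w_def)
   moreover have "(s *\<^sub>R y) \<bullet> (s *\<^sub>R y) = (s * norm y)\<^sup>2" by (simp add: power2_norm_eq_inner[symmetric] power_mult_distrib)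
   moreover have "norm (s *\<^sub>R y) = s * norm y" using s by simp
   ultimately show "cof (1 / \<rho>\<^sup>2) * (b ((s * norm y)\<^sup>2 / \<rho>\<^sup>2) * j (w y) (cof (1 / (s * norm y)))) =
    cof (1 / \<rho>\<^sup>2) * (b ((s *\<^sub>R y) \<bullet> (s *\<^sub>R y) / \<rho>\<^sup>2) * j (w (s *\<^sub>R y)) (cof (1 / norm (s *\<^sub>R y))))"
    by (simp only:)
  qed auto
 qed
 have zero_der: "((\<lambda>s. X (s *\<^sub>R y)) has_vector_derivative 0) (at 1)"
  if "\<And>y. norm y < \<rho> \<Longrightarrow> X y = 0" "norm y < \<rho>" for X :: wave and \<rho> y
 proof -
  have op: "open ((\<lambda>s. s *\<^sub>R y) -` {z. norm z < \<rho>})"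
   by (intro open_vimage open_Collect_less continuous_intros)
  show ?thesis
   by (rule has_vector_derivative_transform_within_open[OF has_vector_derivative_const op]) (use that in auto)
 qed
 have Nw: "N \<rho> y = cof (1 / \<rho>\<^sup>2) * (a (y \<bullet> y / \<rho>\<^sup>2) * J (S y) (w y))" for \<rho> y
  by (simp add: N_def S_def w_def)
 show ?thesis
 \<comment> \<open>\<open>100\<close> is generous: the second derivative, the worst of the three
   amplitudes, is bounded by \<open>24 + 4 + 4 + 3 = 35\<close> times
   \<open>A * B / \<rho>\<^sup>2\<close>.\<close>
 proof (rule radial_oscillation_limit[OF k R0 V cV dV som, where ?\<rho>0.0 = \<rho>0 and DN = DN and DDN = DDN and b = "100 * (A * B)"])
  show "N \<rho> \<in> borel_measurable borel" if "\<rho> \<ge> \<rho>0" for \<rho> by (rule Nm) (use \<rho>0[OF that] in simp)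
  show "N \<rho> y = 0" if "\<rho> \<ge> \<rho>0" "norm y < \<rho> \<or> norm y > 2 * \<rho>" for \<rho> y
   using z[OF that(2) \<rho>0(2)[OF that(1)]] by simp
  show "((\<lambda>s. N \<rho> (s *\<^sub>R y)) has_vector_derivative DN \<rho> y) (at 1)" if "\<rho> \<ge> \<rho>0" for \<rho> y
  proof (cases "norm y < \<rho>")
   case True
   thus ?thesis using zero_der[of \<rho> "N \<rho>" y] z[of _ \<rho>] \<rho>0[OF that] by simp
  next
   case False
   have "((\<lambda>s. N \<rho> (s *\<^sub>R y)) has_vector_derivative cof (1 / \<rho>\<^sup>2) * (cof (2 * (y \<bullet> y / \<rho>\<^sup>2)) * a' (y \<bullet> y / \<rho>\<^sup>2) * J (S y) (w y) - a (y \<bullet> y / \<rho>\<^sup>2) * (S y * J1 (w y) (S y)))) (at 1)"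
    unfolding Nw by (rule der[where j = "\<lambda>w s. J s w"]) (use a(1) dJ(1) False that in auto)
   thus ?thesis unfolding DN_def Ta_def T1_def .
  qed
  show "((\<lambda>s. DN \<rho> (s *\<^sub>R y)) has_vector_derivative DDN \<rho> y) (at 1)" if "\<rho> \<ge> \<rho>0" for \<rho> y
  proof (cases "norm y < \<rho>")
   case True
   thus ?thesis using zero_der[of \<rho> "DN \<rho>" y] z[of _ \<rho>] \<rho>0[OF that] by simp
  next
   case False
   have e: "DN \<rho> y = cof (1 / \<rho>\<^sup>2) * (Ta (y \<bullet> y / \<rho>\<^sup>2) * J (S y) (w y)) - cof (1 / \<rho>\<^sup>2) * (a (y \<bullet> y / \<rho>\<^sup>2) * T1 (w y) (S y))" for y
    by (simp add: DN_def algebra_simps)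
   have d1: "((\<lambda>s. cof (1 / \<rho>\<^sup>2) * (Ta ((s *\<^sub>R y) \<bullet> (s *\<^sub>R y) / \<rho>\<^sup>2) * J (S (s *\<^sub>R y)) (w (s *\<^sub>R y)))) has_vector_derivative
    cof (1 / \<rho>\<^sup>2) * (cof (2 * (y \<bullet> y / \<rho>\<^sup>2)) * Ta' (y \<bullet> y / \<rho>\<^sup>2) * J (S y) (w y) - Ta (y \<bullet> y / \<rho>\<^sup>2) * (S y * J1 (w y) (S y)))) (at 1)"
    by (rule der[where j = "\<lambda>w s. J s w"]) (use dTa dJ(1) False that in auto)
   have d2: "((\<lambda>s. cof (1 / \<rho>\<^sup>2) * (a ((s *\<^sub>R y) \<bullet> (s *\<^sub>R y) / \<rho>\<^sup>2) * T1 (w (s *\<^sub>R y)) (S (s *\<^sub>R y)))) has_vector_derivative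
    cof (1 / \<rho>\<^sup>2) * (cof (2 * (y \<bullet> y / \<rho>\<^sup>2)) * a' (y \<bullet> y / \<rho>\<^sup>2) * T1 (w y) (S y) - a (y \<bullet> y / \<rho>\<^sup>2) * (S y * (J1 (w y) (S y) + S y * J2 (w y) (S y))))) (at 1)"
    by (rule der[where j' = "\<lambda>w s. J1 w s + s * J2 w s"]) (use a(1) dJ(3) False that in auto)
   show ?thesis unfolding e
    by (rule has_vector_derivative_eq_rhs[OF has_vector_derivative_diff[OF d1 d2]]) (simp add: DDN_def Ta_def T1_def algebra_simps)
  qed
  show "0 \<le> 100 * (A * B)" using A0 B0 by simp
  have bounds: "norm (N \<rho> y) \<le> 100 * (A * B) / \<rho>\<^sup>2 \<and> norm (DN \<rho> y) \<le> 100 * (A * B) / \<rho>\<^sup>2 \<and> norm (DDN \<rho> y) \<le> 100 * (A * B) / \<rho>\<^sup>2" if r: "\<rho> \<ge> \<rho>0" for \<rho> y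
  proof (cases "norm y < \<rho> \<or> norm y > 2 * \<rho> \<or> y \<bullet> y / \<rho>\<^sup>2 \<le> 1 \<or> y \<bullet> y / \<rho>\<^sup>2 \<ge> 2")
   case True
   hence t: "y \<bullet> y / \<rho>\<^sup>2 \<le> 1 \<or> y \<bullet> y / \<rho>\<^sup>2 \<ge> 2" using tz[OF _ \<rho>0(2)[OF r]] by blast
   have "N \<rho> y = 0" "DN \<rho> y = 0" "DDN \<rho> y = 0"
    using a0[OF t] by (simp_all add: N_def DN_def DDN_def Ta_def Ta'_def)
   thus ?thesis using A0 B0 by simp
  next
   case False
   define t where "t = y \<bullet> y / \<rho>\<^sup>2"
   have t: "0 \<le> t" "t \<le> 2" using False by (auto simp: t_def)
   have y: "norm y \<ge> \<rho>" using False by simp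
   note sby = sb[OF y r]
   have s1: "S y \<in> ball 0 s0" using sby(1) s0 by simp
   have j0: "norm (J (S y) (w y)) \<le> B" by (rule JB[OF sby(2) s1])
   have j1: "norm (T1 (w y) (S y)) \<le> B"
   proof -
    have "norm (T1 (w y) (S y)) \<le> s0 / 2 * (2 * B / s0)"
     unfolding T1_def norm_mult using bJ(1)[OF sby(2,1)] sby(1) s0 by (intro mult_mono) auto
    thus ?thesis using s0 by simp
   qed
   have j2: "norm (S y * (J1 (w y) (S y) + S y * J2 (w y) (S y))) \<le> 3 * B"
   proof -
    have "norm (S y * (S y * J2 (w y) (S y))) \<le> s0 / 2 * (s0 / 2 * (8 * B / s0\<^sup>2))"
     unfolding norm_mult using bJ(2)[OF sby(2,1)] sby(1) s0 by (intro mult_mono) auto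
    also have "\<dots> = 2 * B" using s0 by (simp add: field_simps power2_eq_square)
    finally have "norm (S y * (S y * J2 (w y) (S y))) \<le> 2 * B" .
    thus ?thesis using j1 norm_triangle_ineq[of "S y * J1 (w y) (S y)" "S y * (S y * J2 (w y) (S y))"]
     by (simp add: T1_def algebra_simps)
   qed
   have a0': "norm (a t) \<le> A" by (rule aA)
   have a1: "norm (Ta t) \<le> 4 * A"
   proof -
    have "norm (Ta t) \<le> 4 * A" unfolding Ta_def norm_mult using aA(2)[of t] t A0 by (intro mult_mono) auto
    thus ?thesis .
   qed
   have a2: "norm (cof (2 * t) * Ta' t) \<le> 24 * A"
   proof -
    have "norm (cof (2 * t) * a'' t) \<le> 4 * A" unfolding norm_mult using aA(3)[of t] t A0 by (intro mult_mono) auto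
    hence "norm (Ta' t) \<le> 6 * A"
     unfolding Ta'_def using norm_triangle_ineq[of "cof (2 * t) * a'' t" "2 * a' t"] aA(2)[of t] by (simp add: norm_mult)
    hence "norm (cof (2 * t) * Ta' t) \<le> 4 * (6 * A)" unfolding norm_mult using t A0 by (intro mult_mono) auto
    thus ?thesis by simp
   qed
   have pm: "norm (x * z) \<le> p * q" if "norm x \<le> p" "norm z \<le> q" for x z :: complex and p q
    unfolding norm_mult using that order_trans[OF norm_ge_zero that(1)] by (intro mult_mono) auto
   have m: "norm (a t * J (S y) (w y)) \<le> A * B" "norm (Ta t * J (S y) (w y)) \<le> 4 * A * B" "norm (a t * T1 (w y) (S y)) \<le> A * B"
    "norm (cof (2 * t) * Ta' t * J (S y) (w y)) \<le> 24 * A * B" "norm (Ta t * T1 (w y) (S y)) \<le> 4 * A * B"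
    "norm (a t * (S y * (J1 (w y) (S y) + S y * J2 (w y) (S y)))) \<le> A * (3 * B)"
    by (intro pm a0' a1 a2 j0 j1 j2)+
   have AB: "0 \<le> A * B" using A0 B0 by simp
   have fin: "norm (cof (1 / \<rho>\<^sup>2) * X) \<le> 100 * (A * B) / \<rho>\<^sup>2" if "norm X \<le> 100 * (A * B)" for X
   proof -
    have "norm (cof (1 / \<rho>\<^sup>2) * X) = norm X / \<rho>\<^sup>2" by (simp add: norm_mult norm_divide norm_power)
    thus ?thesis using that by (simp add: divide_right_mono)
   qed
   show ?thesis unfolding Nw DN_def DDN_def t_def[symmetric]
   proof (intro conjI fin)
    show "norm (a t * J (S y) (w y)) \<le> 100 * (A * B)" using m(1) AB by linarith
    show "norm (Ta t * J (S y) (w y) - a t * T1 (w y) (S y)) \<le> 100 * (A * B)"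
     using m(2,3) AB norm_triangle_ineq4[of "Ta t * J (S y) (w y)" "a t * T1 (w y) (S y)"] by linarith
    show "norm (cof (2 * t) * Ta' t * J (S y) (w y) - Ta t * T1 (w y) (S y) - (Ta t * T1 (w y) (S y) - a t * (S y * (J1 (w y) (S y) + S y * J2 (w y) (S y))))) \<le> 100 * (A * B)"
     using m(4,5,6) AB norm_triangle_ineq4[of "cof (2 * t) * Ta' t * J (S y) (w y) - Ta t * T1 (w y) (S y)" "Ta t * T1 (w y) (S y) - a t * (S y * (J1 (w y) (S y) + S y * J2 (w y) (S y)))"]
      norm_triangle_ineq4[of "cof (2 * t) * Ta' t * J (S y) (w y)" "Ta t * T1 (w y) (S y)"]
      norm_triangle_ineq4[of "Ta t * T1 (w y) (S y)" "a t * (S y * (J1 (w y) (S y) + S y * J2 (w y) (S y)))"] by linarith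
   qed
  qed
  show "norm (N \<rho> y) \<le> 100 * (A * B) / \<rho>\<^sup>2" if "\<rho> \<ge> \<rho>0" for \<rho> y using bounds[OF that] by blast
  show "norm (DN \<rho> y) \<le> 100 * (A * B) / \<rho>\<^sup>2" if "\<rho> \<ge> \<rho>0" for \<rho> y using bounds[OF that] by blast
  show "norm (DDN \<rho> y) \<le> 100 * (A * B) / \<rho>\<^sup>2" if "\<rho> \<ge> \<rho>0" for \<rho> y using bounds[OF that] by blast
 qed
qed

text \<open>Hiding the derivative under an existential lets the closure rules below build
  complicated kernels without their derivatives ever being written down, while joint continuity
  keeps differentiation under the integral available.\<close>

definition hol_cont :: "complex set \<Rightarrow> 'b::topological_space set \<Rightarrow> (complex \<Rightarrow> 'b \<Rightarrow> complex) \<Rightarrow> bool" where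
 "hol_cont U T f \<longleftrightarrow> (\<exists>f'. (\<forall>z\<in>U. \<forall>y\<in>T. ((\<lambda>z. f z y) has_field_derivative f' z y) (at z)) \<and>
   continuous_on (U \<times> T) (\<lambda>p. f (fst p) (snd p)) \<and> continuous_on (U \<times> T) (\<lambda>p. f' (fst p) (snd p)))"

lemma hol_cont_continuous: "hol_cont U T f \<Longrightarrow> continuous_on (U \<times> T) (\<lambda>p. f (fst p) (snd p))"
 by (auto simp: hol_cont_def)

lemma hol_cont_param: "continuous_on T g \<Longrightarrow> hol_cont U T (\<lambda>z y. g y)"
 unfolding hol_cont_def
 by (intro exI[of _ "\<lambda>z y. 0"] conjI) (auto intro!: continuous_intros continuous_on_compose2[of T g])

lemma hol_cont_ident: "hol_cont U T (\<lambda>z y. z)"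
 unfolding hol_cont_def by (intro exI[of _ "\<lambda>z y. 1"] conjI) (auto intro!: continuous_intros)

lemma hol_cont_add:
 assumes "hol_cont U T f" "hol_cont U T g" shows "hol_cont U T (\<lambda>z y. f z y + g z y)"
proof -
 obtain f' where f: "\<forall>z\<in>U. \<forall>y\<in>T. ((\<lambda>z. f z y) has_field_derivative f' z y) (at z)"
   "continuous_on (U \<times> T) (\<lambda>p. f (fst p) (snd p))" "continuous_on (U \<times> T) (\<lambda>p. f' (fst p) (snd p))"
  using assms(1) by (auto simp: hol_cont_def)
 obtain g' where g: "\<forall>z\<in>U. \<forall>y\<in>T. ((\<lambda>z. g z y) has_field_derivative g' z y) (at z)"
   "continuous_on (U \<times> T) (\<lambda>p. g (fst p) (snd p))" "continuous_on (U \<times> T) (\<lambda>p. g' (fst p) (snd p))"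
  using assms(2) by (auto simp: hol_cont_def)
 show ?thesis unfolding hol_cont_def
  by (intro exI[of _ "\<lambda>z y. f' z y + g' z y"] conjI ballI DERIV_add continuous_intros f g) (use f g in auto)
qed

lemma hol_cont_mult:
 assumes "hol_cont U T f" "hol_cont U T g" shows "hol_cont U T (\<lambda>z y. f z y * g z y)"
proof -
 obtain f' where f: "\<forall>z\<in>U. \<forall>y\<in>T. ((\<lambda>z. f z y) has_field_derivative f' z y) (at z)"
   "continuous_on (U \<times> T) (\<lambda>p. f (fst p) (snd p))" "continuous_on (U \<times> T) (\<lambda>p. f' (fst p) (snd p))"
  using assms(1) by (auto simp: hol_cont_def)
 obtain g' where g: "\<forall>z\<in>U. \<forall>y\<in>T. ((\<lambda>z. g z y) has_field_derivative g' z y) (at z)"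
   "continuous_on (U \<times> T) (\<lambda>p. g (fst p) (snd p))" "continuous_on (U \<times> T) (\<lambda>p. g' (fst p) (snd p))"
  using assms(2) by (auto simp: hol_cont_def)
 show ?thesis unfolding hol_cont_def
  by (intro exI[of _ "\<lambda>z y. f' z y * g z y + g' z y * f z y"] conjI ballI DERIV_mult continuous_intros f g) (use f g in auto)
qed

lemma hol_cont_chain:
 assumes f: "hol_cont U T f" and F: "\<And>w. w \<in> W \<Longrightarrow> (F has_field_derivative F' w) (at w)" "continuous_on W F'"
  and W: "\<And>z y. z \<in> U \<Longrightarrow> y \<in> T \<Longrightarrow> f z y \<in> W"
 shows "hol_cont U T (\<lambda>z y. F (f z y))"
proof -
 obtain f' where f: "\<forall>z\<in>U. \<forall>y\<in>T. ((\<lambda>z. f z y) has_field_derivative f' z y) (at z)"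
   "continuous_on (U \<times> T) (\<lambda>p. f (fst p) (snd p))" "continuous_on (U \<times> T) (\<lambda>p. f' (fst p) (snd p))"
  using f by (auto simp: hol_cont_def)
 have cF: "continuous_on W F" using F(1) by (meson DERIV_continuous continuous_at_imp_continuous_on)
 show ?thesis unfolding hol_cont_def
 proof (intro exI[of _ "\<lambda>z y. F' (f z y) * f' z y"] conjI ballI)
  show "((\<lambda>z. F (f z y)) has_field_derivative F' (f z y) * f' z y) (at z)" if "z \<in> U" "y \<in> T" for z y
   by (rule DERIV_chain2[where f = F]) (use F(1)[OF W[OF that]] f(1) that in auto)
  show "continuous_on (U \<times> T) (\<lambda>p. F (f (fst p) (snd p)))"
   by (rule continuous_on_compose2[OF cF f(2)]) (use W in auto)
  show "continuous_on (U \<times> T) (\<lambda>p. F' (f (fst p) (snd p)) * f' (fst p) (snd p))"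
   by (intro continuous_intros f(3) continuous_on_compose2[OF F(2) f(2)]) (use W in auto)
 qed
qed

lemma hol_cont_exp: "hol_cont U T f \<Longrightarrow> hol_cont U T (\<lambda>z y. exp (f z y))"
 by (rule hol_cont_chain[where W = UNIV and F' = exp]) (auto intro!: continuous_intros DERIV_exp)

lemma hol_cont_inverse:
 assumes "hol_cont U T f" "\<And>z y. z \<in> U \<Longrightarrow> y \<in> T \<Longrightarrow> f z y \<noteq> 0"
 shows "hol_cont U T (\<lambda>z y. inverse (f z y))"
proof (rule hol_cont_chain[OF assms(1), where W = "-{0}" and F = inverse and F' = "\<lambda>x. - (inverse x ^ Suc (Suc 0))"])
 show "(inverse has_field_derivative - (inverse w ^ Suc (Suc 0))) (at w)" if "w \<in> -{0}" for w :: complex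
  using that by (intro DERIV_inverse) auto
qed (use assms(2) in \<open>auto intro!: continuous_intros\<close>)

lemma hol_cont_csqrt:
 assumes "hol_cont U T f" "\<And>z y. z \<in> U \<Longrightarrow> y \<in> T \<Longrightarrow> f z y \<notin> \<real>\<^sub>\<le>\<^sub>0"
 shows "hol_cont U T (\<lambda>z y. csqrt (f z y))"
proof (rule hol_cont_chain[OF assms(1), where W = "-\<real>\<^sub>\<le>\<^sub>0" and F' = "\<lambda>x. inverse (2 * csqrt x)"])
 show "(csqrt has_field_derivative inverse (2 * csqrt w)) (at w)" if "w \<in> -\<real>\<^sub>\<le>\<^sub>0" for w
  using has_field_derivative_csqrt[of w] that by (simp add: inverse_eq_divide)
 show "continuous_on (-\<real>\<^sub>\<le>\<^sub>0) (\<lambda>x. inverse (2 * csqrt x))"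
  by (intro continuous_intros continuous_on_csqrt) auto
qed (use assms(2) in auto)

lemma hol_cont_holomorphic:
 assumes "hol_cont U T f" "y \<in> T" "open U" shows "(\<lambda>z. f z y) holomorphic_on U"
 using assms unfolding hol_cont_def holomorphic_on_open[OF assms(3)] by blast

lemma hol_cont_subset: "hol_cont U T f \<Longrightarrow> U' \<subseteq> U \<Longrightarrow> T' \<subseteq> T \<Longrightarrow> hol_cont U' T' f"
 unfolding hol_cont_def by (meson Sigma_mono continuous_on_subset subsetD)

lemma hol_cont_compose_param:
 assumes "hol_cont U T f" "continuous_on T' g" "g ` T' \<subseteq> T"
 shows "hol_cont U T' (\<lambda>z y. f z (g y))"
proof -
 obtain f' where f: "\<forall>z\<in>U. \<forall>y\<in>T. ((\<lambda>z. f z y) has_field_derivative f' z y) (at z)"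
   "continuous_on (U \<times> T) (\<lambda>p. f (fst p) (snd p))" "continuous_on (U \<times> T) (\<lambda>p. f' (fst p) (snd p))"
  using assms(1) by (auto simp: hol_cont_def)
 have c: "continuous_on (U \<times> T') (\<lambda>p. (fst p, g (snd p)))"
  by (intro continuous_intros continuous_on_compose2[OF assms(2)]) auto
 show ?thesis unfolding hol_cont_def
 proof (intro exI[of _ "\<lambda>z y. f' z (g y)"] conjI ballI)
  show "continuous_on (U \<times> T') (\<lambda>p. f (fst p) (g (snd p)))"
   using continuous_on_compose2[OF f(2) c] assms(3) by fastforce
  show "continuous_on (U \<times> T') (\<lambda>p. f' (fst p) (g (snd p)))"
   using continuous_on_compose2[OF f(3) c] assms(3) by fastforce
 qed (use f(1) assms(3) in auto)
qed

text \<open>With \<open>s = 1/r\<close> and \<open>|w| = 1\<close>, \<open>|r w - z| = r * far_root s (w, z)\<close>, and the fundamental solution factors as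
 \<open>exp (i k r) / r\<close> times \<open>far_amp\<close>, which is holomorphic in \<open>s\<close> near \<open>0\<close>.\<close>
definition far_root :: "complex \<Rightarrow> (real^3) \<times> (real^3) \<Rightarrow> complex" where
 "far_root s p = csqrt (1 + (- 2) * s * cof (fst p \<bullet> snd p) + s * s * cof (snd p \<bullet> snd p))"

text \<open>The phase \<open>|r w - z| - r\<close> equals \<open>r (q - 1)\<close> with
  \<open>q = far_root s (w, z)\<close>. Rewriting \<open>q - 1\<close> as
  \<open>(q\<^sup>2 - 1) / (1 + q)\<close> exposes a factor \<open>s = 1 / r\<close>, which cancels
  \<open>r\<close> and leaves an expression that is regular at \<open>s = 0\<close>.\<close>

definition far_amp :: "real \<Rightarrow> complex \<Rightarrow> (real^3) \<times> (real^3) \<Rightarrow> complex" where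
 "far_amp k s p = exp (\<i> * cof k * (cof (- 2 * (fst p \<bullet> snd p)) + s * cof (snd p \<bullet> snd p)) * inverse (1 + far_root s p)) * inverse (far_root s p)"

text \<open>The same factorisation for \<open>fsol k 1\<close>, with the prefactor
  \<open>exp (i k r) / (2 r\<^sup>2)\<close>.\<close>

definition far_amp1 :: "real \<Rightarrow> complex \<Rightarrow> (real^3) \<times> (real^3) \<Rightarrow> complex" where
 "far_amp1 k s p = far_amp k s p * (\<i> * cof k * far_root s p + (- 1) * s) * (inverse (far_root s p) * inverse (far_root s p))"

definition far_dom :: "real \<Rightarrow> ((real^3) \<times> (real^3)) set" where
 "far_dom b = {p. norm (fst p) \<le> 1 \<and> norm (snd p) \<le> b}"

text \<open>The first hypothesis gives \<open>norm s * norm (snd p) \<le> 1/4\<close>, so the two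
  terms next to 1 have modulus at most \<open>1/2\<close> and \<open>1/16\<close>.\<close>

lemma far_arg_pos:
 assumes "4 * s0 * b \<le> 1" "s \<in> ball 0 s0" "p \<in> far_dom b"
 shows "Re (1 + (- 2) * s * cof (fst p \<bullet> snd p) + s * s * cof (snd p \<bullet> snd p)) > 0"
proof -
 have s: "norm s < s0" using assms by simp
 have b: "norm (snd p) \<le> b" "norm (fst p) \<le> 1" using assms(3) unfolding far_dom_def by auto
 have "norm s * norm (snd p) \<le> s0 * b" using s b order_trans[OF norm_ge_zero[of s] less_imp_le[OF s]] by (intro mult_mono) auto
 hence sb: "norm s * norm (snd p) \<le> 1/4" using assms(1) by simp
 have "\<bar>fst p \<bullet> snd p\<bar> \<le> norm (fst p) * norm (snd p)" by (rule Cauchy_Schwarz_ineq2)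
 also have "\<dots> \<le> 1 * norm (snd p)" using b by (intro mult_right_mono) auto
 finally have cs: "\<bar>fst p \<bullet> snd p\<bar> \<le> norm (snd p)" by simp
 have "norm ((- 2) * s * cof (fst p \<bullet> snd p)) \<le> 2 * (norm s * norm (snd p))"
  using mult_left_mono[OF cs, of "norm s"] by (simp add: norm_mult)
 hence 1: "norm ((- 2) * s * cof (fst p \<bullet> snd p)) \<le> 1/2" using sb by simp
 have "norm (s * s * cof (snd p \<bullet> snd p)) = (norm s * norm (snd p)) * (norm s * norm (snd p))"
  by (simp add: norm_mult power2_norm_eq_inner[symmetric] power2_eq_square)
 also have "\<dots> \<le> 1/4 * (1/4)" using sb by (intro mult_mono) auto
 finally have 2: "norm (s * s * cof (snd p \<bullet> snd p)) \<le> 1/16" by simp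
 show ?thesis
  using 1 2 abs_Re_le_cmod[of "(- 2) * s * cof (fst p \<bullet> snd p)"] abs_Re_le_cmod[of "s * s * cof (snd p \<bullet> snd p)"]
  by (simp only: plus_complex.sel one_complex.sel)
qed

lemma Re_csqrt_nonneg: "Re (csqrt z) \<ge> 0"
 using csqrt_principal[of z] by auto

lemma far_root_hol_cont:
 assumes "4 * s0 * b \<le> 1"
 shows "hol_cont (ball 0 s0) (far_dom b) far_root" "hol_cont (ball 0 s0) (far_dom b) (far_amp k)"
  "hol_cont (ball 0 s0) (far_dom b) (far_amp1 k)"
proof -
 have pc: "hol_cont (ball 0 s0) (far_dom b) (\<lambda>s p. g p)" if "continuous_on UNIV g" for g
  by (rule hol_cont_param[OF continuous_on_subset[OF that subset_UNIV]])
 have c1: "continuous_on UNIV (\<lambda>p::(real^3)\<times>(real^3). cof (fst p \<bullet> snd p))"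
  "continuous_on UNIV (\<lambda>p::(real^3)\<times>(real^3). cof (snd p \<bullet> snd p))"
  "continuous_on UNIV (\<lambda>p::(real^3)\<times>(real^3). cof (- 2 * (fst p \<bullet> snd p)))"
  by (intro continuous_intros)+
 show q: "hol_cont (ball 0 s0) (far_dom b) far_root" unfolding far_root_def
  by (intro hol_cont_csqrt hol_cont_add hol_cont_mult pc c1 hol_cont_ident continuous_on_const)
    (use far_arg_pos[OF assms] Re_gt_0_notin_nonpos_Reals in blast)
 have q0: "far_root s p \<noteq> 0" "1 + far_root s p \<noteq> 0" if "s \<in> ball 0 s0" "p \<in> far_dom b" for s p
 proof -
  show "far_root s p \<noteq> 0" unfolding far_root_def
   by (rule csqrt_nonzero[OF Re_gt_0_notin_nonpos_Reals[OF far_arg_pos[OF assms that]]])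
  have "Re (1 + far_root s p) > 0" using Re_csqrt_nonneg unfolding far_root_def plus_complex.sel one_complex.sel by (smt (verit))
  thus "1 + far_root s p \<noteq> 0" by force
 qed
 show e: "hol_cont (ball 0 s0) (far_dom b) (far_amp k)" unfolding far_amp_def
  by (intro hol_cont_exp hol_cont_inverse hol_cont_add hol_cont_mult pc c1 hol_cont_ident continuous_on_const q) (use q0 in auto)
 show "hol_cont (ball 0 s0) (far_dom b) (far_amp1 k)" unfolding far_amp1_def
  by (intro hol_cont_inverse hol_cont_add hol_cont_mult pc hol_cont_ident continuous_on_const q e) (use q0 in auto)
qed

lemma fsol_far:
 assumes "4 * s0 * b \<le> 1" "norm w = 1" "r > 0" "norm z \<le> b" "1 / r < s0"
 shows "fsol k 0 (cof ((r *\<^sub>R w - z) \<bullet> (r *\<^sub>R w - z))) =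
   exp (\<i> * cof (k * r)) / cof r * far_amp k (cof (1 / r)) (w, z)"
  "fsol k 1 (cof ((r *\<^sub>R w - z) \<bullet> (r *\<^sub>R w - z))) =
   exp (\<i> * cof (k * r)) / (2 * (cof r)\<^sup>2) * far_amp1 k (cof (1 / r)) (w, z)"
proof -
 define s where "s = cof (1 / r)"
 define Q where "Q = 1 - 2 * (1 / r) * (w \<bullet> z) + (1 / r) * (1 / r) * (z \<bullet> z)"
 have sb: "s \<in> ball 0 s0" using assms by (simp add: s_def norm_divide)
 have p: "(w, z) \<in> far_dom b" using assms by (simp add: far_dom_def)
 have arg: "1 + (- 2) * s * cof (fst (w, z) \<bullet> snd (w, z)) + s * s * cof (snd (w, z) \<bullet> snd (w, z)) = cof Q"
  by (simp add: Q_def s_def)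
 have Q0: "Q > 0" using far_arg_pos[OF assms(1) sb p] unfolding arg by simp
 define q where "q = sqrt Q"
 have q0: "q > 0" "q * q = Q" using Q0 by (simp_all add: q_def)
 have root: "far_root s (w, z) = cof q" unfolding far_root_def arg using Q0 by (simp add: q_def)
 have ww: "w \<bullet> w = 1" using assms(2) by (simp add: norm_eq_1)
 have D: "(r *\<^sub>R w - z) \<bullet> (r *\<^sub>R w - z) = (r * q) * (r * q)"
 proof -
  have "(r *\<^sub>R w - z) \<bullet> (r *\<^sub>R w - z) = r * r - 2 * r * (w \<bullet> z) + z \<bullet> z"
   by (simp add: inner_diff_left inner_diff_right ww inner_commute algebra_simps)
  also have "\<dots> = r * r * Q" unfolding Q_def using assms(3) by (simp add: field_simps)
  finally show ?thesis by (simp add: q0(2)[symmetric] mult_ac)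
 qed
 have rq: "r * q > 0" using assms q0 by simp
 have cs: "csqrt (cof ((r *\<^sub>R w - z) \<bullet> (r *\<^sub>R w - z))) = cof (r * q)"
  unfolding D using rq by (simp del: of_real_mult)
 have ph: "r * q = r + (- 2 * (w \<bullet> z) + (1 / r) * (z \<bullet> z)) * inverse (1 + q)"
 proof -
  have "(q - 1) * (1 + q) = Q - 1" using q0(2) by (simp add: algebra_simps)
  hence "r * (q - 1) * (1 + q) = - 2 * (w \<bullet> z) + (1 / r) * (z \<bullet> z)" unfolding Q_def using assms(3) by (simp add: field_simps)
  hence "r * (q - 1) = (- 2 * (w \<bullet> z) + (1 / r) * (z \<bullet> z)) * inverse (1 + q)" using q0(1) by (simp add: field_simps)
  thus ?thesis by (simp add: algebra_simps)
 qed
 have ex: "exp (\<i> * cof k * cof (r * q)) = exp (\<i> * cof (k * r)) *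
   exp (\<i> * cof k * (cof (- 2 * (w \<bullet> z)) + s * cof (z \<bullet> z)) * inverse (1 + cof q))"
  unfolding exp_add[symmetric] by (subst ph) (simp add: s_def algebra_simps)
 have q0': "cof q \<noteq> 0" "cof r \<noteq> 0" using q0 assms by auto
 have amp: "exp (\<i> * cof k * cof (r * q)) = exp (\<i> * cof (k * r)) * far_amp k s (w, z) * cof q"
  unfolding ex far_amp_def root fst_conv snd_conv using q0' by simp
 show "fsol k 0 (cof ((r *\<^sub>R w - z) \<bullet> (r *\<^sub>R w - z))) =
   exp (\<i> * cof (k * r)) / cof r * far_amp k (cof (1 / r)) (w, z)"
  unfolding fsol_def Let_def cs amp s_def[symmetric] using q0' by simp
 show "fsol k 1 (cof ((r *\<^sub>R w - z) \<bullet> (r *\<^sub>R w - z))) =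
   exp (\<i> * cof (k * r)) / (2 * (cof r)\<^sup>2) * far_amp1 k (cof (1 / r)) (w, z)"
  unfolding fsol_def Let_def cs amp s_def[symmetric] far_amp1_def root
  using q0' by (simp add: s_def field_simps power2_eq_square power3_eq_cube)
qed

text \<open>At the origin \<open>y /\<^sub>R norm y\<close> is a default value and discontinuous,
  but the profile confines the support to a shell of large radius, where everything is
  continuous.\<close>

lemma symbol_measurable:
 fixes a :: "real \<Rightarrow> complex" and J :: "complex \<Rightarrow> wave"
 assumes a: "continuous_on UNIV a" "\<And>t. t \<le> 1 \<or> t \<ge> 2 \<Longrightarrow> a t = 0" and s0: "s0 > 0"
  and J: "continuous_on (ball 0 s0 \<times> {w. norm w \<le> 1}) (\<lambda>p. J (fst p) (snd p))" and \<rho>: "\<rho> > 2 / s0"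
 shows "(\<lambda>y. cof (1 / \<rho>\<^sup>2) * (a (y \<bullet> y / \<rho>\<^sup>2) * J (cof (1 / norm y)) (y /\<^sub>R norm y))) \<in> borel_measurable borel"
proof (rule borel_measurable_continuous_onI, rule continuous_on_UNIV_support)
 have \<rho>0: "\<rho> > 0" using \<rho> divide_pos_pos[of 2 s0] s0 by linarith
 show "open {y :: real^3. norm y > 1 / s0}" by (intro open_Collect_less continuous_intros)
 show "compact (shell 0 \<rho>)" by (rule compact_shell)
 show "shell 0 \<rho> \<subseteq> {y. norm y > 1 / s0}"
 proof
  fix y assume "y \<in> shell 0 \<rho>"
  hence "\<rho>\<^sup>2 \<le> (norm y)\<^sup>2" by (simp add: shell_def power2_norm_eq_inner)
  hence "\<rho> \<le> norm y" by (rule power2_le_imp_le) simp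
  moreover have "1 / s0 \<le> 2 / s0" using s0 by (simp add: divide_right_mono)
  ultimately show "y \<in> {y. norm y > 1 / s0}" using \<rho> by simp
 qed
 show "cof (1 / \<rho>\<^sup>2) * (a (y \<bullet> y / \<rho>\<^sup>2) * J (cof (1 / norm y)) (y /\<^sub>R norm y)) = 0" if "y \<notin> shell 0 \<rho>" for y
 proof -
  have "y \<bullet> y / \<rho>\<^sup>2 \<le> 1 \<or> y \<bullet> y / \<rho>\<^sup>2 \<ge> 2" using that \<rho>0 by (auto simp: shell_def pos_le_divide_eq)
  thus ?thesis using a(2) by simp
 qed
 show "continuous_on {y. norm y > 1 / s0} (\<lambda>y. cof (1 / \<rho>\<^sup>2) * (a (y \<bullet> y / \<rho>\<^sup>2) * J (cof (1 / norm y)) (y /\<^sub>R norm y)))"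
 proof (intro continuous_intros continuous_on_compose2[OF a(1)])
  have pos: "norm y > 0" if "norm y > 1 / s0" for y :: "real^3" using that divide_pos_pos[of 1 s0] s0 by linarith
  have c: "continuous_on {y :: real^3. norm y > 1 / s0} (\<lambda>y. (cof (1 / norm y), y /\<^sub>R norm y))"
   by (intro continuous_intros) (use pos in auto)
  have im: "(\<lambda>y :: real^3. (cof (1 / norm y), y /\<^sub>R norm y)) ` {y. norm y > 1 / s0} \<subseteq> ball 0 s0 \<times> {w. norm w \<le> 1}"
  proof (rule image_subsetI)
   fix y :: "real^3" assume "y \<in> {y. norm y > 1 / s0}"
   hence y: "1 / s0 < norm y" by simp
   have "1 / norm y < s0" using y s0 pos[OF y] by (simp add: pos_divide_less_eq mult.commute)
   thus "(cof (1 / norm y), y /\<^sub>R norm y) \<in> ball 0 s0 \<times> {w. norm w \<le> 1}"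
    using pos[OF y] by (simp add: norm_divide)
  qed
  from continuous_on_compose2[OF J c im]
  show "continuous_on {y. norm y > 1 / s0} (\<lambda>y. J (cof (1 / norm y)) (y /\<^sub>R norm y))" by simp
 qed (use \<rho>0 in auto)
qed

text \<open>On the outer shell the kernel is the outgoing phase times two amplitudes of the kind
  treated in \<open>symbol_oscillation\<close>: \<open>a1\<close>, \<open>J1\<close> from the
  product of the gradients, \<open>a2\<close>, \<open>J2\<close> from the Laplacian of the
  cut-off.\<close>

lemma outer_term_vanishes:
 fixes V DV :: wave
 assumes k: "k > 0" and R0: "R0 > 0"
  and V: "V \<in> borel_measurable borel" and cV: "continuous_on {y. norm y > R0} V"
  and dV: "\<And>y. norm y > R0 \<Longrightarrow> ((\<lambda>s. V (s *\<^sub>R y)) has_vector_derivative DV y) (at 1)"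
  and som: "\<And>\<eta>. \<eta> > 0 \<Longrightarrow> \<exists>R. \<forall>y. norm y \<ge> R \<longrightarrow> norm y > R0 \<longrightarrow> norm (DV y - \<i> * cof (k * norm y) * V y) \<le> \<eta>"
 shows "((\<lambda>\<rho>. LINT y|lborel. V y * repr_kernel k (cutoff \<rho> 1) (cutoff \<rho> 2) 0 x y) \<longlongrightarrow> 0) at_top"
proof -
 define b where "b = norm x + 1"
 have b: "b > 0" using norm_ge_zero[of x] unfolding b_def by linarith
 define s1 where "s1 = 1 / (4 * b)"
 have s1: "s1 > 0" "4 * s1 * b \<le> 1" using b by (simp_all add: s1_def)
 \<comment> \<open>The closed disc of half the radius lies inside the domain of holomorphy, so
   compactness bounds the symbols there.\<close>
 define s0 where "s0 = s1 / 2"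
 have s0: "s0 > 0" "s0 < s1" using s1 by (simp_all add: s0_def)
 have s0b: "4 * s0 * b \<le> 1" using s1 b by (simp add: s0_def)
 note hc = far_root_hol_cont[OF s1(2)]
 define T where "T = {w :: real^3. norm w \<le> 1}"
 define J1 where "J1 s w = (1 + (-1) * s * cof (w \<bullet> x)) * far_amp1 k s (w, x)" for s w
 define J2 where "J2 s w = s * far_amp k s (w, x)" for s w
 have pc: "continuous_on T (\<lambda>w. (w, x))" "(\<lambda>w. (w, x)) ` T \<subseteq> far_dom b"
  by (auto intro!: continuous_intros simp: T_def far_dom_def b_def)
 have h1: "hol_cont (ball 0 s1) T J1" unfolding J1_def
  by (intro hol_cont_mult hol_cont_add hol_cont_ident hol_cont_param hol_cont_compose_param[OF hc(3) pc] continuous_intros)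
 have h2: "hol_cont (ball 0 s1) T J2" unfolding J2_def
  by (intro hol_cont_mult hol_cont_ident hol_cont_compose_param[OF hc(2) pc])
 have bnd: "\<exists>B. \<forall>s\<in>ball 0 s0. \<forall>w\<in>T. norm (J s w) \<le> B" if "hol_cont (ball 0 s1) T J" for J
 proof -
  have "compact (cball (0::complex) s0 \<times> T)"
  proof (rule compact_Times)
   have "T = cball 0 1" by (auto simp: T_def)
   thus "compact T" by simp
  qed simp
  moreover have "continuous_on (cball 0 s0 \<times> T) (\<lambda>p. J (fst p) (snd p))"
   by (rule continuous_on_subset[OF hol_cont_continuous[OF that]]) (use s0 in auto)
  ultimately have "bounded ((\<lambda>p. J (fst p) (snd p)) ` (cball 0 s0 \<times> T))"
   by (intro compact_imp_bounded compact_continuous_image)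
  then obtain B where B: "\<forall>z\<in>(\<lambda>p. J (fst p) (snd p)) ` (cball 0 s0 \<times> T). norm z \<le> B" unfolding bounded_iff by blast
  show ?thesis
  proof (intro exI[of _ B] ballI)
   fix s :: complex and w :: "real^3" assume "s \<in> ball 0 s0" "w \<in> T"
   hence "(s, w) \<in> cball 0 s0 \<times> T" by auto
   from bspec[OF B imageI[OF this, of "\<lambda>p. J (fst p) (snd p)"]] show "norm (J s w) \<le> B" by simp
  qed
 qed
 define st where "st j t = cof (step j t)" for j t
 have dst: "(st j has_vector_derivative st (Suc j) t) (at t)" if "j < 4" for j t
  unfolding st_def by (rule has_vector_derivative_of_real[OF step_deriv[OF that]])
 have st0: "st (Suc j) t = 0" if "t \<le> 1 \<or> t \<ge> 2" for j t
  using that by (auto simp: st_def step_zero step_Suc_zero)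
 have cst: "continuous_on UNIV (st j)" if "j \<le> 4" for j
  unfolding st_def using continuous_on_step[OF that] by (intro continuous_intros)
 have ex: "\<exists>M. \<forall>t. norm (st j t) \<le> M" if "j \<le> 4" for j
  using step_bounded[OF that] unfolding st_def norm_of_real by metis
 obtain M1 M2 M3 M4 where M: "\<And>t. norm (st 1 t) \<le> M1" "\<And>t. norm (st 2 t) \<le> M2" "\<And>t. norm (st 3 t) \<le> M3" "\<And>t. norm (st 4 t) \<le> M4"
  using ex[of 1] ex[of 2] ex[of 3] ex[of 4] by auto
 have M0: "M1 \<ge> 0" "M2 \<ge> 0" "M3 \<ge> 0" "M4 \<ge> 0"
  using M[of 0] norm_ge_zero order_trans by blast+
 define M where "M = 14 * (M1 + M2 + M3 + M4)"
 have d1: "(st 1 has_vector_derivative st 2 t) (at t)" "(st 2 has_vector_derivative st 3 t) (at t)" "(st 3 has_vector_derivative st 4 t) (at t)" for t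
  using dst[of 1 t] dst[of 2 t] dst[of 3 t] by (simp_all add: eval_nat_numeral)
 have z: "st 1 t = 0" "st 2 t = 0" "st 3 t = 0" "st 4 t = 0" if "t \<le> 1 \<or> t \<ge> 2" for t
  using st0[OF that, of 0] st0[OF that, of 1] st0[OF that, of 2] st0[OF that, of 3] by (simp_all add: eval_nat_numeral)
 \<comment> \<open>The cut-off is \<open>1 - step\<close>, whence the signs. \<open>-4\<close> is
   the \<open>8\<close> of the kernel over the \<open>2\<close> in the prefactor of
   \<open>far_amp1\<close>, and \<open>a2\<close> is the Laplacian \<open>6 F' + 4 t F''\<close> of
   the profile in the scaled variable \<open>t\<close>.\<close>
 define a1 a1' a1'' where "a1 t = -4 * st 1 t" and "a1' t = -4 * st 2 t" and "a1'' t = -4 * st 3 t" for t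
 define a2 where "a2 t = -6 * st 1 t - cof (4 * t) * st 2 t" for t
 define a2' where "a2' t = -10 * st 2 t - cof (4 * t) * st 3 t" for t
 define a2'' where "a2'' t = -14 * st 3 t - cof (4 * t) * st 4 t" for t
 have t4: "((\<lambda>t. cof (4 * t)) has_vector_derivative 4) (at t)" for t
 proof -
  have "((\<lambda>t. 4 * t) has_real_derivative 4) (at t)" by (auto intro!: derivative_eq_intros)
  from has_vector_derivative_of_real[OF this, where 'a = complex] show ?thesis by simp
 qed
 have da1: "(a1 has_vector_derivative a1' t) (at t)" "(a1' has_vector_derivative a1'' t) (at t)" for t
  unfolding a1_def a1'_def a1''_def by (intro has_vector_derivative_mult_right d1)+
 have da2: "(a2 has_vector_derivative a2' t) (at t)" "(a2' has_vector_derivative a2'' t) (at t)" for t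
  unfolding a2_def a2'_def a2''_def
  by (rule has_vector_derivative_eq_rhs[OF has_vector_derivative_diff[OF has_vector_derivative_mult_right[OF d1(1)] has_vector_derivative_mult[OF t4 d1(2)]]], simp add: algebra_simps)
    (rule has_vector_derivative_eq_rhs[OF has_vector_derivative_diff[OF has_vector_derivative_mult_right[OF d1(2)] has_vector_derivative_mult[OF t4 d1(3)]]], simp add: algebra_simps)
 have t8: "norm (cof (4 * t) * st j t) \<le> 8 * m" if "\<And>t. norm (st j t) \<le> m" "\<And>t. t \<le> 1 \<or> t \<ge> 2 \<Longrightarrow> st j t = 0" for j t m
 proof (cases "t \<le> 1 \<or> t \<ge> 2")
  case True
  have "0 \<le> m" using that(1)[of t] norm_ge_zero order_trans by blast
  thus ?thesis using that(2)[OF True] by simp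
 next
  case False
  thus ?thesis unfolding norm_mult using that(1)[of t] by (intro mult_mono) auto
 qed
 have A1: "norm (a1 t) \<le> M" "norm (a1' t) \<le> M" "norm (a1'' t) \<le> M" for t
  unfolding a1_def a1'_def a1''_def M_def norm_mult using M(1-3)[of t] M0 by auto
 have A2: "norm (a2 t) \<le> M" "norm (a2' t) \<le> M" "norm (a2'' t) \<le> M" for t
 proof -
  have n: "norm (c * st j t - cof (4 * t) * st i t) \<le> norm c * norm (st j t) + norm (cof (4 * t) * st i t)" for c i j
   using norm_triangle_ineq4[of "c * st j t" "cof (4 * t) * st i t"] by (simp add: norm_mult)
  show "norm (a2 t) \<le> M" unfolding a2_def M_def
   using n[of "-6" 1 2] M(1)[of t] t8[of 2 M2 t, OF M(2) z(2)] M0 by simp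
  show "norm (a2' t) \<le> M" unfolding a2'_def M_def
   using n[of "-10" 2 3] M(2)[of t] t8[of 3 M3 t, OF M(3) z(3)] M0 by simp
  show "norm (a2'' t) \<le> M" unfolding a2''_def M_def
   using n[of "-14" 3 4] M(3)[of t] t8[of 4 M4 t, OF M(4) z(4)] M0 by simp
 qed
 define N where "N a J \<rho> y = cof (1 / \<rho>\<^sup>2) * (a (y \<bullet> y / \<rho>\<^sup>2) * J (cof (1 / norm y)) (y /\<^sub>R norm y))" for a J \<rho> and y :: "real^3"
 have za: "a1 t = 0" "a1' t = 0" "a1'' t = 0" "a2 t = 0" "a2' t = 0" "a2'' t = 0" if "t \<le> 1 \<or> t \<ge> 2" for t
  unfolding a1_def a1'_def a1''_def a2_def a2'_def a2''_def z[OF that] by simp_all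
 have Jc: "continuous_on (ball 0 s0 \<times> {w. norm w \<le> 1}) (\<lambda>p. J (fst p) (snd p))" if "hol_cont (ball 0 s1) T J" for J
  by (rule continuous_on_subset[OF hol_cont_continuous[OF that]]) (use s0 in \<open>auto simp: T_def\<close>)
 have Jh: "(\<lambda>s. J s w) holomorphic_on ball 0 s0" if "hol_cont (ball 0 s1) T J" "norm w = 1" for J w
  by (rule holomorphic_on_subset[OF hol_cont_holomorphic[OF that(1)]]) (use s0 that in \<open>auto simp: T_def\<close>)
 have c1: "continuous_on UNIV a1" "continuous_on UNIV a2"
  using da1 da2 by (meson continuous_at_imp_continuous_on has_vector_derivative_continuous)+
 have Nm: "N a1 J1 \<rho> \<in> borel_measurable borel" "N a2 J2 \<rho> \<in> borel_measurable borel" if "\<rho> > 2 / s0" for \<rho>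

 proof -
  show "N a1 J1 \<rho> \<in> borel_measurable borel" unfolding N_def
   by (rule symbol_measurable[OF c1(1) za(1) s0(1) Jc[OF h1] that])
  show "N a2 J2 \<rho> \<in> borel_measurable borel" unfolding N_def
   by (rule symbol_measurable[OF c1(2) za(4) s0(1) Jc[OF h2] that])
 qed
 obtain B1 where B1: "\<And>s w. s \<in> ball 0 s0 \<Longrightarrow> w \<in> T \<Longrightarrow> norm (J1 s w) \<le> B1" using bnd[OF h1] by blast
 obtain B2 where B2: "\<And>s w. s \<in> ball 0 s0 \<Longrightarrow> w \<in> T \<Longrightarrow> norm (J2 s w) \<le> B2" using bnd[OF h2] by blast
 have B1': "norm (J1 s w) \<le> B1" if "norm w = 1" "s \<in> ball 0 s0" for s w by (rule B1) (use that in \<open>auto simp: T_def\<close>)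
 have B2': "norm (J2 s w) \<le> B2" if "norm w = 1" "s \<in> ball 0 s0" for s w by (rule B2) (use that in \<open>auto simp: T_def\<close>)
 have L1: "((\<lambda>\<rho>. LINT y|lborel. V y * outgoing k y * N a1 J1 \<rho> y) \<longlongrightarrow> 0) at_top"
  unfolding N_def
  by (rule symbol_oscillation[OF k R0 V cV dV som da1 za(1-3) A1 s0(1) Jh[OF h1] B1' Nm(1)[unfolded N_def]])
 have L2: "((\<lambda>\<rho>. LINT y|lborel. V y * outgoing k y * N a2 J2 \<rho> y) \<longlongrightarrow> 0) at_top"
  unfolding N_def
  by (rule symbol_oscillation[OF k R0 V cV dV som da2 za(4-6) A2 s0(1) Jh[OF h2] B2' Nm(2)[unfolded N_def]])
 have kern: "repr_kernel k (cutoff \<rho> 1) (cutoff \<rho> 2) 0 x y = outgoing k y * (N a1 J1 \<rho> y + N a2 J2 \<rho> y)" if \<rho>: "\<rho> > 2 / s0" for \<rho> y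
 proof -
  have \<rho>0: "\<rho> > 0" using \<rho> divide_pos_pos[of 2 s0] s0 by linarith
  define t where "t = y \<bullet> y / \<rho>\<^sup>2"
  show ?thesis
  proof (cases "t \<le> 1 \<or> t \<ge> 2")
   case True
   hence "step 1 t = 0" "step 2 t = 0" using z[OF True] by (auto simp: st_def)
   thus ?thesis using z[OF True]
    by (simp add: repr_kernel_def cutoff_def t_def[symmetric] N_def za[OF True])
  next
   case False
   define r where "r = norm y"
   have yy: "y \<bullet> y = r\<^sup>2" by (simp add: r_def power2_norm_eq_inner)
   have "\<rho>\<^sup>2 \<le> r\<^sup>2" using False \<rho>0 by (simp add: t_def yy pos_le_divide_eq)
   hence r\<rho>: "\<rho> \<le> r" by (rule power2_le_imp_le) (simp add: r_def)
   hence r0: "r > 0" using \<rho>0 by simp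
   define w where "w = y /\<^sub>R r"
   have w: "norm w = 1" "y = r *\<^sub>R w" using r0 by (simp_all add: w_def r_def)
   have "2 / s0 < r" using \<rho> r\<rho> by simp
   hence "2 < s0 * r" using s0 by (simp add: pos_divide_less_eq mult.commute)
   hence "1 / r < s0" using r0 by (simp add: pos_divide_less_eq)
   note F = fsol_far[OF s0b w(1) r0 _ this, of x k, folded w(2)]
   have xb: "norm x \<le> b" by (simp add: b_def)
   have yx: "y \<bullet> (y - x) = r\<^sup>2 * (1 - 1 / r * (w \<bullet> x))"
   proof -
    have "y \<bullet> x = r * (w \<bullet> x)" by (subst w(2)) simp
    thus ?thesis using r0 by (simp add: inner_diff_right yy field_simps power2_eq_square)
   qed
   have "cutoff \<rho> 1 (y \<bullet> y) = - st 1 t / (cof \<rho>)\<^sup>2" "cutoff \<rho> 2 (y \<bullet> y) = - st 2 t / (cof \<rho>)\<^sup>2 / (cof \<rho>)\<^sup>2"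
    by (simp_all add: cutoff_def st_def t_def power2_eq_square)
   moreover have "cof (y \<bullet> y) = cof t * (cof \<rho>)\<^sup>2" using \<rho>0 by (simp add: t_def)
   moreover have "outgoing k y = exp (\<i> * cof (k * r))" by (simp add: outgoing_def r_def)
   moreover have "N a1 J1 \<rho> y = - 4 * st 1 t / (cof \<rho>)\<^sup>2 * ((1 - cof (1 / r) * cof (w \<bullet> x)) * far_amp1 k (cof (1 / r)) (w, x))"
    unfolding N_def t_def[symmetric] r_def[symmetric] w_def[symmetric] J1_def a1_def by simp
   moreover have "N a2 J2 \<rho> y = (- 6 * st 1 t - 4 * cof t * st 2 t) / (cof \<rho>)\<^sup>2 * (cof (1 / r) * far_amp k (cof (1 / r)) (w, x))"
    unfolding N_def t_def[symmetric] r_def[symmetric] w_def[symmetric] J2_def a2_def by simp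
   moreover have "8 * cof (r\<^sup>2 * (1 - 1 / r * (w \<bullet> x))) * c * (e / (2 * (cof r)\<^sup>2) * f) =
     e * (4 * c * ((1 - cof (1 / r) * cof (w \<bullet> x)) * f))" for c e f
   proof -
    have "cof (r\<^sup>2 * (1 - 1 / r * (w \<bullet> x))) = (cof r)\<^sup>2 * (1 - cof (1 / r) * cof (w \<bullet> x))" by simp
    thus ?thesis using r0 by (simp only:) simp
   qed
   moreover have "6 * (- s / (cof \<rho>)\<^sup>2) + 4 * (cof t * (cof \<rho>)\<^sup>2) * (- s' / (cof \<rho>)\<^sup>2 / (cof \<rho>)\<^sup>2) =
     (- 6 * s - 4 * cof t * s') / (cof \<rho>)\<^sup>2" for s s'
   proof -
    have "6 * (- s / q) + 4 * (cof t * q) * (- s' / q / q) = (- 6 * s - 4 * cof t * s') / q" if "q \<noteq> 0" for q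
     using that by (simp add: field_simps)
    from this[of "(cof \<rho>)\<^sup>2"] show ?thesis using \<rho>0 by simp
   qed
   ultimately show ?thesis
    unfolding repr_kernel_def Let_def diff_zero F(1)[OF xb] F(2)[OF xb] yx by (simp only:) (simp add: algebra_simps)
  qed
 qed
 have iN: "integrable lborel (\<lambda>y. V y * outgoing k y * N a J \<rho> y)"
  if \<rho>: "\<rho> > 2 / s0" "\<rho> > R0" and m: "N a J \<rho> \<in> borel_measurable borel" and a: "\<And>t. t \<le> 1 \<or> t \<ge> 2 \<Longrightarrow> a t = 0" "\<And>t. norm (a t) \<le> M"
   and J: "\<And>s w. s \<in> ball 0 s0 \<Longrightarrow> w \<in> T \<Longrightarrow> norm (J s w) \<le> B" for a J \<rho> B
 proof -
  have \<rho>0: "\<rho> > 0" using \<rho> R0 by linarith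
  have "continuous_on (shell 0 \<rho>) V"
  proof (rule continuous_on_subset[OF cV])
   show "shell 0 \<rho> \<subseteq> {y. norm y > R0}"
   proof
    fix y assume "y \<in> shell 0 \<rho>"
    hence "\<rho>\<^sup>2 \<le> (norm y)\<^sup>2" by (simp add: shell_def power2_norm_eq_inner)
    hence "\<rho> \<le> norm y" by (rule power2_le_imp_le) simp
    thus "y \<in> {y. norm y > R0}" using \<rho> by simp
   qed
  qed
  hence "bounded (V ` shell 0 \<rho>)" by (intro compact_imp_bounded compact_continuous_image compact_shell)
  then obtain v where v: "v > 0" "\<forall>z\<in>V ` shell 0 \<rho>. norm z \<le> v" unfolding bounded_pos by blast
  have B0: "B \<ge> 0" using order_trans[OF norm_ge_zero J[of 0 0]] s0 by (simp add: T_def)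
  have Mp: "M \<ge> 0" using M0 by (simp add: M_def)
  have N0: "N a J \<rho> y = 0" if "y \<notin> shell 0 \<rho>" for y
  proof -
   have "y \<bullet> y / \<rho>\<^sup>2 \<le> 1 \<or> y \<bullet> y / \<rho>\<^sup>2 \<ge> 2" using that \<rho>0 by (auto simp: shell_def pos_le_divide_eq)
   thus ?thesis using a(1) by (simp add: N_def)
  qed
  have NB: "norm (N a J \<rho> y) \<le> 1 / \<rho>\<^sup>2 * (M * B)" if y: "y \<in> shell 0 \<rho>" for y
  proof -
   have "\<rho>\<^sup>2 \<le> (norm y)\<^sup>2" using y by (simp add: shell_def power2_norm_eq_inner)
   hence "\<rho> \<le> norm y" by (rule power2_le_imp_le) simp
   hence ny: "norm y > 2 / s0" "norm y > 0" using \<rho> \<rho>0 by linarith+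
   hence "2 < s0 * norm y" using s0 by (simp add: pos_divide_less_eq mult.commute)
   hence "1 / norm y < s0" using ny by (simp add: pos_divide_less_eq)
   hence "cof (1 / norm y) \<in> ball 0 s0" by (simp add: norm_divide)
   moreover have "y /\<^sub>R norm y \<in> T" using ny by (simp add: T_def)
   ultimately have "norm (J (cof (1 / norm y)) (y /\<^sub>R norm y)) \<le> B" by (rule J)
   moreover have "norm (cof (1 / \<rho>\<^sup>2)) = 1 / \<rho>\<^sup>2" by (simp add: norm_divide norm_power)
   ultimately show ?thesis unfolding N_def norm_mult using a(2)[of "y \<bullet> y / \<rho>\<^sup>2"] Mp by (intro mult_mono) auto
  qed
  show ?thesis
  proof (rule integrable_bounded_support(1)[where B = "v * (1 / \<rho>\<^sup>2 * (M * B))" and b = "2 * \<rho>"])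
   show "(\<lambda>y. V y * outgoing k y * N a J \<rho> y) \<in> borel_measurable borel" using V m by measurable
   show "0 \<le> v * (1 / \<rho>\<^sup>2 * (M * B))" using v Mp B0 by simp
   show "norm (V y * outgoing k y * N a J \<rho> y) \<le> v * (1 / \<rho>\<^sup>2 * (M * B))" for y
   proof (cases "y \<in> shell 0 \<rho>")
    case True
    thus ?thesis unfolding norm_mult[of "V y * outgoing k y"] norm_mult[of "V y"] norm_outgoing mult_1_right
     using v NB[OF True] by (intro mult_mono) auto
   next
    case False
    thus ?thesis using N0[OF False] v Mp B0 by simp
   qed
   show "V y * outgoing k y * N a J \<rho> y = 0" if "norm y > 2 * \<rho>" for y
   proof -
    have "(norm y)\<^sup>2 \<ge> (2 * \<rho>)\<^sup>2" using that \<rho>0 by (intro power_mono) auto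
    hence "y \<bullet> y \<ge> 4 * \<rho>\<^sup>2" by (simp add: power2_norm_eq_inner power_mult_distrib)
    moreover have "\<rho>\<^sup>2 > 0" using \<rho>0 by simp
    ultimately have "\<not> y \<bullet> y \<le> 2 * \<rho>\<^sup>2" by linarith
    hence "y \<notin> shell 0 \<rho>" by (simp add: shell_def)
    thus ?thesis using N0 by simp
   qed
  qed
 qed
 have "((\<lambda>\<rho>. (LINT y|lborel. V y * outgoing k y * N a1 J1 \<rho> y) + (LINT y|lborel. V y * outgoing k y * N a2 J2 \<rho> y)) \<longlongrightarrow> 0 + 0) at_top"
  by (intro tendsto_add L1 L2)
 moreover have "eventually (\<lambda>\<rho>. (LINT y|lborel. V y * outgoing k y * N a1 J1 \<rho> y) + (LINT y|lborel. V y * outgoing k y * N a2 J2 \<rho> y) =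
   (LINT y|lborel. V y * repr_kernel k (cutoff \<rho> 1) (cutoff \<rho> 2) 0 x y)) at_top"
  using eventually_gt_at_top[of "max (2 / s0) R0"]
 proof eventually_elim
  case (elim \<rho>)
  hence \<rho>: "\<rho> > 2 / s0" "\<rho> > R0" by auto
  have i1: "integrable lborel (\<lambda>y. V y * outgoing k y * N a1 J1 \<rho> y)"
   by (rule iN[OF \<rho> Nm(1)[OF \<rho>(1)] za(1) A1(1) B1])
  have i2: "integrable lborel (\<lambda>y. V y * outgoing k y * N a2 J2 \<rho> y)"
   by (rule iN[OF \<rho> Nm(2)[OF \<rho>(1)] za(4) A2(1) B2])
  show ?case unfolding kern[OF \<rho>(1)] Bochner_Integration.integral_add[OF i1 i2, symmetric]
   by (simp add: algebra_simps)
 qed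
 ultimately show ?thesis by (simp add: tendsto_cong)
qed

section \<open>Convergent expansion at infinity\<close>

lemma repr_kernel_zero_off_shell:
 assumes "r > 0" "y \<notin> shell 0 r" shows "repr_kernel k (cutoff r 1) (cutoff r 2) 0 x y = 0"
 using cutoff_zero_off_shell[OF assms, of 1] cutoff_zero_off_shell[OF assms, of 2] by (simp add: repr_kernel_def)

lemma repr_kernel_integrable:
 assumes cV: "continuous_on {y. norm y > R0} V" and r: "r > R0" "R0 > 0" and x: "x \<notin> shell 0 r"
 shows "integrable lborel (\<lambda>y. V y * repr_kernel k (cutoff r 1) (cutoff r 2) 0 x y)"
proof -
 define S where "S = {y. norm y > R0} \<inter> - {x}"
 have oS: "open S" unfolding S_def by (intro open_Int open_Collect_less continuous_intros)
 have r0: "r > 0" using r by simp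
 have KS: "shell 0 r \<subseteq> S"
 proof
  fix y assume y: "y \<in> shell 0 r"
  hence "r\<^sup>2 \<le> (norm y)\<^sup>2" by (simp add: shell_def power2_norm_eq_inner)
  hence "r \<le> norm y" by (rule power2_le_imp_le) simp
  thus "y \<in> S" using r x y by (auto simp: S_def)
 qed
 have z: "V y * repr_kernel k (cutoff r 1) (cutoff r 2) 0 x y = 0" if "y \<notin> shell 0 r" for y
  by (simp only: repr_kernel_zero_off_shell[OF r0 that] mult_zero_right)
 have "continuous_on UNIV (\<lambda>y. V y * repr_kernel k (cutoff r 1) (cutoff r 2) 0 x y)"
 proof (rule continuous_on_UNIV_support[OF _ oS compact_shell KS])
  have pos: "(y - x) \<bullet> (y - x) > 0" if "y \<in> S" for y using that by (simp add: S_def)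
  show "continuous_on S (\<lambda>y. V y * repr_kernel k (cutoff r 1) (cutoff r 2) 0 x y)"
   unfolding repr_kernel_def Let_def
   by (intro continuous_intros continuous_on_fsol continuous_on_subset[OF cV] pos_notin_nonpos_Reals pos
      continuous_on_compose2[OF continuous_on_cutoff[OF r0]]) (auto simp: S_def)
 qed (rule z)
 thus ?thesis
  by (rule integrable_continuous_compact_support[OF _ compact_shell[of 0 r]]) (rule z)
qed

text \<open>Use the difference of the cut-offs of radii \<rho> and \<open>r1\<close>, which is 1
  near \<open>x\<close>. The outer part of the kernel disappears as \<rho> grows, and nothing else
  depends on \<rho>.\<close>

lemma exterior_representation:
 fixes V DV :: wave
 assumes k: "k > 0" and R0: "R0 > 0" and weak: "weak_helmholtz k {y. norm y > R0} V"
  and V: "V \<in> borel_measurable borel"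
  and dV: "\<And>y. norm y > R0 \<Longrightarrow> ((\<lambda>s. V (s *\<^sub>R y)) has_vector_derivative DV y) (at 1)"
  and som: "\<And>\<eta>. \<eta> > 0 \<Longrightarrow> \<exists>R. \<forall>y. norm y \<ge> R \<longrightarrow> norm y > R0 \<longrightarrow> norm (DV y - \<i> * cof (k * norm y) * V y) \<le> \<eta>"
  and r1: "r1 > R0" and x: "norm x > 2 * r1"
 shows "repr_const * V x = - (LINT y|lborel. V y * repr_kernel k (cutoff r1 1) (cutoff r1 2) 0 x y)"
proof -
 have r10: "r1 > 0" using r1 R0 by simp
 have cV: "continuous_on {y. norm y > R0} V" by (rule weak_helmholtz_continuous[OF weak])
 have oS: "open {y :: real^3. norm y > R0}" by (intro open_Collect_less continuous_intros)
 have xs: "x \<notin> shell 0 r1"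
 proof -
  have "(norm x)\<^sup>2 > (2 * r1)\<^sup>2" using x r10 by (intro power_strict_mono) auto
  hence "x \<bullet> x > 4 * r1\<^sup>2" by (simp add: power2_norm_eq_inner power_mult_distrib)
  hence "\<not> x \<bullet> x \<le> 2 * r1\<^sup>2" using zero_le_power2[of r1] by linarith
  thus ?thesis by (simp add: shell_def)
 qed
 have main: "repr_const * V x = (LINT y|lborel. V y * repr_kernel k (cutoff \<rho> 1) (cutoff \<rho> 2) 0 x y) - (LINT y|lborel. V y * repr_kernel k (cutoff r1 1) (cutoff r1 2) 0 x y)"
  if \<rho>: "\<rho> \<ge> 2 * norm x" for \<rho>
 proof -
  have \<rho>r: "\<rho> > r1" "\<rho> > 0" using \<rho> x r10 by linarith+
  have xr: "x \<notin> shell 0 \<rho>"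
  proof -
   have "norm x < \<rho>" using \<rho> x r10 by linarith
   hence "(norm x)\<^sup>2 < \<rho>\<^sup>2" by (intro power_strict_mono) auto
   thus ?thesis by (simp add: shell_def power2_norm_eq_inner)
  qed
  define th where "th j t = cutoff \<rho> j t - cutoff r1 j t" for j t
  have dth: "\<And>t. (th 0 has_vector_derivative th 1 t) (at t)" "\<And>t. (th 1 has_vector_derivative th 2 t) (at t)" "continuous_on UNIV (th 2)"
   unfolding th_def by (intro has_vector_derivative_diff continuous_intros cutoff_derivs \<rho>r r10)+
  have big: "cutoff r j (y \<bullet> y) = 0" if "norm y > 2 * r" "r > 0" for y :: "real^3" and r j
  proof -
   have "(norm y)\<^sup>2 \<ge> (2 * r)\<^sup>2" using that by (intro power_mono) auto
   hence "y \<bullet> y \<ge> 4 * r\<^sup>2" by (simp add: power2_norm_eq_inner power_mult_distrib)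
   hence "y \<bullet> y \<ge> 2 * r\<^sup>2" using zero_le_power2[of r] by linarith
   thus ?thesis using cutoff_outside[OF that(2)] by simp
  qed
  have small: "cutoff r j (y \<bullet> y) = (if j = 0 then 1 else 0)" if "norm y \<le> r" "r > 0" for y :: "real^3" and r j
  proof -
   have "(norm y)\<^sup>2 \<le> r\<^sup>2" using that by (intro power_mono) auto
   thus ?thesis using cutoff_inside[OF that(2)] by (simp add: power2_norm_eq_inner)
  qed
  define K where "K = {y :: real^3. r1 \<le> norm y} \<inter> cball 0 (2 * \<rho>)"
  have "repr_const * V x = (LINT y|lborel. V y * repr_kernel k (th 1) (th 2) 0 x y)"
  proof (rule helmholtz_representation[OF weak oS dth, where K = K and \<delta> = "norm x / 8"])
   show "compact K" unfolding K_def by (intro closed_Int_compact closed_Collect_le continuous_intros) auto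
   show "K \<subseteq> {y. norm y > R0}" using r1 by (auto simp: K_def)
   show "th 0 ((y - 0) \<bullet> (y - 0)) = 0" if "y \<notin> K" for y
   proof (cases "norm y < r1")
    case True
    thus ?thesis using small[of y r1 0] small[of y \<rho> 0] \<rho>r r10 by (simp add: th_def)
   next
    case False
    hence "norm y > 2 * \<rho>" using that by (simp add: K_def)
    thus ?thesis using big[of r1 y 0] big[of \<rho> y 0] \<rho>r r10 by (simp add: th_def)
   qed
   show "norm x / 8 > 0" using x r10 by linarith
   \<comment> \<open>With \<open>1/8\<close> the ball around \<open>x\<close> stays outside the
     inner shell, since \<open>(7/8 * 2)\<^sup>2 = 49/16 > 2\<close>, and inside the ball of radius
     \<rho>, since \<open>9/8 < 2\<close>.\<close>
   have near: "th j ((y - 0) \<bullet> (y - 0)) = (if j = 0 then 1 else 0)" if "dist y x < norm x / 8" for y j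
   proof -
    have 1: "norm y \<le> norm x + norm x / 8" using norm_triangle_sub[of y x] that by (simp add: dist_norm)
    have 2: "norm x - norm x / 8 \<le> norm y" using norm_triangle_sub[of x y] that by (simp add: dist_norm norm_minus_commute)
    have "norm y \<le> \<rho>" using 1 \<rho> norm_ge_zero[of x] by linarith
    hence a: "cutoff \<rho> j (y \<bullet> y) = (if j = 0 then 1 else 0)" using small \<rho>r by blast
    have "norm y \<ge> 7/8 * (2 * r1)" using 2 x by linarith
    hence "(norm y)\<^sup>2 \<ge> (7/8 * (2 * r1))\<^sup>2" using r10 by (intro power_mono) auto
    hence "y \<bullet> y \<ge> 49/16 * r1\<^sup>2" by (simp add: power2_norm_eq_inner power_mult_distrib power_divide)
    hence "y \<bullet> y \<ge> 2 * r1\<^sup>2" using zero_le_power2[of r1] by linarith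
    hence "cutoff r1 j (y \<bullet> y) = 0" using cutoff_outside[OF r10] by simp
    thus ?thesis using a by (simp add: th_def)
   qed
   show "th 0 ((y - 0) \<bullet> (y - 0)) = 1" "th 1 ((y - 0) \<bullet> (y - 0)) = 0" "th 2 ((y - 0) \<bullet> (y - 0)) = 0" if "dist y x < norm x / 8" for y
    using near[OF that] by simp_all
  qed
  also have "\<dots> = (LINT y|lborel. V y * repr_kernel k (cutoff \<rho> 1) (cutoff \<rho> 2) 0 x y - V y * repr_kernel k (cutoff r1 1) (cutoff r1 2) 0 x y)"
   by (rule Bochner_Integration.integral_cong[OF refl]) (simp add: repr_kernel_def Let_def th_def algebra_simps)
  also have "\<dots> = (LINT y|lborel. V y * repr_kernel k (cutoff \<rho> 1) (cutoff \<rho> 2) 0 x y) - (LINT y|lborel. V y * repr_kernel k (cutoff r1 1) (cutoff r1 2) 0 x y)"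
   by (rule Bochner_Integration.integral_diff[OF repr_kernel_integrable[OF cV _ R0 xr] repr_kernel_integrable[OF cV r1 R0 xs]]) (use \<rho>r r1 in simp)
  finally show ?thesis .
 qed
 have "eventually (\<lambda>\<rho>. (LINT y|lborel. V y * repr_kernel k (cutoff \<rho> 1) (cutoff \<rho> 2) 0 x y) =
   repr_const * V x + (LINT y|lborel. V y * repr_kernel k (cutoff r1 1) (cutoff r1 2) 0 x y)) at_top"
  using eventually_ge_at_top[of "2 * norm x"] by eventually_elim (simp add: main)
 with outer_term_vanishes[OF k R0 V cV dV som, of x]
 have "((\<lambda>\<rho>::real. repr_const * V x + (LINT y|lborel. V y * repr_kernel k (cutoff r1 1) (cutoff r1 2) 0 x y)) \<longlongrightarrow> 0) at_top"
  by (simp add: tendsto_cong)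
 hence "repr_const * V x + (LINT y|lborel. V y * repr_kernel k (cutoff r1 1) (cutoff r1 2) 0 x y) = 0"
  by (simp add: tendsto_const_iff)
 thus ?thesis by (simp add: eq_neg_iff_add_eq_0)
qed

text \<open>The Atkinson-Wilcox expansion in convergent form: \<open>h 0\<close> is the far-field
  pattern, the higher Taylor coefficients in \<open>s = 1 / r\<close> are the corrections, and the
  bound \<open>B\<close> is uniform in the direction.\<close>

definition far_expansion :: "real \<Rightarrow> real \<Rightarrow> real \<Rightarrow> (complex \<Rightarrow> wave) \<Rightarrow> wave \<Rightarrow> bool" where
 "far_expansion k s1 B h V \<longleftrightarrow> (\<forall>w. norm w = 1 \<longrightarrow> (\<lambda>s. h s w) holomorphic_on ball 0 s1 \<and>
   (\<forall>s\<in>ball 0 s1. norm (h s w) \<le> B) \<and>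
   (\<forall>r>1 / s1. V (r *\<^sub>R w) = exp (\<i> * cof (k * r)) / cof r * h (cof (1 / r)) w))"

lemma far_expansionI:
 assumes "\<And>w. norm w = 1 \<Longrightarrow> (\<lambda>s. h s w) holomorphic_on ball 0 s1"
  "\<And>w s. norm w = 1 \<Longrightarrow> s \<in> ball 0 s1 \<Longrightarrow> norm (h s w) \<le> B"
  "\<And>w r. norm w = 1 \<Longrightarrow> r > 1 / s1 \<Longrightarrow>
    V (r *\<^sub>R w) = exp (\<i> * cof (k * r)) / cof r * h (cof (1 / r)) w"
 shows "far_expansion k s1 B h V"
 using assms unfolding far_expansion_def by blast

lemma far_expansionD:
 assumes "far_expansion k s1 B h V" "norm w = 1"
 shows "(\<lambda>s. h s w) holomorphic_on ball 0 s1" "s \<in> ball 0 s1 \<Longrightarrow> norm (h s w) \<le> B"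
  "r > 1 / s1 \<Longrightarrow> V (r *\<^sub>R w) = exp (\<i> * cof (k * r)) / cof r * h (cof (1 / r)) w"
 using assms unfolding far_expansion_def by blast+

text \<open>By \<open>exterior_representation\<close>, \<open>V\<close> is an integral of
  \<open>fsol\<close> and its derivative over one fixed shell; factoring these by
  \<open>fsol_far\<close> makes the integrand holomorphic in \<open>1 / r\<close>.\<close>

theorem radiating_expansion:
 fixes V DV :: wave
 assumes k: "k > 0" and R0: "R0 > 0" and weak: "weak_helmholtz k {y. norm y > R0} V"
  and dV: "\<And>y. norm y > R0 \<Longrightarrow> ((\<lambda>s. V (s *\<^sub>R y)) has_vector_derivative DV y) (at 1)"
  and som: "\<And>\<eta>. \<eta> > 0 \<Longrightarrow> \<exists>R. \<forall>y. norm y \<ge> R \<longrightarrow> norm y > R0 \<longrightarrow> norm (DV y - \<i> * cof (k * norm y) * V y) \<le> \<eta>"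
 obtains s1 B h where "s1 > 0" "R0 < 1 / s1" "far_expansion k s1 B h V"
proof -
 \<comment> \<open>Inside the ball \<open>V\<close> is arbitrary, perhaps not measurable; setting it
   to 0 there leaves the hypotheses intact, since they concern the exterior.\<close>
 define Vm where "Vm y = (if norm y > R0 then V y else 0)" for y
 have cV: "continuous_on {y. norm y > R0} V" by (rule weak_helmholtz_continuous[OF weak])
 have oS: "open {y :: real^3. norm y > R0}" by (intro open_Collect_less continuous_intros)
 have Vmm: "Vm \<in> borel_measurable borel"
 proof -
  have "(\<lambda>y. indicator {y. norm y > R0} y *\<^sub>R V y) \<in> borel_measurable borel"
   by (rule borel_measurable_continuous_on_indicator[OF _ cV]) (use oS in simp)
  moreover have "(\<lambda>y. indicator {y. norm y > R0} y *\<^sub>R V y) = Vm" by (auto simp: Vm_def indicator_def)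
  ultimately show ?thesis by simp
 qed
 have weakm: "weak_helmholtz k {y. norm y > R0} Vm" by (rule weak_helmholtz_cong[OF weak]) (simp add: Vm_def)
 have cVm: "continuous_on {y. norm y > R0} Vm" by (rule weak_helmholtz_continuous[OF weakm])
 have dVm: "((\<lambda>s. Vm (s *\<^sub>R y)) has_vector_derivative DV y) (at 1)" if "norm y > R0" for y
 proof (rule has_vector_derivative_transform_within_open[OF dV[OF that]])
  show "open ((\<lambda>s. s *\<^sub>R y) -` {y. norm y > R0})" by (rule open_vimage[OF oS]) (intro continuous_intros)
 qed (use that in \<open>auto simp: Vm_def\<close>)
 have somm: "\<exists>R. \<forall>y. norm y \<ge> R \<longrightarrow> norm y > R0 \<longrightarrow> norm (DV y - \<i> * cof (k * norm y) * Vm y) \<le> \<eta>" if "\<eta> > 0" for \<eta>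
  using som[OF that] by (auto simp: Vm_def)
 define r1 where "r1 = R0 + 1"
 have r1: "r1 > R0" "r1 > 0" using R0 by (simp_all add: r1_def)
 \<comment> \<open>\<open>2 * r1\<close> bounds the points of the shell, and this value gives
   equality in the condition \<open>4 * s0 * (2 * r1) \<le> 1\<close> of \<open>far_arg_pos\<close>.
   Halving it once more, in \<open>s1\<close>, makes room for uniform bounds.\<close>
 define s0 where "s0 = 1 / (8 * r1)"
 have s0: "s0 > 0" "4 * s0 * (2 * r1) \<le> 1" using r1 by (simp_all add: s0_def)
 define s1 where "s1 = s0 / 2"
 have s1: "s1 > 0" "s1 < s0" using s0 by (simp_all add: s1_def)
 have is1: "1 / s1 = 16 * r1" using r1 by (simp add: s1_def s0_def)
 define T where "T = {y :: real^3. norm y > R0} \<inter> ball 0 (2 * r1)"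
 have oT: "open T" unfolding T_def by (intro open_Int oS) auto
 define K where "K = shell (0::real^3) r1"
 have K: "compact K" unfolding K_def by (rule compact_shell)
 have KT: "K \<subseteq> T"
 proof
  fix y assume y: "y \<in> K"
  hence "r1\<^sup>2 \<le> (norm y)\<^sup>2" by (simp add: K_def shell_def power2_norm_eq_inner)
  hence 1: "r1 \<le> norm y" by (rule power2_le_imp_le) simp
  have "(norm y)\<^sup>2 \<le> 2 * r1\<^sup>2" using y by (simp add: K_def shell_def power2_norm_eq_inner)
  also have "\<dots> < (2 * r1)\<^sup>2" using r1 by (simp add: power_mult_distrib)
  finally have "norm y < 2 * r1" by (rule power2_less_imp_less) (use r1 in simp)
  thus "y \<in> T" using 1 r1 by (simp add: T_def)
 qed
 define c1 where "c1 y = cutoff r1 1 (y \<bullet> y)" for y :: "real^3"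
 define c2 where "c2 y = 6 * cutoff r1 1 (y \<bullet> y) + 4 * cof (y \<bullet> y) * cutoff r1 2 (y \<bullet> y)" for y :: "real^3"
 have cc: "continuous_on A c1" "continuous_on A c2" for A unfolding c1_def c2_def
  by (intro continuous_intros continuous_on_compose2[OF continuous_on_cutoff[OF r1(2)]]; auto)+
 have c0: "c1 y = 0" "c2 y = 0" if "y \<notin> K" for y
  using cutoff_zero_off_shell[OF r1(2), of y 0 1] cutoff_zero_off_shell[OF r1(2), of y 0 2] that by (simp_all add: K_def c1_def c2_def)
 define f where "f s p = Vm (snd p) * (4 * c1 (snd p) * (s * cof (snd p \<bullet> snd p) + cof (- (fst p \<bullet> snd p))) * far_amp1 k s p + c2 (snd p) * far_amp k s p)" for s p
 define D where "D = {p :: (real^3) \<times> (real^3). norm (fst p) \<le> 1 \<and> snd p \<in> T}"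
 have Ddom: "D \<subseteq> far_dom (2 * r1)" by (auto simp: D_def far_dom_def T_def)
 note hc = far_root_hol_cont[OF s0(2)]
 have cVT: "continuous_on T Vm" by (rule continuous_on_subset[OF cVm]) (auto simp: T_def)
 have par: "continuous_on D (\<lambda>p. Vm (snd p))" "continuous_on D (\<lambda>p. c1 (snd p))" "continuous_on D (\<lambda>p. c2 (snd p))"
  by (rule continuous_on_compose2[OF cVT] continuous_on_compose2[OF cc(1)] continuous_on_compose2[OF cc(2)]; auto simp: D_def intro!: continuous_intros)+
 have hf: "hol_cont (ball 0 s0) D f" unfolding f_def
  by (intro hol_cont_mult hol_cont_add hol_cont_ident hol_cont_param par hol_cont_subset[OF hc(2) subset_refl Ddom] hol_cont_subset[OF hc(3) subset_refl Ddom] continuous_intros)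
 have fz: "f s (w, y) = 0" if "y \<notin> K" for s w y using c0[OF that] by (simp add: f_def)
 define h where "h s w = - (LINT y|lborel. f s (w, y)) / cof repr_const" for s w
 have hol: "(\<lambda>s. LINT y|lborel. f s (w, y)) holomorphic_on ball 0 s0" if w: "norm w = 1" for w
 proof -
  have "hol_cont (ball 0 s0) T (\<lambda>s y. f s (w, y))"
   by (rule hol_cont_compose_param[OF hf]) (use w in \<open>auto simp: D_def intro!: continuous_intros\<close>)
  then obtain f' where f': "\<And>s y. s \<in> ball 0 s0 \<Longrightarrow> y \<in> T \<Longrightarrow> ((\<lambda>s. f s (w, y)) has_field_derivative f' s y) (at s)"
   "continuous_on (ball 0 s0 \<times> T) (\<lambda>p. f (fst p) (w, snd p))" "continuous_on (ball 0 s0 \<times> T) (\<lambda>p. f' (fst p) (snd p))"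
   unfolding hol_cont_def by blast
  \<comment> \<open>\<open>f'\<close> is unspecified off \<open>T\<close>. Since \<open>f\<close>
    vanishes for \<open>y\<close> off \<open>K\<close>, replacing the derivative by 0 there changes
    nothing on \<open>T\<close>.\<close>
  define f2 where "f2 s y = (if y \<in> K then f' s y else 0)" for s y
  have eq: "f2 s y = f' s y" if "s \<in> ball 0 s0" "y \<in> T" for s y
  proof (cases "y \<in> K")
   case False
   have "((\<lambda>s. 0) has_field_derivative f' s y) (at s)" using f'(1)[OF that] fz[OF False] by simp
   thus ?thesis using DERIV_unique[OF _ DERIV_const] False by (simp add: f2_def) blast
  qed (simp add: f2_def)
  show ?thesis
  proof (rule holomorphic_parametric_integral[OF open_ball convex_ball oT K KT, where f' = f2])
   show "((\<lambda>s. f s (w, y)) has_field_derivative f2 s y) (at s)" if "s \<in> ball 0 s0" "y \<in> T" for s y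
    unfolding eq[OF that] by (rule f'(1)[OF that])
   show "continuous_on T (\<lambda>y. f s (w, y))" if "s \<in> ball 0 s0" for s
   proof -
    have c: "continuous_on T (\<lambda>y. (s, y))" by (intro continuous_intros)
    have im: "(\<lambda>y. (s, y)) ` T \<subseteq> ball 0 s0 \<times> T" using that by auto
    from continuous_on_compose2[OF f'(2) c im] show ?thesis by simp
   qed
   have "continuous_on (ball 0 s0 \<times> T) (\<lambda>p. f2 (fst p) (snd p))"
    using f'(3) by (rule continuous_on_cong[THEN iffD1, rotated 2]) (auto simp: eq)
   thus "continuous_on (ball 0 s0 \<times> T) (\<lambda>(s, y). f2 s y)" by (simp add: case_prod_unfold)
  qed (auto simp: fz f2_def)
 qed
 obtain Bf where Bf: "\<And>s w y. s \<in> cball 0 s1 \<Longrightarrow> norm w \<le> 1 \<Longrightarrow> y \<in> K \<Longrightarrow> norm (f s (w, y)) \<le> Bf"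
 proof -
  define C where "C = cball (0::complex) s1 \<times> (cball (0::real^3) 1 \<times> K)"
  have "compact C" unfolding C_def by (intro compact_Times compact_cball K)
  moreover have "continuous_on C (\<lambda>p. f (fst p) (snd p))"
   by (rule continuous_on_subset[OF hol_cont_continuous[OF hf]]) (use s1 KT in \<open>auto simp: C_def D_def\<close>)
  ultimately have "bounded ((\<lambda>p. f (fst p) (snd p)) ` C)" by (intro compact_imp_bounded compact_continuous_image)
  then obtain B where B: "\<forall>z\<in>(\<lambda>p. f (fst p) (snd p)) ` C. norm z \<le> B" unfolding bounded_iff by blast
  show ?thesis
  proof (rule that)
   fix s :: complex and w y :: "real^3" assume "s \<in> cball 0 s1" "norm w \<le> 1" "y \<in> K"
   hence "(s, (w, y)) \<in> C" by (simp add: C_def)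
   from bspec[OF B imageI[OF this, of "\<lambda>p. f (fst p) (snd p)"]] show "norm (f s (w, y)) \<le> B" by simp
  qed
 qed
 have fint: "(\<lambda>y. f s (w, y)) \<in> borel_measurable borel" if "s \<in> ball 0 s0" "norm w = 1" for s w
 proof (rule borel_measurable_continuous_onI, rule continuous_on_UNIV_support[OF _ oT K KT])
  show "continuous_on T (\<lambda>y. f s (w, y))"
  proof -
   have c: "continuous_on T (\<lambda>y. (s, (w, y)))" by (intro continuous_intros)
   have im: "(\<lambda>y. (s, (w, y))) ` T \<subseteq> ball 0 s0 \<times> D" using that by (auto simp: D_def)
   from continuous_on_compose2[OF hol_cont_continuous[OF hf] c im] show ?thesis by simp
  qed
 qed (rule fz)
 define Bf' where "Bf' = max Bf 0"
 define B where "B = Bf' * measure lborel (cball (0::real^3) (2 * r1)) / repr_const"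
 show ?thesis
 proof (rule that[OF _ _ far_expansionI[of h s1 B]])
  show "s1 > 0" by (rule s1)
  show "R0 < 1 / s1" unfolding is1 using r1 by simp
  show "(\<lambda>s. h s w) holomorphic_on ball 0 s1" if "norm w = 1" for w
   unfolding h_def using hol[OF that] s1 repr_const_pos
   by (intro holomorphic_intros) (auto intro: holomorphic_on_subset)
  show "norm (h s w) \<le> B" if "norm w = 1" "s \<in> ball 0 s1" for w s
  proof -
   have s: "s \<in> cball 0 s1" "s \<in> ball 0 s0" using that s1 by auto
   have "norm (LINT y|lborel. f s (w, y)) \<le> Bf' * measure lborel (cball (0::real^3) (2 * r1))"
   proof (rule integrable_bounded_support(2)[OF fint[OF s(2) that(1)]])
    show "norm (f s (w, y)) \<le> Bf'" for y
     using Bf[OF s(1), of w y] that(1) fz[of y s w] by (cases "y \<in> K") (auto simp: Bf'_def)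
    show "f s (w, y) = 0" if "norm y > 2 * r1" for y
     by (rule fz) (use that KT in \<open>auto simp: T_def\<close>)
   qed (simp add: Bf'_def)
   thus ?thesis using repr_const_pos by (simp add: h_def B_def norm_divide divide_right_mono)
  qed
  fix w :: "real^3" and r :: real assume w: "norm w = 1" and r: "r > 1 / s1"
  have r16: "r > 16 * r1" using r is1 by simp
  have r0: "r > 0" using r16 r1 by linarith
  have rs: "1 / r < s0"
  proof -
   have "r > 8 * r1" using r16 r1 by linarith
   thus ?thesis using r0 r1 by (simp add: s0_def frac_less2)
  qed
  define x where "x = r *\<^sub>R w"
  have nx: "norm x = r" using w r0 by (simp add: x_def)
  have x2: "norm x > 2 * r1" using nx r16 r1 by linarith
  have Vx: "Vm x = V x" using x2 r1 by (simp add: Vm_def)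
  have "repr_const * Vm x = - (LINT y|lborel. Vm y * repr_kernel k (cutoff r1 1) (cutoff r1 2) 0 x y)"
   by (rule exterior_representation[OF k R0 weakm Vmm dVm somm r1(1) x2])
  also have "(LINT y|lborel. Vm y * repr_kernel k (cutoff r1 1) (cutoff r1 2) 0 x y) =
   (LINT y|lborel. exp (\<i> * cof (k * r)) / cof r * f (cof (1 / r)) (w, y))"
  proof (rule Bochner_Integration.integral_cong[OF refl])
   fix y :: "real^3"
   show "Vm y * repr_kernel k (cutoff r1 1) (cutoff r1 2) 0 x y = exp (\<i> * cof (k * r)) / cof r * f (cof (1 / r)) (w, y)"
   proof (cases "y \<in> K")
    case False
    thus ?thesis using fz[OF False] repr_kernel_zero_off_shell[OF r1(2)] by (simp add: K_def)
   next
    case True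
    hence yb: "norm y \<le> 2 * r1" using KT by (auto simp: T_def)
    have sw: "(y - x) \<bullet> (y - x) = (r *\<^sub>R w - y) \<bullet> (r *\<^sub>R w - y)"
     by (simp add: x_def inner_diff_left inner_diff_right algebra_simps)
    have yx: "cof (y \<bullet> (y - x)) = cof r * (cof (1 / r) * cof (y \<bullet> y) + cof (- (w \<bullet> y)))"
     using r0 by (simp add: x_def inner_diff_right inner_commute algebra_simps)
    note F = fsol_far[OF s0(2) w r0 yb rs, of k]
    show ?thesis unfolding repr_kernel_def Let_def diff_zero sw F yx f_def fst_conv snd_conv c1_def c2_def
     using r0 by (simp add: power2_eq_square algebra_simps)
   qed
  qed
  also have "\<dots> = exp (\<i> * cof (k * r)) / cof r * (LINT y|lborel. f (cof (1 / r)) (w, y))"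
   by (rule integral_mult_right_zero)
  finally have "cof repr_const * V x = cof repr_const * (exp (\<i> * cof (k * r)) / cof r * h (cof (1 / r)) w)"
   using repr_const_pos by (simp add: Vx h_def)
  moreover have "cof repr_const \<noteq> 0" using repr_const_pos by simp
  ultimately have "V x = exp (\<i> * cof (k * r)) / cof r * h (cof (1 / r)) w"
   by (metis mult_left_cancel)
  thus "V (r *\<^sub>R w) = exp (\<i> * cof (k * r)) / cof r * h (cof (1 / r)) w"
   by (simp only: x_def)
 qed
qed

section \<open>Rellich's lemma\<close>

lemma step0_bounds: "0 \<le> step 0 t" "step 0 t \<le> 1"
proof -
 have i: "bump 0 integrable_on {a..b}" for a b
  by (intro integrable_continuous_real continuous_on_subset[OF continuous_on_bump]) auto
 have n: "integral {0..t} (bump 0) \<ge> 0" by (rule integral_nonneg[OF i]) (simp add: bump0_nonneg)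
 show "0 \<le> step 0 t" using n bump_mass_pos by (simp add: step_def)
 show "step 0 t \<le> 1"
 proof (cases "t \<ge> 2")
  case False
  hence "integral {0..t} (bump 0) \<le> bump_mass" unfolding bump_mass_def
   by (intro integral_subset_le i) (auto simp: bump0_nonneg)
  thus ?thesis using bump_mass_pos by (simp add: step_def)
 qed (simp add: step_one)
qed

text \<open>For \<open>norm z \<ge> R / 2\<close> the quotient is bounded by
  \<open>2 * M / R\<close> directly, and the maximum principle carries the bound to the smaller
  disc. The explicit constant makes the bounds in \<open>rellich\<close> geometric.\<close>

lemma holomorphic_divide_out:
 fixes f :: "complex \<Rightarrow> complex"
 assumes f: "f holomorphic_on ball 0 R" and R: "R > 0" and M: "\<And>z. z \<in> ball 0 R \<Longrightarrow> norm (f z) \<le> M" and f0: "f 0 = 0"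
 obtains g where "g holomorphic_on ball 0 R" "\<And>z. z \<in> ball 0 R \<Longrightarrow> f z = z * g z"
  "\<And>z. z \<in> ball 0 R \<Longrightarrow> norm (g z) \<le> 2 * M / R"
proof -
 obtain g where g: "g holomorphic_on ball 0 R" "\<And>z. norm z < R \<Longrightarrow> f z = z * g z" using Schwarz3[OF f f0] by metis
 have far: "norm (g z) \<le> 2 * M / R" if "norm z < R" "R / 2 \<le> norm z" for z
 proof -
  have "norm z * norm (g z) \<le> M" using M[of z] g(2)[OF that(1)] that by (simp add: norm_mult)
  moreover have "R / 2 * norm (g z) \<le> norm z * norm (g z)" using that by (intro mult_right_mono) auto
  ultimately have "R / 2 * norm (g z) \<le> M" by linarith
  thus ?thesis using R by (simp add: field_simps)
 qed
 have near: "norm (g z) \<le> 2 * M / R" if "norm z < R / 2" for z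
 proof (rule maximum_modulus_frontier[of g "cball 0 (R/2)"])
  have sub: "cball 0 (R/2) \<subseteq> ball (0::complex) R" using R by auto
  show "g holomorphic_on interior (cball 0 (R/2))" by (rule holomorphic_on_subset[OF g(1)]) (use sub interior_subset in blast)
  show "continuous_on (closure (cball 0 (R/2))) g"
   using continuous_on_subset[OF holomorphic_on_imp_continuous_on[OF g(1)] sub] by simp
  show "norm (g z) \<le> 2 * M / R" if "z \<in> frontier (cball 0 (R/2))" for z
   by (rule far) (use that R in \<open>auto simp: frontier_cball\<close>)
 qed (use that R in auto)
 show ?thesis
 proof (rule that[OF g(1)])
  show "norm (g z) \<le> 2 * M / R" if "z \<in> ball 0 R" for z
   using far[of z] near[of z] that by (cases "norm z < R / 2") auto
 qed (use g in auto)
qed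

text \<open>\<open>exp (- i k r)\<close> as a function of \<open>z = r\<^sup>2\<close>, with two
  derivatives. The factor \<open>1 / r\<close> of a genuine incoming solution is left out; the
  resulting defect \<open>- 2 i k / r\<close> in the Helmholtz equation becomes part of the
  transport operator.\<close>

definition inwave :: "real \<Rightarrow> nat \<Rightarrow> complex \<Rightarrow> complex" where
 "inwave k j z = (let q = csqrt z in
   if j = 0 then exp (- \<i> * k * q)
   else if j = 1 then exp (- \<i> * k * q) * (- \<i> * k) / (2 * q)
   else exp (- \<i> * k * q) * (\<i> * k - k\<^sup>2 * q) / (4 * q ^ 3))"

lemma inwave_deriv:
 assumes z: "z \<notin> \<real>\<^sub>\<le>\<^sub>0" and j: "j < 2"
 shows "(inwave k j has_field_derivative inwave k (Suc j) z) (at z)"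
proof -
 define q where "q = csqrt z"
 have q: "q \<noteq> 0" using csqrt_nonzero[OF z] by (simp add: q_def)
 have d: "(csqrt has_field_derivative (1 / (2 * q))) (at z)"
  using has_field_derivative_csqrt[OF z] by (simp add: q_def inverse_eq_divide)
 have chain: "((\<lambda>z. F (csqrt z)) has_field_derivative F' * (1 / (2 * q))) (at z)"
  if "(F has_field_derivative F') (at q)" for F F'
  using DERIV_chain2[OF _ d, of F F'] that by (simp add: q_def)
 consider "j = 0" | "j = 1" using j by linarith
 thus ?thesis
 proof cases
  case 1
  have "((\<lambda>q. exp (- \<i> * k * q)) has_field_derivative exp (- \<i> * k * q) * (- \<i> * k)) (at q)"
   by (rule derivative_eq_intros refl | simp)+
  from chain[OF this] have "((\<lambda>z. exp (- \<i> * k * csqrt z)) has_field_derivative exp (- \<i> * k * q) * (- \<i> * k) / (2 * q)) (at z)"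
   by simp
  thus ?thesis using 1 by (simp add: inwave_def[abs_def] Let_def q_def)
 next
  case 2
  have "((\<lambda>q. exp (- \<i> * k * q) * (- \<i> * k) / (2 * q)) has_field_derivative
    (exp (- \<i> * k * q) * (- \<i> * k) * (- \<i> * k) * (2 * q) - exp (- \<i> * k * q) * (- \<i> * k) * 2) / ((2 * q) * (2 * q))) (at q)"
   by (rule derivative_eq_intros refl | simp add: q)+
  from chain[OF this] have "((\<lambda>z. exp (- \<i> * k * csqrt z) * (- \<i> * k) / (2 * csqrt z)) has_field_derivative
    exp (- \<i> * k * q) * (\<i> * k - k\<^sup>2 * q) / (4 * q ^ 3)) (at z)"
  proof (rule DERIV_cong)
   define e where "e = exp (- \<i> * k * q)"
   have ii: "\<i> * \<i> = -1" by simp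
   have "(e * (- \<i> * k) * (- \<i> * k) * (2 * q) - e * (- \<i> * k) * 2) * (4 * q ^ 3) = e * (\<i> * k - k\<^sup>2 * q) * (((2 * q) * (2 * q)) * (2 * q))"
    unfolding of_real_power using ii by algebra
   thus "(exp (- \<i> * k * q) * (- \<i> * k) * (- \<i> * k) * (2 * q) - exp (- \<i> * k * q) * (- \<i> * k) * 2) / ((2 * q) * (2 * q)) * (1 / (2 * q)) =
     exp (- \<i> * k * q) * (\<i> * k - k\<^sup>2 * q) / (4 * q ^ 3)"
    unfolding e_def using q by (simp add: frac_eq_eq)
  qed
  thus ?thesis using 2 by (simp add: inwave_def[abs_def] Let_def q_def numeral_2_eq_2[symmetric])
 qed
qed

lemma inwave_real_deriv:
 assumes "t > 0" "j < 2"
 shows "((\<lambda>t. inwave k j (cof t)) has_vector_derivative inwave k (Suc j) (cof t)) (at t)"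
proof -
 have "(cof has_vector_derivative 1) (at t)"
  using has_vector_derivative_of_real[OF DERIV_ident[of "at t"]] by simp
 hence "(inwave k j \<circ> cof has_vector_derivative 1 * inwave k (Suc j) (cof t)) (at t)"
  by (rule field_vector_diff_chain_at) (rule inwave_deriv[OF pos_notin_nonpos_Reals[OF assms(1)] assms(2)])
 thus ?thesis by (simp add: o_def)
qed

text \<open>\<open>outgoing\<close> depends on the norm alone, so \<open>axis 1 1\<close> just
  stands for some unit vector.\<close>

lemma inwave_values:
 assumes "r > 0"
 shows "inwave k 0 (cof (r\<^sup>2)) = outgoing (-k) (r *\<^sub>R axis 1 1)"
  "inwave k 1 (cof (r\<^sup>2)) = outgoing (-k) (r *\<^sub>R axis 1 1) * (- \<i> * cof k) / (2 * cof r)"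
  "6 * inwave k 1 (cof (r\<^sup>2)) + 4 * cof (r\<^sup>2) * inwave k 2 (cof (r\<^sup>2)) + (cof k)\<^sup>2 * inwave k 0 (cof (r\<^sup>2)) =
   outgoing (-k) (r *\<^sub>R axis 1 1) * (- 2 * \<i> * cof k) / cof r"
proof -
 have c: "csqrt (cof (r\<^sup>2)) = cof r" using assms by (simp add: csqrt_of_real_nonneg del: of_real_power)
 have o: "outgoing (-k) (r *\<^sub>R axis 1 1) = exp (- \<i> * cof k * cof r)"
  using assms by (simp add: outgoing_def mult.assoc)
 show "inwave k 0 (cof (r\<^sup>2)) = outgoing (-k) (r *\<^sub>R axis 1 1)"
  "inwave k 1 (cof (r\<^sup>2)) = outgoing (-k) (r *\<^sub>R axis 1 1) * (- \<i> * cof k) / (2 * cof r)"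
  by (simp_all only: inwave_def Let_def c o) simp_all
 define q where "q = cof r"
 define e where "e = exp (- \<i> * cof k * q)"
 have q: "q \<noteq> 0" using assms by (simp add: q_def)
 have key: "6 * (e * (- \<i> * cof k) / (2 * q)) + 4 * q\<^sup>2 * (e * (\<i> * cof k - (cof k)\<^sup>2 * q) / (4 * q ^ 3)) + (cof k)\<^sup>2 * e =
   e * (- 2 * \<i> * cof k) / q"
  using q by (simp add: field_simps power2_eq_square power3_eq_cube)
 have v: "inwave k 1 (cof (r\<^sup>2)) = e * (- \<i> * cof k) / (2 * q)"
  "inwave k 2 (cof (r\<^sup>2)) = e * (\<i> * cof k - (cof k)\<^sup>2 * q) / (4 * q ^ 3)"
  "inwave k 0 (cof (r\<^sup>2)) = e"
  by (simp_all only: inwave_def Let_def c e_def q_def) simp_all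
 have q2: "cof (r\<^sup>2) = q\<^sup>2" by (simp add: q_def)
 show "6 * inwave k 1 (cof (r\<^sup>2)) + 4 * cof (r\<^sup>2) * inwave k 2 (cof (r\<^sup>2)) + (cof k)\<^sup>2 * inwave k 0 (cof (r\<^sup>2)) =
   outgoing (-k) (r *\<^sub>R axis 1 1) * (- 2 * \<i> * cof k) / cof r"
  unfolding v o q_def[symmetric] e_def[symmetric] unfolding q2 by (rule key)
qed

lemma cutoff_scale:
 assumes "R > 0" "\<delta> > 0"
 shows "cutoff (R * \<delta>) j (R\<^sup>2 * t) = cutoff \<delta> j t / (cof (R\<^sup>2)) ^ j"
proof -
 have e: "R\<^sup>2 * t / (R * \<delta>)\<^sup>2 = t / \<delta>\<^sup>2" "((R * \<delta>)\<^sup>2) ^ j = (R\<^sup>2) ^ j * (\<delta>\<^sup>2) ^ j"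
  using assms by (simp_all add: power_mult_distrib)
 show ?thesis unfolding cutoff_def e by (cases "j = 0") (simp_all add: mult.commute)
qed

text \<open>Tested against an incoming wave times a bump dilated by \<open>R\<close>, the equation becomes, to leading order
 as \<open>R\<close> grows, a transport equation for the leading coefficient.\<close>
lemma transport_identity:
 fixes W :: wave and g :: "complex \<Rightarrow> wave"
 assumes k: "k > 0" and s1: "s1 > 0" and weak: "weak_helmholtz k {x. norm x > 1 / s1} W"
  and g: "\<And>w. norm w = 1 \<Longrightarrow> (\<lambda>s. g s w) holomorphic_on ball 0 s1"
  and M: "\<And>w s. norm w = 1 \<Longrightarrow> s \<in> ball 0 s1 \<Longrightarrow> norm (g s w) \<le> M"
  and rep: "\<And>w r. norm w = 1 \<Longrightarrow> r > 1 / s1 \<Longrightarrow>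
    W (r *\<^sub>R w) = exp (\<i> * cof (k * r)) / cof r ^ Suc n * g (cof (1 / r)) w"
  and e0: "norm e0 = 1" and d: "\<delta> > 0" "\<delta> \<le> 1/4"
  and G: "\<And>y. G y = g 0 (y /\<^sub>R norm y) / cof (norm y) ^ (n + 2)"
  and cG: "continuous_on (- {0}) G"
 shows "(LINT y|lborel. G y * (cof (2 * (y \<bullet> (y - e0))) * cutoff \<delta> 1 ((y - e0) \<bullet> (y - e0)) + cutoff \<delta> 0 ((y - e0) \<bullet> (y - e0)))) = 0"
proof -
 define sg where "sg y = (y - e0) \<bullet> (y - e0)" for y
 define K0 where "K0 = {y. sg y \<le> 2 * \<delta>\<^sup>2}"
 have K0n: "norm y > 1/2" if "y \<in> K0" for y
 proof -
  have "(norm (y - e0))\<^sup>2 \<le> 2 * \<delta>\<^sup>2" using that by (simp add: K0_def sg_def power2_norm_eq_inner)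
  also have "\<dots> \<le> 2 * (1/4)\<^sup>2" using d by (intro mult_left_mono power_mono) auto
  also have "\<dots> < (1/2)\<^sup>2" by (simp add: power2_eq_square)
  finally have "norm (y - e0) < 1/2" by (rule power2_less_imp_less) simp
  thus ?thesis using norm_triangle_sub[of e0 y] e0 by (simp add: norm_minus_commute)
 qed
 have K0b: "K0 \<subseteq> cball e0 1"
 proof
  fix y assume "y \<in> K0"
  hence "(norm (y - e0))\<^sup>2 \<le> 2 * \<delta>\<^sup>2" by (simp add: K0_def sg_def power2_norm_eq_inner)
  also have "\<dots> \<le> 2 * (1/4)\<^sup>2" using d by (intro mult_left_mono power_mono) auto
  also have "\<dots> \<le> 1\<^sup>2" by (simp add: power2_eq_square)
  finally have "norm (y - e0) \<le> 1" by (rule power2_le_imp_le) simp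
  thus "y \<in> cball e0 1" by (simp add: dist_norm norm_minus_commute)
 qed
 have csg: "continuous_on A sg" for A unfolding sg_def by (intro continuous_intros)
 have K0: "compact K0"
 proof -
  have "closed K0" unfolding K0_def by (intro closed_Collect_le csg continuous_intros)
  thus ?thesis using K0b bounded_subset[OF bounded_cball] compact_eq_bounded_closed by blast
 qed
 define c where "c j y = cutoff \<delta> j (sg y)" for j y
 have cc: "continuous_on A (c j)" if "j \<le> 4" for A j unfolding c_def
  by (rule continuous_on_compose2[OF continuous_on_cutoff[OF d(1) that] csg]) auto
 have c0: "c j y = 0" if "y \<notin> K0" for j y
  using cutoff_outside[OF d(1), of "sg y" j] that by (simp add: c_def K0_def)
 define a1 where "a1 y = 6 * c 1 y + 4 * cof (sg y) * c 2 y" for y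
 define a2 where "a2 y = cof (2 * (y \<bullet> (y - e0))) * c 1 y + c 0 y" for y
 have ca1: "continuous_on A a1" for A unfolding a1_def by (intro continuous_intros cc csg) auto
 have ca2: "continuous_on A a2" for A unfolding a2_def by (intro continuous_intros cc) auto
 have az: "a1 y = 0" "a2 y = 0" if "y \<notin> K0" for y using c0[OF that] by (simp_all add: a1_def a2_def)
 \<comment> \<open>This is \<open>helm\<close> of the dilated test function divided by the incoming
   phase and by \<open>1 / R\<close>: the Laplacian of the bump, \<open>a1\<close>, is one order in
   \<open>1 / R\<close> below the transport term \<open>a2\<close>.\<close>
 define brk where "brk R y = cof (1 / R) * a1 y - 2 * \<i> * cof k * cof (1 / norm y) * a2 y" for R y
 define S where "S R y = cof (R ^ Suc n) * (W (R *\<^sub>R y) * outgoing (-k) (R *\<^sub>R y) * brk R y)" for R y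
 have int0: "(LINT y|lborel. S R y) = 0" and Sm: "S R \<in> borel_measurable borel" if R: "R > 2 / s1" for R
 proof -
  have R0: "R > 0" using R divide_pos_pos[of 2 s1] s1 by linarith
  define Kp where "Kp = {y. (y - R *\<^sub>R e0) \<bullet> (y - R *\<^sub>R e0) \<le> 2 * (R * \<delta>)\<^sup>2}"
  have scal: "((R *\<^sub>R y) - R *\<^sub>R e0) \<bullet> ((R *\<^sub>R y) - R *\<^sub>R e0) = R\<^sup>2 * sg y" for y
   by (simp add: sg_def scaleR_diff_right[symmetric] power2_eq_square)
  have KpK: "R *\<^sub>R y \<in> Kp \<longleftrightarrow> y \<in> K0" for y
   unfolding Kp_def K0_def mem_Collect_eq scal using R0 by (simp add: power_mult_distrib)
  have Kpe: "Kp = (\<lambda>y. R *\<^sub>R y) ` K0"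
  proof (intro set_eqI iffI)
   fix y assume y: "y \<in> Kp"
   have "y = R *\<^sub>R (y /\<^sub>R R)" using R0 by simp
   moreover have "y /\<^sub>R R \<in> K0" using y KpK[of "y /\<^sub>R R"] R0 by simp
   ultimately show "y \<in> (\<lambda>y. R *\<^sub>R y) ` K0" by blast
  qed (use KpK in auto)
  have Kpc: "compact Kp" unfolding Kpe by (intro compact_continuous_image K0 continuous_intros)
  have Kpn: "norm y > R / 2" if "y \<in> Kp" for y
   using that K0n R0 unfolding Kpe by (auto simp: field_simps)
  have R2: "R / 2 > 1 / s1" using R by simp
  have Kps: "Kp \<subseteq> {x. norm x > 1 / s1}" using Kpn R2 by force
  have Rd: "R * \<delta> > 0" using R0 d by simp
  note dc = C2_data_radial[OF cutoff_derivs[OF Rd], of "R *\<^sub>R e0"]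
  \<comment> \<open>As a function of the squared radius the incoming wave is singular at the origin;
    gluing below radius \<open>R / 2\<close> does not touch the support of the bump, which lies
    farther out.\<close>
  define E where "E = taylor_glue ((R/2)\<^sup>2) (\<lambda>j t. inwave k j (cof t))"
  have Rp: "(R/2)\<^sup>2 > 0" using R0 by simp
  have ia: "((\<lambda>t. inwave k j (cof t)) has_vector_derivative inwave k (Suc j) (cof t)) (at t)" if "t \<ge> (R/2)\<^sup>2" "j < 2" for t j
   by (rule inwave_real_deriv) (use that Rp in linarith)+
  have ib: "continuous_on {(R/2)\<^sup>2..} (\<lambda>t. inwave k 2 (cof t))"
  proof -
   have pos: "t > 0" if "t \<in> {(R/2)\<^sup>2..}" for t using less_le_trans[OF Rp, of t] that by simp
   have cs: "continuous_on {(R/2)\<^sup>2..} (\<lambda>t. csqrt (cof t))"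
    by (rule continuous_on_compose2[OF continuous_on_csqrt]) (intro continuous_intros, use pos pos_notin_nonpos_Reals in blast)
   show ?thesis unfolding inwave_def Let_def using csqrt_nonzero[OF pos_notin_nonpos_Reals[OF pos]]
    by (auto intro!: continuous_intros cs)
  qed
  note T = taylor_glue_deriv[of "(R/2)\<^sup>2" "\<lambda>j t. inwave k j (cof t)", OF ia ib, folded E_def]
  have Ed: "\<And>t. (E 0 has_vector_derivative E 1 t) (at t)" "\<And>t. (E 1 has_vector_derivative E 2 t) (at t)" "continuous_on UNIV (E 2)"
   using T by blast+
  note dE = C2_data_radial[OF Ed, of 0]
  note pr = C2_data_mult[OF dc dE]
  have cz: "cutoff (R * \<delta>) j ((y - R *\<^sub>R e0) \<bullet> (y - R *\<^sub>R e0)) = 0" if "y \<notin> Kp" for y j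
   by (rule cutoff_outside[OF Rd]) (use that in \<open>simp add: Kp_def\<close>)
  have prz: "cutoff (R * \<delta>) 0 ((y - R *\<^sub>R e0) \<bullet> (y - R *\<^sub>R e0)) * E 0 ((y - 0) \<bullet> (y - 0)) = 0" if "y \<notin> Kp" for y
   using cz[OF that] by simp
  define H where "H = helm k (\<lambda>y. cutoff (R * \<delta>) 0 ((y - R *\<^sub>R e0) \<bullet> (y - R *\<^sub>R e0)) * E 0 ((y - 0) \<bullet> (y - 0)))
   (\<lambda>i j y. cutoff (R * \<delta>) 0 ((y - R *\<^sub>R e0) \<bullet> (y - R *\<^sub>R e0)) * ((if i = j then 2 else 0) *\<^sub>R E 1 ((y - 0) \<bullet> (y - 0)) + (4 * (y - 0) $ i * (y - 0) $ j) *\<^sub>R E 2 ((y - 0) \<bullet> (y - 0))) +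
    (2 * (y - R *\<^sub>R e0) $ j) *\<^sub>R cutoff (R * \<delta>) 1 ((y - R *\<^sub>R e0) \<bullet> (y - R *\<^sub>R e0)) * ((2 * (y - 0) $ i) *\<^sub>R E 1 ((y - 0) \<bullet> (y - 0))) +
    ((2 * (y - R *\<^sub>R e0) $ i) *\<^sub>R cutoff (R * \<delta>) 1 ((y - R *\<^sub>R e0) \<bullet> (y - R *\<^sub>R e0)) * ((2 * (y - 0) $ j) *\<^sub>R E 1 ((y - 0) \<bullet> (y - 0))) +
     ((if i = j then 2 else 0) *\<^sub>R cutoff (R * \<delta>) 1 ((y - R *\<^sub>R e0) \<bullet> (y - R *\<^sub>R e0)) + (4 * (y - R *\<^sub>R e0) $ i * (y - R *\<^sub>R e0) $ j) *\<^sub>R cutoff (R * \<delta>) 2 ((y - R *\<^sub>R e0) \<bullet> (y - R *\<^sub>R e0))) * E 0 ((y - 0) \<bullet> (y - 0))))"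
  have oS: "open {x :: real^3. norm x > 1 / s1}" by (intro open_Collect_less continuous_intros)
  have wk: "(LINT y|lborel. W y * H y) = 0" unfolding H_def by (rule weak_helmholtzD[OF weak pr Kpc Kps prz])
  have cWH: "continuous_on UNIV (\<lambda>y. W y * H y)" unfolding H_def
   by (rule helm_mult_continuous[OF weak_helmholtz_continuous[OF weak] oS pr Kpc Kps prz])
  have Hz: "H y = 0" if "y \<notin> Kp" for y
   unfolding H_def by (rule helm_zero_outside[OF pr compact_imp_closed[OF Kpc] prz that])
  have HR: "H (R *\<^sub>R y) = outgoing (-k) (R *\<^sub>R y) * cof (1 / R) * brk R y" for y
  proof (cases "y \<in> K0")
   case False
   thus ?thesis using Hz[of "R *\<^sub>R y"] KpK az[OF False] by (simp add: brk_def)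
  next
   case True
   define r where "r = R * norm y"
   have ny: "norm y > 1/2" by (rule K0n[OF True])
   have "R * (1/2) < R * norm y" using R0 ny by (intro mult_strict_left_mono)
   hence r: "r > R / 2" "r > 0" using R0 unfolding r_def by linarith+
   have rr: "(R *\<^sub>R y) \<bullet> (R *\<^sub>R y) = r\<^sup>2" by (simp add: r_def power2_norm_eq_inner[symmetric] power_mult_distrib)
   have rR: "r\<^sup>2 \<ge> (R/2)\<^sup>2" using r R0 by (intro power_mono) auto
   have o: "outgoing (-k) (r *\<^sub>R axis 1 1) = outgoing (-k) (R *\<^sub>R y)" using r R0 by (simp add: outgoing_def r_def)
   have Ev: "E 0 (r\<^sup>2) = outgoing (-k) (R *\<^sub>R y)" "E 1 (r\<^sup>2) = outgoing (-k) (R *\<^sub>R y) * (- \<i> * cof k) / (2 * cof r)"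
    "6 * E 1 (r\<^sup>2) + 4 * cof (r\<^sup>2) * E 2 (r\<^sup>2) + (cof k)\<^sup>2 * E 0 (r\<^sup>2) = outgoing (-k) (R *\<^sub>R y) * (- 2 * \<i> * cof k) / cof r"
    using inwave_values[OF r(2), of k, unfolded o] rR by (simp_all only: E_def taylor_glue_def if_True)
   define tau where "tau = ((R *\<^sub>R y) - R *\<^sub>R e0) \<bullet> ((R *\<^sub>R y) - R *\<^sub>R e0)"
   have tau: "tau = R\<^sup>2 * sg y" unfolding tau_def by (rule scal)
   have inn: "((R *\<^sub>R y) - R *\<^sub>R e0) \<bullet> (R *\<^sub>R y) = R\<^sup>2 * (y \<bullet> (y - e0))"
    by (simp add: scaleR_diff_right[symmetric] power2_eq_square inner_commute)
   have ct: "cutoff (R * \<delta>) 0 tau = c 0 y" "cutoff (R * \<delta>) 1 tau = c 1 y / cof (R\<^sup>2)" "cutoff (R * \<delta>) 2 tau = c 2 y / (cof (R\<^sup>2))\<^sup>2"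
    unfolding tau cutoff_scale[OF R0 d(1)] c_def by simp_all
   have lap: "(\<Sum>i\<in>UNIV. (if i = i then 2 else 0) *\<^sub>R cutoff (R * \<delta>) 1 tau + (4 * ((R *\<^sub>R y) - R *\<^sub>R e0) $ i * ((R *\<^sub>R y) - R *\<^sub>R e0) $ i) *\<^sub>R cutoff (R * \<delta>) 2 tau)
     = 6 * cutoff (R * \<delta>) 1 tau + 4 * cof tau * cutoff (R * \<delta>) 2 tau"
    using helm_radial[of 0 "cutoff (R * \<delta>) 0" "R *\<^sub>R e0" "cutoff (R * \<delta>) 1" "cutoff (R * \<delta>) 2" "R *\<^sub>R y"] by (simp add: helm_def tau_def[symmetric])
   have "H (R *\<^sub>R y) = cutoff (R * \<delta>) 0 tau * (6 * E 1 (r\<^sup>2) + 4 * cof (r\<^sup>2) * E 2 (r\<^sup>2) + (cof k)\<^sup>2 * E 0 (r\<^sup>2)) +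
     2 * (4 * cof (((R *\<^sub>R y) - R *\<^sub>R e0) \<bullet> (R *\<^sub>R y)) * cutoff (R * \<delta>) 1 tau * E 1 (r\<^sup>2)) +
     (6 * cutoff (R * \<delta>) 1 tau + 4 * cof tau * cutoff (R * \<delta>) 2 tau) * E 0 (r\<^sup>2)"
    unfolding H_def helm_mult helm_radial sum_radial_gradients tau_def[symmetric] lap unfolding diff_zero rr ..
   also have "\<dots> = outgoing (-k) (R *\<^sub>R y) * cof (1 / R) * brk R y"
   proof -
    define P where "P = cof R"
    define q where "q = cof (norm y)"
    define o' where "o' = outgoing (-k) (R *\<^sub>R y)"
    define i' where "i' = cof (y \<bullet> (y - e0))"
    define s' where "s' = cof (sg y)"
    have nz: "P \<noteq> 0" "q \<noteq> 0" using R0 ny by (auto simp: P_def q_def)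
    have cr: "cof r = P * q" "cof (R\<^sup>2) = P\<^sup>2" "cof tau = P\<^sup>2 * s'"
     "cof (R\<^sup>2 * (y \<bullet> (y - e0))) = P\<^sup>2 * i'" "cof (1 / R) = 1 / P" "cof (1 / norm y) = 1 / q"
     "cof (2 * (y \<bullet> (y - e0))) = 2 * i'"
     by (simp_all add: r_def P_def q_def tau s'_def i'_def)
    have "c 0 y * (o' * (- 2 * \<i> * cof k) / (P * q)) + 2 * (4 * (P\<^sup>2 * i') * (c 1 y / P\<^sup>2) * (o' * (- \<i> * cof k) / (2 * (P * q)))) +
     (6 * (c 1 y / P\<^sup>2) + 4 * (P\<^sup>2 * s') * (c 2 y / (P\<^sup>2)\<^sup>2)) * o' =
     o' * (1 / P) * (1 / P * (6 * c 1 y + 4 * s' * c 2 y) - 2 * \<i> * cof k * (1 / q) * (2 * i' * c 1 y + c 0 y))"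
     using nz by (simp add: field_simps power2_eq_square)
    thus ?thesis unfolding Ev(3) unfolding Ev(1,2) ct inn brk_def a1_def a2_def cr o'_def[symmetric] s'_def[symmetric] .
   qed
   finally show ?thesis .
  qed
  have "(\<lambda>y. W (R *\<^sub>R y) * H (R *\<^sub>R y)) = (\<lambda>y. cof (1 / R) * (W (R *\<^sub>R y) * outgoing (-k) (R *\<^sub>R y) * brk R y))"
   unfolding HR by (simp add: mult_ac)
  moreover have "(\<lambda>y. W y * H y) \<in> borel_measurable borel" by (rule borel_measurable_continuous_onI[OF cWH])
  ultimately have "0 = R ^ 3 *\<^sub>R (LINT y|lborel. cof (1 / R) * (W (R *\<^sub>R y) * outgoing (-k) (R *\<^sub>R y) * brk R y))"
   using lborel_integral_dilate[of "\<lambda>y. W y * H y" R] R0 wk by simp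
  hence "(LINT y|lborel. W (R *\<^sub>R y) * outgoing (-k) (R *\<^sub>R y) * brk R y) = 0" using R0 by simp
  thus "(LINT y|lborel. S R y) = 0" by (simp add: S_def)
  have "continuous_on UNIV (\<lambda>y. W (R *\<^sub>R y) * H (R *\<^sub>R y))"
   by (rule continuous_on_compose2[OF cWH]) (auto intro!: continuous_intros)
  hence "continuous_on UNIV (\<lambda>y. cof (R ^ Suc n * R) * (W (R *\<^sub>R y) * H (R *\<^sub>R y)))"
   by (rule continuous_on_mult_left)
  moreover have "(\<lambda>y. cof (R ^ Suc n * R) * (W (R *\<^sub>R y) * H (R *\<^sub>R y))) = S R"
   unfolding S_def HR using R0 by (simp add: fun_eq_iff)
  ultimately have "continuous_on UNIV (S R)" by (simp only:)
  thus "S R \<in> borel_measurable borel" by (rule borel_measurable_continuous_onI)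
 qed
 have Sv: "S R y = g (cof (1 / (R * norm y))) (y /\<^sub>R norm y) / cof (norm y) ^ Suc n * brk R y"
  "R * norm y > 1 / s1" "norm (y /\<^sub>R norm y) = 1" if R: "R > 2 / s1" and y: "y \<in> K0" for R y
 proof -
  have R0: "R > 0" using R divide_pos_pos[of 2 s1] s1 by linarith
  have ny: "norm y > 1/2" by (rule K0n[OF y])
  show w: "norm (y /\<^sub>R norm y) = 1" using ny by (simp add: divide_simps) auto
  have "R * norm y > R * (1/2)" using R0 ny by (intro mult_strict_left_mono) auto
  moreover have "R * (1/2) > 1 / s1" using R by simp
  ultimately show r: "R * norm y > 1 / s1" by linarith
  have "norm y \<noteq> 0" using ny by linarith
  hence "R *\<^sub>R y = (R * norm y) *\<^sub>R (y /\<^sub>R norm y)" by simp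
  hence "W (R *\<^sub>R y) = exp (\<i> * cof (k * (R * norm y))) / cof (R * norm y) ^ Suc n * g (cof (1 / (R * norm y))) (y /\<^sub>R norm y)"
   using rep[OF w r] by metis
  moreover have "outgoing (-k) (R *\<^sub>R y) * exp (\<i> * cof (k * (R * norm y))) = 1"
   using R0 by (simp add: outgoing_def exp_add[symmetric])
  ultimately have "W (R *\<^sub>R y) * outgoing (-k) (R *\<^sub>R y) = g (cof (1 / (R * norm y))) (y /\<^sub>R norm y) / cof (R * norm y) ^ Suc n"
   by (simp add: field_simps)
  thus "S R y = g (cof (1 / (R * norm y))) (y /\<^sub>R norm y) / cof (norm y) ^ Suc n * brk R y"
   unfolding S_def using R0 ny by (simp add: power_mult_distrib field_simps del: power_Suc)
 qed
 define Rm where "Rm m = 2 / s1 + 1 + real m" for m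
 have Rm: "Rm m > 2 / s1" "Rm m \<ge> 1" for m using s1 by (simp_all add: Rm_def)
 have Rlim: "filterlim Rm at_top sequentially" unfolding Rm_def
  by (rule filterlim_tendsto_add_at_top[OF tendsto_const filterlim_real_sequentially])
 have iR: "(\<lambda>m. 1 / Rm m) \<longlonglongrightarrow> 0" by (rule real_tendsto_divide_at_top[OF tendsto_const Rlim])
 obtain A1 where A1: "\<And>y. norm (a1 y) \<le> A1" using bounded_compact_support[OF ca1 K0 az(1)] by metis
 obtain A2 where A2: "\<And>y. norm (a2 y) \<le> A2" using bounded_compact_support[OF ca2 K0 az(2)] by metis
 have A0: "A1 \<ge> 0" "A2 \<ge> 0" using order_trans[OF norm_ge_zero A1[of 0]] order_trans[OF norm_ge_zero A2[of 0]] by auto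
 have M0: "M \<ge> 0" using order_trans[OF norm_ge_zero M[OF e0, of 0]] s1 by simp
 \<comment> \<open>\<open>2 ^ Suc n\<close> and the second factor 2 in
   \<open>4 * k = 2 * k * 2\<close> come from \<open>1 / norm y \<le> 2\<close> on
   \<open>K0\<close>.\<close>
 define Bd where "Bd = M * 2 ^ Suc n * (A1 + 4 * k * A2)"
 have Bd0: "Bd \<ge> 0" using M0 A0 k by (simp add: Bd_def)
 have "(\<lambda>m. LINT y|lborel. S (Rm m) y) \<longlonglongrightarrow> (LINT y|lborel. - 2 * \<i> * cof k * (G y * a2 y))"
 proof (rule integral_dominated_convergence[where w = "\<lambda>y. indicator K0 y * Bd"])
  show "S (Rm m) \<in> borel_measurable lborel" for m using Sm[OF Rm(1)] by simp
  have o: "open (- {0 :: real^3})" by (rule open_Compl) simp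
  have K00: "K0 \<subseteq> - {0}" using K0n by force
  have cGa: "continuous_on UNIV (\<lambda>y. G y * a2 y)"
   by (rule continuous_on_UNIV_support[OF _ o K0 K00]) (auto intro!: continuous_intros cG ca2 simp: az)
  hence "continuous_on UNIV (\<lambda>y. - 2 * \<i> * cof k * (G y * a2 y))" by (rule continuous_on_mult_left)
  thus "(\<lambda>y. - 2 * \<i> * cof k * (G y * a2 y)) \<in> borel_measurable lborel"
   unfolding measurable_lborel2 by (rule borel_measurable_continuous_onI)
  show "integrable lborel (\<lambda>y. indicator K0 y * Bd)"
   by (intro integrable_mult_left integrable_real_indicator emeasure_compact_finite K0) (use K0 in \<open>simp add: borel_compact\<close>)
  show "AE y in lborel. (\<lambda>m. S (Rm m) y) \<longlonglongrightarrow> - 2 * \<i> * cof k * (G y * a2 y)"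
  proof (rule AE_I2)
   fix y :: "real^3"
   show "(\<lambda>m. S (Rm m) y) \<longlonglongrightarrow> - 2 * \<i> * cof k * (G y * a2 y)"
   proof (cases "y \<in> K0")
    case False
    thus ?thesis using az[OF False] by (simp add: S_def brk_def)
   next
    case True
    have ny: "norm y > 1/2" by (rule K0n[OF True])
    have w: "norm (y /\<^sub>R norm y) = 1" by (rule Sv(3)[OF Rm(1)[of 0] True])
    have "isCont (\<lambda>s. g s (y /\<^sub>R norm y)) 0"
     using holomorphic_on_imp_continuous_on[OF g[OF w]] s1 by (simp add: continuous_on_eq_continuous_at)
    moreover have "(\<lambda>m. cof (1 / (Rm m * norm y))) \<longlonglongrightarrow> 0"
    proof -
     have "(\<lambda>m. cof (1 / Rm m * (1 / norm y))) \<longlonglongrightarrow> cof (0 * (1 / norm y))"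
      by (intro tendsto_intros iR)
     thus ?thesis by simp
    qed
    ultimately have "(\<lambda>m. g (cof (1 / (Rm m * norm y))) (y /\<^sub>R norm y)) \<longlonglongrightarrow> g 0 (y /\<^sub>R norm y)"
     by (rule isCont_tendsto_compose)
    moreover have "(\<lambda>m. brk (Rm m) y) \<longlonglongrightarrow> cof 0 * a1 y - 2 * \<i> * cof k * cof (1 / norm y) * a2 y"
     unfolding brk_def by (intro tendsto_intros iR)
    ultimately have "(\<lambda>m. g (cof (1 / (Rm m * norm y))) (y /\<^sub>R norm y) / cof (norm y) ^ Suc n * brk (Rm m) y) \<longlonglongrightarrow>
      g 0 (y /\<^sub>R norm y) / cof (norm y) ^ Suc n * (cof 0 * a1 y - 2 * \<i> * cof k * cof (1 / norm y) * a2 y)"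
     using ny by (intro tendsto_mult tendsto_divide tendsto_const) auto
    moreover have "g 0 (y /\<^sub>R norm y) / cof (norm y) ^ Suc n * (cof 0 * a1 y - 2 * \<i> * cof k * cof (1 / norm y) * a2 y) =
      - 2 * \<i> * cof k * (G y * a2 y)"
     unfolding G using ny by (simp add: field_simps)
    ultimately show ?thesis using Sv(1)[OF Rm(1) True] by simp
   qed
  qed
  show "AE y in lborel. norm (S (Rm m) y) \<le> indicator K0 y * Bd" for m
  proof (rule AE_I2)
   fix y :: "real^3"
   show "norm (S (Rm m) y) \<le> indicator K0 y * Bd"
   proof (cases "y \<in> K0")
    case False
    thus ?thesis using az[OF False] by (simp add: S_def brk_def)
   next
    case True
    have ny: "norm y > 1/2" by (rule K0n[OF True])
    note v = Sv[OF Rm(1)[of m] True]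
    have p: "Rm m * norm y > 0" using v(2) divide_pos_pos[of 1 s1] s1 by linarith
    have "1 / (Rm m * norm y) < s1" using v(2) s1 p by (simp add: pos_divide_less_eq mult.commute)
    hence "cof (1 / (Rm m * norm y)) \<in> ball 0 s1"
     by (simp only: mem_ball dist_0_norm norm_of_real abs_of_pos[OF divide_pos_pos[OF zero_less_one p]])
    hence g1: "norm (g (cof (1 / (Rm m * norm y))) (y /\<^sub>R norm y)) \<le> M" by (rule M[OF v(3)])
    have inv: "1 / norm y \<le> 2"
    proof -
     have "1 / norm y \<le> 1 / (1/2)" using ny by (intro divide_left_mono mult_pos_pos) linarith+
     thus ?thesis by simp
    qed
    have "norm (g (cof (1 / (Rm m * norm y))) (y /\<^sub>R norm y) / cof (norm y) ^ Suc n) =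
     norm (g (cof (1 / (Rm m * norm y))) (y /\<^sub>R norm y)) * (1 / norm y) ^ Suc n"
     by (simp add: norm_divide norm_power norm_mult power_divide)
    also have "\<dots> \<le> M * 2 ^ Suc n" using g1 inv M0 ny by (intro mult_mono power_mono) auto
    finally have b1: "norm (g (cof (1 / (Rm m * norm y))) (y /\<^sub>R norm y) / cof (norm y) ^ Suc n) \<le> M * 2 ^ Suc n" .
    have R1: "1 / Rm m \<le> 1" "0 \<le> 1 / Rm m" using Rm(2)[of m] by auto
    have "norm (cof (1 / Rm m) * a1 y) \<le> 1 * A1" unfolding norm_mult norm_of_real using R1 A1[of y] by (intro mult_mono) auto
    moreover have "norm (2 * \<i> * cof k * cof (1 / norm y) * a2 y) \<le> (2 * k * 2) * A2"
    proof -
     have "norm (2 * \<i> * cof k * cof (1 / norm y) * a2 y) = (2 * k * (1 / norm y)) * norm (a2 y)" using k by (simp add: norm_mult norm_divide)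
     also have "\<dots> \<le> (2 * k * 2) * A2" using k inv A2[of y] ny by (intro mult_mono mult_left_mono) auto
     finally show ?thesis .
    qed
    ultimately have b2: "norm (brk (Rm m) y) \<le> A1 + 4 * k * A2" unfolding brk_def
     using norm_triangle_ineq4[of "cof (1 / Rm m) * a1 y" "2 * \<i> * cof k * cof (1 / norm y) * a2 y"] by linarith
    have "norm (S (Rm m) y) \<le> Bd" unfolding v(1) Bd_def norm_mult[of _ "brk (Rm m) y"]
     using b1 b2 M0 by (intro mult_mono) auto
    thus ?thesis using True by simp
   qed
  qed
 qed
 hence "(LINT y|lborel. - 2 * \<i> * cof k * (G y * a2 y)) = 0"
  using int0[OF Rm(1)] by (simp add: LIMSEQ_const_iff)
 hence "(LINT y|lborel. G y * a2 y) = 0" using k by simp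
 thus ?thesis by (simp add: a2_def c_def sg_def)
qed

text \<open>If \<open>a = G e0\<close> were non-zero, the real part of \<open>cnj a * G\<close>
  would exceed \<open>(norm a)\<^sup>2 / 2\<close> on the support of a small bump of non-negative
  weight, and its integral could not vanish.\<close>

lemma bump_test_zero:
 fixes G :: wave
 assumes cG: "continuous_on (- {0}) G" and e0: "norm e0 = 1"
  and zero: "\<And>\<delta>. \<delta> > 0 \<Longrightarrow> \<delta> \<le> 1/4 \<Longrightarrow> (LINT y|lborel. G y * cutoff \<delta> 0 ((y - e0) \<bullet> (y - e0))) = 0"
 shows "G e0 = 0"
proof (rule ccontr)
 assume ne: "G e0 \<noteq> 0"
 define a where "a = G e0"
 have a: "(norm a)\<^sup>2 > 0" using ne by (simp add: a_def)
 have e00: "e0 \<noteq> 0" using e0 by auto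
 define H where "H y = Re (cnj a * G y)" for y
 have cH: "continuous_on (- {0}) H" unfolding H_def by (intro continuous_intros cG)
 have He: "H e0 = (norm a)\<^sup>2" unfolding H_def a_def[symmetric] cmod_power2 by (simp add: power2_eq_square)
 have "isCont H e0" using cH e00 by (simp add: continuous_on_eq_continuous_at open_Compl)
 hence "eventually (\<lambda>y. H y > (norm a)\<^sup>2 / 2) (nhds e0)"
  using a He by (intro order_tendstoD(1)[of H "H e0"]) (auto simp: isCont_def tendsto_nhds_iff)
 then obtain d where d: "d > 0" "\<And>y. dist y e0 < d \<Longrightarrow> H y > (norm a)\<^sup>2 / 2" unfolding eventually_nhds_metric by blast
 define \<delta> where "\<delta> = min (1/4) (d / 2)"
 have \<delta>: "\<delta> > 0" "\<delta> \<le> 1/4" "2 * \<delta> \<le> d" using d by (auto simp: \<delta>_def)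
 define sg where "sg y = (y - e0) \<bullet> (y - e0)" for y
 define p where "p y = 1 - step 0 (sg y / \<delta>\<^sup>2)" for y
 have pc: "cutoff \<delta> 0 (sg y) = cof (p y)" for y by (simp add: cutoff_def p_def)
 have p0: "p y \<ge> 0" for y using step0_bounds(2) by (simp add: p_def)
 define K where "K = {y. sg y \<le> 2 * \<delta>\<^sup>2}"
 have Kd: "dist y e0 < 2 * \<delta>" if "y \<in> K" for y
 proof -
  have "(norm (y - e0))\<^sup>2 \<le> 2 * \<delta>\<^sup>2" using that by (simp add: K_def sg_def power2_norm_eq_inner)
  also have "\<dots> < (2 * \<delta>)\<^sup>2" using \<delta> by (simp add: power_mult_distrib)
  finally show ?thesis unfolding dist_norm by (rule power2_less_imp_less) (use \<delta> in simp)
 qed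
 have pz: "p y = 0" if "y \<notin> K" for y
 proof -
  have "cutoff \<delta> 0 (sg y) = 0" by (rule cutoff_outside[OF \<delta>(1)]) (use that in \<open>simp add: K_def\<close>)
  thus ?thesis by (simp add: pc)
 qed
 have K: "compact K"
 proof -
  have "closed K" unfolding K_def sg_def by (intro closed_Collect_le continuous_intros)
  moreover have "K \<subseteq> ball e0 (2 * \<delta>)" using Kd by (auto simp: dist_commute)
  ultimately show ?thesis using bounded_subset[OF bounded_ball] compact_eq_bounded_closed by blast
 qed
 have K0: "K \<subseteq> - {0}"
 proof
  fix y assume "y \<in> K"
  hence "dist y e0 < 1" using Kd[of y] \<delta> by linarith
  thus "y \<in> - {0}" using e0 by auto
 qed
 have cp: "continuous_on A p" for A
  unfolding p_def sg_def using \<delta> by (intro continuous_intros continuous_on_compose2[OF continuous_on_step[of 0]]) auto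
 have cc: "continuous_on UNIV (\<lambda>y. G y * cof (p y))"
  by (rule continuous_on_UNIV_support[OF _ _ K K0]) (auto intro!: continuous_intros cG cp simp: pz open_Compl)
 have iG: "integrable lborel (\<lambda>y. G y * cof (p y))"
  by (rule integrable_continuous_compact_support[OF cc K]) (simp add: pz)
 have ip: "integrable lborel p" by (rule integrable_continuous_compact_support[OF cp K pz])
 have z: "(LINT y|lborel. G y * cof (p y)) = 0" using zero[OF \<delta>(1,2)] unfolding sg_def[symmetric] pc .
 have iH: "integrable lborel (\<lambda>y. H y * p y)"
 proof -
  have "integrable lborel (\<lambda>y. Re (cnj a * (G y * cof (p y))))" by (intro integrable_Re integrable_mult_right iG)
  moreover have "Re (cnj a * (G y * cof (p y))) = H y * p y" for y
   unfolding H_def mult.assoc[symmetric] by simp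
  ultimately show ?thesis by simp
 qed
 have "(LINT y|lborel. H y * p y) = Re (LINT y|lborel. cnj a * (G y * cof (p y)))"
 proof -
  have "Re (LINT y|lborel. cnj a * (G y * cof (p y))) = (LINT y|lborel. Re (cnj a * (G y * cof (p y))))"
   by (rule integral_Re[symmetric]) (intro integrable_mult_right iG)
  moreover have "Re (cnj a * (G y * cof (p y))) = H y * p y" for y
   unfolding H_def mult.assoc[symmetric] by simp
  ultimately show ?thesis by simp
 qed
 also have "\<dots> = 0" using z by simp
 finally have H0: "(LINT y|lborel. H y * p y) = 0" .
 have "(norm a)\<^sup>2 / 2 * (LINT y|lborel. p y) = (LINT y|lborel. (norm a)\<^sup>2 / 2 * p y)" by simp
 also have "\<dots> \<le> (LINT y|lborel. H y * p y)"
 proof (rule integral_mono[OF _ iH])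
  show "integrable lborel (\<lambda>y. (norm a)\<^sup>2 / 2 * p y)" by (intro integrable_mult_right ip)
  fix y
  show "(norm a)\<^sup>2 / 2 * p y \<le> H y * p y"
  proof (cases "y \<in> K")
   case True
   hence "H y > (norm a)\<^sup>2 / 2" using Kd[OF True] \<delta> by (intro d(2)) linarith
   thus ?thesis using p0[of y] by (intro mult_right_mono) auto
  qed (simp add: pz)
 qed
 finally have le: "(LINT y|lborel. p y) \<le> 0" using a H0 by (simp add: mult_le_0_iff)
 have "0 < measure lborel (ball e0 \<delta>)" using content_ball_pos[OF \<delta>(1), of e0] by simp
 also have "\<dots> = (LINT y|lborel. indicator (ball e0 \<delta>) y)" by simp
 also have "\<dots> \<le> (LINT y|lborel. p y)"
 proof (rule integral_mono[OF _ ip])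
  show "integrable lborel (\<lambda>y. indicator (ball e0 \<delta>) y :: real)"
   by (auto intro!: integrable_real_indicator emeasure_bounded_finite)
  fix y
  show "indicator (ball e0 \<delta>) y \<le> p y"
  proof (cases "y \<in> ball e0 \<delta>")
   case True
   hence "norm (y - e0) \<le> \<delta>" by (simp add: dist_norm norm_minus_commute)
   hence "(norm (y - e0))\<^sup>2 \<le> \<delta>\<^sup>2" by (intro power_mono) auto
   hence "sg y / \<delta>\<^sup>2 \<le> 1" using \<delta> by (simp add: sg_def power2_norm_eq_inner)
   thus ?thesis using True by (simp add: p_def step_zero)
  qed (simp add: p0)
 qed
 finally show False using le by simp
qed

text \<open>Let \<open>G\<close> be the coefficient extended to be homogeneous of degree
  \<open>- (n + 2)\<close>. By the transport identity the integrals of \<open>G * p1\<close> and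
  \<open>G * p\<close> add up to 0, \<open>p1\<close> being the radial derivative of the bump
  \<open>p\<close>. Radial integration by parts makes the first integral
  \<open>(n + 2) - 3 = n - 1\<close> times the second. So \<open>n\<close> times the integral of
  \<open>G * p\<close> is 0, for all small bumps.\<close>

lemma rellich_coefficient_zero:
 fixes W :: wave and g :: "complex \<Rightarrow> wave"
 assumes k: "k > 0" and s1: "s1 > 0" and n: "n > 0" and weak: "weak_helmholtz k {x. norm x > 1 / s1} W"
  and g: "\<And>w. norm w = 1 \<Longrightarrow> (\<lambda>s. g s w) holomorphic_on ball 0 s1"
  and M: "\<And>w s. norm w = 1 \<Longrightarrow> s \<in> ball 0 s1 \<Longrightarrow> norm (g s w) \<le> M"
  and rep: "\<And>w r. norm w = 1 \<Longrightarrow> r > 1 / s1 \<Longrightarrow>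
    W (r *\<^sub>R w) = exp (\<i> * cof (k * r)) / cof r ^ Suc n * g (cof (1 / r)) w"
  and e0: "norm e0 = 1"
 shows "g 0 e0 = 0"
proof -
 have M0: "M \<ge> 0" using order_trans[OF norm_ge_zero M[OF e0, of 0]] s1 by simp
 have unif: "norm (g s w - g 0 w) \<le> norm s * (2 * (2 * M) / s1)" if w: "norm w = 1" and s: "s \<in> ball 0 s1" for s w
 proof -
  have h: "(\<lambda>s. g s w - g 0 w) holomorphic_on ball 0 s1" using g[OF w] by (intro holomorphic_intros)
  have b: "norm (g z w - g 0 w) \<le> 2 * M" if "z \<in> ball 0 s1" for z
   using M[OF w that] M[OF w, of 0] s1 norm_triangle_ineq4[of "g z w" "g 0 w"] by simp
  obtain f where f: "\<And>z. z \<in> ball 0 s1 \<Longrightarrow> g z w - g 0 w = z * f z" "\<And>z. z \<in> ball 0 s1 \<Longrightarrow> norm (f z) \<le> 2 * (2 * M) / s1"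
   by (rule holomorphic_divide_out[OF h s1 b]) auto
  show ?thesis unfolding f(1)[OF s] norm_mult using f(2)[OF s] by (intro mult_left_mono) auto
 qed
 \<comment> \<open>The hypotheses on \<open>g\<close> concern single directions. For
   \<open>s = 1 / Rm m\<close> continuity in the direction is inherited from \<open>W\<close> on a
   sphere, and \<open>unif\<close> makes the limit \<open>s = 0\<close> uniform.\<close>
 have cont: "continuous_on (sphere 0 1) (\<lambda>w. g 0 w)"
 proof -
  define Rm where "Rm m = 1 / s1 + 1 + real m" for m
  have Rm: "Rm m > 1 / s1" "Rm m > 0" for m using s1 by (simp_all add: Rm_def add_pos_nonneg)
  have Rlim: "filterlim Rm at_top sequentially" unfolding Rm_def
   by (rule filterlim_tendsto_add_at_top[OF tendsto_const filterlim_real_sequentially])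
  have iR: "(\<lambda>m. 1 / Rm m) \<longlonglongrightarrow> 0" by (rule real_tendsto_divide_at_top[OF tendsto_const Rlim])
  have sb: "cof (1 / Rm m) \<in> ball 0 s1" for m
  proof -
   have "1 / Rm m < s1" using Rm[of m] s1 by (simp add: pos_divide_less_eq mult.commute)
   thus ?thesis using Rm(2)[of m] by (simp only: mem_ball dist_0_norm norm_of_real abs_of_pos[OF divide_pos_pos[OF zero_less_one Rm(2)[of m]]])
  qed
  have c: "continuous_on (sphere 0 1) (\<lambda>w. g (cof (1 / Rm m)) w)" for m
  proof -
   have "continuous_on (sphere 0 1) (\<lambda>w. W (Rm m *\<^sub>R w))"
    by (rule continuous_on_compose2[OF weak_helmholtz_continuous[OF weak]]) (use Rm[of m] in \<open>auto intro!: continuous_intros\<close>)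
   hence "continuous_on (sphere 0 1) (\<lambda>w. (cof (Rm m) ^ Suc n / exp (\<i> * cof (k * Rm m))) * W (Rm m *\<^sub>R w))"
    by (rule continuous_on_mult_left)
   moreover have "(cof (Rm m) ^ Suc n / exp (\<i> * cof (k * Rm m))) * W (Rm m *\<^sub>R w) = g (cof (1 / Rm m)) w" if "w \<in> sphere 0 1" for w
    using rep[of w "Rm m"] Rm[of m] that by simp
   ultimately show ?thesis using continuous_on_cong[of "sphere 0 1" "sphere 0 1"] by (metis (no_types, lifting))
  qed
  have "uniform_limit (sphere 0 1) (\<lambda>m w. g (cof (1 / Rm m)) w) (\<lambda>w. g 0 w) sequentially"
  proof (rule uniform_limitI)
   fix e :: real assume e: "e > 0"
   have "(\<lambda>m. 1 / Rm m * (2 * (2 * M) / s1)) \<longlonglongrightarrow> 0 * (2 * (2 * M) / s1)" by (intro tendsto_intros iR)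
   hence "eventually (\<lambda>m. 1 / Rm m * (2 * (2 * M) / s1) < e) sequentially" using e by (intro order_tendstoD(2)) auto
   thus "\<forall>\<^sub>F m in sequentially. \<forall>w\<in>sphere 0 1. dist (g (cof (1 / Rm m)) w) (g 0 w) < e"
   proof eventually_elim
    case (elim m)
    show ?case
    proof
     fix w :: "real^3" assume "w \<in> sphere 0 1"
     hence w: "norm w = 1" by simp
     have "norm (cof (1 / Rm m)) = 1 / Rm m"
      by (simp only: norm_of_real abs_of_pos[OF divide_pos_pos[OF zero_less_one Rm(2)[of m]]])
     thus "dist (g (cof (1 / Rm m)) w) (g 0 w) < e"
      using unif[OF w sb[of m]] elim by (simp only: dist_norm)
    qed
   qed
  qed
  thus ?thesis by (rule uniform_limit_theorem[rotated]) (use c in simp_all)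
 qed
 define G where "G y = g 0 (y /\<^sub>R norm y) / cof (norm y) ^ (n + 2)" for y
 have cG: "continuous_on (- {0}) G" unfolding G_def
 proof (intro continuous_intros continuous_on_compose2[OF cont])
  show "(\<lambda>y. y /\<^sub>R norm y) ` (- {0}) \<subseteq> sphere (0::real^3) 1" by (auto intro: ccontr[of "_ = 0"] simp: field_simps)
 qed auto
 have "G e0 = 0"
 proof (rule bump_test_zero[OF cG e0])
  fix \<delta> :: real assume d: "\<delta> > 0" "\<delta> \<le> 1/4"
  define sg where "sg y = (y - e0) \<bullet> (y - e0)" for y
  define p where "p y = cutoff \<delta> 0 (sg y)" for y
  define p1 where "p1 y = cof (2 * (y \<bullet> (y - e0))) * cutoff \<delta> 1 (sg y)" for y
  have T: "(LINT y|lborel. G y * (p1 y + p y)) = 0"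
   unfolding p1_def p_def sg_def by (rule transport_identity[OF k s1 weak g M rep e0 d G_def cG])
  define K where "K = {y. sg y \<le> 2 * \<delta>\<^sup>2}"
  have z: "p y = 0" "p1 y = 0" if "y \<notin> K" for y
   using cutoff_outside[OF d(1), of "sg y"] that by (simp_all add: K_def p_def p1_def)
  have Kd: "dist y e0 < 1/2" if "y \<in> K" for y
  proof -
   have "(norm (y - e0))\<^sup>2 \<le> 2 * \<delta>\<^sup>2" using that by (simp add: K_def sg_def power2_norm_eq_inner)
   also have "\<dots> \<le> 2 * (1/4)\<^sup>2" using d by (intro mult_left_mono power_mono) auto
   also have "\<dots> < (1/2)\<^sup>2" by (simp add: power2_eq_square)
   finally show ?thesis unfolding dist_norm by (rule power2_less_imp_less) simp
  qed
  have K: "compact K"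
  proof -
   have "closed K" unfolding K_def sg_def by (intro closed_Collect_le continuous_intros)
   moreover have "K \<subseteq> ball e0 (1/2)" using Kd by (auto simp: dist_commute)
   ultimately show ?thesis using bounded_subset[OF bounded_ball] compact_eq_bounded_closed by blast
  qed
  have K0: "K \<subseteq> - {0}" using Kd e0 by force
  have n0: "0 \<notin> K" using K0 by auto
  have Kb: "norm y \<le> 2" if "y \<in> K" for y
   using Kd[OF that] norm_triangle_sub[of y e0] e0 by (simp add: dist_norm)
  have cp: "continuous_on A p" "continuous_on A p1" for A unfolding p_def p1_def sg_def
   by (intro continuous_intros continuous_on_compose2[OF continuous_on_cutoff[OF d(1)]]; auto)+
  have o: "open (- {0 :: real^3})" by (rule open_Compl) simp
  have c1: "continuous_on UNIV (\<lambda>y. G y * p y)"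
   by (rule continuous_on_UNIV_support[OF _ o K K0]) (auto intro!: continuous_intros cG cp simp: z)
  have c2: "continuous_on UNIV (\<lambda>y. G y * p1 y)"
   by (rule continuous_on_UNIV_support[OF _ o K K0]) (auto intro!: continuous_intros cG cp simp: z)
  have i1: "integrable lborel (\<lambda>y. G y * p y)" by (rule integrable_continuous_compact_support[OF c1 K]) (simp add: z)
  have i2: "integrable lborel (\<lambda>y. G y * p1 y)" by (rule integrable_continuous_compact_support[OF c2 K]) (simp add: z)
  define D where "D y = G y * p1 y - of_nat (n + 2) * (G y * p y)" for y
  have cD: "continuous_on UNIV D" unfolding D_def by (intro continuous_on_diff continuous_on_mult_left c1 c2)
  obtain B1 where B1: "B1 > 0" "\<And>y. norm (G y * p y) \<le> B1" using bounded_compact_support[OF c1 K] z(1) by auto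
  obtain B2 where B2: "B2 > 0" "\<And>y. norm (D y) \<le> B2"
   using bounded_compact_support[OF cD K] z by (auto simp: D_def)
  have Dint: "(LINT y|lborel. D y) = - 3 * (LINT y|lborel. G y * p y)"
  proof (rule integral_radial_derivative(2)[where b = 2 and B = "max B1 B2"])
   show "(\<lambda>y. G y * p y) \<in> borel_measurable borel" by (rule borel_measurable_continuous_onI[OF c1])
   show "G y * p y = 0" if "norm y > 2" for y using Kb[of y] z(1)[of y] that by force
   show "norm (G y * p y) \<le> max B1 B2" for y using B1(2)[of y] by simp
   show "norm (D y) \<le> max B1 B2" for y using B2(2)[of y] by simp
   show "((\<lambda>s. G (s *\<^sub>R y) * p (s *\<^sub>R y)) has_vector_derivative D y) (at 1)" for y
   proof (cases "y = 0")
    case True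
    thus ?thesis using z[of 0] n0 by (simp add: D_def)
   next
    case False
    have s1: "((\<lambda>s. sg (s *\<^sub>R y)) has_vector_derivative 2 * (y \<bullet> (y - e0))) (at 1)"
    proof -
     have "((\<lambda>s. (s *\<^sub>R y - e0) \<bullet> (s *\<^sub>R y - e0)) has_derivative (\<lambda>h. (1 *\<^sub>R y - e0) \<bullet> (h *\<^sub>R y) + (h *\<^sub>R y) \<bullet> (1 *\<^sub>R y - e0))) (at 1)"
      by (auto intro!: derivative_eq_intros)
     thus ?thesis unfolding has_vector_derivative_def sg_def
      by (rule has_derivative_eq_rhs) (auto simp: inner_commute algebra_simps)
    qed
    have s2: "(cutoff \<delta> 0 has_vector_derivative cutoff \<delta> 1 (sg y)) (at (sg (1 *\<^sub>R y)))"
     using cutoff_derivs(1)[OF d(1), of "sg y"] by simp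
    have "(cutoff \<delta> 0 \<circ> (\<lambda>s. sg (s *\<^sub>R y)) has_vector_derivative (2 * (y \<bullet> (y - e0))) *\<^sub>R cutoff \<delta> 1 (sg y)) (at 1)"
     by (rule vector_diff_chain_at[OF s1 s2])
    hence dp: "((\<lambda>s. p (s *\<^sub>R y)) has_vector_derivative p1 y) (at 1)"
     by (simp add: o_def p_def p1_def scaleR_conv_of_real)
    have dr: "((\<lambda>s. (1 / s) ^ (n + 2)) has_real_derivative - real (n + 2)) (at 1)"
    proof -
     have "((\<lambda>s::real. 1 / s) has_real_derivative -1) (at 1)" by (auto intro!: derivative_eq_intros)
     from DERIV_power[OF this, of "n + 2"] show ?thesis by simp
    qed
    have "((\<lambda>s. cof ((1 / s) ^ (n + 2)) * G y) has_vector_derivative cof (- real (n + 2)) * G y) (at 1)"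
     by (intro has_vector_derivative_mult_left has_vector_derivative_of_real dr)
    hence dG: "((\<lambda>s. G (s *\<^sub>R y)) has_vector_derivative cof (- real (n + 2)) * G y) (at 1)"
    proof (rule has_vector_derivative_transform_within_open[where S = "{0<..}"])
     fix s :: real assume "s \<in> {0<..}"
     thus "cof ((1 / s) ^ (n + 2)) * G y = G (s *\<^sub>R y)"
      using False by (simp add: G_def power_mult_distrib power_divide field_simps)
    qed auto
    show ?thesis using has_vector_derivative_mult[OF dG dp] by (simp add: D_def algebra_simps)
   qed
  qed
  have "(LINT y|lborel. D y) = (LINT y|lborel. G y * p1 y) - of_nat (n + 2) * (LINT y|lborel. G y * p y)"
   unfolding D_def using i1 i2 by simp
  moreover have "(LINT y|lborel. G y * p1 y) + (LINT y|lborel. G y * p y) = 0"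
   using T i1 i2 by (simp add: distrib_left)
  ultimately have "of_nat n * (LINT y|lborel. G y * p y) = 0"
   using Dint by (simp add: algebra_simps add_eq_0_iff)
  thus "(LINT y|lborel. G y * cutoff \<delta> 0 ((y - e0) \<bullet> (y - e0))) = 0"
   using n by (simp add: p_def sg_def)
 qed
 thus ?thesis using e0 by (simp add: G_def)
qed

text \<open>Each power of \<open>s = 1/r\<close> splits off in turn.\<close>
theorem rellich:
 assumes k: "k > 0" and s1: "s1 > 0" and weak: "weak_helmholtz k {x. norm x > 1 / s1} W"
  and ex: "far_expansion k s1 B h W" and h0: "\<And>w. norm w = 1 \<Longrightarrow> h 0 w = 0"
  and x: "norm x > 4 / s1"
 shows "W x = 0"
proof -
 note h = far_expansionD(1)[OF ex] and B = far_expansionD(2)[OF ex] and rep = far_expansionD(3)[OF ex]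
 have "\<exists>g. \<forall>w. norm w = 1 \<longrightarrow> (\<lambda>s. g s w) holomorphic_on ball 0 s1 \<and>
   (\<forall>s\<in>ball 0 s1. h s w = s ^ n * g s w \<and> norm (g s w) \<le> B * (2 / s1) ^ n)" for n
 proof (induction n)
  case 0
  show ?case by (rule exI[of _ h]) (use h B in auto)
 next
  case (Suc n)
  then obtain g where g: "\<And>w. norm w = 1 \<Longrightarrow> (\<lambda>s. g s w) holomorphic_on ball 0 s1"
   "\<And>w s. norm w = 1 \<Longrightarrow> s \<in> ball 0 s1 \<Longrightarrow> h s w = s ^ n * g s w"
   "\<And>w s. norm w = 1 \<Longrightarrow> s \<in> ball 0 s1 \<Longrightarrow> norm (g s w) \<le> B * (2 / s1) ^ n" by metis
  have g0: "g 0 w = 0" if w: "norm w = 1" for w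
  proof (cases "n = 0")
   case True
   thus ?thesis using g(2)[OF w, of 0] h0[OF w] s1 by simp
  next
   case False
   show ?thesis
   proof (rule rellich_coefficient_zero[OF k s1 _ weak g(1) g(3) _ w])
    fix w :: "real^3" and r :: real assume w: "norm w = 1" and r: "r > 1 / s1"
    have r0: "r > 0" using r divide_pos_pos[of 1 s1] s1 by linarith
    have "1 / r < s1" using r r0 s1 by (simp add: pos_divide_less_eq mult.commute)
    hence "cof (1 / r) \<in> ball 0 s1"
     by (simp only: mem_ball dist_0_norm norm_of_real abs_of_pos[OF divide_pos_pos[OF zero_less_one r0]])
    from g(2)[OF w this] rep[OF w r]
    show "W (r *\<^sub>R w) = exp (\<i> * cof (k * r)) / cof r ^ Suc n * g (cof (1 / r)) w"
     by (simp add: power_divide)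
   qed (use False in auto)
  qed
  have "\<exists>f. f holomorphic_on ball 0 s1 \<and> (\<forall>s\<in>ball 0 s1. g s w = s * f s \<and> norm (f s) \<le> 2 * (B * (2 / s1) ^ n) / s1)" if w: "norm w = 1" for w
   using holomorphic_divide_out[OF g(1)[OF w] s1 g(3)[OF w] g0[OF w]] by metis
  then obtain f where f: "\<And>w. norm w = 1 \<Longrightarrow> f w holomorphic_on ball 0 s1"
   "\<And>w s. norm w = 1 \<Longrightarrow> s \<in> ball 0 s1 \<Longrightarrow> g s w = s * f w s"
   "\<And>w s. norm w = 1 \<Longrightarrow> s \<in> ball 0 s1 \<Longrightarrow> norm (f w s) \<le> 2 * (B * (2 / s1) ^ n) / s1" by metis
  show ?case
  proof (rule exI[of _ "\<lambda>s w. f w s"], intro allI impI conjI ballI)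
   fix w :: "real^3" assume w: "norm w = 1"
   show "f w holomorphic_on ball 0 s1" by (rule f(1)[OF w])
   fix s :: complex assume s: "s \<in> ball 0 s1"
   show "h s w = s ^ Suc n * f w s" using g(2)[OF w s] f(2)[OF w s] by simp
   show "norm (f w s) \<le> B * (2 / s1) ^ Suc n" using f(3)[OF w s] by (simp add: mult_ac)
  qed
 qed
 then obtain g where g: "\<And>n w s. norm w = 1 \<Longrightarrow> s \<in> ball 0 s1 \<Longrightarrow> h s w = s ^ n * g n s w"
   "\<And>n w s. norm w = 1 \<Longrightarrow> s \<in> ball 0 s1 \<Longrightarrow> norm (g n s w) \<le> B * (2 / s1) ^ n" by metis
 define r where "r = norm x"
 have r0: "r > 0" using x divide_pos_pos[of 4 s1] s1 unfolding r_def by linarith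
 define w where "w = x /\<^sub>R r"
 have w: "norm w = 1" "x = r *\<^sub>R w" using r0 by (simp_all add: w_def r_def)
 have r4: "r > 4 / s1" using x by (simp add: r_def)
 have r1: "r > 1 / s1"
 proof -
  have "1 / s1 \<le> 4 / s1" using s1 by (simp add: divide_right_mono)
  thus ?thesis using r4 by linarith
 qed
 define s where "s = cof (1 / r)"
 have ns: "norm s = 1 / r" unfolding s_def by (simp only: norm_of_real abs_of_pos[OF divide_pos_pos[OF zero_less_one r0]])
 have rs: "4 < r * s1" using r4 s1 by (simp add: pos_divide_less_eq)
 have sb: "s \<in> ball 0 s1" using ns rs r0 s1 by (simp add: pos_divide_less_eq mult.commute)
 \<comment> \<open>Each factor \<open>s\<close> contributes \<open>1 / r\<close> and each division
   costs \<open>2 / s1\<close>; beyond radius \<open>4 / s1\<close> the product is at most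
   \<open>1/2\<close>. Letting \<open>n\<close> grow forces \<open>h s w = 0\<close> without summing
   a power series.\<close>
 have "norm (h s w) \<le> B * (1/2) ^ n" for n
 proof -
  have "norm (h s w) = (1 / r) ^ n * norm (g n s w)" using g(1)[OF w(1) sb, of n] ns by (simp add: norm_mult norm_power)
  also have "\<dots> \<le> (1 / r) ^ n * (B * (2 / s1) ^ n)" using g(2)[OF w(1) sb, of n] r0 by (intro mult_left_mono) auto
  also have "\<dots> = B * (2 / (r * s1)) ^ n" by (simp add: power_divide power_mult_distrib)
  also have "\<dots> \<le> B * (1/2) ^ n"
  proof (intro mult_left_mono power_mono)
   show "2 / (r * s1) \<le> 1/2" using rs by (simp add: pos_divide_le_eq)
   show "0 \<le> B" using order_trans[OF norm_ge_zero B[OF w(1) sb]] .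
   show "0 \<le> 2 / (r * s1)" using r0 s1 by simp
  qed
  finally show ?thesis .
 qed
 moreover have "(\<lambda>n. B * (1/2) ^ n) \<longlonglongrightarrow> B * 0" by (intro tendsto_intros LIMSEQ_power_zero) auto
 ultimately have "norm (h s w) \<le> 0" by (intro LIMSEQ_le_const[of "\<lambda>n. B * (1/2) ^ n"]) auto
 thus ?thesis using rep[OF w(1) r1] w(2) by (simp add: s_def)
qed

section \<open>The scattered field of a locally perturbed surface\<close>

definition lift3 :: "real^2 \<Rightarrow> real \<Rightarrow> real^3" where
 "lift3 z s = (z $ 1) *\<^sub>R axis 1 1 + (z $ 2) *\<^sub>R axis 2 1 + s *\<^sub>R axis 3 1"

lemma lift3_nth [simp]: "lift3 z s $ 1 = z $ 1" "lift3 z s $ 2 = z $ 2" "lift3 z s $ 3 = s"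
 by (simp_all add: lift3_def axis_def)

lemma hproj_nth [simp]: "hproj x $ 1 = x $ 1" "hproj x $ 2 = x $ 2"
 by (simp_all add: hproj_def vector_2)

lemma hproj_lift3 [simp]: "hproj (lift3 z s) = z"
 by (simp add: vec_eq_iff forall_2)

lemma lift3_hproj [simp]: "lift3 (hproj x) (x $ 3) = x"
 by (simp add: vec_eq_iff forall_3)

lemma vec3_eq_iff: "x = y \<longleftrightarrow> hproj x = hproj y \<and> x $ 3 = (y::real^3) $ 3"
 by (metis lift3_hproj)

lemma bounded_linear_hproj: "bounded_linear hproj"
 by (intro linear_conv_bounded_linear[THEN iffD1] linearI) (simp_all add: vec_eq_iff forall_2)

lemma hproj_linear [simp]: "hproj (x + y) = hproj x + hproj y" "hproj (x - y) = hproj x - hproj y" "hproj (c *\<^sub>R x) = c *\<^sub>R hproj x"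
 by (simp_all add: vec_eq_iff forall_2)

lemma hproj_axis3 [simp]: "hproj (axis 3 c) = 0"
 by (simp add: vec_eq_iff forall_2 axis_def)

lemma continuous_on_hproj [continuous_intros]: "continuous_on S f \<Longrightarrow> continuous_on S (\<lambda>x. hproj (f x))"
 by (rule bounded_linear.continuous_on[OF bounded_linear_hproj])

lemma continuous_on_lift3 [continuous_intros]:
 "continuous_on S f \<Longrightarrow> continuous_on S g \<Longrightarrow> continuous_on S (\<lambda>x. lift3 (f x) (g x))"
 unfolding lift3_def by (intro continuous_intros)

lemma norm_vec3: "(norm (x::real^3))\<^sup>2 = (norm (hproj x))\<^sup>2 + (x $ 3)\<^sup>2"
 by (simp add: norm_vec_def L2_set_def sum_nonneg sum_2 sum_3)

lemma norm_vec3_bounds: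
 shows "norm (hproj x) \<le> norm x" "\<bar>x $ 3\<bar> \<le> norm x" "norm x \<le> norm (hproj x) + \<bar>x $ 3\<bar>"
proof -
 show "norm (hproj x) \<le> norm x" by (rule power2_le_imp_le) (simp_all add: norm_vec3)
 show "\<bar>x $ 3\<bar> \<le> norm x" by (rule component_le_norm_cart)
 show "norm x \<le> norm (hproj x) + \<bar>x $ 3\<bar>"
  by (rule power2_le_imp_le) (simp_all add: norm_vec3 power2_sum)
qed

lemma mirror_nth [simp]: "mirror x $ 3 = - x $ 3" "hproj (mirror x) = hproj x"
 by (simp_all add: mirror_def vec_eq_iff forall_2)

lemma mirror_simps [simp]: "mirror (mirror x) = x" "norm (mirror x) = norm x" "mirror (s *\<^sub>R x) = s *\<^sub>R mirror x"
proof -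
 have "(norm (mirror x))\<^sup>2 = (norm x)\<^sup>2" by (simp add: norm_vec3)
 thus "norm (mirror x) = norm x" by simp
qed (simp_all add: vec3_eq_iff)

lemma mirror_eq_self: "x $ 3 = 0 \<Longrightarrow> mirror x = x"
 by (simp add: vec3_eq_iff)

lemma plane_refl_axis3: "plane_refl (axis 3 1) 0 x = mirror x"
 by (simp add: vec3_eq_iff plane_refl_def inner_axis)

lemma continuous_on_mirror: "continuous_on S mirror"
 using continuous_on_plane_refl[of "axis 3 1" S 0] by (simp add: plane_refl_axis3[abs_def])

lemma open_Omega:
 assumes "continuous_on UNIV f" shows "open (Omega f)"
 unfolding Omega_def
 by (rule open_Collect_less[OF continuous_on_compose2[OF assms continuous_on_hproj]]) (auto intro!: continuous_intros)

lemma connected_Omega: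
 assumes "continuous_on UNIV f" shows "connected (Omega f)"
proof -
 have "Omega f = (\<lambda>(z, s). lift3 z (f z + s)) ` (UNIV \<times> {0<..})"
 proof (intro equalityI subsetI)
  fix x assume "x \<in> Omega f"
  thus "x \<in> (\<lambda>(z, s). lift3 z (f z + s)) ` (UNIV \<times> {0<..})"
   by (intro image_eqI[of _ _ "(hproj x, x $ 3 - f (hproj x))"]) (auto simp: Omega_def)
 qed (auto simp: Omega_def)
 moreover have "connected ((\<lambda>(z, s). lift3 z (f z + s)) ` (UNIV \<times> {0<..}))"
  unfolding case_prod_unfold
  by (intro connected_continuous_image connected_Times continuous_on_lift3 continuous_on_add continuous_on_compose2[OF assms, of _ fst])
    (auto intro: continuous_intros)
 ultimately show ?thesis by simp
qed

lemma above_mem_closure_Omega: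
 assumes "f (hproj x) \<le> x $ 3" shows "x \<in> closure (Omega f)"
proof (subst closure_sequential, intro exI conjI allI)
 show "x + (1 / real (Suc n)) *\<^sub>R axis 3 1 \<in> Omega f" for n
  using assms by (simp add: Omega_def) (smt (verit) divide_pos_pos of_nat_0_le_iff)
 have "(\<lambda>n. x + (1 / real (Suc n)) *\<^sub>R axis 3 1) \<longlonglongrightarrow> x + 0 *\<^sub>R axis 3 1"
  by (intro tendsto_intros LIMSEQ_Suc lim_1_over_n)
 thus "(\<lambda>n. x + (1 / real (Suc n)) *\<^sub>R axis 3 1) \<longlonglongrightarrow> x" by simp
qed

section \<open>Plane waves\<close>

definition plane_wave :: "real \<Rightarrow> real^3 \<Rightarrow> complex \<Rightarrow> wave" where
 "plane_wave k e a x = a * exp (\<i> * cof (k * (x \<bullet> e)))"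

lemma has_derivative_plane_wave:
 "(plane_wave k e a has_derivative (\<lambda>h. \<i> * cof (k * (h \<bullet> e)) * plane_wave k e a x)) (at x)"
proof -
 have "((\<lambda>x. exp (\<i> * cof (k * (x \<bullet> e)))) has_derivative
   (\<lambda>h. exp (\<i> * cof (k * (x \<bullet> e))) * (\<i> * cof (k * (h \<bullet> e))))) (at x)"
  by (rule has_derivative_compose[of "\<lambda>x. \<i> * cof (k * (x \<bullet> e))" "\<lambda>h. \<i> * cof (k * (h \<bullet> e))"])
    (auto intro!: derivative_eq_intros DERIV_exp[unfolded has_field_derivative_def])
 from has_derivative_mult_right[OF this, of a] show ?thesis
  unfolding plane_wave_def by (rule has_derivative_eq_rhs) (simp add: fun_eq_iff ac_simps)
qed

lemma pd_plane_wave: "pd i (plane_wave k e a) = plane_wave k e (\<i> * cof (k * e $ i) * a)"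
proof
 fix x
 have "((\<lambda>t. plane_wave k e a (x + t *\<^sub>R axis i 1)) has_derivative
   (\<lambda>t. \<i> * cof (k * ((t *\<^sub>R axis i 1) \<bullet> e)) * plane_wave k e a (x + 0 *\<^sub>R axis i 1))) (at 0)"
  by (rule has_derivative_compose[of "\<lambda>t. x + t *\<^sub>R axis i 1" "\<lambda>t. t *\<^sub>R axis i 1"])
    (auto intro!: derivative_eq_intros has_derivative_plane_wave[of k e a "x + 0 *\<^sub>R axis i 1", simplified])
 hence "((\<lambda>t. plane_wave k e a (x + t *\<^sub>R axis i 1)) has_vector_derivative
   plane_wave k e (\<i> * cof (k * e $ i) * a) x) (at 0)"
  unfolding has_vector_derivative_def
  by (rule has_derivative_eq_rhs) (simp add: fun_eq_iff plane_wave_def inner_axis' scaleR_conv_of_real[where 'a=complex])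
 thus "pd i (plane_wave k e a) x = plane_wave k e (\<i> * cof (k * e $ i) * a) x"
  unfolding pd_def by (rule vector_derivative_at)
qed

lemma continuous_on_plane_wave: "continuous_on S (plane_wave k e a)"
 unfolding plane_wave_def by (intro continuous_intros)

lemma weak_helmholtz_plane_wave:
 assumes "norm e = 1" shows "weak_helmholtz k UNIV (plane_wave k e a)"
proof (rule C2_on_imp_weak_helmholtz)
 show "C2_on UNIV (plane_wave k e a)"
  unfolding C2_on_def pd_plane_wave
  by (auto intro: differentiableI[OF has_derivative_plane_wave] continuous_on_plane_wave)
 have e2: "(e $ 1)\<^sup>2 + (e $ 2)\<^sup>2 + (e $ 3)\<^sup>2 = 1"
  using norm_vec3[of e] assms by (simp add: norm_vec_def L2_set_def sum_nonneg sum_2)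
 have "laplacian (plane_wave k e a) x = - cof (k\<^sup>2 * ((e $ 1)\<^sup>2 + (e $ 2)\<^sup>2 + (e $ 3)\<^sup>2)) * plane_wave k e a x" for x
  by (simp add: laplacian_def pd_plane_wave sum_3 plane_wave_def power2_eq_square algebra_simps)
 thus "laplacian (plane_wave k e a) x + (cof k)\<^sup>2 * plane_wave k e a x = 0" for x
  by (simp only: e2) simp
qed simp

lemma u_in_plane_wave: "u_in k d = plane_wave k d 1"
 by (simp add: fun_eq_iff u_in_def plane_wave_def)

lemma u_re_D_plane_wave: "u_re_D k d = plane_wave k (mirror d) (- 1)"
 by (simp add: fun_eq_iff u_re_D_def plane_wave_def)

lemma u_in_plus_u_re_D:
 "u_in k d x + u_re_D k d x = exp (\<i> * cof (k * (x $ 1 * d $ 1 + x $ 2 * d $ 2))) * (- 2 * \<i> * cof (sin (k * - d $ 3 * x $ 3)))"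
proof -
 define A where "A = k * (x $ 1 * d $ 1 + x $ 2 * d $ 2)"
 define b where "b = k * - d $ 3 * x $ 3"
 have 1: "k * (x \<bullet> d) = A + - b" and 2: "k * (x \<bullet> mirror d) = A + b"
  by (simp_all add: A_def b_def inner_vec_def sum_3 mirror_def algebra_simps)
 have 3: "exp (\<i> * cof t) = cof (cos t) + \<i> * cof (sin t)" for t
  by (simp only: exp_Euler cos_of_real sin_of_real)
 have "u_in k d x + u_re_D k d x = exp (\<i> * cof A) * (- 2 * \<i> * cof (sin b))"
  unfolding u_in_def u_re_D_def 1 2 of_real_add distrib_left exp_add unfolding 3 by (simp add: algebra_simps)
 thus ?thesis unfolding A_def b_def .
qed

lemma norm_u_in_plus_u_re_D: "norm (u_in k d x + u_re_D k d x) = 2 * \<bar>sin (k * - d $ 3 * x $ 3)\<bar>"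
 unfolding u_in_plus_u_re_D norm_mult by (simp flip: of_real_mult)

section \<open>The odd extension of the scattered field\<close>

locale dirichlet_scattering =
 fixes k :: real and f :: "real^2 \<Rightarrow> real" and d :: "real^3" and u :: wave and R :: real
 assumes k: "k > 0" and cf: "continuous_on UNIV f" and fR: "\<And>y. \<bar>f y\<bar> < R"
  and f0: "\<And>y. norm y > R \<Longrightarrow> f y = 0" and d: "d \<in> S2_minus"
  and tot: "dirichlet_total_field k f d u"
begin

definition "usc = u_sc_D k d u"

text \<open>Outside radius \<open>2 * R\<close> the surface is the plane, where \<open>u\<close> and
  the sum of incident and reflected wave both vanish, so this extension is continuous there. Closer
  to the origin its values carry no meaning.\<close>

definition "usc_odd x = (if x $ 3 \<le> 0 then - usc (mirror x) else usc x)"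

lemma R_pos: "R > 0" using fR[of 0] by linarith

lemma norm_d: "norm d = 1" "d $ 3 < 0" using d by (auto simp: S2_minus_def)

lemma weak_u: "weak_helmholtz k (Omega f) u"
 using tot open_Omega[OF cf] unfolding dirichlet_total_field_def by (blast intro: C2_on_imp_weak_helmholtz)

lemma usc_eq: "usc = (\<lambda>x. u x - plane_wave k d 1 x - plane_wave k (mirror d) (- 1) x)"
 by (simp add: usc_def u_sc_D_def fun_eq_iff u_in_plane_wave u_re_D_plane_wave)

lemma weak_usc: "weak_helmholtz k (Omega f) usc"
 unfolding usc_eq using norm_d open_Omega[OF cf]
 by (intro weak_helmholtz_diff weak_u weak_helmholtz_subset[OF weak_helmholtz_plane_wave]) auto

lemma continuous_u: "continuous_on (closure (Omega f)) u"
 using tot by (simp add: dirichlet_total_field_def)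

lemma u_Gamma: "x \<in> Gamma f \<Longrightarrow> u x = 0"
 using tot by (simp add: dirichlet_total_field_def)

text \<open>\<open>norm x > 2 * R\<close> forces the horizontal part or the height beyond
  \<open>R\<close>. In the first case \<open>f\<close> is 0 there, in the second
  \<open>|f| < R\<close> cannot interfere.\<close>

lemma exterior_above:
 assumes "norm x > 2 * R" shows "f (hproj x) \<le> x $ 3 \<longleftrightarrow> x $ 3 \<ge> 0" "x \<in> Omega f \<longleftrightarrow> x $ 3 > 0"
proof -
 have "f (hproj x) = 0 \<or> \<bar>x $ 3\<bar> > R" using f0[of "hproj x"] norm_vec3_bounds(3)[of x] assms by linarith
 thus "f (hproj x) \<le> x $ 3 \<longleftrightarrow> x $ 3 \<ge> 0" "x \<in> Omega f \<longleftrightarrow> x $ 3 > 0"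
  using fR[of "hproj x"] R_pos by (auto simp: Omega_def)
qed

lemma usc_equator: "x $ 3 = 0 \<Longrightarrow> norm x > 2 * R \<Longrightarrow> usc x = 0"
proof -
 assume x: "x $ 3 = 0" "norm x > 2 * R"
 have "f (hproj x) = 0" using f0[of "hproj x"] norm_vec3_bounds(3)[of x] x R_pos by linarith
 hence "u x = 0" using x by (intro u_Gamma) (simp add: Gamma_def)
 moreover have "norm (u_in k d x + u_re_D k d x) = 0" unfolding norm_u_in_plus_u_re_D using x by simp
 ultimately show "usc x = 0" by (simp add: usc_def u_sc_D_def add_eq_0_iff)
qed

lemma usc_odd_mirror: "norm x > 2 * R \<Longrightarrow> usc_odd (mirror x) = - usc_odd x"
 using usc_equator[of x] by (auto simp: usc_odd_def mirror_eq_self)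

lemma weak_usc_odd: "weak_helmholtz k {x. norm x > 2 * R} usc_odd"
proof (rule weak_helmholtz_odd_reflection[of "axis 3 1" _ 0])
 show oS: "open {x :: real^3. norm x > 2 * R}" by (intro open_Collect_less continuous_intros)
 have c: "continuous_on (closure (Omega f)) usc"
  unfolding usc_eq by (intro continuous_intros continuous_u continuous_on_plane_wave)
 have cl: "x \<in> closure (Omega f)" if "norm x > 2 * R" "x $ 3 \<ge> 0" for x :: "real^3"
  using exterior_above[OF that(1)] that(2) by (intro above_mem_closure_Omega) simp
 show "continuous_on {x. norm x > 2 * R} usc_odd" unfolding usc_odd_def
 proof (rule continuous_on_cases_le)
  show "continuous_on {t \<in> {x. 2 * R < norm x}. t $ 3 \<le> 0} (\<lambda>x. - usc (mirror x))"
   by (intro continuous_intros continuous_on_compose2[OF c continuous_on_mirror]) (auto intro!: cl)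
  show "continuous_on {t \<in> {x. 2 * R < norm x}. 0 \<le> t $ 3} usc"
   by (rule continuous_on_subset[OF c]) (auto intro!: cl)
  show "- usc (mirror t) = usc t" if "t \<in> {x. 2 * R < norm x}" "t $ 3 = 0" for t :: "real^3"
   using that usc_equator[of t] by (simp add: mirror_eq_self)
 qed (intro continuous_intros)
 have "weak_helmholtz k ({x. norm x > 2 * R} \<inter> {x. x \<bullet> axis 3 1 > 0}) usc"
  by (rule weak_helmholtz_subset[OF weak_usc]) (auto simp: inner_axis exterior_above)
 thus "weak_helmholtz k ({x. norm x > 2 * R} \<inter> {x. x \<bullet> axis 3 1 > 0}) usc_odd"
  by (rule weak_helmholtz_cong) (auto simp: usc_odd_def inner_axis)
qed (auto simp: plane_refl_axis3 usc_odd_mirror)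

lemma usc_radial:
 assumes "y \<in> Omega f" "y \<noteq> 0"
 shows "((\<lambda>s. usc (s *\<^sub>R y)) has_vector_derivative cof (norm y) * radial_deriv usc y) (at 1)"
proof -
 have "u differentiable (at y)" using assms tot by (auto simp: dirichlet_total_field_def C2_on_def)
 then obtain D0 where D0: "(u has_derivative D0) (at y)" unfolding differentiable_def by blast
 have "\<exists>D. (usc has_derivative D) (at y)"
  unfolding usc_eq by (rule exI, (rule has_derivative_diff D0 has_derivative_plane_wave)+)
 then obtain D where D: "(usc has_derivative D) (at y)" ..
 interpret D: bounded_linear D by (rule has_derivative_bounded_linear[OF D])
 have a: "((\<lambda>s. usc (s *\<^sub>R y)) has_vector_derivative D y) (at 1)"
  unfolding has_vector_derivative_def
  by (rule has_derivative_compose[of "\<lambda>s. s *\<^sub>R y" "\<lambda>s. s *\<^sub>R y" _ _ usc D, THEN has_derivative_eq_rhs])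
    (auto intro!: derivative_eq_intros D simp: D.scaleR)
 have "((\<lambda>t. usc (y + t *\<^sub>R (y /\<^sub>R norm y))) has_vector_derivative D (y /\<^sub>R norm y)) (at 0)"
  unfolding has_vector_derivative_def
  by (rule has_derivative_compose[of "\<lambda>t. y + t *\<^sub>R (y /\<^sub>R norm y)" "\<lambda>t. t *\<^sub>R (y /\<^sub>R norm y)" _ _ usc D, THEN has_derivative_eq_rhs])
    (auto intro!: derivative_eq_intros D simp: D.scaleR)
 hence "radial_deriv usc y = D (y /\<^sub>R norm y)" unfolding radial_deriv_def by (rule vector_derivative_at)
 hence "cof (norm y) * radial_deriv usc y = D y"
  using assms(2) by (simp add: D.scaleR) (simp add: scaleR_conv_of_real)
 thus ?thesis using a by simp
qed

definition "usc_odd_radial y = (if y $ 3 = 0 then 0 else if y $ 3 > 0 then cof (norm y) * radial_deriv usc y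
  else - (cof (norm y) * radial_deriv usc (mirror y)))"

lemma usc_odd_radial:
 assumes y: "norm y > 2 * R"
 shows "((\<lambda>s. usc_odd (s *\<^sub>R y)) has_vector_derivative usc_odd_radial y) (at 1)"
proof -
 have y0: "y \<noteq> 0" using y R_pos by auto
 hence y1: "mirror y \<noteq> 0" by (metis mirror_simps(2) norm_eq_zero)
 have om: "y $ 3 > 0 \<Longrightarrow> y \<in> Omega f" "y $ 3 < 0 \<Longrightarrow> mirror y \<in> Omega f"
  using exterior_above(2)[of y] exterior_above(2)[of "mirror y"] y by auto
 have "((\<lambda>s. norm (s *\<^sub>R y)) \<longlongrightarrow> norm (1 *\<^sub>R y)) (nhds (1::real))"
  by (intro tendsto_intros filterlim_ident)
 hence "eventually (\<lambda>s. norm (s *\<^sub>R y) > 2 * R) (nhds (1::real))" using y by (intro order_tendstoD(1)) auto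
 moreover have "eventually (\<lambda>s. s \<in> {0<..}) (nhds (1::real))" by (intro eventually_nhds_in_open) auto
 ultimately have ev: "eventually (\<lambda>s. s > 0 \<and> norm (s *\<^sub>R y) > 2 * R) (nhds (1::real))" by eventually_elim simp
 then obtain \<delta> where dl: "\<delta> > 0" "\<And>s. dist s 1 < \<delta> \<Longrightarrow> s > 0 \<and> norm (s *\<^sub>R y) > 2 * R"
  unfolding eventually_nhds_metric by blast
 have tr: "((\<lambda>s. usc_odd (s *\<^sub>R y)) has_vector_derivative D) (at 1)"
  if "(g has_vector_derivative D) (at 1)" "\<And>s. dist s 1 < \<delta> \<Longrightarrow> g s = usc_odd (s *\<^sub>R y)" for g D
  by (rule has_vector_derivative_transform_within[OF that(1) dl(1) UNIV_I that(2)])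
 consider "y $ 3 = 0" | "y $ 3 > 0" | "y $ 3 < 0" by linarith
 thus ?thesis
 proof cases
  \<comment> \<open>The whole ray lies in the plane, where the extension vanishes. This settles the
    boundary points, at which differentiability of \<open>u\<close> is not known.\<close>
  case 1
  have "0 = usc_odd (s *\<^sub>R y)" if "dist s 1 < \<delta>" for s
   using 1 dl(2)[OF that] usc_equator[of "s *\<^sub>R y"] by (auto simp: usc_odd_def mirror_eq_self)
  from tr[OF has_vector_derivative_const this] show ?thesis using 1 by (simp add: usc_odd_radial_def)
 next
  case 2
  have "usc (s *\<^sub>R y) = usc_odd (s *\<^sub>R y)" if "dist s 1 < \<delta>" for s
   using 2 dl(2)[OF that] by (simp add: usc_odd_def mult_le_0_iff)
  from tr[OF usc_radial[OF om(1)[OF 2] y0] this] show ?thesis using 2 by (simp add: usc_odd_radial_def)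
 next
  case 3
  have "- usc (s *\<^sub>R mirror y) = usc_odd (s *\<^sub>R y)" if "dist s 1 < \<delta>" for s
   using 3 dl(2)[OF that] by (simp add: usc_odd_def mult_le_0_iff)
  from tr[OF has_vector_derivative_minus[OF usc_radial[OF om(2)[OF 3] y1]] this] show ?thesis
   using 3 by (simp add: usc_odd_radial_def)
 qed
qed

lemma usc_odd_sommerfeld:
 assumes "\<eta> > 0"
 shows "\<exists>R1. \<forall>y. norm y \<ge> R1 \<longrightarrow> norm y > 2 * R \<longrightarrow>
  norm (usc_odd_radial y - \<i> * cof (k * norm y) * usc_odd y) \<le> \<eta>"
proof -
 have "sommerfeld k (Omega f) usc" using tot by (simp add: dirichlet_total_field_def usc_def)
 then obtain R1 where R1: "\<And>x. x \<in> Omega f \<Longrightarrow> norm x \<ge> R1 \<Longrightarrow>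
   cmod (cof (norm x) * (radial_deriv usc x - \<i> * cof k * usc x)) \<le> \<eta>"
  using assms unfolding sommerfeld_def by blast
 show ?thesis
 proof (intro exI[of _ R1] allI impI)
  fix y :: "real^3" assume y: "norm y \<ge> R1" "norm y > 2 * R"
  consider "y $ 3 = 0" | "y $ 3 > 0" | "y $ 3 < 0" by linarith
  thus "norm (usc_odd_radial y - \<i> * cof (k * norm y) * usc_odd y) \<le> \<eta>"
  proof cases
   case 1
   thus ?thesis using assms usc_equator[of y] y by (simp add: usc_odd_radial_def usc_odd_def mirror_eq_self)
  next
   case 2
   thus ?thesis using R1[of y] y exterior_above(2)[of y]
    by (simp add: usc_odd_radial_def usc_odd_def algebra_simps)
  next
   case 3
   have "usc_odd_radial y - \<i> * cof (k * norm y) * usc_odd y =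
    - (cof (norm (mirror y)) * (radial_deriv usc (mirror y) - \<i> * cof k * usc (mirror y)))"
    using 3 by (simp add: usc_odd_radial_def usc_odd_def algebra_simps)
   thus ?thesis using R1[of "mirror y"] y exterior_above(2)[of "mirror y"] 3
    by (simp only: norm_minus_cancel mirror_simps mirror_nth)
  qed
 qed
qed

lemma usc_odd_expansion:
 obtains s1 B h where "s1 > 0" "2 * R < 1 / s1" "far_expansion k s1 B h usc_odd"
 by (rule radiating_expansion[OF k _ weak_usc_odd usc_odd_radial usc_odd_sommerfeld]) (use R_pos in auto)

lemma usc_decay: "\<exists>R1 C. \<forall>x\<in>Omega f. norm x > R1 \<longrightarrow> norm (usc x) \<le> C / norm x"
proof -
 obtain s1 B h where h: "s1 > 0" "2 * R < 1 / s1" and ex: "far_expansion k s1 B h usc_odd"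
  by (rule usc_odd_expansion)
 show ?thesis
 proof (rule exI[of _ "1 / s1"], rule exI[of _ B], intro ballI impI)
  fix x assume x: "x \<in> Omega f" "norm x > 1 / s1"
  hence x3: "x $ 3 > 0" using exterior_above(2)[of x] h(2) by simp
  have x0: "norm x > 0" using x h(2) R_pos by linarith
  hence w: "norm (x /\<^sub>R norm x) = 1" "norm x *\<^sub>R (x /\<^sub>R norm x) = x" by auto
  have "1 / norm x < s1" using x(2) h(1) x0 by (simp add: field_simps)
  hence "cof (1 / norm x) \<in> ball 0 s1"
   by (simp only: mem_ball dist_0_norm norm_of_real abs_of_pos[OF divide_pos_pos[OF zero_less_one x0]])
  hence "norm (h (cof (1 / norm x)) (x /\<^sub>R norm x)) \<le> B" by (rule far_expansionD(2)[OF ex w(1)])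
  hence "norm (usc_odd x) \<le> B / norm x"
   using far_expansionD(3)[OF ex w(1) x(2)] x0 by (simp only: w(2)) (simp add: norm_mult norm_divide divide_right_mono)
  thus "norm (usc x) \<le> B / norm x" using x3 by (simp add: usc_odd_def)
 qed
qed

end

section \<open>From the far field to the total field\<close>

lemma expansion_far_limit:
 assumes s1: "s1 > 0" and ex: "far_expansion k s1 B h V" and w: "norm w = 1"
 shows "((\<lambda>r. cof r * exp (- \<i> * cof (k * r)) * V (r *\<^sub>R w)) \<longlongrightarrow> h 0 w) at_top"
proof -
 have "isCont (\<lambda>s. h s w) 0"
  using holomorphic_on_imp_continuous_on[OF far_expansionD(1)[OF ex w]] s1 by (simp add: continuous_on_eq_continuous_at)
 moreover have "((\<lambda>r. cof (1 / r)) \<longlongrightarrow> cof 0) at_top"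
  by (intro tendsto_of_real tendsto_divide_0[OF tendsto_const] filterlim_at_top_imp_at_infinity filterlim_ident)
 ultimately have "((\<lambda>r. h (cof (1 / r)) w) \<longlongrightarrow> h 0 w) at_top"
  using isCont_tendsto_compose[of 0 "\<lambda>s. h s w" "\<lambda>r. cof (1 / r)"] by simp
 moreover have "eventually (\<lambda>r. h (cof (1 / r)) w =
   cof r * exp (- \<i> * cof (k * r)) * V (r *\<^sub>R w)) at_top"
  using eventually_gt_at_top[of "1 / s1"]
 proof eventually_elim
  case (elim r)
  have "r > 0" using elim s1 by (meson divide_pos_pos less_trans zero_less_one)
  thus ?case unfolding far_expansionD(3)[OF ex w elim] by (simp add: exp_minus field_simps)
 qed
 ultimately show ?thesis by (rule Lim_transform_eventually)
qed

context dirichlet_scattering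
begin

lemma usc_odd_expansion_far:
 obtains s1 B h where "s1 > 0" "2 * R < 1 / s1" "far_expansion k s1 B h usc_odd"
  "\<And>w. w \<in> S2_plus \<Longrightarrow> far_field k (u_sc_D k d u) w = h 0 w"
  "\<And>w. norm w = 1 \<Longrightarrow> h 0 (mirror w) = - h 0 w"
proof -
 obtain s B h where A: "s > 0" "2 * R < 1 / s" "far_expansion k s B h usc_odd" by (rule usc_odd_expansion)
 let ?q = "\<lambda>r. cof r * exp (- \<i> * cof (k * r))"
 have lim: "((\<lambda>r. ?q r * usc_odd (r *\<^sub>R w)) \<longlongrightarrow> h 0 w) at_top" if "norm w = 1" for w
  by (rule expansion_far_limit[OF A(1,3) that])
 have big: "eventually (\<lambda>r. norm (r *\<^sub>R w) > 2 * R \<and> r > 0) at_top" if "norm w = 1" for w :: "real^3"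
  using eventually_gt_at_top[of "2 * R"] by eventually_elim (use that R_pos in simp)
 show thesis
 proof (rule that[OF A])
  fix w :: "real^3" assume w: "w \<in> S2_plus"
  hence w1: "norm w = 1" and w3: "w $ 3 > 0" by (auto simp: S2_plus_def)
  have "eventually (\<lambda>r. ?q r * usc_odd (r *\<^sub>R w) = ?q r * u_sc_D k d u (r *\<^sub>R w)) at_top"
   using big[OF w1] by eventually_elim (use w3 in \<open>simp add: usc_odd_def usc_def mult_le_0_iff\<close>)
  from Lim_transform_eventually[OF lim[OF w1] this] show "far_field k (u_sc_D k d u) w = h 0 w"
   unfolding far_field_def by (intro tendsto_Lim) simp
 next
  fix w :: "real^3" assume w: "norm w = 1"
  have "eventually (\<lambda>r. - (?q r * usc_odd (r *\<^sub>R w)) = ?q r * usc_odd (r *\<^sub>R mirror w)) at_top"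
   using big[OF w]
  proof eventually_elim
   case (elim r)
   from usc_odd_mirror[OF conjunct1[OF elim]] show ?case by simp
  qed
  from Lim_transform_eventually[OF tendsto_minus[OF lim[OF w]] this] show "h 0 (mirror w) = - h 0 w"
   by (rule tendsto_unique[rotated 2]) (use lim[of "mirror w"] w in simp_all)
 qed
qed

end

text \<open>The data cover the open upper hemisphere. Oddness adds the lower one and the equator,
  where the coefficient equals its own negative. After \<open>rellich\<close> the fields agree far
  out, and unique continuation brings this down to the connected region above both graphs.\<close>

theorem far_field_determines_field:
 assumes S1: "dirichlet_scattering k f1 d u1 R" and S2: "dirichlet_scattering k f2 d u2 R"
  and ff: "\<And>w. w \<in> S2_plus \<Longrightarrow> far_field k (u_sc_D k d u1) w = far_field k (u_sc_D k d u2) w"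
  and x: "x \<in> Omega (\<lambda>y. max (f1 y) (f2 y))"
 shows "u1 x = u2 x"
proof -
 interpret A: dirichlet_scattering k f1 d u1 R by fact
 interpret B: dirichlet_scattering k f2 d u2 R by fact
 obtain s B h where A: "s > 0" "2 * R < 1 / s" "far_expansion k s B h A.usc_odd"
  "\<And>w. w \<in> S2_plus \<Longrightarrow> far_field k (u_sc_D k d u1) w = h 0 w" "\<And>w. norm w = 1 \<Longrightarrow> h 0 (mirror w) = - h 0 w"
  by (rule A.usc_odd_expansion_far) (rule that)
 obtain s' B' h' where B: "s' > 0" "2 * R < 1 / s'" "far_expansion k s' B' h' B.usc_odd"
  "\<And>w. w \<in> S2_plus \<Longrightarrow> far_field k (u_sc_D k d u2) w = h' 0 w" "\<And>w. norm w = 1 \<Longrightarrow> h' 0 (mirror w) = - h' 0 w"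
  by (rule B.usc_odd_expansion_far) (rule that)
 have h0: "h 0 w - h' 0 w = 0" if w: "norm w = 1" for w :: "real^3"
 proof -
  have plus: "h 0 w = h' 0 w" if "norm w = 1" "w $ 3 > 0" for w :: "real^3"
   using A(4)[of w] B(4)[of w] ff[of w] that by (simp add: S2_plus_def)
  consider "w $ 3 > 0" | "w $ 3 < 0" | "w $ 3 = 0" by linarith
  thus ?thesis
  proof cases
   case 2
   thus ?thesis using A(5)[OF w] B(5)[OF w] plus[of "mirror w"] w by simp
  next
   case 3
   thus ?thesis using A(5)[OF w] B(5)[OF w] by (simp add: mirror_eq_self)
  qed (use plus w in simp)
 qed
 define t where "t = min s s'"
 have t: "t > 0" "1 / s \<le> 1 / t" "1 / s' \<le> 1 / t" using A(1) B(1) by (auto simp: t_def frac_le)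
 have W0: "A.usc_odd y - B.usc_odd y = 0" if "norm y > 4 / t" for y
 proof (rule rellich[of k t _ "B + B'" "\<lambda>z w. h z w - h' z w", OF A.k t(1) _ far_expansionI h0 that])
  have "{x :: real^3. 1 / t < norm x} \<subseteq> {x. norm x > 2 * R}" using t(2) A(2) by auto
  thus "weak_helmholtz k {x. 1 / t < norm x} (\<lambda>y. A.usc_odd y - B.usc_odd y)"
   by (intro weak_helmholtz_diff weak_helmholtz_subset[OF A.weak_usc_odd] weak_helmholtz_subset[OF B.weak_usc_odd])
     (auto intro!: open_Collect_less continuous_intros)
  fix w :: "real^3" assume w: "norm w = 1"
  note Aw = far_expansionD[OF A(3) w] and Bw = far_expansionD[OF B(3) w]
  show "(\<lambda>z. h z w - h' z w) holomorphic_on ball 0 t"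
   by (intro holomorphic_intros holomorphic_on_subset[OF Aw(1)] holomorphic_on_subset[OF Bw(1)]) (auto simp: t_def)
  show "norm (h z w - h' z w) \<le> B + B'" if "z \<in> ball 0 t" for z
  proof -
   have "z \<in> ball 0 s" "z \<in> ball 0 s'" using that by (auto simp: t_def)
   thus ?thesis using Aw(2)[of z] Bw(2)[of z] norm_triangle_ineq4[of "h z w" "h' z w"] by linarith
  qed
  show "A.usc_odd (r *\<^sub>R w) - B.usc_odd (r *\<^sub>R w) =
    exp (\<i> * cof (k * r)) / cof r * (h (cof (1 / r)) w - h' (cof (1 / r)) w)" if "r > 1 / t" for r
   unfolding right_diff_distrib using Aw(3)[of r] Bw(3)[of r] t that by simp
 qed
 define g where "g y = max (f1 y) (f2 y)" for y
 have cg: "continuous_on UNIV g" unfolding g_def by (intro continuous_intros A.cf B.cf)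
 have sub: "Omega g \<subseteq> Omega f1" "Omega g \<subseteq> Omega f2" by (auto simp: Omega_def g_def)
 have t0: "4 / t > 0" using t by simp
 define a :: "real^3" where "a = axis 3 (4 / t + R + 1)"
 have near: "y $ 3 > 4 / t + R" if "dist y a < 1" for y :: "real^3"
  using that component_le_norm_cart[of "y - a" 3] by (simp add: a_def dist_norm)
 have "u1 x - u2 x = 0"
 proof (rule weak_helmholtz_unique_continuation[of k "Omega g" _ a 1])
  show "weak_helmholtz k (Omega g) (\<lambda>x. u1 x - u2 x)"
   by (intro weak_helmholtz_diff open_Omega cg weak_helmholtz_subset[OF A.weak_u sub(1)] weak_helmholtz_subset[OF B.weak_u sub(2)])
  have "f1 0 < 4 / t + R + 1" "f2 0 < 4 / t + R + 1" using A.fR[of 0] B.fR[of 0] t0 by linarith+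
  thus "a \<in> Omega g" by (simp add: Omega_def g_def a_def)
  show "u1 y - u2 y = 0" if "dist y a < 1" for y :: "real^3"
  proof -
   have y3: "y $ 3 > 4 / t" using near[OF that] A.R_pos by linarith
   hence "norm y > 4 / t" using norm_vec3_bounds(2)[of y] by linarith
   from W0[OF this] show ?thesis using y3 t0
    by (simp add: A.usc_odd_def B.usc_odd_def A.usc_def B.usc_def u_sc_D_def)
  qed
 qed (use open_Omega[OF cg] connected_Omega[OF cg] x in \<open>simp_all add: g_def[abs_def]\<close>)
 thus ?thesis by simp
qed

section \<open>Nodal discs\<close>

lemma cos_not_tendsto_zero:
 assumes "b > (0::real)" shows "\<not> ((\<lambda>s. cos (a + b * s)) \<longlongrightarrow> 0) at_top"
proof
 assume L: "((\<lambda>s. cos (a + b * s)) \<longlongrightarrow> 0) at_top"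
 hence "eventually (\<lambda>s. cos (a + b * s) < 1) at_top" by (rule order_tendstoD) simp
 then obtain N where N: "\<And>s. s \<ge> N \<Longrightarrow> cos (a + b * s) < 1" unfolding eventually_at_top_linorder by blast
 obtain m :: nat where m: "a + b * N < real m * (2 * pi)" using ex_less_of_nat_mult[of "2 * pi" "a + b * N"] by auto
 define s where "s = (real m * (2 * pi) - a) / b"
 have "a + b * s = 2 * pi * real m" "s \<ge> N" using assms m by (simp_all add: s_def field_simps)
 thus False using N[of s] cos_2npi[of m] by (simp add: mult_ac)
qed

lemma filterlim_norm_ray:
 fixes p v :: "real^3"
 assumes "v \<noteq> 0" shows "filterlim (\<lambda>s. norm (p + s *\<^sub>R v)) at_top at_top"
 unfolding filterlim_at_top
proof
 fix Z
 show "eventually (\<lambda>s. Z \<le> norm (p + s *\<^sub>R v)) at_top"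
  using eventually_ge_at_top[of "(Z + norm p) / norm v"] eventually_ge_at_top[of 0]
 proof eventually_elim
  case (elim s)
  have "Z + norm p \<le> s * norm v" using elim assms by (simp add: field_simps)
  thus ?case using norm_triangle_ineq2[of "s *\<^sub>R v" "- p"] elim by (simp add: add.commute)
 qed
qed

lemma weak_helmholtz_plane_refl:
 assumes n: "norm n = 1" and weak: "weak_helmholtz k S u" and S: "open S"
 shows "weak_helmholtz k (plane_refl n c -` S) (\<lambda>x. u (plane_refl n c x))"
 unfolding weak_helmholtz_def
proof (intro conjI allI impI)
 let ?R = "plane_refl n c"
 show "continuous_on (?R -` S) (\<lambda>x. u (?R x))"
  by (rule continuous_on_compose2[OF weak_helmholtz_continuous[OF weak] continuous_on_plane_refl[OF n]]) auto
 fix \<phi> g h K assume a: "C2_data \<phi> g h" "compact K" "K \<subseteq> ?R -` S" "\<forall>x. x \<notin> K \<longrightarrow> \<phi> x = 0"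
 obtain g' h' where gh: "C2_data (\<lambda>x. \<phi> (?R x)) g' h'" "\<And>x. helm k (\<lambda>x. \<phi> (?R x)) h' x = helm k \<phi> h (?R x)"
  using C2_data_plane_refl(1)[OF n a(1), of c] C2_data_plane_refl(2)[OF n a(1), of k c] by blast
 have K': "compact (?R ` K)" "?R ` K \<subseteq> S"
  using a(2,3) by (auto intro!: compact_continuous_image continuous_on_plane_refl[OF n])
 have z: "\<phi> (?R x) = 0" if "x \<notin> ?R ` K" for x
  using a(4) that plane_refl_plane_refl[OF n, of c x] by (metis image_eqI)
 have c: "continuous_on UNIV (\<lambda>x. u x * helm k (\<lambda>x. \<phi> (?R x)) h' x)"
  by (rule helm_mult_continuous[OF weak_helmholtz_continuous[OF weak] S gh(1) K' z])
 have "(LINT x|lborel. u (?R x) * helm k \<phi> h x) = (LINT x|lborel. u (?R x) * helm k (\<lambda>x. \<phi> (?R x)) h' (?R x))"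
  by (simp add: gh(2) plane_refl_plane_refl[OF n])
 also have "\<dots> = (LINT x|lborel. u x * helm k (\<lambda>x. \<phi> (?R x)) h' x)"
  by (rule lborel_integral_plane_refl[OF n c])
 also have "\<dots> = 0" by (rule weak_helmholtzD[OF weak gh(1) K' z])
 finally show "(LINT x|lborel. u (?R x) * helm k \<phi> h x) = 0" .
qed

context dirichlet_scattering
begin

lemma u_ray_asymptotics:
 assumes v: "v \<noteq> 0" and in_Omega: "\<And>s. s \<ge> 0 \<Longrightarrow> p + s *\<^sub>R v \<in> Omega f"
 shows "((\<lambda>s. norm (u (p + s *\<^sub>R v)) - 2 * \<bar>sin (k * - d $ 3 * (p $ 3 + s * v $ 3))\<bar>) \<longlongrightarrow> 0) at_top"
proof -
 obtain R1 C where C: "\<And>x. x \<in> Omega f \<Longrightarrow> norm x > R1 \<Longrightarrow> norm (usc x) \<le> C / norm x" using usc_decay by blast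
 have lim: "((\<lambda>s. C / norm (p + s *\<^sub>R v)) \<longlongrightarrow> 0) at_top"
  by (rule real_tendsto_divide_at_top[OF tendsto_const filterlim_norm_ray[OF v]])
 have "eventually (\<lambda>s. norm (p + s *\<^sub>R v) > R1) at_top"
  using filterlim_norm_ray[OF v, of p] unfolding filterlim_at_top_dense by blast
 hence "eventually (\<lambda>s. norm (norm (u (p + s *\<^sub>R v)) - 2 * \<bar>sin (k * - d $ 3 * (p $ 3 + s * v $ 3))\<bar>) \<le> C / norm (p + s *\<^sub>R v)) at_top"
  using eventually_ge_at_top[of 0]
 proof eventually_elim
  case (elim s)
  define x where "x = p + s *\<^sub>R v"
  have x3: "x $ 3 = p $ 3 + s * v $ 3" by (simp add: x_def)
  have "\<bar>norm (u x) - norm (u_in k d x + u_re_D k d x)\<bar> \<le> norm (usc x)"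
   using norm_triangle_ineq3[of "u x" "u_in k d x + u_re_D k d x"] by (simp add: usc_def u_sc_D_def diff_diff_eq)
  moreover have "norm (usc x) \<le> C / norm x" using C in_Omega elim by (simp add: x_def)
  ultimately show ?case unfolding x3[symmetric] x_def[symmetric] norm_u_in_plus_u_re_D real_norm_def by linarith
 qed
 from Lim_null_comparison[OF this lim] show ?thesis .
qed

lemma no_zero_ray:
 fixes p v :: "real^3"
 assumes v: "v $ 3 > 0" and in_Omega: "\<And>s. s \<ge> 0 \<Longrightarrow> p + s *\<^sub>R v \<in> Omega f"
  and zero: "\<And>s. s \<ge> 0 \<Longrightarrow> u (p + s *\<^sub>R v) = 0"
 shows False
proof -
 define b where "b = k * - d $ 3"
 have b: "b > 0" using k norm_d by (simp add: b_def mult_pos_neg)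
 have "v \<noteq> 0" using v by auto
 from u_ray_asymptotics[OF this in_Omega]
 have "((\<lambda>s. norm (u (p + s *\<^sub>R v)) - 2 * \<bar>sin (b * (p $ 3 + s * v $ 3))\<bar>) \<longlongrightarrow> 0) at_top" by (simp add: b_def)
 hence "((\<lambda>s. cos ((b * p $ 3 - pi / 2) + (b * v $ 3) * s)) \<longlongrightarrow> 0) at_top"
 \<comment> \<open>Since \<open>u\<close> is 0 on the ray, the weight \<open>- 1\<close> turns the
   vanishing difference into an upper bound for the modulus of the sine, which is written as a
   shifted cosine.\<close>
 proof (rule Lim_null_comparison[rotated, OF tendsto_mult_right_zero, of _ _ _ "- 1"])
  show "eventually (\<lambda>s. norm (cos ((b * p $ 3 - pi / 2) + (b * v $ 3) * s))
    \<le> - 1 * (norm (u (p + s *\<^sub>R v)) - 2 * \<bar>sin (b * (p $ 3 + s * v $ 3))\<bar>)) at_top"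
   using eventually_ge_at_top[of 0]
  proof eventually_elim
   case (elim s)
   have "(b * p $ 3 - pi / 2) + (b * v $ 3) * s = b * (p $ 3 + s * v $ 3) - pi / 2" by (simp add: algebra_simps)
   hence "cos ((b * p $ 3 - pi / 2) + (b * v $ 3) * s) = sin (b * (p $ 3 + s * v $ 3))" by (simp only:) (simp add: cos_diff)
   thus ?case using zero[OF elim] by simp
  qed
 qed
 thus False using cos_not_tendsto_zero[of "b * v $ 3"] b v by simp
qed

definition nodal :: "real^3 \<Rightarrow> real^3 \<Rightarrow> bool" where
 "nodal p n \<longleftrightarrow> norm n = 1 \<and> (\<exists>\<rho>>0. \<forall>x. dist x p < \<rho> \<longrightarrow> (x - p) \<bullet> n = 0 \<longrightarrow> u x = 0)"

text \<open>Segments from \<open>x0\<close> to points of the same plane stay in \<open>C\<close> and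
  in the plane, and \<open>u\<close> is analytic along them. So a nodal disc, however small, fills
  the whole section of any open convex part of the domain.\<close>

lemma nodal_spread:
 assumes C: "convex C" "open C" "C \<subseteq> Omega f" and x0: "x0 \<in> C" and e: "\<epsilon> > 0"
  and zero: "\<And>x. dist x x0 < \<epsilon> \<Longrightarrow> (x - x0) \<bullet> n = 0 \<Longrightarrow> u x = 0"
  and y: "y \<in> C" "(y - x0) \<bullet> n = 0"
 shows "u y = 0"
proof -
 define e where "e = y - x0"
 define I where "I = (\<lambda>t. x0 + t *\<^sub>R e) -` C"
 have "convex I"
 proof (rule convexI)
  fix s t a b :: real assume h: "s \<in> I" "t \<in> I" "0 \<le> a" "0 \<le> b" "a + b = 1"
  have "x0 + (a * s + b * t) *\<^sub>R e = (a + b) *\<^sub>R x0 + (a * s + b * t) *\<^sub>R e" using h by simp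
  also have "\<dots> = a *\<^sub>R (x0 + s *\<^sub>R e) + b *\<^sub>R (x0 + t *\<^sub>R e)" by (simp add: algebra_simps)
  finally show "a *\<^sub>R s + b *\<^sub>R t \<in> I" using h convexD[OF C(1), of "x0 + s *\<^sub>R e" "x0 + t *\<^sub>R e" a b] by (simp add: I_def)
 qed
 have "open I" unfolding I_def by (intro open_vimage C(2) continuous_intros)
 have "u (x0 + 1 *\<^sub>R e) = 0"
 proof (rule weak_helmholtz_line_unique[OF weak_u open_Omega[OF cf] \<open>open I\<close> convex_connected[OF \<open>convex I\<close>]])
  show "0 < \<epsilon> / (norm e + 1)" using e by (simp add: add_nonneg_pos)
  fix t :: real assume t: "\<bar>t - 0\<bar> < \<epsilon> / (norm e + 1)"
  have "\<bar>t\<bar> * norm e \<le> \<bar>t\<bar> * (norm e + 1)" by (simp add: mult_left_mono)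
  also have "\<dots> < \<epsilon>" using t by (simp add: pos_less_divide_eq add_nonneg_pos)
  finally show "u (x0 + t *\<^sub>R e) = 0" using y(2) by (intro zero) (auto simp: dist_norm e_def)
 qed (use C x0 y in \<open>auto simp: I_def e_def\<close>)
 thus ?thesis by (simp add: e_def)
qed

text \<open>The projection \<open>v\<close> of the vertical axis to the nodal plane climbs unless
  the normal is vertical. Above height \<open>H\<close> the domain contains a half-space, which is
  convex, so the zeros spread along the whole climbing ray, against
  \<open>no_zero_ray\<close>.\<close>

lemma nodal_high_horizontal:
 fixes p n :: "real^3"
 assumes H: "\<And>y. f y \<le> H" and p: "p $ 3 > H" and nodal: "nodal p n"
 shows "(n $ 3)\<^sup>2 = 1"
proof (rule ccontr)
 assume ne: "(n $ 3)\<^sup>2 \<noteq> 1"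
 have n: "norm n = 1" using nodal by (simp add: nodal_def)
 have "(n $ 3)\<^sup>2 \<le> 1" using component_le_norm_cart[of n 3] n by (simp add: abs_square_le_1)
 hence n3: "(n $ 3)\<^sup>2 < 1" using ne by simp
 define v where "v = axis 3 1 - n $ 3 *\<^sub>R n"
 have v3: "v $ 3 > 0" using n3 by (simp add: v_def power2_eq_square)
 have vn: "v \<bullet> n = 0" using n by (simp add: v_def inner_diff_left inner_axis' norm_eq_1)
 define C where "C = {x :: real^3. x $ 3 > H}"
 have C: "convex C" "open C" "C \<subseteq> Omega f"
  using convex_halfspace_gt[of H "axis 3 (1::real) :: real^3"]
  by (auto simp: C_def Omega_def inner_axis' intro!: open_Collect_less continuous_intros le_less_trans[OF H])
 obtain \<rho> where r: "\<rho> > 0" "\<And>x. dist x p < \<rho> \<Longrightarrow> (x - p) \<bullet> n = 0 \<Longrightarrow> u x = 0" using nodal unfolding nodal_def by blast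
 have inC: "p + s *\<^sub>R v \<in> C" if "s \<ge> 0" for s using mult_nonneg_nonneg[OF that less_imp_le[OF v3]] p by (simp add: C_def)
 show False
 proof (rule no_zero_ray[OF v3])
  show "p + s *\<^sub>R v \<in> Omega f" if "s \<ge> 0" for s using inC[OF that] C by auto
  show "u (p + s *\<^sub>R v) = 0" if "s \<ge> 0" for s
   by (rule nodal_spread[OF C _ r inC[OF that]]) (use p vn in \<open>auto simp: C_def\<close>)
 qed
qed

lemma above_in_Omega: "p \<in> Omega f \<Longrightarrow> s \<ge> 0 \<Longrightarrow> p + s *\<^sub>R axis 3 1 \<in> Omega f"
 by (simp add: Omega_def)

text \<open>Otherwise the vertical ray through \<open>p\<close> would lie in the nodal plane and
  consist of zeros.\<close>

lemma nodal_not_vertical: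
 fixes p n :: "real^3"
 assumes p: "p \<in> Omega f" and nodal: "nodal p n" shows "n $ 3 \<noteq> 0"
proof
 assume n3: "n $ 3 = 0"
 obtain \<rho> where r: "\<rho> > 0" "\<And>x. dist x p < \<rho> \<Longrightarrow> (x - p) \<bullet> n = 0 \<Longrightarrow> u x = 0" using nodal unfolding nodal_def by blast
 show False
 proof (rule no_zero_ray[of "axis 3 1" p])
  fix s :: real assume s: "s \<ge> 0"
  show "p + s *\<^sub>R axis 3 1 \<in> Omega f" by (rule above_in_Omega[OF p s])
  show "u (p + s *\<^sub>R axis 3 1) = 0"
  proof (rule weak_helmholtz_line_unique[OF weak_u open_Omega[OF cf], of "{f (hproj p) - p $ 3<..}"])
   show "u (p + t *\<^sub>R axis 3 1) = 0" if "\<bar>t - 0\<bar> < \<rho>" for t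
    using that n3 by (intro r(2)) (auto simp: dist_norm inner_axis')
  qed (use p s r in \<open>auto simp: Omega_def\<close>)
 qed simp
qed

text \<open>In a small ball the odd extension \<open>W\<close> of \<open>u\<close> from one side of
  the plane is a weak solution equal to \<open>u\<close> on that side, hence everywhere in the ball.
  So \<open>u\<close> is odd near \<open>p\<close>, and unique continuation carries this along
  \<open>C\<close>, where both a point and its mirror image lie in the domain.\<close>

lemma nodal_antisymmetric:
 assumes p: "p \<in> Omega f" and nodal: "nodal p n" and C: "connected C" "p \<in> C" "C \<subseteq> Omega f"
  and CR: "\<And>x. x \<in> C \<Longrightarrow> plane_refl n (p \<bullet> n) x \<in> Omega f" and x: "x \<in> C"
 shows "u (plane_refl n (p \<bullet> n) x) = - u x"
proof -
 define c where "c = p \<bullet> n"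
 let ?R = "plane_refl n c"
 have n: "norm n = 1" using nodal by (simp add: nodal_def)
 have oO: "open (Omega f)" by (rule open_Omega[OF cf])
 obtain r where r: "r > 0" "\<And>x. dist x p < r \<Longrightarrow> (x - p) \<bullet> n = 0 \<Longrightarrow> u x = 0" using nodal unfolding nodal_def by blast
 obtain r' where r': "r' > 0" "ball p r' \<subseteq> Omega f" using oO p unfolding open_contains_ball by blast
 define \<rho> where "\<rho> = min r r'"
 have rho: "\<rho> > 0" "ball p \<rho> \<subseteq> Omega f" using r r' by (auto simp: \<rho>_def)
 have Rp: "?R p = p" by (simp add: plane_refl_on_plane[OF n] c_def)
 have Rball: "?R y \<in> ball p \<rho>" if "y \<in> ball p \<rho>" for y
  using that dist_plane_refl[OF n, of c p y] Rp by simp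
 define W where "W y = (if y \<bullet> n \<le> c then - u (?R y) else u y)" for y
 have on_plane: "u y = 0" if "y \<in> ball p \<rho>" "y \<bullet> n = c" for y
  using that by (intro r(2)) (auto simp: \<rho>_def dist_commute inner_diff_left c_def)
 have cu: "continuous_on (ball p \<rho>) u" by (rule continuous_on_subset[OF weak_helmholtz_continuous[OF weak_u] rho(2)])
 have cW: "continuous_on (ball p \<rho>) W" unfolding W_def
 proof (rule continuous_on_cases_le)
  show "continuous_on {t \<in> ball p \<rho>. t \<bullet> n \<le> c} (\<lambda>y. - u (?R y))"
   by (intro continuous_intros continuous_on_compose2[OF cu continuous_on_plane_refl[OF n]]) (use Rball in auto)
  show "continuous_on {t \<in> ball p \<rho>. c \<le> t \<bullet> n} u" by (rule continuous_on_subset[OF cu]) auto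
 qed (use on_plane in \<open>auto intro!: continuous_intros simp: plane_refl_on_plane[OF n]\<close>)
 have wW: "weak_helmholtz k (ball p \<rho>) W"
 proof (rule weak_helmholtz_odd_reflection[OF n _ Rball cW])
  show "W (?R y) = - W y" if "y \<in> ball p \<rho>" for y
   using plane_refl_inner[OF n, of c y] on_plane[OF that] plane_refl_on_plane[OF n, of y c]
   by (auto simp: W_def plane_refl_plane_refl[OF n])
  have "weak_helmholtz k (ball p \<rho> \<inter> {y. c < y \<bullet> n}) u" using rho(2) by (intro weak_helmholtz_subset[OF weak_u]) auto
  thus "weak_helmholtz k (ball p \<rho> \<inter> {y. c < y \<bullet> n}) W" by (rule weak_helmholtz_cong) (simp add: W_def)
 qed auto
 have eqW: "W y - u y = 0" if "y \<in> ball p \<rho>" for y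
 proof (rule weak_helmholtz_unique_continuation[of k "ball p \<rho>" _ "p + (\<rho> / 2) *\<^sub>R n" "\<rho> / 2"])
  show "weak_helmholtz k (ball p \<rho>) (\<lambda>y. W y - u y)"
   by (intro weak_helmholtz_diff wW weak_helmholtz_subset[OF weak_u rho(2)]) simp
  show "W y - u y = 0" if y: "dist y (p + (\<rho> / 2) *\<^sub>R n) < \<rho> / 2" for y
  proof -
   have "\<bar>(y - (p + (\<rho> / 2) *\<^sub>R n)) \<bullet> n\<bar> < \<rho> / 2"
    using Cauchy_Schwarz_ineq2[of "y - (p + (\<rho> / 2) *\<^sub>R n)" n] y n by (simp add: dist_norm)
   moreover have "(y - (p + (\<rho> / 2) *\<^sub>R n)) \<bullet> n = y \<bullet> n - c - \<rho> / 2"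
    using n by (simp add: inner_diff_left inner_add_left c_def norm_eq_1)
   ultimately have "y \<bullet> n > c" by linarith
   thus ?thesis by (simp add: W_def)
  qed
 qed (use that rho n in \<open>auto simp: dist_norm\<close>)
 have anti: "u (?R y) + u y = 0" if "y \<in> ball p \<rho>" for y
 proof (cases "y \<bullet> n \<le> c")
  case True
  thus ?thesis using eqW[OF that] by (simp add: W_def add_eq_0_iff)
 next
  case False
  hence "?R y \<bullet> n \<le> c" using plane_refl_inner[OF n, of c y] by simp
  thus ?thesis using eqW[OF Rball[OF that]] by (simp add: W_def plane_refl_plane_refl[OF n]) (metis add.left_inverse)
 qed
 define S where "S = Omega f \<inter> ?R -` Omega f"
 have oS: "open S" unfolding S_def by (intro open_Int oO open_vimage continuous_on_plane_refl[OF n])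
 have wR: "weak_helmholtz k S (\<lambda>y. u (?R y))"
  by (rule weak_helmholtz_subset[OF weak_helmholtz_plane_refl[OF n weak_u oO]]) (simp add: S_def)
 \<comment> \<open>A sum written by differences, so that \<open>weak_helmholtz_diff\<close>
   applies.\<close>
 have "weak_helmholtz k S (\<lambda>y. u (?R y) - ((u y - u y) - u y))"
  by (intro weak_helmholtz_diff wR oS weak_helmholtz_subset[OF weak_u]) (auto simp: S_def)
 hence wS: "weak_helmholtz k S (\<lambda>y. u (?R y) + u y)" by (rule weak_helmholtz_cong) simp
 \<comment> \<open>\<open>C\<close> may be thin, for instance a ray; unique continuation runs in the
   open component of \<open>S\<close> that contains it.\<close>
 define T where "T = connected_component_set S p"
 have CT: "C \<subseteq> T" unfolding T_def by (rule connected_component_maximal[OF C(2,1)]) (use C(3) CR in \<open>auto simp: S_def c_def\<close>)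
 have "u (?R x) + u x = 0"
 proof (rule weak_helmholtz_unique_continuation[of k T _ p \<rho>])
  show "weak_helmholtz k T (\<lambda>y. u (?R y) + u y)"
   by (rule weak_helmholtz_subset[OF wS]) (simp add: T_def connected_component_subset)
  show "open T" unfolding T_def by (rule open_connected_component[OF oS])
  show "connected T" unfolding T_def by (rule connected_connected_component)
 qed (use CT C x rho anti in \<open>auto simp: dist_commute\<close>)
 thus ?thesis unfolding c_def[symmetric] by (simp add: add_eq_0_iff)
qed

end

section \<open>Polyhedral surfaces\<close>

text \<open>Pieces with empty interior are negligible. The others form a closed union whose
  complement is open and negligible, hence empty, and a convex set with interior points is contained
  in the closure of its interior.\<close>

lemma polyhedral_type_facets:
 assumes "polyhedral_type f"
 obtains F where "finite F" "\<And>y. \<exists>(a, b)\<in>F. y \<in> closure (interior {z. f z = a \<bullet> z + b})"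
proof -
 obtain Q where Q: "finite Q" "\<Union>Q = UNIV" and Q': "\<forall>P\<in>Q. polyhedron P \<and> (\<exists>a b. \<forall>y\<in>P. f y = a \<bullet> y + b)"
  using assms unfolding polyhedral_type_def by blast
 have poly: "polyhedron P" if "P \<in> Q" for P using Q' that by simp
 have "\<forall>P\<in>Q. \<exists>ab. \<forall>y\<in>P. f y = fst ab \<bullet> y + snd ab" using Q' by simp
 from bchoice[OF this] obtain AB where AB: "\<forall>P\<in>Q. \<forall>y\<in>P. f y = fst (AB P) \<bullet> y + snd (AB P)" ..
 define A B where "A P = fst (AB P)" and "B P = snd (AB P)" for P
 show thesis
 proof (rule that[of "(\<lambda>P. (A P, B P)) ` Q"])
  fix y
  define U where "U = \<Union>{P \<in> Q. interior P \<noteq> {}}"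
  have "closed U" unfolding U_def using Q(1) poly by (intro closed_Union) (auto intro: polyhedron_imp_closed)
  have "negligible (\<Union>{P \<in> Q. interior P = {}})"
   using Q(1) poly by (intro negligible_Union) (auto simp: negligible_convex_interior[OF polyhedron_imp_convex])
  moreover have "- U \<subseteq> \<Union>{P \<in> Q. interior P = {}}"
  proof
   fix x assume "x \<in> - U"
   moreover obtain P where "P \<in> Q" "x \<in> P" using Q(2) UNIV_I[of x] unfolding Q(2)[symmetric] by (elim UnionE)
   ultimately show "x \<in> \<Union>{P \<in> Q. interior P = {}}" by (auto simp: U_def)
  qed
  ultimately have "negligible (- U)" by (rule negligible_subset)
  hence "U = UNIV" using \<open>closed U\<close> open_not_negligible[of "- U"] by auto
  then obtain P where P: "P \<in> Q" "interior P \<noteq> {}" "y \<in> P" unfolding U_def by blast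
  have "y \<in> closure (interior P)"
   using P convex_closure_interior[OF polyhedron_imp_convex[OF poly]] closure_subset[of P] by auto
  also have "\<dots> \<subseteq> closure (interior {z. f z = A P \<bullet> z + B P})"
   by (intro closure_mono interior_mono) (use AB P(1) in \<open>auto simp: A_def B_def\<close>)
  finally show "\<exists>(a, b)\<in>(\<lambda>P. (A P, B P)) ` Q. y \<in> closure (interior {z. f z = a \<bullet> z + b})" using P(1) by auto
 qed (use Q in simp)
qed

lemma closure_facet:
 assumes "continuous_on UNIV f" "y \<in> closure (interior {z. f z = a \<bullet> z + b})" shows "f y = a \<bullet> y + (b::real)"
proof -
 have "closed {z. f z = a \<bullet> z + b}" by (intro closed_Collect_eq assms continuous_intros)
 hence "closure (interior {z. f z = a \<bullet> z + b}) \<subseteq> {z. f z = a \<bullet> z + b}" by (intro closure_minimal interior_subset)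
 thus ?thesis using assms by auto
qed

text \<open>The upward unit normal of the graph of any affine function with gradient
  \<open>a\<close>.\<close>

definition facet_normal :: "real^2 \<Rightarrow> real^3" where
 "facet_normal a = lift3 (- a) 1 /\<^sub>R norm (lift3 (- a) 1)"

lemma inner_lift3: "x \<bullet> lift3 z s = hproj x \<bullet> z + x $ 3 * s"
 by (simp add: inner_vec_def sum_2 sum_3)

lemma facet_normal_props:
 shows "norm (facet_normal a) = 1" "x \<bullet> facet_normal a = 0 \<longleftrightarrow> x $ 3 = a \<bullet> hproj x" "(facet_normal a $ 3)\<^sup>2 = 1 \<Longrightarrow> a = 0"
proof -
 have 0: "lift3 (- a) 1 \<noteq> 0" by (metis lift3_nth(3) zero_index zero_neq_one)
 show n: "norm (facet_normal a) = 1" using 0 by (simp add: facet_normal_def)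
 show "x \<bullet> facet_normal a = 0 \<longleftrightarrow> x $ 3 = a \<bullet> hproj x" using 0 by (auto simp: facet_normal_def inner_lift3 inner_commute)
 assume "(facet_normal a $ 3)\<^sup>2 = 1"
 hence "hproj (facet_normal a) = 0" using norm_vec3[of "facet_normal a"] n by simp
 thus "a = 0" using 0 by (simp add: facet_normal_def)
qed

lemma facet_plane_point:
 assumes z: "\<And>z. dist z z0 < \<epsilon> \<Longrightarrow> f z = a \<bullet> z + b" and e: "\<epsilon> > 0"
  and x: "dist x (lift3 z0 (f z0)) < \<epsilon>" "(x - lift3 z0 (f z0)) \<bullet> facet_normal a = 0"
 shows "dist (hproj x) z0 < \<epsilon>" "lift3 (hproj x) (f (hproj x)) = x"
proof -
 show 2: "dist (hproj x) z0 < \<epsilon>" using norm_vec3_bounds(1)[of "x - lift3 z0 (f z0)"] x(1) by (simp add: dist_norm)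
 have "x $ 3 - f z0 = a \<bullet> (hproj x - z0)" using x(2) by (simp add: facet_normal_props(2))
 hence "x $ 3 = f (hproj x)" using z[OF 2] z[of z0] e by (simp add: inner_diff_right)
 thus "lift3 (hproj x) (f (hproj x)) = x" by (metis lift3_hproj)
qed

lemma plane_refl_diff_inner:
 "(plane_refl n c x - plane_refl n c y) \<bullet> v = (x - y) \<bullet> (v - (2 * (v \<bullet> n)) *\<^sub>R n)"
 by (simp add: plane_refl_def inner_diff_left inner_diff_right inner_commute[of n] algebra_simps)

lemma norm_reflected: "norm n = 1 \<Longrightarrow> norm (v - (2 * (v \<bullet> n)) *\<^sub>R n) = norm (v :: real^3)"
 using dist_plane_refl[of n 0 v 0] by (simp add: plane_refl_def dist_norm)

text \<open>The shift \<open>h = \<pi> / b\<close> is half a period of the faster cosine. The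
  combination \<open>g (s + h) + g (s - h) - 2 cos (\<pi> t) g s\<close> annihilates the slower one
  and multiplies the faster by \<open>- 2 (1 + cos (\<pi> t))\<close>, which is non-zero because
  \<open>t < 1\<close>.\<close>

lemma cos_sum_beat:
 fixes a b t :: real
 assumes b: "b > 0" and t: "0 \<le> t" "t < 1"
 shows "\<not> ((\<lambda>s. cos (a + b * s) - cos (a + b * t * s)) \<longlongrightarrow> 0) at_top"
proof
 define g where "g s = cos (a + b * s) - cos (a + b * t * s)" for s
 define h where "h = pi / b"
 assume L: "((\<lambda>s. cos (a + b * s) - cos (a + b * t * s)) \<longlongrightarrow> 0) at_top"
 have sh: "filterlim (\<lambda>s. s + c) at_top at_top" for c :: real
  using filterlim_tendsto_add_at_top[OF tendsto_const filterlim_ident, of c] by (simp add: add.commute)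
 have g: "((\<lambda>s. g (s + c)) \<longlongrightarrow> 0) at_top" for c using filterlim_compose[OF L sh[of c]] by (simp add: g_def)
 have bh: "b * h = pi" using b by (simp add: h_def)
 have "g (s + h) + g (s + - h) - 2 * cos (pi * t) * g (s + 0) = - 2 * (1 + cos (pi * t)) * cos (a + b * s)" for s
 proof -
  have 1: "a + b * (s + h) = (a + b * s) + pi" "a + b * (s + - h) = (a + b * s) - pi"
   using bh by (simp_all add: algebra_simps)
  have 2: "a + b * t * (s + h) = (a + b * t * s) + pi * t" "a + b * t * (s + - h) = (a + b * t * s) - pi * t"
   unfolding bh[symmetric] by (simp_all add: algebra_simps)
  show ?thesis unfolding g_def 1 2 cos_add[of _ "pi * t"] cos_diff by (simp add: algebra_simps)
 qed
 moreover have "((\<lambda>s. g (s + h) + g (s + - h) - 2 * cos (pi * t) * g (s + 0)) \<longlongrightarrow> 0 + 0 - 2 * cos (pi * t) * 0) at_top"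
  by (intro tendsto_intros g)
 ultimately have "((\<lambda>s. - 2 * (1 + cos (pi * t)) * cos (a + b * s)) \<longlongrightarrow> 0) at_top" by simp
 moreover have "cos pi < cos (pi * t)" using t by (intro cos_monotone_0_pi) auto
 hence "- 2 * (1 + cos (pi * t)) \<noteq> 0" by simp
 ultimately have "((\<lambda>s. cos (a + b * s)) \<longlongrightarrow> 0) at_top" using tendsto_mult_left_iff[of "- 2 * (1 + cos (pi * t))" "\<lambda>s. cos (a + b * s)" 0 at_top] by simp
 thus False using cos_not_tendsto_zero[OF b] by simp
qed

context dirichlet_scattering
begin

text \<open>The surface is approached vertically from above. The factor \<open>c\<close> is 1 when
  two fields are compared above both surfaces and \<open>- 1\<close> when a field is compared with
  its mirror image.\<close>

lemma boundary_limit_zero: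
 assumes w: "isCont w (lift3 z (f z))" and e: "\<epsilon> > 0"
  and eq: "\<And>s. 0 < s \<Longrightarrow> s < \<epsilon> \<Longrightarrow> w (lift3 z (f z + s)) = c * u (lift3 z (f z + s))"
 shows "w (lift3 z (f z)) = 0"
proof -
 let ?y = "\<lambda>s. lift3 z (f z + s)"
 have y0: "(?y \<longlongrightarrow> ?y 0) (at_right 0)" unfolding lift3_def by (intro tendsto_intros)
 have ev: "eventually (\<lambda>s. 0 < s \<and> s < \<epsilon>) (at_right 0)" using e by (auto simp: eventually_at_right_field)
 have "((\<lambda>s. u (?y s)) \<longlongrightarrow> u (?y 0)) (at_right 0)"
 proof (rule continuous_on_tendsto_compose[OF continuous_u y0])
  show "eventually (\<lambda>s. ?y s \<in> closure (Omega f)) (at_right 0)"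
   using ev by eventually_elim (auto intro!: above_mem_closure_Omega)
 qed (auto intro!: above_mem_closure_Omega)
 hence 1: "((\<lambda>s. c * u (?y s)) \<longlongrightarrow> 0) (at_right 0)"
  using u_Gamma[of "?y 0"] by (intro tendsto_mult_right_zero) (simp add: Gamma_def)
 have "((\<lambda>s. w (?y s)) \<longlongrightarrow> w (?y 0)) (at_right 0)" using isCont_tendsto_compose[of "?y 0", OF _ y0] w by simp
 moreover have "eventually (\<lambda>s. w (?y s) = c * u (?y s)) (at_right 0)" using ev by eventually_elim (use eq in auto)
 ultimately have "((\<lambda>s. c * u (?y s)) \<longlongrightarrow> w (?y 0)) (at_right 0)" by (rule Lim_transform_eventually)
 from tendsto_unique[OF _ this 1] show ?thesis by simp
qed

text \<open>Unit normals have a convergent subsequence, but the radii of the discs may shrink to 0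
  along it. \<open>nodal_spread\<close> removes this danger: inside a ball
  \<open>ball q \<rho>\<close> of the domain each disc extends to the full section.\<close>

lemma nodal_ray_closed:
 assumes p: "p \<in> Omega f" shows "closed {s. s \<ge> 0 \<and> (\<exists>m. nodal (p + s *\<^sub>R axis 3 1) m)}"
 unfolding closed_sequential_limits
proof (intro allI impI)
 fix s :: "nat \<Rightarrow> real" and l
 assume "(\<forall>j. s j \<in> {s. s \<ge> 0 \<and> (\<exists>m. nodal (p + s *\<^sub>R axis 3 1) m)}) \<and> s \<longlonglongrightarrow> l"
 hence s: "\<And>j. s j \<ge> 0" "\<forall>j. \<exists>m. nodal (p + s j *\<^sub>R axis 3 1) m" "s \<longlonglongrightarrow> l" by auto
 obtain m where m: "\<And>j. nodal (p + s j *\<^sub>R axis 3 1) (m j)" using s(2) by metis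
 have "\<forall>j. m j \<in> sphere 0 1" using m by (simp add: nodal_def)
 then obtain m0 r where r: "m0 \<in> sphere 0 1" "strict_mono r" "(m \<circ> r) \<longlonglongrightarrow> m0"
  using compact_sphere[of "0 :: real^3" 1] unfolding compact_def by blast
 have l: "l \<ge> 0" using LIMSEQ_le_const[OF s(3)] s(1) by blast
 define q where "q = p + l *\<^sub>R axis 3 1"
 define c where "c j = p + s (r j) *\<^sub>R axis 3 1" for j
 have cq: "c \<longlonglongrightarrow> q" unfolding c_def q_def by (intro tendsto_intros LIMSEQ_subseq_LIMSEQ[OF s(3) r(2), unfolded o_def])
 have mr: "(\<lambda>j. m (r j)) \<longlonglongrightarrow> m0" using r(3) by (simp add: o_def)
 obtain \<rho> where rho: "\<rho> > 0" "ball q \<rho> \<subseteq> Omega f"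
  using open_Omega[OF cf] above_in_Omega[OF p l] unfolding q_def open_contains_ball by blast
 have "nodal q m0" unfolding nodal_def
 proof (intro conjI exI[of _ \<rho>] allI impI)
  show "norm m0 = 1" using r(1) by simp
  fix x assume x: "dist x q < \<rho>" "(x - q) \<bullet> m0 = 0"
  \<comment> \<open>The projection of \<open>x\<close> to the j-th nodal plane; it converges to
    \<open>x\<close> because \<open>x\<close> lies in the limiting plane.\<close>
  define y where "y j = c j + ((x - q) - ((x - q) \<bullet> m (r j)) *\<^sub>R m (r j))" for j
  have "y \<longlonglongrightarrow> q + ((x - q) - ((x - q) \<bullet> m0) *\<^sub>R m0)" unfolding y_def by (intro tendsto_intros cq mr)
  hence yx: "y \<longlonglongrightarrow> x" using x(2) by simp
  have ev: "eventually (\<lambda>j. c j \<in> ball q \<rho>) sequentially" "eventually (\<lambda>j. y j \<in> ball q \<rho>) sequentially"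
   using topological_tendstoD[OF cq, of "ball q \<rho>"] topological_tendstoD[OF yx, of "ball q \<rho>"] rho x by (auto simp: dist_commute)
  hence "eventually (\<lambda>j. u (y j) = 0) sequentially"
  proof eventually_elim
   case (elim j)
   obtain \<epsilon> where e: "\<epsilon> > 0" "\<And>x. dist x (c j) < \<epsilon> \<Longrightarrow> (x - c j) \<bullet> m (r j) = 0 \<Longrightarrow> u x = 0"
    using m[of "r j"] unfolding nodal_def c_def by blast
   have "m (r j) \<bullet> m (r j) = 1" using m[of "r j"] by (simp add: nodal_def norm_eq_1)
   hence "(y j - c j) \<bullet> m (r j) = 0" by (simp add: y_def inner_diff_left)
   from nodal_spread[OF convex_ball open_ball rho(2) elim(1) e elim(2) this] show ?case .
  qed
  moreover have "isCont u x" using weak_helmholtz_continuous[OF weak_u] rho x open_Omega[OF cf]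
   by (auto simp: continuous_on_eq_continuous_at dist_commute subset_eq)
  from isCont_tendsto_compose[OF this yx] have "(\<lambda>j. u (y j)) \<longlonglongrightarrow> u x" .
  ultimately have "(\<lambda>j. 0) \<longlonglongrightarrow> u x" by (rule Lim_transform_eventually[rotated])
  thus "u x = 0" by (simp add: LIMSEQ_const_iff)
 qed (rule rho)
 thus "l \<in> {s. s \<ge> 0 \<and> (\<exists>m. nodal (p + s *\<^sub>R axis 3 1) m)}" using l by (auto simp: q_def)
qed

lemma reflected_ray_leaves:
 assumes p: "p \<in> Omega f" and nodal: "nodal p n"
 shows "\<exists>s>0. plane_refl n (p \<bullet> n) (p + s *\<^sub>R axis 3 1) \<notin> Omega f"
proof (rule ccontr)
 assume stay0: "\<not> ?thesis"
 have n: "norm n = 1" using nodal by (simp add: nodal_def)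
 define \<theta> where "\<theta> = axis 3 1 - (2 * n $ 3) *\<^sub>R n"
 have ray: "plane_refl n (p \<bullet> n) (p + s *\<^sub>R axis 3 1) = p + s *\<^sub>R \<theta>" for s
  by (simp add: plane_refl_def \<theta>_def inner_add_left inner_axis' algebra_simps)
 have ray': "plane_refl n (p \<bullet> n) (p + s *\<^sub>R \<theta>) = p + s *\<^sub>R axis 3 1" for s
  by (simp add: ray[symmetric] plane_refl_plane_refl[OF n])
 have stay: "p + s *\<^sub>R \<theta> \<in> Omega f" if "s \<ge> 0" for s
  using stay0 p that by (cases "s = 0") (auto simp: ray)
 \<comment> \<open>\<theta> is the mirror image of the vertical direction. It is less steep because
   the nodal plane is not vertical, and it does not descend, since a descending ray would be at
   height \<open>- R\<close> or below at the parameter \<open>s\<close> chosen below.\<close>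
 have t3: "\<theta> $ 3 = 1 - 2 * (n $ 3)\<^sup>2" by (simp add: \<theta>_def power2_eq_square)
 have t1: "\<theta> $ 3 < 1" using nodal_not_vertical[OF p nodal] by (simp add: t3)
 have t0: "\<theta> $ 3 \<ge> 0"
 proof (rule ccontr)
  assume neg: "\<not> ?thesis"
  define s where "s = (\<bar>p $ 3\<bar> + R) / - \<theta> $ 3"
  have s: "s \<ge> 0" using divide_nonneg_neg[of "\<bar>p $ 3\<bar> + R" "\<theta> $ 3"] neg R_pos by (simp add: s_def)
  have "s * \<theta> $ 3 = - (\<bar>p $ 3\<bar> + R)" using neg by (simp add: s_def field_simps)
  hence "(p + s *\<^sub>R \<theta>) $ 3 \<le> - R" by simp
  thus False using stay[OF s] fR[of "hproj (p + s *\<^sub>R \<theta>)"] unfolding Omega_def mem_Collect_eq by linarith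
 qed
 have th: "\<theta> \<noteq> 0"
 proof
  assume "\<theta> = 0"
  thus False using ray'[of 1] ray'[of 0] by (metis add_left_cancel axis_eq_0_iff scaleR_one scaleR_zero_right zero_neq_one scaleR_zero_left)
 qed
 have eq: "norm (u (p + s *\<^sub>R axis 3 1)) = norm (u (p + s *\<^sub>R \<theta>))" if "s \<ge> 0" for s
 proof -
  have "u (plane_refl n (p \<bullet> n) (p + s *\<^sub>R \<theta>)) = - u (p + s *\<^sub>R \<theta>)"
  proof (rule nodal_antisymmetric[OF p nodal, of "(\<lambda>s. p + s *\<^sub>R \<theta>) ` {0..}"])
   show "connected ((\<lambda>s. p + s *\<^sub>R \<theta>) ` {0..})" by (intro connected_continuous_image continuous_intros) auto
   show "p \<in> (\<lambda>s. p + s *\<^sub>R \<theta>) ` {0..}" by (rule image_eqI[of _ _ 0]) auto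
  qed (use stay that above_in_Omega[OF p] in \<open>auto simp: ray'\<close>)
  thus ?thesis by (simp add: ray')
 qed
 define b where "b = k * - d $ 3"
 have b: "b > 0" using k norm_d by (simp add: b_def mult_pos_neg)
 define A where "A s = sin (b * (p $ 3 + s))" for s
 define B where "B s = sin (b * (p $ 3 + s * \<theta> $ 3))" for s
 have 1: "((\<lambda>s. norm (u (p + s *\<^sub>R axis 3 1)) - 2 * \<bar>A s\<bar>) \<longlongrightarrow> 0) at_top"
  using u_ray_asymptotics[of "axis 3 1" p] above_in_Omega[OF p] by (simp add: A_def b_def axis_eq_0_iff)
 have 2: "((\<lambda>s. norm (u (p + s *\<^sub>R \<theta>)) - 2 * \<bar>B s\<bar>) \<longlongrightarrow> 0) at_top"
  using u_ray_asymptotics[OF th stay] by (simp add: B_def b_def)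
 have 3: "((\<lambda>s. 2 * \<bar>(norm (u (p + s *\<^sub>R axis 3 1)) - 2 * \<bar>A s\<bar>) - (norm (u (p + s *\<^sub>R \<theta>)) - 2 * \<bar>B s\<bar>)\<bar>) \<longlongrightarrow> 2 * \<bar>0 - 0\<bar>) at_top"
  by (intro tendsto_intros 1 2)
 \<comment> \<open>\<open>cos (2 x) = 1 - 2 sin\<^sup>2 x\<close> gets rid of the absolute values: a
   difference of moduli of sines tending to 0 becomes a difference of cosines with the frequencies
   \<open>2 b\<close> and \<open>2 b \<theta>\<^sub>3\<close>.\<close>
 have "((\<lambda>s. cos (2 * b * p $ 3 + (2 * b) * s) - cos (2 * b * p $ 3 + (2 * b) * \<theta> $ 3 * s)) \<longlongrightarrow> 0) at_top"
 proof (rule Lim_null_comparison[OF _ 3[simplified]])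
  show "eventually (\<lambda>s. norm (cos (2 * b * p $ 3 + (2 * b) * s) - cos (2 * b * p $ 3 + (2 * b) * \<theta> $ 3 * s))
   \<le> 2 * \<bar>norm (u (p + s *\<^sub>R axis 3 1)) - 2 * \<bar>A s\<bar> - (norm (u (p + s *\<^sub>R \<theta>)) - 2 * \<bar>B s\<bar>)\<bar>) at_top"
   using eventually_ge_at_top[of 0]
  proof eventually_elim
   case (elim s)
   have e: "2 * b * p $ 3 + (2 * b) * s = 2 * (b * (p $ 3 + s))" "2 * b * p $ 3 + (2 * b) * \<theta> $ 3 * s = 2 * (b * (p $ 3 + s * \<theta> $ 3))"
    by (simp_all add: algebra_simps)
   have "cos (2 * b * p $ 3 + (2 * b) * s) - cos (2 * b * p $ 3 + (2 * b) * \<theta> $ 3 * s) = 2 * (\<bar>B s\<bar> - \<bar>A s\<bar>) * (\<bar>B s\<bar> + \<bar>A s\<bar>)"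
    unfolding e cos_double_sin A_def B_def by (simp add: algebra_simps power2_eq_square)
   moreover have "\<bar>2 * (\<bar>B s\<bar> - \<bar>A s\<bar>) * (\<bar>B s\<bar> + \<bar>A s\<bar>)\<bar> \<le> \<bar>2 * (\<bar>B s\<bar> - \<bar>A s\<bar>)\<bar> * 2"
    unfolding abs_mult[of "2 * (\<bar>B s\<bar> - \<bar>A s\<bar>)"] using add_mono[OF abs_sin_le_one[of "b * (p $ 3 + s * \<theta> $ 3)"] abs_sin_le_one[of "b * (p $ 3 + s)"]]
    by (intro mult_left_mono) (simp_all add: A_def B_def)
   ultimately show ?case using eq[OF elim] by simp
  qed
 qed
 thus False using cos_sum_beat[of "2 * b" "\<theta> $ 3" "2 * b * p $ 3"] b t0 t1 by simp
qed

end

lemma connected_between_graphs: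
 fixes f g :: "real^2 \<Rightarrow> real"
 assumes B: "connected B" and c: "continuous_on B f" "continuous_on B g" and less: "\<And>z. z \<in> B \<Longrightarrow> f z < g z"
 shows "connected {x. hproj x \<in> B \<and> f (hproj x) < x $ 3 \<and> x $ 3 < g (hproj x)}" (is "connected ?C")
proof -
 let ?h = "\<lambda>y. lift3 (fst y) ((1 - snd y) * f (fst y) + snd y * g (fst y))"
 have "?C = ?h ` (B \<times> {0<..<1})"
 proof (intro equalityI subsetI)
  fix x assume x: "x \<in> ?C"
  define t where "t = (x $ 3 - f (hproj x)) / (g (hproj x) - f (hproj x))"
  have d: "g (hproj x) - f (hproj x) > 0" using less x by simp
  have "t * (g (hproj x) - f (hproj x)) = x $ 3 - f (hproj x)" using d by (simp add: t_def)
  hence "(1 - t) * f (hproj x) + t * g (hproj x) = x $ 3" by (simp add: algebra_simps)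
  moreover have "0 < t" "t < 1" using x d by (simp_all add: t_def)
  ultimately show "x \<in> ?h ` (B \<times> {0<..<1})" using x by (intro image_eqI[of _ _ "(hproj x, t)"]) auto
 next
  fix x assume "x \<in> ?h ` (B \<times> {0<..<1})"
  then obtain z t where zt: "z \<in> B" "0 < t" "t < 1" "x = lift3 z ((1 - t) * f z + t * g z)" by auto
  have "(1 - t) * f z + t * g z = f z + t * (g z - f z)" "(1 - t) * f z + t * g z = g z - (1 - t) * (g z - f z)"
   by (simp_all add: algebra_simps)
  moreover have "t * (g z - f z) > 0" "(1 - t) * (g z - f z) > 0" using zt less[OF zt(1)] by simp_all
  ultimately show "x \<in> ?C" using zt by simp
 qed
 moreover have "connected (?h ` (B \<times> {0<..<1}))"
  by (intro connected_continuous_image connected_Times B continuous_intros continuous_on_compose2[OF c(1) continuous_on_fst]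
    continuous_on_compose2[OF c(2) continuous_on_fst]) auto
 ultimately show ?thesis by simp
qed

context dirichlet_scattering
begin

lemma isCont_f: "isCont f z"
 using cf by (simp add: continuous_on_eq_continuous_at)

lemma isCont_u_plane_refl:
 assumes n: "norm n = 1" and x: "plane_refl n c x \<in> Omega f" shows "isCont (\<lambda>y. u (plane_refl n c y)) x"
proof (rule isCont_o2[of _ "plane_refl n c"])
 show "isCont (plane_refl n c) x" using continuous_on_plane_refl[OF n, of UNIV c] by (simp add: continuous_on_eq_continuous_at)
 show "isCont u (plane_refl n c x)"
  using weak_helmholtz_continuous[OF weak_u] x open_Omega[OF cf] by (simp add: continuous_on_eq_continuous_at)
qed

lemma ray_exit:
 assumes p: "p \<in> Omega f" and nodal: "nodal p n"
 obtains t where "t > 0" "plane_refl n (p \<bullet> n) (p + t *\<^sub>R axis 3 1) \<in> Gamma f"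
  "\<And>s. 0 \<le> s \<Longrightarrow> s < t \<Longrightarrow> plane_refl n (p \<bullet> n) (p + s *\<^sub>R axis 3 1) \<in> Omega f"
proof -
 have n: "norm n = 1" using nodal by (simp add: nodal_def)
 define g where "g s = plane_refl n (p \<bullet> n) (p + s *\<^sub>R axis 3 1) $ 3 - f (hproj (plane_refl n (p \<bullet> n) (p + s *\<^sub>R axis 3 1)))" for s
 have Om: "plane_refl n (p \<bullet> n) (p + s *\<^sub>R axis 3 1) \<in> Omega f \<longleftrightarrow> g s > 0" for s by (simp add: Omega_def g_def)
 have cr: "continuous_on UNIV (\<lambda>s. plane_refl n (p \<bullet> n) (p + s *\<^sub>R axis 3 1))"
  by (rule continuous_on_compose2[OF continuous_on_plane_refl[OF n, of UNIV]]) (auto intro!: continuous_intros)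
 have cg: "continuous_on UNIV g" unfolding g_def
  by (intro continuous_on_diff continuous_on_component cr continuous_on_compose2[OF cf continuous_on_hproj[OF cr]]) auto
 define A where "A = {s. s \<ge> 0 \<and> g s \<le> 0}"
 have A: "closed A" unfolding A_def by (intro closed_Collect_conj closed_Collect_le continuous_intros cg)
 have "A \<noteq> {}" using reflected_ray_leaves[OF p nodal] Om by (auto simp: A_def not_less intro: less_imp_le)
 have bdd: "bdd_below A" by (rule bdd_belowI[of _ 0]) (simp add: A_def)
 define t where "t = Inf A"
 have tA: "t \<in> A" unfolding t_def by (rule closed_contains_Inf[OF \<open>A \<noteq> {}\<close> bdd A])
 have g0: "g 0 > 0" using p Om[of 0] by (simp add: plane_refl_on_plane[OF n])
 hence t0: "t > 0" using tA by (cases "t = 0") (auto simp: A_def)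
 have before: "g s > 0" if "0 \<le> s" "s < t" for s
 proof (rule ccontr)
  assume "\<not> ?thesis"
  hence "s \<in> A" using that by (simp add: A_def)
  from cInf_lower[OF this bdd] show False using that by (simp add: t_def)
 qed
 obtain x where x: "0 \<le> x" "x \<le> t" "g x = 0"
  using IVT2'[of g t 0 0] tA g0 t0 continuous_on_subset[OF cg] by (auto simp: A_def)
 hence "x = t" using before[of x] by (cases "x < t") auto
 thus thesis using x t0 before Om by (intro that[of t]) (auto simp: Gamma_def g_def)
qed

lemma reflected_facet_disc:
 assumes n: "norm n = 1" and e: "\<epsilon> > 0" and z: "\<And>z. dist z z0 < \<epsilon> \<Longrightarrow> f z = a \<bullet> z + b"
  and zero: "\<And>z. dist z z0 < \<epsilon> \<Longrightarrow> u (plane_refl n c (lift3 z (f z))) = 0"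
  and x: "dist x (plane_refl n c (lift3 z0 (f z0))) < \<epsilon>"
   "(x - plane_refl n c (lift3 z0 (f z0))) \<bullet> (facet_normal a - (2 * (facet_normal a \<bullet> n)) *\<^sub>R n) = 0"
 shows "u x = 0"
proof -
 let ?R = "plane_refl n c" and ?y0 = "lift3 z0 (f z0)"
 have 1: "dist (?R x) ?y0 < \<epsilon>" using x(1) dist_plane_refl[OF n, of c x "?R ?y0"] by (simp add: plane_refl_plane_refl[OF n])
 have 2: "(?R x - ?y0) \<bullet> facet_normal a = 0"
  using x(2) plane_refl_diff_inner[of n c x "?R ?y0" "facet_normal a"] by (simp add: plane_refl_plane_refl[OF n])
 have *: "dist (hproj (?R x)) z0 < \<epsilon>" "lift3 (hproj (?R x)) (f (hproj (?R x))) = ?R x"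
  by (rule facet_plane_point[of z0 \<epsilon> f a b, OF _ e 1 2], rule z, assumption)+
 from zero[OF *(1), unfolded *(2)] show ?thesis by (simp add: plane_refl_plane_refl[OF n])
qed

text \<open>The reflected ray leaves the domain at \<open>q\<close>. Antisymmetry, valid along the
  ray, is continued to the thin layer \<open>C\<close> above the surface near \<open>q\<close>, so
  that \<open>u\<close> vanishes on the mirror image of the surface there. As \<open>q\<close> may
  lie on an edge, a disc is found around a nearby interior point \<open>z0\<close> of an affine
  piece and then transported within its plane to the mirror image of \<open>q\<close>, a point of
  the vertical ray.\<close>

lemma next_nodal:
 assumes poly: "polyhedral_type f" and p: "p \<in> Omega f" and nodal: "nodal p n"
 shows "\<exists>s>0. \<exists>m. nodal (p + s *\<^sub>R axis 3 1) m"
proof -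
 define c where "c = p \<bullet> n"
 let ?R = "plane_refl n c" and ?g = "\<lambda>s. p + s *\<^sub>R axis 3 1"
 have n: "norm n = 1" using nodal by (simp add: nodal_def)
 obtain t where t: "t > 0" "?R (?g t) \<in> Gamma f" "\<And>s. 0 \<le> s \<Longrightarrow> s < t \<Longrightarrow> ?R (?g s) \<in> Omega f"
  by (rule ray_exit[OF p nodal, folded c_def]) (rule that)
 define q where "q = ?R (?g t)"
 have q: "q $ 3 = f (hproj q)" "?R q = ?g t" using t(2) by (simp_all add: q_def Gamma_def plane_refl_plane_refl[OF n])
 obtain r0 where r0: "r0 > 0" "ball (?g t) r0 \<subseteq> Omega f"
  using open_Omega[OF cf] above_in_Omega[OF p less_imp_le[OF t(1)]] unfolding open_contains_ball by blast
 \<comment> \<open>Horizontal and vertical deviation from \<open>q\<close> each get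
   \<open>r\<close>, and their sum bounds the distance.\<close>
 define r where "r = r0 / 2"
 have r: "r > 0" "ball (?g t) (2 * r) \<subseteq> Omega f" using r0 by (auto simp: r_def)
 obtain \<delta> where dl: "\<delta> > 0" "\<And>z. dist z (hproj q) < \<delta> \<Longrightarrow> dist (f z) (f (hproj q)) < r"
  using isCont_f[of "hproj q"] r(1) unfolding continuous_at_eps_delta by blast
 define \<rho> where "\<rho> = min \<delta> r"
 have rho: "\<rho> > 0" "\<And>z. dist z (hproj q) < \<rho> \<Longrightarrow> \<bar>f z - q $ 3\<bar> < r" using dl r q by (auto simp: \<rho>_def dist_real_def)
 have Rnear: "?R x \<in> ball (?g t) (2 * r)" if "dist (hproj x) (hproj q) < \<rho>" "\<bar>x $ 3 - q $ 3\<bar> < r" for x :: "real^3"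
 proof -
  have "dist (?R x) (?g t) = dist x q" using dist_plane_refl[OF n, of c x q] by (simp add: q(2))
  also have "\<dots> < 2 * r" using norm_vec3_bounds(3)[of "x - q"] that by (simp add: dist_norm \<rho>_def)
  finally show ?thesis by (simp add: dist_commute)
 qed
 define C where "C = {x. hproj x \<in> ball (hproj q) \<rho> \<and> f (hproj x) < x $ 3 \<and> x $ 3 < q $ 3 + r}"
 have "connected C" unfolding C_def
  by (rule connected_between_graphs) (use rho(2) in \<open>force intro: continuous_on_subset[OF cf] simp: dist_commute\<close>)+
 have CR: "?R x \<in> Omega f" if "x \<in> C" for x
 proof -
  have h: "dist (hproj x) (hproj q) < \<rho>" using that by (simp add: C_def dist_commute)
  have "\<bar>x $ 3 - q $ 3\<bar> < r" using rho(2)[OF h] that by (auto simp: C_def)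
  from Rnear[OF h this] r(2) show ?thesis by blast
 qed
 let ?L = "(\<lambda>s. ?R (?g s)) ` {0..<t}"
 have cr: "continuous_on UNIV (\<lambda>s. ?R (?g s))"
  by (rule continuous_on_compose2[OF continuous_on_plane_refl[OF n, of UNIV]]) (auto intro!: continuous_intros)
 have "connected ?L" by (intro connected_continuous_image continuous_on_subset[OF cr]) auto
 moreover have "?L \<inter> C \<noteq> {}"
 proof -
  define N where "N = {x. norm (hproj x - hproj q) < \<rho> \<and> x $ 3 < q $ 3 + r}"
  have "open N" unfolding N_def by (intro open_Collect_conj open_Collect_less continuous_intros)
  hence "open ((\<lambda>s. ?R (?g s)) -` N)" by (intro open_vimage cr)
  moreover have "t \<in> (\<lambda>s. ?R (?g s)) -` N" using rho(1) r(1) by (simp add: N_def q_def[symmetric])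
  ultimately obtain e where e: "e > 0" "ball t e \<subseteq> (\<lambda>s. ?R (?g s)) -` N" unfolding open_contains_ball by blast
  \<comment> \<open>A parameter shortly before the exit: its point still lies in the domain and
    already in the neighbourhood \<open>N\<close>, hence in \<open>C\<close>.\<close>
  define s where "s = max 0 (t - e / 2)"
  have s: "0 \<le> s" "s < t" "s \<in> ball t e" using e(1) t(1) by (auto simp: s_def dist_real_def)
  hence "?R (?g s) \<in> N" using e(2) by blast
  hence "?R (?g s) \<in> C" using t(3)[OF s(1,2)] by (simp add: C_def N_def Omega_def dist_norm norm_minus_commute)
  moreover have "?R (?g s) \<in> ?L" using s by (intro image_eqI[of _ _ s]) auto
  ultimately show ?thesis by blast
 qed
 ultimately have conn: "connected (?L \<union> C)" by (intro connected_Un \<open>connected C\<close>)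
 have anti: "u (?R x) = - u x" if "x \<in> C" for x
  unfolding c_def
 proof (rule nodal_antisymmetric[OF p nodal conn])
  show "p \<in> ?L \<union> C" using t(1) by (intro UnI1 image_eqI[of _ _ 0]) (auto simp: plane_refl_on_plane[OF n] c_def)
  show "?L \<union> C \<subseteq> Omega f" using t(3) by (auto simp: C_def Omega_def)
  show "plane_refl n (p \<bullet> n) x \<in> Omega f" if "x \<in> ?L \<union> C" for x
   using that CR above_in_Omega[OF p] by (auto simp: c_def plane_refl_plane_refl[OF n])
 qed (use that in simp)
 obtain F where F: "finite F" "\<And>y. \<exists>(a, b)\<in>F. y \<in> closure (interior {z. f z = a \<bullet> z + b})" by (rule polyhedral_type_facets[OF poly]) (rule that)
 obtain a b where ab: "hproj q \<in> closure (interior {z. f z = a \<bullet> z + b})" using F(2)[of "hproj q"] by blast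
 define X where "X = interior {z. f z = a \<bullet> z + b} \<inter> ball (hproj q) \<rho>"
 obtain z0 where "z0 \<in> X" using ab rho(1) unfolding closure_approachable X_def by (auto simp: dist_commute)
 moreover have "open X" unfolding X_def by (intro open_Int open_interior open_ball)
 ultimately obtain \<epsilon> where e: "\<epsilon> > 0" "ball z0 \<epsilon> \<subseteq> X" unfolding open_contains_ball by blast
 have zX: "f z = a \<bullet> z + b" "dist z (hproj q) < \<rho>" if "dist z z0 < \<epsilon>" for z
  using e(2) that interior_subset[of "{z. f z = a \<bullet> z + b}"] by (auto simp: X_def dist_commute subset_eq)
 have near: "?R (lift3 z (f z)) \<in> ball (?g t) (2 * r)" if "dist z z0 < \<epsilon>" for z
  using zX(2)[OF that] rho(2)[OF zX(2)[OF that]] by (intro Rnear) simp_all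
 have zero: "u (?R (lift3 z (f z))) = 0" if "dist z z0 < \<epsilon>" for z
 proof (rule boundary_limit_zero[where w="\<lambda>y. u (?R y)" and c="- 1" and \<epsilon>="q $ 3 + r - f z"])
  show "isCont (\<lambda>y. u (?R y)) (lift3 z (f z))" using near[OF that] r(2) by (intro isCont_u_plane_refl[OF n]) blast
  show "0 < q $ 3 + r - f z" using rho(2)[OF zX(2)[OF that]] by linarith
  show "u (?R (lift3 z (f z + s))) = - 1 * u (lift3 z (f z + s))" if "0 < s" "s < q $ 3 + r - f z" for s
   using anti[of "lift3 z (f z + s)"] that zX(2)[OF \<open>dist z z0 < \<epsilon>\<close>] by (simp add: C_def dist_commute)
 qed
 define m where "m = facet_normal a - (2 * (facet_normal a \<bullet> n)) *\<^sub>R n"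
 define x0 where "x0 = ?R (lift3 z0 (f z0))"
 have x0: "?R x0 = lift3 z0 (f z0)" by (simp add: x0_def plane_refl_plane_refl[OF n])
 have disc: "u x = 0" if "dist x x0 < \<epsilon>" "(x - x0) \<bullet> m = 0" for x
  by (rule reflected_facet_disc[OF n e(1) zX(1) zero that[unfolded x0_def m_def]])
 \<comment> \<open>The projection of \<open>q\<close> is only in the closure of the affine piece,
   but by continuity \<open>q\<close> lies in the same plane, so its image \<open>?g t\<close> lies
   in the plane of the nodal disc.\<close>
 have "f (hproj q) = a \<bullet> hproj q + b" by (rule closure_facet[OF cf ab])
 hence "(q - lift3 z0 (f z0)) \<bullet> facet_normal a = 0"
  using zX(1)[of z0] e(1) q(1) by (simp add: facet_normal_props(2) inner_diff_right)
 hence gx: "(?g t - x0) \<bullet> m = 0" using plane_refl_diff_inner[of n c "?g t" x0 "facet_normal a"] by (simp add: x0 m_def q_def)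
 have "nodal (?g t) m" unfolding nodal_def
 proof (intro conjI exI[of _ "2 * r"] allI impI)
  show "norm m = 1" unfolding m_def using norm_reflected[OF n] facet_normal_props(1) by simp
  fix x assume x: "dist x (?g t) < 2 * r" "(x - ?g t) \<bullet> m = 0"
  have "(x - x0) \<bullet> m = 0" using x(2) gx by (simp add: inner_diff_left inner_add_left)
  moreover have "x0 \<in> ball (?g t) (2 * r)" using near[of z0] e(1) by (simp add: x0_def)
  ultimately show "u x = 0"
   by (intro nodal_spread[of "ball (?g t) (2 * r)" x0 \<epsilon> m x] convex_ball open_ball r(2) e(1) disc) (use x(1) in \<open>simp_all add: dist_commute\<close>)
 qed (use r in simp)
 thus ?thesis using t(1) by blast
qed

section \<open>Flatness of the surfaces\<close>

lemma finite_range_imp_zero: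
 fixes g :: "real^2 \<Rightarrow> real"
 assumes "continuous_on UNIV g" "finite (range g)" "\<And>y. norm y > R \<Longrightarrow> g y = 0" shows "g y = 0"
proof -
 have "g constant_on UNIV" by (rule continuous_finite_range_constant[OF connected_UNIV assms(1,2)])
 hence "g y = g ((R + 1) *\<^sub>R axis 1 1)" by (auto simp: constant_on_def)
 thus ?thesis using assms(3)[of "(R + 1) *\<^sub>R axis 1 1"] R_pos by (simp add: norm_axis_1)
qed

text \<open>The nodal plane at \<open>p\<close> is horizontal and lies above the whole surface. The
  region \<open>C\<close> between the surface and its mirror image is symmetric and contained in the
  domain, so every mirrored facet is nodal, lies above height \<open>R\<close>, and is therefore
  horizontal. Finitely many heights remain, and \<open>f\<close> is continuous and 0 far
  out.\<close>

lemma high_nodal_imp_flat: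
 fixes p n :: "real^3"
 assumes poly: "polyhedral_type f" and p: "p $ 3 > R" and nodal: "nodal p n"
 shows "f y = 0"
proof -
 have fR': "f z < R" for z using fR[of z] by linarith
 have pO: "p \<in> Omega f" using p fR'[of "hproj p"] by (simp add: Omega_def)
 define c where "c = p \<bullet> n"
 let ?R = "plane_refl n c"
 have n: "norm n = 1" using nodal by (simp add: nodal_def)
 have n3: "(n $ 3)\<^sup>2 = 1" by (rule nodal_high_horizontal[OF _ p nodal]) (use fR' in \<open>simp add: less_imp_le\<close>)
 hence hn: "hproj n = 0" using norm_vec3[of n] n by simp
 have xn: "x \<bullet> n = x $ 3 * n $ 3" for x :: "real^3"
  using inner_lift3[of x "hproj n" "n $ 3"] unfolding lift3_hproj by (simp add: hn)
 have n3': "t * n $ 3 * n $ 3 = t" for t using n3 by (simp add: power2_eq_square mult.assoc)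
 have Rx: "hproj (?R x) = hproj x" "?R x $ 3 = 2 * p $ 3 - x $ 3" for x
  by (simp_all add: plane_refl_def hn xn c_def left_diff_distrib right_diff_distrib n3' flip: mult.assoc)
 define C where "C = {x. hproj x \<in> UNIV \<and> f (hproj x) < x $ 3 \<and> x $ 3 < 2 * p $ 3 - f (hproj x)}"
 have less: "f z < 2 * p $ 3 - f z" for z using fR'[of z] p by linarith
 have "connected C" unfolding C_def
  by (rule connected_between_graphs) (use less in \<open>auto intro!: continuous_intros cf\<close>)
 have anti: "u (?R x) = - u x" if "x \<in> C" for x
  unfolding c_def
 proof (rule nodal_antisymmetric[OF pO nodal \<open>connected C\<close>])
  show "p \<in> C" using pO p fR'[of "hproj p"] by (simp add: C_def Omega_def)
  show "plane_refl n (p \<bullet> n) x \<in> Omega f" if "x \<in> C" for x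
   using that unfolding c_def[symmetric] by (simp add: C_def Omega_def Rx)
 qed (use that in \<open>auto simp: C_def Omega_def\<close>)
 have RO: "?R (lift3 z (f z)) \<in> Omega f" for z using less[of z] by (simp add: Omega_def Rx)
 have zero: "u (?R (lift3 z (f z))) = 0" for z
  by (rule boundary_limit_zero[where w="\<lambda>y. u (?R y)" and c="- 1" and \<epsilon>="2 * p $ 3 - f z - f z"])
    (use less[of z] anti isCont_u_plane_refl[OF n RO] in \<open>auto simp: C_def\<close>)
 obtain F where F: "finite F" "\<And>y. \<exists>(a, b)\<in>F. y \<in> closure (interior {z. f z = a \<bullet> z + b})" by (rule polyhedral_type_facets[OF poly]) (rule that)
 have "f y \<in> snd ` F" for y
 proof -
  obtain a b where ab: "(a, b) \<in> F" "y \<in> closure (interior {z. f z = a \<bullet> z + b})" using F(2)[of y] by blast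
  then obtain z0 where "z0 \<in> interior {z. f z = a \<bullet> z + b}" by fastforce
  then obtain \<epsilon> where e: "\<epsilon> > 0" "ball z0 \<epsilon> \<subseteq> {z. f z = a \<bullet> z + b}" unfolding mem_interior by blast
  have z: "f z = a \<bullet> z + b" if "dist z z0 < \<epsilon>" for z using e(2) that by (auto simp: dist_commute)
  define x0 where "x0 = ?R (lift3 z0 (f z0))"
  define m where "m = facet_normal a - (2 * (facet_normal a \<bullet> n)) *\<^sub>R n"
  have "nodal x0 m" unfolding nodal_def
  proof (intro conjI exI[of _ \<epsilon>] allI impI)
   show "norm m = 1" unfolding m_def using norm_reflected[OF n] facet_normal_props(1) by simp
   fix x assume x: "dist x x0 < \<epsilon>" "(x - x0) \<bullet> m = 0"
   show "u x = 0" by (rule reflected_facet_disc[OF n e(1) z zero x[unfolded x0_def m_def]])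
  qed (rule e)
  hence "(m $ 3)\<^sup>2 = 1"
   by (rule nodal_high_horizontal[where H=R, rotated 2]) (use fR' p less_trans[OF fR'[of z0] p] in \<open>simp_all add: x0_def Rx less_imp_le\<close>)
  moreover have "m $ 3 = - facet_normal a $ 3" by (simp add: m_def xn n3' flip: mult.assoc)
  ultimately have "a = 0" using facet_normal_props(3)[of a] by simp
  hence "f y = b" using closure_facet[OF cf ab(2)] by simp
  thus ?thesis using ab(1) by force
 qed
 hence "finite (range f)" by (intro finite_subset[OF _ finite_imageI[OF F(1)]] image_subsetI)
 from finite_range_imp_zero[OF cf this f0] show ?thesis .
qed

text \<open>\<open>next_nodal\<close> gives no lower bound for the ascent, so the supremum of the
  nodal parameters is used: it is finite if \<open>f\<close> is not flat, attained by closedness,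
  and exceeded by one more step.\<close>

lemma nodal_imp_flat:
 assumes poly: "polyhedral_type f" and p: "p \<in> Omega f" and nodal: "nodal p n"
 shows "f y = 0"
proof (rule ccontr)
 assume nz: "f y \<noteq> 0"
 define A where "A = {s. s \<ge> 0 \<and> (\<exists>m. nodal (p + s *\<^sub>R axis 3 1) m)}"
 have bdd: "bdd_above A"
 proof (rule bdd_aboveI[of _ "R - p $ 3"])
  fix s assume "s \<in> A"
  then obtain m where "nodal (p + s *\<^sub>R axis 3 1) m" by (auto simp: A_def)
  from high_nodal_imp_flat[OF poly _ this, of y] nz show "s \<le> R - p $ 3" by force
 qed
 have "0 \<in> A" using nodal by (auto simp: A_def)
 hence "Sup A \<in> A" using nodal_ray_closed[OF p] bdd by (intro closed_contains_Sup) (auto simp: A_def[symmetric])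
 then obtain m where m: "Sup A \<ge> 0" "nodal (p + Sup A *\<^sub>R axis 3 1) m" by (auto simp: A_def)
 obtain s m' where s: "s > 0" "nodal (p + Sup A *\<^sub>R axis 3 1 + s *\<^sub>R axis 3 1) m'"
  using next_nodal[OF poly above_in_Omega[OF p m(1)] m(2)] by blast
 hence "Sup A + s \<in> A" using m(1) by (auto simp: A_def scaleR_add_left add.assoc)
 from cSup_upper[OF this bdd] s(1) show False by simp
qed

end

text \<open>Where \<open>f1 > f2\<close> the graph of \<open>f1\<close> runs inside the second
  domain, and \<open>u2\<close> vanishes on it as the limit of \<open>u1\<close> from above. The
  opposite inequality follows by exchanging the roles.\<close>

lemma equal_fields_imp_below:
 assumes S1: "dirichlet_scattering k f1 d u1 R" and S2: "dirichlet_scattering k f2 d u2 R"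
  and poly: "polyhedral_type f1" "polyhedral_type f2"
  and eq: "\<And>x. x \<in> Omega (\<lambda>y. max (f1 y) (f2 y)) \<Longrightarrow> u1 x = u2 x"
 shows "f1 y \<le> f2 y"
proof (rule ccontr)
 assume y: "\<not> ?thesis"
 interpret A: dirichlet_scattering k f1 d u1 R by fact
 interpret B: dirichlet_scattering k f2 d u2 R by fact
 define D where "D = {z. f2 z < f1 z}"
 have "open D" unfolding D_def by (intro open_Collect_less A.cf B.cf)
 have in2: "lift3 z (f1 z) \<in> Omega f2" if "z \<in> D" for z using that by (simp add: D_def Omega_def)
 have zero: "u2 (lift3 z (f1 z)) = 0" if "z \<in> D" for z
 proof (rule A.boundary_limit_zero[where w=u2 and c=1 and \<epsilon>=1])
  show "isCont u2 (lift3 z (f1 z))"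
   using weak_helmholtz_continuous[OF B.weak_u] in2[OF that] open_Omega[OF B.cf] by (simp add: continuous_on_eq_continuous_at)
  show "u2 (lift3 z (f1 z + s)) = 1 * u1 (lift3 z (f1 z + s))" if "0 < s" for s
   using eq[of "lift3 z (f1 z + s)"] that \<open>z \<in> D\<close> by (simp add: Omega_def D_def)
 qed simp
 obtain F where F: "finite F" "\<And>y. \<exists>(a, b)\<in>F. y \<in> closure (interior {z. f1 z = a \<bullet> z + b})" by (rule polyhedral_type_facets[OF poly(1)]) (rule that)
 have key: "\<exists>b. b \<in> snd ` F \<and> f1 z = b \<and> f2 z' = 0" if zD: "z \<in> D" for z z'
 proof -
  obtain a b where ab: "(a, b) \<in> F" "z \<in> closure (interior {z. f1 z = a \<bullet> z + b})" using F(2)[of z] by blast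
  define X where "X = interior {z. f1 z = a \<bullet> z + b} \<inter> D"
  have "X \<noteq> {}" using ab(2) zD \<open>open D\<close> unfolding X_def closure_iff_nhds_not_empty by blast
  moreover have "open X" using \<open>open D\<close> by (auto simp: X_def)
  ultimately obtain z0 \<epsilon> where e: "\<epsilon> > 0" "ball z0 \<epsilon> \<subseteq> X" unfolding open_contains_ball by blast
  have z0: "f1 z = a \<bullet> z + b" "z \<in> D" if "dist z z0 < \<epsilon>" for z
   using e(2) that interior_subset[of "{z. f1 z = a \<bullet> z + b}"] by (auto simp: X_def dist_commute subset_eq)
  have nod: "B.nodal (lift3 z0 (f1 z0)) (facet_normal a)" unfolding B.nodal_def
  proof (intro conjI exI[of _ \<epsilon>] allI impI facet_normal_props(1))
   fix x assume x: "dist x (lift3 z0 (f1 z0)) < \<epsilon>" "(x - lift3 z0 (f1 z0)) \<bullet> facet_normal a = 0"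
   have *: "dist (hproj x) z0 < \<epsilon>" "lift3 (hproj x) (f1 (hproj x)) = x"
    by (rule facet_plane_point[of z0 \<epsilon> f1 a b x, OF _ e(1) x], rule z0(1), assumption)+
   show "u2 x = 0" using zero[OF z0(2)[OF *(1)]] unfolding *(2) .
  qed (rule e)
  have D0: "z0 \<in> D" using z0(2)[of z0] e(1) by simp
  have flat: "f2 y = 0" for y by (rule B.nodal_imp_flat[OF poly(2) in2[OF D0] nod])
  \<comment> \<open>Once \<open>f2\<close> is known to be 0, the bound \<open>H\<close> may be taken
    as 0, so every point of the first surface over \<open>D\<close> counts as high.\<close>
  have "(facet_normal a $ 3)\<^sup>2 = 1"
   by (rule B.nodal_high_horizontal[where H=0, OF _ _ nod]) (use flat D0 in \<open>auto simp: D_def\<close>)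
  hence "a = 0" by (rule facet_normal_props(3))
  hence "f1 z = b" using closure_facet[OF A.cf ab(2)] by simp
  thus ?thesis using ab(1) flat by force
 qed
 have "y \<in> D" using y by (simp add: D_def)
 hence flat: "f2 z' = 0" for z' using key by blast
 \<comment> \<open>\<open>f1\<close> is controlled over \<open>D\<close> only; its maximum with 0,
   the value of \<open>f2\<close>, is continuous everywhere and takes finitely many values.\<close>
 have "range (\<lambda>z. max (f1 z) 0) \<subseteq> insert 0 (snd ` F)"
 proof
  fix v assume "v \<in> range (\<lambda>z. max (f1 z) 0)"
  then obtain z where v: "v = max (f1 z) 0" by blast
  show "v \<in> insert 0 (snd ` F)" using key[of z] flat[of z] v by (cases "z \<in> D") (auto simp: D_def max_def)
 qed
 hence fin: "finite (range (\<lambda>z. max (f1 z) 0))" using F(1) by (auto intro: finite_subset)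
 have "max (f1 y) 0 = 0"
  by (rule A.finite_range_imp_zero[OF _ fin]) (simp_all add: continuous_on_max A.cf A.f0)
 thus False using y flat[of y] by simp
qed

theorem mainTheorem5:
  fixes k :: real and f1 f2 :: "real^2 \<Rightarrow> real" and d :: "real^3"
    and u1 u2 :: "real^3 \<Rightarrow> complex"
  assumes "k > 0"
    and "locally_perturbed f1" and "polyhedral_type f1"
    and "locally_perturbed f2" and "polyhedral_type f2"
    and "d \<in> S2_minus"
    and "dirichlet_total_field k f1 d u1"
    and "dirichlet_total_field k f2 d u2"
    and "\<forall>xh\<in>S2_plus. far_field k (u_sc_D k d u1) xh = far_field k (u_sc_D k d u2) xh"
  shows "Gamma f1 = Gamma f2"
proof -
 obtain R1 where R1: "\<And>y. \<bar>f1 y\<bar> < R1" "\<And>y. norm y > R1 \<Longrightarrow> f1 y = 0"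
  using assms(2) unfolding locally_perturbed_def by blast
 obtain R2 where R2: "\<And>y. \<bar>f2 y\<bar> < R2" "\<And>y. norm y > R2 \<Longrightarrow> f2 y = 0"
  using assms(4) unfolding locally_perturbed_def by blast
 have S1: "dirichlet_scattering k f1 d u1 (max R1 R2)"
  by unfold_locales (use assms R1 in \<open>auto simp: polyhedral_type_def less_max_iff_disj\<close>)
 have S2: "dirichlet_scattering k f2 d u2 (max R1 R2)"
  by unfold_locales (use assms R2 in \<open>auto simp: polyhedral_type_def less_max_iff_disj\<close>)
 have eq: "u1 x = u2 x" if "x \<in> Omega (\<lambda>y. max (f1 y) (f2 y))" for x
  by (rule far_field_determines_field[OF S1 S2 _ that]) (use assms(9) in blast)
 have eq': "u2 x = u1 x" if "x \<in> Omega (\<lambda>y. max (f2 y) (f1 y))" for x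
  using eq[of x] that by (simp add: max.commute)
 have "f1 y = f2 y" for y
  using equal_fields_imp_below[OF S1 S2 assms(3,5) eq, of y] equal_fields_imp_below[OF S2 S1 assms(5,3) eq', of y] by simp
 thus ?thesis by (simp add: Gamma_def)
qed

end
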